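(* Let $d\ge 1$ and let $\mathcal{T}(\mathcal{X}_1),\ldots,\mathcal{T}(\mathcal{X}_d)$ be reduced connected absolutely free set operads. Then there exists a minimal resolution of the form \[ \big((\mathbb{I}\oplus\Bbbk\mathcal{X}_1)\mathbin{\square}\cdots\mathbin{\square}(\mathbb{I}\oplus\Bbbk\mathcal{X}_d)\big)\circ\big(\mathcal{T}(\mathcal{X}_1)\otimes\cdots\otimes\mathcal{T}(\mathcal{X}_d)\big) \] of the augmentation module $\mathbb{I}$ over the $\Bbbk$-linearisation of the $d$-fold Boardman--Vogt tensor product $\mathcal{T}(\mathcal{X}_1)\otimes\cdots\otimes\mathcal{T}(\mathcal{X}_d)$ by free right modules. Here the homological degree of all factors $\mathbb{I}$ is $0$, and the homological degree of $\Bbbk\mathcal{X}_k$ is $1$ for all $1\le k\le d$.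
   Context: $\Bbbk$ is a field. A symmetric collection ($\mathbb{S}$-module) with values in a category $\mathcal{C}$ (finite sets, finite-dimensional vector spaces, or nonnegatively graded chain complexes with finite-dimensional components) is a contravariant functor from the groupoid of nonempty finite sets and bijections to $\mathcal{C}$; write $\underline{n}=\{1,\ldots,n\}$, so that $S_n$ acts on $\mathcal{F}(\underline{n})$ on the right. A collection is free if each $S_n$ acts freely on $\mathcal{F}(\underline{n})$. The unit collection $\mathbb{I}$ has $\mathbb{I}(X)$ equal to the monoidal unit if $|X|=1$ and the initial object otherwise. For a set collection $\mathcal{X}$, $\Bbbk\mathcal{X}$ is its linearisation. The composition is $(\mathcal{P}\circ\mathcal{Q})(X)=\bigsqcup_k \mathcal{P}(\underline{k})\otimes_{S_k}\big(\bigsqcup_{f\colon X\twoheadrightarrow \underline{k}}\mathcal{Q}(f^{-1}(1))\otimes\cdots\otimes\mathcal{Q}(f^{-1}(k))\big)$; operads are monoids for $\circ$, with structure map $\gamma$. An operad $\mathcal{O}$ is reduced if $\mathcal{O}(\underline{0})$ is the initial object, and connected if $\mathcal{O}(\underline{1})$ is the monoidal unit; a reduced connected linear operad is augmented over $\mathbb{I}$ with augmentation ideal spanned by elements of arity $>1$, which makes $\mathbb{I}$ a right $\mathcal{O}$-module (the augmentation module). An absolutely free operad is a free operad $\mathcal{T}(\mathcal{X})$ generated by a free symmetric collection $\mathcal{X}$ of finite sets; reduced and connected means $\mathcal{X}(\underline{0})=\mathcal{X}(\underline{1})=\varnothing$. The matrix product of collections is $(\mathcal{X}\mathbin{\square}\mathcal{Y})(X)=\bigsqcup_{(\pi,\tau)}\mathcal{X}(\pi)\otimes\mathcal{Y}(\tau)$,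 over all pairs of set partitions $\pi=\{\pi_1,\ldots,\pi_k\}$, $\tau=\{\tau_1,\ldots,\tau_l\}$ of $X$ with $|\pi_i\cap\tau_j|=1$ for all $i,j$. It is associative with unit $\mathbb{I}$; homological degrees add. The Boardman--Vogt tensor product $\mathcal{P}\otimes\mathcal{Q}$ of set operads is the quotient of the coproduct $\mathcal{P}\sqcup\mathcal{Q}$ by the operadic congruence generated by the interchange relations $\gamma(p;q,\ldots,q)=\gamma(q;p,\ldots,p).\sigma_{k,l}$ for $p\in\mathcal{P}(\underline{k})$, $q\in\mathcal{Q}(\underline{l})$, where $\sigma_{k,l}((i-1)l+j)=(j-1)k+i$ for $1\le i\le k$, $1\le j\le l$; that is, $p(q(x_{11},\ldots,x_{1l}),\ldots,q(x_{k1},\ldots,x_{kl}))=q(p(x_{11},\ldots,x_{k1}),\ldots,p(x_{1l},\ldots,x_{kl}))$. The $d$-fold product is obtained by iteration. A resolution of $\mathbb{I}$ by free right $\mathcal{O}$-modules of the form $\mathcal{V}\circ\mathcal{O}$, with $\mathcal{V}$ a graded collection, is a differential of homological degree $-1$ on the free right $\mathcal{O}$-module $\mathcal{V}\circ\mathcal{O}$ that is a map of right $\mathcal{O}$-modules, together with an augmentation making its homology $\mathbb{I}$ concentrated in degree $0$. It is minimal if the differential induced on $(\mathcal{V}\circ\mathcal{O})\circ_{\mathcal{O}}\mathbb{I}\cong\mathcal{V}$ is zero. *)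

theory Defs
  imports
    Complex_Main
    "HOL-Library.Poly_Mapping"
    "HOL-Library.Disjoint_Sets"
    "HOL-Library.Nat_Bijection"
    "HOL-Combinatorics.Permutations"
begin

section \<open>Symmetric collections of sets\<close>

text \<open>
  The groupoid of nonempty finite sets is represented by its equivalent full subgroupoid of
  nonempty finite sets of natural numbers. For a bijection \<open>f : X \<rightarrow> f ` X\<close>, the map
  \<open>pull F X f\<close> is \<open>F f : F (f ` X) \<rightarrow> F X\<close>. The standard set with \<open>n\<close> elements is \<open>{..<n}\<close>
  (all indices start at 0), and \<open>S\<^sub>n\<close> acts on the right on \<open>vals F {..<n}\<close> by
  \<open>x.\<sigma> = pull F {..<n} \<sigma> x\<close>.

  The set \<open>{}\<close> is not an object of the groupoid: \<open>vals F {}\<close> serves only to say that a collection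
  is reduced, and no construction below uses it.
\<close>

record 'a collection =
  vals :: "nat set \<Rightarrow> 'a set"
  pull :: "nat set \<Rightarrow> (nat \<Rightarrow> nat) \<Rightarrow> 'a \<Rightarrow> 'a"

definition fin_ne :: "nat set \<Rightarrow> bool" where
  "fin_ne X \<longleftrightarrow> finite X \<and> X \<noteq> {}"

definition is_collection :: "('a, 'z) collection_scheme \<Rightarrow> bool" where
  "is_collection F \<longleftrightarrow>
     (\<forall>X f x. fin_ne X \<and> inj_on f X \<and> x \<in> vals F (f ` X) \<longrightarrow> pull F X f x \<in> vals F X) \<and>
     (\<forall>X x. fin_ne X \<and> x \<in> vals F X \<longrightarrow> pull F X (\<lambda>i. i) x = x) \<and>
     (\<forall>X g f x. fin_ne X \<and> inj_on g X \<and> inj_on f (g ` X) \<and> x \<in> vals F (f ` g ` X) \<longrightarrow>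
        pull F X (\<lambda>i. f (g i)) x = pull F X g (pull F (g ` X) f x)) \<and>
     (\<forall>X f g x. fin_ne X \<and> inj_on f X \<and> (\<forall>i\<in>X. f i = g i) \<and> x \<in> vals F (f ` X) \<longrightarrow>
        pull F X f x = pull F X g x)"

definition finite_valued :: "('a, 'z) collection_scheme \<Rightarrow> bool" where
  "finite_valued F \<longleftrightarrow> (\<forall>X. fin_ne X \<longrightarrow> finite (vals F X))"

definition free_collection :: "('a, 'z) collection_scheme \<Rightarrow> bool" where
  "free_collection F \<longleftrightarrow>
     (\<forall>n \<sigma>. \<forall>x\<in>vals F {..<n}. \<sigma> permutes {..<n} \<and> pull F {..<n} \<sigma> x = x \<longrightarrow> \<sigma> = id)"

text \<open>The condition on generators \<open>\<X>\<close> which makes the free operad on \<open>\<X>\<close> reduced and connected.\<close>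

definition no_small_arities :: "('a, 'z) collection_scheme \<Rightarrow> bool" where
  "no_small_arities F \<longleftrightarrow> vals F {..<0} = {} \<and> vals F {..<1} = {}"

text \<open>
  A surjection \<open>f : X \<rightarrow> {..<k}\<close> is encoded by the list of its fibres
  \<open>[f\<^sup>-\<^sup>1(0), \<dots>, f\<^sup>-\<^sup>1(k-1)]\<close>.
\<close>

definition ordered_partition :: "nat set list \<Rightarrow> nat set \<Rightarrow> bool" where
  "ordered_partition Bs X \<longleftrightarrow> finite X \<and> distinct Bs \<and> partition_on X (set Bs)"


section \<open>Set operads\<close>

text \<open>
  \<open>ounit P x\<close> is the unit in \<open>vals P {x}\<close>; for an ordered partition \<open>[B\<^sub>0, \<dots>, B\<^bsub>k-1\<^esub>]\<close> of \<open>X\<close>,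
  \<open>p \<in> vals P {..<k}\<close> and \<open>q\<^sub>i \<in> vals P B\<^sub>i\<close>, \<open>ocomp P p [B\<^sub>0, \<dots>] [q\<^sub>0, \<dots>]\<close> is
  \<open>\<gamma>(p; q\<^sub>0, \<dots>, q\<^bsub>k-1\<^esub>) \<in> vals P X\<close>.
\<close>

record 'a operad = "'a collection" +
  ounit :: "nat \<Rightarrow> 'a"
  ocomp :: "'a \<Rightarrow> nat set list \<Rightarrow> 'a list \<Rightarrow> 'a"

text \<open>The operadic congruence generated by a family of relations \<open>R X\<close> on \<open>vals P X\<close>.\<close>

inductive ocong ::
  "('a, 'z) operad_scheme \<Rightarrow> (nat set \<Rightarrow> 'a \<Rightarrow> 'a \<Rightarrow> bool) \<Rightarrow> nat set \<Rightarrow> 'a \<Rightarrow> 'a \<Rightarrow> bool"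
  for P R where
  base: "R X a b \<Longrightarrow> a \<in> vals P X \<Longrightarrow> b \<in> vals P X \<Longrightarrow> ocong P R X a b"
| refl: "a \<in> vals P X \<Longrightarrow> ocong P R X a a"
| sym: "ocong P R X a b \<Longrightarrow> ocong P R X b a"
| trans: "ocong P R X a b \<Longrightarrow> ocong P R X b c \<Longrightarrow> ocong P R X a c"
| pull: "fin_ne X \<Longrightarrow> inj_on f X \<Longrightarrow> ocong P R (f ` X) a b \<Longrightarrow>
    ocong P R X (pull P X f a) (pull P X f b)"
| comp: "ordered_partition Bs X \<Longrightarrow> Bs \<noteq> [] \<Longrightarrow>
    length qs = length Bs \<Longrightarrow> length qs' = length Bs \<Longrightarrow>
    ocong P R {..<length Bs} p p' \<Longrightarrow>
    (\<And>i. i < length Bs \<Longrightarrow> ocong P R (Bs ! i) (qs ! i) (qs' ! i)) \<Longrightarrow>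
    ocong P R X (ocomp P p Bs qs) (ocomp P p' Bs qs')"

text \<open>
  The elements of the quotient operad are chosen representatives of the congruence classes, so that
  a quotient has the same type as the operad itself; this is what allows the tensor product of
  operads to be iterated.
\<close>

definition rep ::
  "('a, 'z) operad_scheme \<Rightarrow> (nat set \<Rightarrow> 'a \<Rightarrow> 'a \<Rightarrow> bool) \<Rightarrow> nat set \<Rightarrow> 'a \<Rightarrow> 'a" where
  "rep P R X a = (SOME b. ocong P R X a b)"

definition quot_operad :: "'a operad \<Rightarrow> (nat set \<Rightarrow> 'a \<Rightarrow> 'a \<Rightarrow> bool) \<Rightarrow> 'a operad" where
  "quot_operad P R =
     \<lparr>vals = (\<lambda>X. rep P R X ` vals P X),
      pull = (\<lambda>X f a. rep P R X (pull P X f a)),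
      ounit = (\<lambda>x. rep P R {x} (ounit P x)),
      ocomp = (\<lambda>p Bs qs. rep P R (\<Union>(set Bs)) (ocomp P p Bs qs))\<rparr>"


section \<open>Free operads\<close>

text \<open>
  A universe containing the generators (\<open>Gen\<close>), closed under disjoint unions (\<open>InL\<close>, \<open>InR\<close>) and
  under planar rooted trees whose leaves are labelled by natural numbers and whose internal
  vertices are labelled by elements of the universe (\<open>Leaf\<close>, \<open>Node\<close>).
\<close>

datatype 'a expr =
    Gen 'a
  | InL "'a expr"
  | InR "'a expr"
  | Leaf nat
  | Node "'a expr" "'a expr list"

inductive is_tree :: "('a expr, 'z) collection_scheme \<Rightarrow> 'a expr \<Rightarrow> bool" for F where
  "is_tree F (Leaf x)"
| "ts \<noteq> [] \<Longrightarrow> g \<in> vals F {..<length ts} \<Longrightarrow> (\<And>t. t \<in> set ts \<Longrightarrow> is_tree F t) \<Longrightarrow>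
     is_tree F (Node g ts)"

fun leaves :: "'a expr \<Rightarrow> nat list" where
  "leaves (Leaf x) = [x]"
| "leaves (Node g ts) = concat (map leaves ts)"
| "leaves _ = []"

fun subst :: "(nat \<Rightarrow> 'a expr) \<Rightarrow> 'a expr \<Rightarrow> 'a expr" where
  "subst s (Leaf x) = s x"
| "subst s (Node g ts) = Node g (map (subst s) ts)"
| "subst s t = t"

text \<open>
  The operad of planar trees: elements over \<open>X\<close> are the planar trees whose leaves are labelled
  bijectively by \<open>X\<close>. The free operad is its quotient by equivariance of the vertex labels,
  i.e. the corolla of \<open>g.\<sigma>\<close> equals (the corolla of \<open>g\<close>)\<open>.\<sigma>\<close>.
\<close>

definition tree_operad :: "('a expr, 'z) collection_scheme \<Rightarrow> 'a expr operad" where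
  "tree_operad F =
     \<lparr>vals = (\<lambda>X. {t. is_tree F t \<and> distinct (leaves t) \<and> set (leaves t) = X}),
      pull = (\<lambda>X f. subst (\<lambda>y. Leaf (inv_into X f y))),
      ounit = Leaf,
      ocomp = (\<lambda>p Bs qs. subst (\<lambda>i. qs ! i) p)\<rparr>"

definition equivariance ::
  "('a expr, 'z) collection_scheme \<Rightarrow> nat set \<Rightarrow> 'a expr \<Rightarrow> 'a expr \<Rightarrow> bool" where
  "equivariance F X a b \<longleftrightarrow>
     (\<exists>n \<sigma> g. n \<ge> 1 \<and> X = {..<n} \<and> \<sigma> permutes {..<n} \<and> g \<in> vals F {..<n} \<and>
        a = Node (pull F {..<n} \<sigma> g) (map Leaf [0..<n]) \<and>
        b = pull (tree_operad F) {..<n} \<sigma> (Node g (map Leaf [0..<n])))"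

definition free_operad :: "('a expr, 'z) collection_scheme \<Rightarrow> 'a expr operad" where
  "free_operad F = quot_operad (tree_operad F) (equivariance F)"

text \<open>
  The inclusion of generators; the corolla is taken with respect to the increasing enumeration
  of \<open>X\<close>, any other enumeration gives the same element.
\<close>

definition generator ::
  "('a expr, 'z) collection_scheme \<Rightarrow> nat set \<Rightarrow> 'a expr \<Rightarrow> 'a expr" where
  "generator F X g =
     (let xs = sorted_list_of_set X in
      rep (tree_operad F) (equivariance F) X
        (Node (pull F {..<card X} (\<lambda>i. xs ! i) g) (map Leaf xs)))"

definition gen_collection :: "('a, 'z) collection_scheme \<Rightarrow> 'a expr collection" where
  "gen_collection F =
     \<lparr>vals = (\<lambda>X. Gen ` vals F X),
      pull = (\<lambda>X f y. case y of Gen x \<Rightarrow> Gen (pull F X f x) | _ \<Rightarrow> y)\<rparr>"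

definition abs_free_operad :: "('a, 'z) collection_scheme \<Rightarrow> 'a expr operad" where
  "abs_free_operad F = free_operad (gen_collection F)"


section \<open>Coproducts and Boardman--Vogt tensor products\<close>

definition disj_union ::
  "('a expr, 'y) collection_scheme \<Rightarrow> ('a expr, 'z) collection_scheme \<Rightarrow> 'a expr collection" where
  "disj_union F G =
     \<lparr>vals = (\<lambda>X. InL ` vals F X \<union> InR ` vals G X),
      pull = (\<lambda>X f y. case y of InL x \<Rightarrow> InL (pull F X f x)
                              | InR x \<Rightarrow> InR (pull G X f x) | _ \<Rightarrow> y)\<rparr>"

text \<open>The relations forcing the map of collections \<open>j : P \<rightarrow> Q\<close> to be a map of operads.\<close>

definition operad_map_rels ::
  "('a, 'y) operad_scheme \<Rightarrow> ('b, 'z) operad_scheme \<Rightarrow> (nat set \<Rightarrow> 'a \<Rightarrow> 'b) \<Rightarrow>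
   nat set \<Rightarrow> 'b \<Rightarrow> 'b \<Rightarrow> bool" where
  "operad_map_rels P Q j X a b \<longleftrightarrow>
     (\<exists>x. X = {x} \<and> a = j {x} (ounit P x) \<and> b = ounit Q x) \<or>
     (\<exists>p Bs qs. Bs \<noteq> [] \<and> ordered_partition Bs X \<and> p \<in> vals P {..<length Bs} \<and>
        length qs = length Bs \<and> (\<forall>i<length Bs. qs ! i \<in> vals P (Bs ! i)) \<and>
        a = j X (ocomp P p Bs qs) \<and>
        b = ocomp Q (j {..<length Bs} p) Bs (map2 j Bs qs))"

text \<open>
  The coproduct is the quotient of the free operad on the disjoint union of the underlying
  collections by the relations making both inclusions maps of operads.
\<close>

definition coproduct_rels ::
  "'a expr operad \<Rightarrow> 'a expr operad \<Rightarrow> nat set \<Rightarrow> 'a expr \<Rightarrow> 'a expr \<Rightarrow> bool" where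
  "coproduct_rels P Q X a b \<longleftrightarrow>
     (let U = disj_union P Q; T = free_operad U in
      operad_map_rels P T (\<lambda>Y p. generator U Y (InL p)) X a b \<or>
      operad_map_rels Q T (\<lambda>Y q. generator U Y (InR q)) X a b)"

definition coproduct :: "'a expr operad \<Rightarrow> 'a expr operad \<Rightarrow> 'a expr operad" where
  "coproduct P Q = quot_operad (free_operad (disj_union P Q)) (coproduct_rels P Q)"

definition coproj :: "'a expr operad \<Rightarrow> 'a expr operad \<Rightarrow> nat set \<Rightarrow> 'a expr \<Rightarrow> 'a expr" where
  "coproj P Q X t = rep (free_operad (disj_union P Q)) (coproduct_rels P Q) X t"

definition inl_map :: "'a expr operad \<Rightarrow> 'a expr operad \<Rightarrow> nat set \<Rightarrow> 'a expr \<Rightarrow> 'a expr" where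
  "inl_map P Q X p = coproj P Q X (generator (disj_union P Q) X (InL p))"

definition inr_map :: "'a expr operad \<Rightarrow> 'a expr operad \<Rightarrow> nat set \<Rightarrow> 'a expr \<Rightarrow> 'a expr" where
  "inr_map P Q X q = coproj P Q X (generator (disj_union P Q) X (InR q))"

text \<open>
  \<open>\<gamma>(p; q, \<dots>, q)\<close> for \<open>p\<close> of arity \<open>k\<close> and \<open>q\<close> of arity \<open>l\<close>: input \<open>i*l + j\<close> is the
  \<open>j\<close>-th input of the \<open>i\<close>-th copy of \<open>q\<close>.
\<close>

definition diag_comp :: "('a, 'z) operad_scheme \<Rightarrow> nat \<Rightarrow> nat \<Rightarrow> 'a \<Rightarrow> 'a \<Rightarrow> 'a" where
  "diag_comp P k l p q =
     ocomp P p (map (\<lambda>i. {i*l ..< (i+1)*l}) [0..<k])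
       (map (\<lambda>i. pull P {i*l ..< (i+1)*l} (\<lambda>m. m - i*l) q) [0..<k])"

definition interchange ::
  "'a expr operad \<Rightarrow> 'a expr operad \<Rightarrow> nat set \<Rightarrow> 'a expr \<Rightarrow> 'a expr \<Rightarrow> bool" where
  "interchange P Q X a b \<longleftrightarrow>
     (\<exists>k l p q. k \<ge> 1 \<and> l \<ge> 1 \<and> p \<in> vals P {..<k} \<and> q \<in> vals Q {..<l} \<and> X = {..<k*l} \<and>
        (let C = coproduct P Q; p' = inl_map P Q {..<k} p; q' = inr_map P Q {..<l} q;
             \<sigma> = (\<lambda>m. (m mod l) * k + m div l)
         in a = diag_comp C k l p' q' \<and> b = pull C {..<k*l} \<sigma> (diag_comp C l k q' p')))"

definition bv_tensor :: "'a expr operad \<Rightarrow> 'a expr operad \<Rightarrow> 'a expr operad" where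
  "bv_tensor P Q = quot_operad (coproduct P Q) (interchange P Q)"

definition bv_tensor_list :: "'a expr operad list \<Rightarrow> 'a expr operad" where
  "bv_tensor_list Ps = foldl bv_tensor (hd Ps) (tl Ps)"


section \<open>Graded collections and the matrix product\<close>

text \<open>
  All graded linear collections needed here are linearisations of graded set collections, i.e. of
  set collections together with a homological degree for each element. Linearisation carries
  disjoint unions, products, \<open>\<box>\<close> and \<open>\<circ>\<close> of set collections to \<open>\<oplus>\<close>, \<open>\<otimes>\<close>, \<open>\<box>\<close> and \<open>\<circ>\<close> of
  linear collections, so these are all formed before linearising.
\<close>

record 'a graded_collection = "'a collection" +
  hdeg :: "nat set \<Rightarrow> 'a \<Rightarrow> nat"

text \<open>
  A universe for iterated matrix products: \<open>Box \<pi> \<tau> x y\<close> is the element \<open>x \<otimes> y\<close> of the summand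
  \<open>\<X>(\<pi>) \<otimes> \<Y>(\<tau>)\<close>.
\<close>

datatype 'a cell =
    Unit
  | Cell 'a
  | Box "nat set set" "nat set set" "'a cell" "'a cell"

text \<open>\<open>\<I> \<oplus> \<k>\<X>\<close> is the linearisation of \<open>\<I> \<squnion> \<X>\<close>, with \<open>\<I>\<close> in degree 0 and \<open>\<X>\<close> in degree 1.\<close>

definition unit_plus :: "('a, 'z) collection_scheme \<Rightarrow> 'a cell graded_collection" where
  "unit_plus F =
     \<lparr>vals = (\<lambda>X. (if card X = 1 then {Unit} else {}) \<union> Cell ` vals F X),
      pull = (\<lambda>X f y. case y of Cell x \<Rightarrow> Cell (pull F X f x) | _ \<Rightarrow> y),
      hdeg = (\<lambda>X y. case y of Cell x \<Rightarrow> 1 | _ \<Rightarrow> 0)\<rparr>"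

text \<open>
  A set partition \<open>\<pi>\<close> is itself a finite set; it becomes a set of natural numbers, hence an
  admissible argument of a collection, via the injective coding \<open>set_encode\<close> of finite
  sets of natural numbers.
\<close>

definition code :: "nat set set \<Rightarrow> nat set" where
  "code \<pi> = set_encode ` \<pi>"

definition pull_partition :: "nat set \<Rightarrow> (nat \<Rightarrow> nat) \<Rightarrow> nat set set \<Rightarrow> nat set set" where
  "pull_partition X f \<pi> = (\<lambda>B. X \<inter> f -` B) ` \<pi>"

text \<open>The bijection from the blocks of \<open>pull_partition X f \<pi>\<close> to those of \<open>\<pi>\<close> induced by \<open>f\<close>.\<close>

definition on_blocks :: "(nat \<Rightarrow> nat) \<Rightarrow> nat \<Rightarrow> nat" where
  "on_blocks f b = set_encode (f ` set_decode b)"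

definition matrix_prod ::
  "'a cell graded_collection \<Rightarrow> 'a cell graded_collection \<Rightarrow> 'a cell graded_collection" where
  "matrix_prod F G =
     \<lparr>vals = (\<lambda>X. {Box \<pi> \<tau> x y | \<pi> \<tau> x y.
        partition_on X \<pi> \<and> partition_on X \<tau> \<and> (\<forall>B\<in>\<pi>. \<forall>C\<in>\<tau>. card (B \<inter> C) = 1) \<and>
        x \<in> vals F (code \<pi>) \<and> y \<in> vals G (code \<tau>)}),
      pull = (\<lambda>X f z. case z of
          Box \<pi> \<tau> x y \<Rightarrow>
            (let \<pi>' = pull_partition X f \<pi>; \<tau>' = pull_partition X f \<tau> in
             Box \<pi>' \<tau>' (pull F (code \<pi>') (on_blocks f) x) (pull G (code \<tau>') (on_blocks f) y))
        | _ \<Rightarrow> z),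
      hdeg = (\<lambda>X z. case z of
          Box \<pi> \<tau> x y \<Rightarrow> hdeg F (code \<pi>) x + hdeg G (code \<tau>) y
        | _ \<Rightarrow> 0)\<rparr>"

definition matrix_prod_list :: "'a cell graded_collection list \<Rightarrow> 'a cell graded_collection" where
  "matrix_prod_list Fs = foldl matrix_prod (hd Fs) (tl Fs)"

definition homogeneous :: "'a graded_collection \<Rightarrow> nat \<Rightarrow> 'a collection" where
  "homogeneous V n = \<lparr>vals = (\<lambda>X. {v \<in> vals V X. hdeg V X v = n}), pull = pull V\<rparr>"


section \<open>The composition product\<close>

text \<open>
  An element \<open>(v, [B\<^sub>0, \<dots>, B\<^bsub>k-1\<^esub>], [p\<^sub>0, \<dots>, p\<^bsub>k-1\<^esub>])\<close> consists of \<open>v \<in> \<V>(k)\<close>, the surjection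
  \<open>X \<rightarrow> {..<k}\<close> with fibres \<open>B\<^sub>i\<close>, and \<open>p\<^sub>i \<in> P(B\<^sub>i)\<close>. An element of the composition \<open>\<V> \<circ> P\<close>
  is an \<open>S\<^sub>k\<close>-orbit of those.
\<close>

type_synonym ('v, 'o) precomp = "'v \<times> nat set list \<times> 'o list"

definition precomp ::
  "('v, 'y) collection_scheme \<Rightarrow> ('o, 'z) collection_scheme \<Rightarrow> nat set \<Rightarrow> ('v, 'o) precomp set" where
  "precomp V P X = {(v, Bs, ps). ordered_partition Bs X \<and> v \<in> vals V {..<length Bs} \<and>
     length ps = length Bs \<and> (\<forall>i<length Bs. ps ! i \<in> vals P (Bs ! i))}"

definition orbit ::
  "('v, 'y) collection_scheme \<Rightarrow> ('v, 'o) precomp \<Rightarrow> ('v, 'o) precomp set" where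
  "orbit V = (\<lambda>(v, Bs, ps).
     {(pull V {..<length Bs} \<sigma> v, permute_list \<sigma> Bs, permute_list \<sigma> ps) | \<sigma>.
        \<sigma> permutes {..<length Bs}})"

definition comp_vals ::
  "('v, 'y) collection_scheme \<Rightarrow> ('o, 'z) collection_scheme \<Rightarrow> nat set \<Rightarrow>
   ('v, 'o) precomp set set" where
  "comp_vals V P X = orbit V ` precomp V P X"

definition comp_pull ::
  "('o, 'z) collection_scheme \<Rightarrow> nat set \<Rightarrow> (nat \<Rightarrow> nat) \<Rightarrow>
   ('v, 'o) precomp set \<Rightarrow> ('v, 'o) precomp set" where
  "comp_pull P X f b =
     (\<lambda>(v, Bs, ps). (v, map (\<lambda>B. X \<inter> f -` B) Bs,
        map2 (\<lambda>B p. pull P (X \<inter> f -` B) f p) Bs ps)) ` b"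

text \<open>
  Composition with \<open>p \<in> P(C)\<close> for a finite \<open>C \<subseteq> {..<n}\<close> in place of a standard set, taking the
  \<open>i\<close>-th entries, \<open>i \<in> C\<close>, of the lists of length \<open>n\<close>.
\<close>

definition ocomp_on ::
  "('o, 'z) operad_scheme \<Rightarrow> nat set \<Rightarrow> 'o \<Rightarrow> nat set list \<Rightarrow> 'o list \<Rightarrow> 'o" where
  "ocomp_on P C p Bs qs =
     (let cs = sorted_list_of_set C in
      ocomp P (pull P {..<card C} (\<lambda>i. cs ! i) p)
        (map (\<lambda>c. Bs ! c) cs) (map (\<lambda>c. qs ! c) cs))"

text \<open>
  The right action of \<open>P\<close> on \<open>\<V> \<circ> P\<close>. It is defined on representatives: the map of
  representatives is \<open>S\<^sub>k\<close>-equivariant, so the image of an orbit is an orbit.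
\<close>

definition comp_act ::
  "('o, 'z) operad_scheme \<Rightarrow> ('v, 'o) precomp set \<Rightarrow> nat set list \<Rightarrow> 'o list \<Rightarrow>
   ('v, 'o) precomp set" where
  "comp_act P b Bs qs =
     (\<lambda>(v, Cs, ps). (v, map (\<lambda>C. \<Union>i\<in>C. Bs ! i) Cs,
        map2 (\<lambda>C p. ocomp_on P C p Bs qs) Cs ps)) ` b"


section \<open>Linearisation and right modules\<close>

definition lin :: "'b set \<Rightarrow> ('b \<Rightarrow>\<^sub>0 'k::field) set" where
  "lin B = {\<phi>. Poly_Mapping.keys \<phi> \<subseteq> B}"

definition lin_scale :: "'k \<Rightarrow> ('b \<Rightarrow>\<^sub>0 'k) \<Rightarrow> ('b \<Rightarrow>\<^sub>0 'k::field)" where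
  "lin_scale c \<phi> = Poly_Mapping.map (\<lambda>a. c * a) \<phi>"

definition lin_map :: "('b \<Rightarrow> 'c) \<Rightarrow> ('b \<Rightarrow>\<^sub>0 'k) \<Rightarrow> ('c \<Rightarrow>\<^sub>0 'k::field)" where
  "lin_map g \<phi> =
     (\<Sum>b\<in>Poly_Mapping.keys \<phi>. Poly_Mapping.single (g b) (Poly_Mapping.lookup \<phi> b))"

text \<open>
  Right modules over the linearisation of a set operad \<open>P\<close> (elements of type \<open>'o\<close>): for
  \<open>m \<in> mvals M {..<k}\<close>, an ordered partition \<open>[B\<^sub>0, \<dots>, B\<^bsub>k-1\<^esub>]\<close> of \<open>X\<close> and \<open>a\<^sub>i \<in> \<k>P(B\<^sub>i)\<close>,
  \<open>mact M m [B\<^sub>0, \<dots>] [a\<^sub>0, \<dots>]\<close> is \<open>\<gamma>(m; a\<^sub>0, \<dots>, a\<^bsub>k-1\<^esub>) \<in> mvals M X\<close>.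
\<close>

record (overloaded) ('k, 'o, 'm) rmodule =
  mvals :: "nat set \<Rightarrow> 'm set"
  mscale :: "'k \<Rightarrow> 'm \<Rightarrow> 'm"
  mpull :: "nat set \<Rightarrow> (nat \<Rightarrow> nat) \<Rightarrow> 'm \<Rightarrow> 'm"
  mact :: "'m \<Rightarrow> nat set list \<Rightarrow> ('o \<Rightarrow>\<^sub>0 'k) list \<Rightarrow> 'm"

definition lin_args ::
  "('o, 'z) operad_scheme \<Rightarrow> nat set \<Rightarrow> nat set list \<Rightarrow> ('o \<Rightarrow>\<^sub>0 'k::field) list \<Rightarrow> bool" where
  "lin_args P X Bs as \<longleftrightarrow> Bs \<noteq> [] \<and> ordered_partition Bs X \<and> length as = length Bs \<and>
     (\<forall>i<length Bs. as ! i \<in> lin (vals P (Bs ! i)))"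

definition rmodule_hom ::
  "('o, 'z) operad_scheme \<Rightarrow> ('k::field, 'o, 'm::ab_group_add) rmodule \<Rightarrow>
   ('k, 'o, 'n::ab_group_add) rmodule \<Rightarrow> (nat set \<Rightarrow> 'm \<Rightarrow> 'n) \<Rightarrow> bool" where
  "rmodule_hom P M N h \<longleftrightarrow>
     (\<forall>X. fin_ne X \<longrightarrow>
        (\<forall>x\<in>mvals M X. h X x \<in> mvals N X) \<and>
        (\<forall>x\<in>mvals M X. \<forall>y\<in>mvals M X. h X (x + y) = h X x + h X y) \<and>
        (\<forall>c. \<forall>x\<in>mvals M X. h X (mscale M c x) = mscale N c (h X x))) \<and>
     (\<forall>X f. fin_ne X \<and> inj_on f X \<longrightarrow>
        (\<forall>x\<in>mvals M (f ` X). h X (mpull M X f x) = mpull N X f (h (f ` X) x))) \<and>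
     (\<forall>X Bs as. lin_args P X Bs as \<longrightarrow>
        (\<forall>m\<in>mvals M {..<length Bs}.
           h X (mact M m Bs as) = mact N (h {..<length Bs} m) Bs as))"

text \<open>
  The free right module \<open>\<k>\<V> \<circ> \<k>P\<close>, which is the linearisation of \<open>\<V> \<circ> P\<close>; the action is
  extended multilinearly from basis elements.
\<close>

definition free_rmodule ::
  "('v, 'y) collection_scheme \<Rightarrow> ('o, 'z) operad_scheme \<Rightarrow>
   ('k::field, 'o, ('v, 'o) precomp set \<Rightarrow>\<^sub>0 'k) rmodule" where
  "free_rmodule V P =
     \<lparr>mvals = (\<lambda>X. lin (comp_vals V P X)),
      mscale = lin_scale,
      mpull = (\<lambda>X f. lin_map (comp_pull P X f)),
      mact = (\<lambda>m Bs as.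
        \<Sum>b\<in>Poly_Mapping.keys m. \<Sum>qs\<in>listset (map Poly_Mapping.keys as).
          Poly_Mapping.single (comp_act P b Bs qs)
            (Poly_Mapping.lookup m b *
               (\<Prod>i<length as. Poly_Mapping.lookup (as ! i) (qs ! i))))\<rparr>"

text \<open>
  The augmentation of the linearisation of a reduced connected operad: in arity 1 it is the
  coordinate with respect to the unit, in higher arities it vanishes.
\<close>

definition aug :: "('o, 'z) operad_scheme \<Rightarrow> nat set \<Rightarrow> ('o \<Rightarrow>\<^sub>0 'k::field) \<Rightarrow> 'k" where
  "aug P B a = (if card B = 1 then Poly_Mapping.lookup a (ounit P (the_elem B)) else 0)"

definition aug_module :: "('o, 'z) operad_scheme \<Rightarrow> ('k::field, 'o, 'k) rmodule" where
  "aug_module P =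
     \<lparr>mvals = (\<lambda>X. if card X = 1 then UNIV else {0}),
      mscale = (\<lambda>c x. c * x),
      mpull = (\<lambda>X f x. x),
      mact = (\<lambda>x Bs as. if length Bs = 1 then x * aug P (hd Bs) (hd as) else 0)\<rparr>"

text \<open>
  \<open>M \<circ>\<^sub>P \<I>\<close> is the coequaliser of the two maps \<open>M \<circ> \<k>P \<circ> \<I> \<rightarrow> M \<circ> \<I> \<cong> M\<close>, one acting by
  \<open>\<k>P\<close> on \<open>M\<close> and the other by \<open>\<k>P\<close> on \<open>\<I>\<close>. Hence it is the quotient of \<open>M(X)\<close> by the subspace
  \<open>rel_composite_kernel P M X\<close> spanned by the differences of their values, where
  \<open>unit_aug\<close> is the composite \<open>\<k>P \<rightarrow> \<I> \<rightarrow> \<k>P\<close> of the augmentation and the unit.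
\<close>

definition unit_aug ::
  "('o, 'z) operad_scheme \<Rightarrow> nat set \<Rightarrow> ('o \<Rightarrow>\<^sub>0 'k::field) \<Rightarrow> ('o \<Rightarrow>\<^sub>0 'k)" where
  "unit_aug P B a =
     (if card B = 1 then Poly_Mapping.single (ounit P (the_elem B)) (aug P B a) else 0)"

definition rel_composite_kernel ::
  "('o, 'z) operad_scheme \<Rightarrow> ('k::field, 'o, 'm::ab_group_add) rmodule \<Rightarrow> nat set \<Rightarrow> 'm set" where
  "rel_composite_kernel P M X =
     module.span (mscale M)
       {mact M m Bs as - mact M m Bs (map2 (unit_aug P) Bs as) | m Bs as.
          lin_args P X Bs as \<and> m \<in> mvals M {..<length Bs}}"


section \<open>Minimal resolutions\<close>

text \<open>
  A complex of right modules \<open>\<dots> \<rightarrow> M\<^sub>2 \<rightarrow> M\<^sub>1 \<rightarrow> M\<^sub>0\<close> with differentials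
  \<open>d n : M\<^bsub>n+1\<^esub> \<rightarrow> M\<^sub>n\<close> and augmentation \<open>\<epsilon> : M\<^sub>0 \<rightarrow> \<I>\<close>: its homology vanishes in positive degrees
  and is mapped isomorphically to \<open>\<I>\<close> by \<open>\<epsilon>\<close> in degree 0.
\<close>

definition resolution_of_unit ::
  "('o, 'z) operad_scheme \<Rightarrow> (nat \<Rightarrow> ('k::field, 'o, 'm::ab_group_add) rmodule) \<Rightarrow>
   (nat \<Rightarrow> nat set \<Rightarrow> 'm \<Rightarrow> 'm) \<Rightarrow> (nat set \<Rightarrow> 'm \<Rightarrow> 'k) \<Rightarrow> bool" where
  "resolution_of_unit P M d \<epsilon> \<longleftrightarrow>
     (\<forall>n. rmodule_hom P (M (Suc n)) (M n) (d n)) \<and>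
     rmodule_hom P (M 0) (aug_module P) \<epsilon> \<and>
     (\<forall>X. fin_ne X \<longrightarrow>
        (\<forall>n. \<forall>x\<in>mvals (M (Suc (Suc n))) X. d n X (d (Suc n) X x) = 0) \<and>
        (\<forall>x\<in>mvals (M (Suc 0)) X. \<epsilon> X (d 0 X x) = 0) \<and>
        (\<forall>n. \<forall>x\<in>mvals (M (Suc n)) X. d n X x = 0 \<longrightarrow>
           x \<in> d (Suc n) X ` mvals (M (Suc (Suc n))) X) \<and>
        (\<forall>x\<in>mvals (M 0) X. \<epsilon> X x = 0 \<longrightarrow> x \<in> d 0 X ` mvals (M (Suc 0)) X) \<and>
        \<epsilon> X ` mvals (M 0) X = mvals (aug_module P) X)"

text \<open>The differential induced on \<open>M \<circ>\<^sub>P \<I>\<close> is zero.\<close>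

definition minimal_complex ::
  "('o, 'z) operad_scheme \<Rightarrow> (nat \<Rightarrow> ('k::field, 'o, 'm::ab_group_add) rmodule) \<Rightarrow>
   (nat \<Rightarrow> nat set \<Rightarrow> 'm \<Rightarrow> 'm) \<Rightarrow> bool" where
  "minimal_complex P M d \<longleftrightarrow>
     (\<forall>n X. fin_ne X \<longrightarrow>
        (\<forall>x\<in>mvals (M (Suc n)) X. d n X x \<in> rel_composite_kernel P (M n) X))"

text \<open>
  Since \<open>P\<close> lives in degree 0, the degree \<open>n\<close> part of \<open>\<k>\<V> \<circ> \<k>P\<close> is the free module on the
  degree \<open>n\<close> part of \<open>\<V>\<close>.
\<close>

definition graded_free_rmodule ::
  "'v graded_collection \<Rightarrow> ('o, 'z) operad_scheme \<Rightarrow>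
   nat \<Rightarrow> ('k::field, 'o, ('v, 'o) precomp set \<Rightarrow>\<^sub>0 'k) rmodule" where
  "graded_free_rmodule V P n = free_rmodule (homogeneous V n) P"

end

theory Submission
  imports Defs
begin

text \<open>
  Fix one direction for each factor \<open>\<T>(\<X>\<^sub>i)\<close>. A leaf of a tree built from generators is reached from
  the root by a sequence of pairs of a generator and one of its inputs; sorting these steps by their
  directions gives the address of the leaf, a tuple of words. The interchange relations do not change
  addresses. Conversely, if in direction \<open>i\<close> the words of all leaves of \<open>a\<close> start with inputs of one
  generator \<open>g\<close>, then \<open>a = g(a\<^sub>1, \<dots>, a\<^sub>n)\<close>: by induction this holds for all subtrees at the root of \<open>a\<close>,
  and interchange moves \<open>g\<close> to the root. Hence an element of the tensor product is determined by its
  addresses, again by induction.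

  Let \<open>S(a)\<close> be the set of directions in which a generator can be split off \<open>a\<close> at the root; it is empty
  only if \<open>a\<close> is a unit. An element of the matrix product is a choice of generators in a set \<open>J\<close> of
  directions, so composing identifies the basis of the resolution in degree \<open>n\<close> with the pairs \<open>(J, a)\<close>
  with \<open>J \<subseteq> S(a)\<close> and \<open>|J| = n\<close>. With the simplicial differential the complex is the direct sum over
  \<open>a\<close> of the augmented chain complexes of the full simplices on \<open>S(a)\<close>, which are contractible unless
  \<open>S(a) = {}\<close>.
\<close>

section \<open>Addresses and quotients of operads\<close>

text \<open>A generator is given only up to the symmetric groups, so a letter is an orbit of pairs
  of a generator and an input; freeness of the action keeps the inputs of one generator apart.
  Arities of at least 2 make each child of a generator have fewer leaves than the whole, so
  inductions can run over the number of leaves: the congruence changes the shape of trees too much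
  for structural induction. In place of the laws of an operad, equality of addresses is used, and
  identities become computations with words. The properties gathered in \<open>models\<close>
  mention neither trees nor relations, hence pass from two operads to their tensor product and along
  the iteration. Passing from J to J - {j} hands the generator of direction j over to the operad
  factor and leaves a alone. Relabelling and the right action change a but not J, and the signs
  depend on J alone, so the differential is a map of modules. The contraction adds the smallest
  direction of S(a), which the action may change, so it is only linear. A proper face misses a
  direction of S(a), so its operad factor contains a non-unit; this gives minimality.\<close>

type_synonym 'b addr = "nat \<Rightarrow> 'b list"

definition nil_addr :: "'b addr" where
  "nil_addr = (\<lambda>_. [])"

definition cat :: "'b addr \<Rightarrow> 'b addr \<Rightarrow> 'b addr" where
  "cat u w = (\<lambda>i. u i @ w i)"

lemma cat_assoc: "cat (cat u v) w = cat u (cat v w)"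
  by (simp add: cat_def)

lemma cat_nil [simp]: "cat nil_addr u = u" "cat u nil_addr = u"
  by (simp_all add: cat_def nil_addr_def)

lemma cat_left_cancel [simp]: "cat u v = cat u w \<longleftrightarrow> v = w"
  by (auto simp: cat_def fun_eq_iff)

section \<open>Ordered partitions as lists of blocks\<close>

lemma ordered_partition_nth:
  assumes "ordered_partition Bs X"
  shows "finite X" "\<And>i. i < length Bs \<Longrightarrow> Bs ! i \<noteq> {}" "(\<Union>i<length Bs. Bs ! i) = X"
    "\<And>i j. i < length Bs \<Longrightarrow> j < length Bs \<Longrightarrow> i \<noteq> j \<Longrightarrow> Bs ! i \<inter> Bs ! j = {}"
    "\<Union> (set Bs) = X"
    "disjoint_family_on (\<lambda>i. Bs ! i) {..<length Bs}"
proof -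
  have fin: "finite X" and d: "distinct Bs" and p: "partition_on X (set Bs)"
    using assms by (auto simp: ordered_partition_def)
  show "finite X" by fact
  show "\<And>i. i < length Bs \<Longrightarrow> Bs ! i \<noteq> {}"
    using p by (metis nth_mem partition_onD3)
  show U: "\<Union> (set Bs) = X" using p by (simp add: partition_on_def)
  show "(\<Union>i<length Bs. Bs ! i) = X"
    unfolding U [symmetric] set_conv_nth by blast
  show dj: "\<And>i j. i < length Bs \<Longrightarrow> j < length Bs \<Longrightarrow> i \<noteq> j \<Longrightarrow> Bs ! i \<inter> Bs ! j = {}"
    using p d by (metis disjointD nth_eq_iff_index_eq nth_mem partition_onD2)
  show "disjoint_family_on (\<lambda>i. Bs ! i) {..<length Bs}"
    using dj by (auto simp: disjoint_family_on_def)
qed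

lemma ordered_partitionI:
  assumes "finite X" "\<And>i. i < length Bs \<Longrightarrow> Bs ! i \<noteq> {}" "(\<Union>i<length Bs. Bs ! i) = X"
    "\<And>i j. i < length Bs \<Longrightarrow> j < length Bs \<Longrightarrow> i \<noteq> j \<Longrightarrow> Bs ! i \<inter> Bs ! j = {}"
  shows "ordered_partition Bs X"
proof -
  have "distinct Bs"
    unfolding distinct_conv_nth using assms(2,4) by (metis Int_absorb)
  moreover have "partition_on X (set Bs)"
  proof (unfold partition_on_def disjoint_def, intro conjI ballI impI)
    show "\<Union> (set Bs) = X" unfolding assms(3) [symmetric] set_conv_nth by blast
    show "\<And>p q. p \<in> set Bs \<Longrightarrow> q \<in> set Bs \<Longrightarrow> p \<noteq> q \<Longrightarrow> p \<inter> q = {}"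
      using assms(4) by (metis in_set_conv_nth)
    show "{} \<notin> set Bs" using assms(2) by (metis in_set_conv_nth)
  qed
  ultimately show ?thesis using assms(1) by (simp add: ordered_partition_def)
qed

lemma ordered_partition_index:
  assumes "ordered_partition Bs X" "x \<in> X"
  obtains i where "i < length Bs" "x \<in> Bs ! i"
  using ordered_partition_nth(3)[OF assms(1)] assms(2) by blast

lemma ordered_partition_subset: "ordered_partition Bs X \<Longrightarrow> i < length Bs \<Longrightarrow> Bs ! i \<subseteq> X"
  unfolding ordered_partition_def partition_on_def by (metis Union_upper nth_mem)

lemma ordered_partition_ne:
  assumes "ordered_partition Bs X" "Bs \<noteq> []"
  shows "fin_ne X" "\<And>i. i < length Bs \<Longrightarrow> fin_ne (Bs ! i)"
proof -
  note p = ordered_partition_nth[OF assms(1)]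
  have sub: "Bs ! i \<subseteq> X" if "i < length Bs" for i using p(3) that by blast
  show *: "\<And>i. i < length Bs \<Longrightarrow> fin_ne (Bs ! i)"
    using p(1,2) sub by (meson fin_ne_def finite_subset)
  show "fin_ne X" using *[of 0] sub[of 0] p(1) assms(2) by (auto simp: fin_ne_def)
qed

text \<open>Closure under the structure maps, with nothing in arity 0. Equational laws are left to
  the comparison of addresses.\<close>

definition closed_operad :: "('o, 'z) operad_scheme \<Rightarrow> bool" where
  "closed_operad P \<longleftrightarrow>
     (\<forall>X. \<forall>a\<in>vals P X. fin_ne X) \<and>
     (\<forall>X f a. fin_ne X \<and> inj_on f X \<and> a \<in> vals P (f ` X) \<longrightarrow> pull P X f a \<in> vals P X) \<and>
     (\<forall>x. ounit P x \<in> vals P {x}) \<and>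
     (\<forall>X Bs p qs. ordered_partition Bs X \<and> Bs \<noteq> [] \<and> p \<in> vals P {..<length Bs} \<and>
        length qs = length Bs \<and> (\<forall>i<length Bs. qs ! i \<in> vals P (Bs ! i)) \<longrightarrow>
        ocomp P p Bs qs \<in> vals P X)"

lemma closed_operadD:
  assumes "closed_operad P"
  shows "a \<in> vals P X \<Longrightarrow> fin_ne X"
    "fin_ne X \<Longrightarrow> inj_on f X \<Longrightarrow> a \<in> vals P (f ` X) \<Longrightarrow> pull P X f a \<in> vals P X"
    "ounit P x \<in> vals P {x}"
    "ordered_partition Bs X \<Longrightarrow> Bs \<noteq> [] \<Longrightarrow> p \<in> vals P {..<length Bs} \<Longrightarrow>
        length qs = length Bs \<Longrightarrow> (\<And>i. i < length Bs \<Longrightarrow> qs ! i \<in> vals P (Bs ! i)) \<Longrightarrow>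
        ocomp P p Bs qs \<in> vals P X"
  using assms unfolding closed_operad_def by blast+

text \<open>The maps from \<open>X\<close> to a monoid form an operad, in which composition
  multiplies the outer value at a block by the inner value at a point. For the monoid of addresses,
  a product of free monoids, \<open>e\<close> is a map of operads into it.\<close>

definition addr_hom :: "('o, 'z) operad_scheme \<Rightarrow> ('o \<Rightarrow> nat \<Rightarrow> 'b addr) \<Rightarrow> bool" where
  "addr_hom P e \<longleftrightarrow>
     (\<forall>X f a. fin_ne X \<and> inj_on f X \<and> a \<in> vals P (f ` X) \<longrightarrow>
        (\<forall>x\<in>X. e (pull P X f a) x = e a (f x))) \<and>
     (\<forall>x. e (ounit P x) x = nil_addr) \<and>
     (\<forall>X Bs p qs. ordered_partition Bs X \<and> Bs \<noteq> [] \<and> p \<in> vals P {..<length Bs} \<and>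
        length qs = length Bs \<and> (\<forall>i<length Bs. qs ! i \<in> vals P (Bs ! i)) \<longrightarrow>
        (\<forall>i<length Bs. \<forall>x\<in>Bs ! i. e (ocomp P p Bs qs) x = cat (e p i) (e (qs ! i) x)))"

lemma addr_homD:
  assumes "addr_hom P e"
  shows "fin_ne X \<Longrightarrow> inj_on f X \<Longrightarrow> a \<in> vals P (f ` X) \<Longrightarrow> x \<in> X \<Longrightarrow>
      e (pull P X f a) x = e a (f x)"
    "e (ounit P x) x = nil_addr"
    "ordered_partition Bs X \<Longrightarrow> Bs \<noteq> [] \<Longrightarrow> p \<in> vals P {..<length Bs} \<Longrightarrow>
        length qs = length Bs \<Longrightarrow> (\<And>i. i < length Bs \<Longrightarrow> qs ! i \<in> vals P (Bs ! i)) \<Longrightarrow>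
        i < length Bs \<Longrightarrow> x \<in> Bs ! i \<Longrightarrow> e (ocomp P p Bs qs) x = cat (e p i) (e (qs ! i) x)"
  using assms unfolding addr_hom_def by blast+

definition op_hom ::
  "('o, 'y) operad_scheme \<Rightarrow> ('p, 'z) operad_scheme \<Rightarrow> (nat set \<Rightarrow> 'o \<Rightarrow> 'p) \<Rightarrow> bool" where
  "op_hom P Q h \<longleftrightarrow>
     (\<forall>X. \<forall>a\<in>vals P X. h X a \<in> vals Q X) \<and>
     (\<forall>X f a. fin_ne X \<and> inj_on f X \<and> a \<in> vals P (f ` X) \<longrightarrow>
        h X (pull P X f a) = pull Q X f (h (f ` X) a)) \<and>
     (\<forall>x. h {x} (ounit P x) = ounit Q x) \<and>
     (\<forall>X Bs p qs. ordered_partition Bs X \<and> Bs \<noteq> [] \<and> p \<in> vals P {..<length Bs} \<and>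
        length qs = length Bs \<and> (\<forall>i<length Bs. qs ! i \<in> vals P (Bs ! i)) \<longrightarrow>
        h X (ocomp P p Bs qs) = ocomp Q (h {..<length Bs} p) Bs (map2 h Bs qs))"

lemma op_homD:
  assumes "op_hom P Q h"
  shows "a \<in> vals P X \<Longrightarrow> h X a \<in> vals Q X"
    "fin_ne X \<Longrightarrow> inj_on f X \<Longrightarrow> a \<in> vals P (f ` X) \<Longrightarrow>
        h X (pull P X f a) = pull Q X f (h (f ` X) a)"
    "h {x} (ounit P x) = ounit Q x"
    "ordered_partition Bs X \<Longrightarrow> Bs \<noteq> [] \<Longrightarrow> p \<in> vals P {..<length Bs} \<Longrightarrow>
        length qs = length Bs \<Longrightarrow> (\<And>i. i < length Bs \<Longrightarrow> qs ! i \<in> vals P (Bs ! i)) \<Longrightarrow>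
        h X (ocomp P p Bs qs) = ocomp Q (h {..<length Bs} p) Bs (map2 h Bs qs)"
  using assms unfolding op_hom_def by blast+

lemma op_hom_compose:
  assumes "op_hom P Q h" "op_hom Q R k"
  shows "op_hom P R (\<lambda>X a. k X (h X a))"
  unfolding op_hom_def
proof (intro conjI allI ballI impI; (elim conjE)?)
  note h = op_homD[OF assms(1)] and k = op_homD[OF assms(2)]
  fix X Bs p qs
  assume a: "ordered_partition Bs X" "Bs \<noteq> []" "p \<in> vals P {..<length Bs}"
    "length qs = length Bs" "\<forall>i<length Bs. qs ! i \<in> vals P (Bs ! i)"
  have "k X (h X (ocomp P p Bs qs)) = k X (ocomp Q (h {..<length Bs} p) Bs (map2 h Bs qs))"
    using h(4) a by metis
  also have "\<dots> = ocomp R (k {..<length Bs} (h {..<length Bs} p)) Bs (map2 k Bs (map2 h Bs qs))"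
    by (rule k(4)) (use a h(1) in auto)
  also have "map2 k Bs (map2 h Bs qs) = map2 (\<lambda>X a. k X (h X a)) Bs qs"
    by (rule nth_equalityI) (use a in auto)
  finally show "k X (h X (ocomp P p Bs qs)) = ocomp R (k {..<length Bs} (h {..<length Bs} p)) Bs
    (map2 (\<lambda>X a. k X (h X a)) Bs qs)" .
qed (use op_homD(1-3)[OF assms(1)] op_homD(1-3)[OF assms(2)] in auto)

section \<open>Quotients by operadic congruences\<close>

lemma ocong_vals:
  assumes "closed_operad P" "ocong P R X a b"
  shows "a \<in> vals P X \<and> b \<in> vals P X"
  using assms(2)
proof induction
  case (pull X f a b)
  then show ?case using closed_operadD(2)[OF assms(1)] by blast
next
  case (comp Bs X qs qs' p p')
  then show ?case using closed_operadD(4)[OF assms(1)] by auto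
qed auto

lemma rep_ocong: "a \<in> vals P X \<Longrightarrow> ocong P R X a (rep P R X a)"
  unfolding rep_def by (rule someI) (rule ocong.refl)

lemma rep_eqI: "ocong P R X a b \<Longrightarrow> rep P R X a = rep P R X b"
proof -
  assume a: "ocong P R X a b"
  have "ocong P R X a c = ocong P R X b c" for c
    using ocong.trans[OF a] ocong.trans[OF ocong.sym[OF a]] by blast
  then show ?thesis by (simp add: rep_def)
qed

lemma rep_idem: "a \<in> vals P X \<Longrightarrow> rep P R X (rep P R X a) = rep P R X a"
  by (metis rep_eqI rep_ocong)

lemma rep_vals: "closed_operad P \<Longrightarrow> a \<in> vals P X \<Longrightarrow> rep P R X a \<in> vals P X"
  using ocong_vals rep_ocong by fast

lemma vals_quot: "closed_operad P \<Longrightarrow> vals (quot_operad P R) X = {a \<in> vals P X. rep P R X a = a}"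
  unfolding quot_operad_def by (auto simp: rep_vals rep_idem intro: rev_image_eqI)

lemma rep_hom:
  assumes "closed_operad P"
  shows "op_hom P (quot_operad P R) (rep P R)"
  unfolding op_hom_def
proof (intro conjI allI ballI impI; (elim conjE)?)
  fix X f a assume "fin_ne X" "inj_on f X" "a \<in> vals P (f ` X)"
  then show "rep P R X (pull P X f a) = pull (quot_operad P R) X f (rep P R (f ` X) a)"
    by (simp add: quot_operad_def) (rule rep_eqI, rule ocong.pull, simp_all add: rep_ocong)
next
  fix X Bs p qs
  assume a: "ordered_partition Bs X" "Bs \<noteq> []" "p \<in> vals P {..<length Bs}"
    "length qs = length Bs" "\<forall>i<length Bs. qs ! i \<in> vals P (Bs ! i)"
  have "rep P R X (ocomp P p Bs qs) =
      rep P R X (ocomp P (rep P R {..<length Bs} p) Bs (map2 (rep P R) Bs qs))"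
    by (rule rep_eqI, rule ocong.comp) (use a in \<open>auto intro: rep_ocong\<close>)
  then show "rep P R X (ocomp P p Bs qs) =
      ocomp (quot_operad P R) (rep P R {..<length Bs} p) Bs (map2 (rep P R) Bs qs)"
    by (simp add: quot_operad_def ordered_partition_nth(5)[OF a(1)])
qed (auto simp: quot_operad_def)

lemma closed_quot:
  assumes "closed_operad P"
  shows "closed_operad (quot_operad P R)"
  unfolding closed_operad_def
proof (intro conjI allI ballI impI; (elim conjE)?)
  note c = closed_operadD[OF assms]
  fix X show "a \<in> vals (quot_operad P R) X \<Longrightarrow> fin_ne X" for a
    using c(1) by (auto simp: vals_quot[OF assms])
next
  note c = closed_operadD[OF assms]
  fix X f a assume "fin_ne X" "inj_on f X" "a \<in> vals (quot_operad P R) (f ` X)"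
  then show "pull (quot_operad P R) X f a \<in> vals (quot_operad P R) X"
    using c(2)[of X f a] rep_vals[OF assms, of "pull P X f a"] rep_idem[of "pull P X f a" P]
    by (auto simp: vals_quot[OF assms]) (auto simp: quot_operad_def)
next
  fix x show "ounit (quot_operad P R) x \<in> vals (quot_operad P R) {x}"
    by (metis assms closed_operadD(3) op_homD(1,3) rep_hom)
next
  note c = closed_operadD[OF assms]
  fix X Bs p qs
  assume a: "ordered_partition Bs X" "Bs \<noteq> []" "p \<in> vals (quot_operad P R) {..<length Bs}"
    "length qs = length Bs" "\<forall>i<length Bs. qs ! i \<in> vals (quot_operad P R) (Bs ! i)"
  have "ocomp P p Bs qs \<in> vals P X"
    by (rule c(4)) (use a in \<open>auto simp: vals_quot[OF assms]\<close>)
  then show "ocomp (quot_operad P R) p Bs qs \<in> vals (quot_operad P R) X"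
    by (auto simp: quot_operad_def ordered_partition_nth(5)[OF a(1)])
qed

text \<open>Relabelling and composition act on addresses by formulas that see only the addresses of
  the arguments, so checking the generating relations suffices.\<close>

lemma ocong_addr:
  assumes P: "closed_operad P" and e: "addr_hom P e"
    and R: "\<And>X a b x. R X a b \<Longrightarrow> a \<in> vals P X \<Longrightarrow> b \<in> vals P X \<Longrightarrow> x \<in> X \<Longrightarrow> e a x = e b x"
  shows "ocong P R X a b \<Longrightarrow> x \<in> X \<Longrightarrow> e a x = e b x"
proof (induction arbitrary: x rule: ocong.induct)
  case (pull X f a b)
  then show ?case using ocong_vals[OF P pull.hyps(3)] addr_homD(1)[OF e] by (metis imageI)
next
  case (comp Bs X qs qs' p p')
  obtain i where i: "i < length Bs" "x \<in> Bs ! i"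
    using comp by (metis ordered_partition_index)
  have v: "p \<in> vals P {..<length Bs}" "p' \<in> vals P {..<length Bs}"
    "\<And>i. i < length Bs \<Longrightarrow> qs ! i \<in> vals P (Bs ! i)"
    "\<And>i. i < length Bs \<Longrightarrow> qs' ! i \<in> vals P (Bs ! i)"
    using ocong_vals[OF P] comp.hyps by blast+
  have "e p i = e p' i" "e (qs ! i) x = e (qs' ! i) x"
    using comp.IH i by auto
  then show ?case
    using addr_homD(3)[OF e comp.hyps(1,2) v(1) comp.hyps(3) v(3) i]
      addr_homD(3)[OF e comp.hyps(1,2) v(2) comp.hyps(4) v(4) i] by simp
qed (use R in auto)

text \<open>A representative has the addresses of every element of its class, so the quotient is
  evaluated by the same function \<open>e\<close>.\<close>

lemma quot_addr:
  assumes P: "closed_operad P" and e: "addr_hom P e"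
    and R: "\<And>X a b x. R X a b \<Longrightarrow> a \<in> vals P X \<Longrightarrow> b \<in> vals P X \<Longrightarrow> x \<in> X \<Longrightarrow> e a x = e b x"
  shows "addr_hom (quot_operad P R) e"
    and rep_addr: "a \<in> vals P X \<Longrightarrow> x \<in> X \<Longrightarrow> e (rep P R X a) x = e a x"
proof -
  show r: "e (rep P R X a) x = e a x" if "a \<in> vals P X" "x \<in> X" for X a x
    using ocong_addr[OF P e R rep_ocong[OF that(1)] that(2)] by simp
  show "addr_hom (quot_operad P R) e"
    unfolding addr_hom_def
  proof (intro conjI allI ballI impI; (elim conjE)?)
    fix X f a x assume "fin_ne X" "inj_on f X" "a \<in> vals (quot_operad P R) (f ` X)" "x \<in> X"
    then show "e (pull (quot_operad P R) X f a) x = e a (f x)"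
      using r closed_operadD(2)[OF P] addr_homD(1)[OF e]
      by (auto simp: vals_quot[OF P]) (auto simp: quot_operad_def)
  next
    fix x show "e (ounit (quot_operad P R) x) x = nil_addr"
      using r closed_operadD(3)[OF P] addr_homD(2)[OF e] by (auto simp: quot_operad_def)
  next
    fix X Bs p qs i x
    assume a: "ordered_partition Bs X" "Bs \<noteq> []" "p \<in> vals (quot_operad P R) {..<length Bs}"
      "length qs = length Bs" "\<forall>i<length Bs. qs ! i \<in> vals (quot_operad P R) (Bs ! i)"
      "i < length Bs" "x \<in> Bs ! i"
    have v: "p \<in> vals P {..<length Bs}" "\<And>i. i < length Bs \<Longrightarrow> qs ! i \<in> vals P (Bs ! i)"
      using a by (auto simp: vals_quot[OF P])
    have "x \<in> X" using a ordered_partition_nth(3)[OF a(1)] by blast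
    then have "e (ocomp (quot_operad P R) p Bs qs) x = e (ocomp P p Bs qs) x"
      using r closed_operadD(4)[OF P a(1,2) v(1) a(4) v(2)]
      by (auto simp: quot_operad_def ordered_partition_nth(5)[OF a(1)])
    then show "e (ocomp (quot_operad P R) p Bs qs) x = cat (e p i) (e (qs ! i) x)"
      using addr_homD(3)[OF e a(1,2) v(1) a(4) v(2) a(6,7)] by simp
  qed
qed

section \<open>The operad of planar trees\<close>

lemma distinct_concat_nth:
  "distinct (concat xss) \<longleftrightarrow> (\<forall>i<length xss. distinct (xss ! i)) \<and>
     (\<forall>i<length xss. \<forall>j<length xss. i \<noteq> j \<longrightarrow> set (xss ! i) \<inter> set (xss ! j) = {})"
proof (induction xss)
  case (Cons xs xss)
  have "set xs \<inter> set (concat xss) = {} \<longleftrightarrow> (\<forall>j<length xss. set xs \<inter> set (xss ! j) = {})"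
    by (auto simp: set_conv_nth[of xss])
  then show ?case
    unfolding concat.simps distinct_append Cons.IH
    by (simp only: length_Cons All_less_Suc2 nth_Cons_0 nth_Cons_Suc)
      (simp add: Int_commute, intro iffI conjI allI impI; (elim conjE)?; simp)
qed simp

lemma tree_vals: "t \<in> vals (tree_operad U) X \<longleftrightarrow> is_tree U t \<and> distinct (leaves t) \<and> set (leaves t) = X"
  by (simp add: tree_operad_def)

lemma Leaf_vals [simp]: "Leaf x \<in> vals (tree_operad U) X \<longleftrightarrow> X = {x}"
  by (auto simp: tree_vals intro: is_tree.intros)

lemma is_tree_Node: "is_tree U (Node g ts) \<longleftrightarrow>
    ts \<noteq> [] \<and> g \<in> vals U {..<length ts} \<and> (\<forall>t\<in>set ts. is_tree U t)"
  by (subst is_tree.simps) auto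

lemma Node_valsI:
  assumes "ts \<noteq> []" "g \<in> vals U {..<length ts}"
    "\<And>i. i < length ts \<Longrightarrow> ts ! i \<in> vals (tree_operad U) (B i)"
    "disjoint_family_on B {..<length ts}" "X = (\<Union>i<length ts. B i)"
  shows "Node g ts \<in> vals (tree_operad U) X"
proof -
  have B: "is_tree U (ts ! i) \<and> distinct (leaves (ts ! i)) \<and> set (leaves (ts ! i)) = B i"
    if "i < length ts" for i using assms(3)[OF that] by (simp add: tree_vals)
  have "is_tree U (Node g ts)"
    using assms(1,2) B by (auto simp: is_tree_Node in_set_conv_nth)
  moreover have "distinct (leaves (Node g ts))"
    using B assms(4) by (simp add: distinct_concat_nth disjoint_family_on_def del: distinct_concat)
  moreover have "set (leaves (Node g ts)) = X"
    using B by (auto simp: assms(5) set_conv_nth[of ts])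
  ultimately show ?thesis by (simp add: tree_vals)
qed

lemma Node_valsD:
  assumes "Node g ts \<in> vals (tree_operad U) X"
  shows "ts \<noteq> []" "g \<in> vals U {..<length ts}"
    "\<And>i. i < length ts \<Longrightarrow> ts ! i \<in> vals (tree_operad U) (set (leaves (ts ! i)))"
    "disjoint_family_on (\<lambda>i. set (leaves (ts ! i))) {..<length ts}"
    "X = (\<Union>i<length ts. set (leaves (ts ! i)))"
proof -
  have a: "is_tree U (Node g ts)" "distinct (concat (map leaves ts))"
    "set (leaves (Node g ts)) = X"
    using assms by (simp_all add: tree_vals)
  show "ts \<noteq> []" "g \<in> vals U {..<length ts}" using a(1) by (auto simp: is_tree_Node)
  show "\<And>i. i < length ts \<Longrightarrow> ts ! i \<in> vals (tree_operad U) (set (leaves (ts ! i)))"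
    using a(1,2) by (auto simp: is_tree_Node tree_vals distinct_concat_nth simp del: distinct_concat)
  show "disjoint_family_on (\<lambda>i. set (leaves (ts ! i))) {..<length ts}"
    using a(2) by (simp add: distinct_concat_nth disjoint_family_on_def del: distinct_concat)
  show "X = (\<Union>i<length ts. set (leaves (ts ! i)))"
    using a(3) by (auto simp: set_conv_nth[of ts])
qed

lemma tree_fin_ne: "t \<in> vals (tree_operad U) X \<Longrightarrow> fin_ne X"
proof -
  have "is_tree U t \<Longrightarrow> leaves t \<noteq> []"
    by (induction rule: is_tree.induct) (auto simp: neq_Nil_conv)
  then show "t \<in> vals (tree_operad U) X \<Longrightarrow> fin_ne X" by (auto simp: tree_vals fin_ne_def)
qed

lemma subst_cong: "(\<And>y. y \<in> set (leaves t) \<Longrightarrow> s y = r y) \<Longrightarrow> subst s t = subst r t"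
  by (induction t) auto

lemma subst_vals:
  assumes "t \<in> vals (tree_operad U) Y" "\<And>y. y \<in> Y \<Longrightarrow> s y \<in> vals (tree_operad U) (B y)"
    "disjoint_family_on B Y" "X = (\<Union>y\<in>Y. B y)"
  shows "subst s t \<in> vals (tree_operad U) X"
proof -
  have "is_tree U t" using assms(1) by (simp add: tree_vals)
  then show ?thesis using assms
  proof (induction arbitrary: X Y rule: is_tree.induct)
    case (1 x)
    then show ?case by simp
  next
    case (2 ts g)
    note n = Node_valsD[OF 2(5)]
    show ?case
    proof (unfold subst.simps, rule Node_valsI)
      fix i assume i: "i < length (map (subst s) ts)"
      let ?L = "set (leaves (ts ! i))"
      show "map (subst s) ts ! i \<in> vals (tree_operad U) (\<Union>y\<in>?L. B y)"
        using i n(3)[of i] 2(6,7) n(5)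
        by (auto intro!: 2(4)[of "ts ! i" ?L] simp: disjoint_family_on_def)
    next
      have "(\<Union>y\<in>set (leaves (ts ! i)). B y) \<inter> (\<Union>y\<in>set (leaves (ts ! j)). B y) = {}"
        if ij: "i < length ts" "j < length ts" "i \<noteq> j" for i j
      proof -
        have "B y \<inter> B z = {}" if "y \<in> set (leaves (ts ! i))" "z \<in> set (leaves (ts ! j))" for y z
          using 2(7) that n(4,5) ij unfolding disjoint_family_on_def
          by (metis UN_I disjoint_iff lessThan_iff)
        then show ?thesis by blast
      qed
      then show "disjoint_family_on (\<lambda>i. \<Union>y\<in>set (leaves (ts ! i)). B y) {..<length (map (subst s) ts)}"
        by (simp add: disjoint_family_on_def)
      show "X = (\<Union>i<length (map (subst s) ts). \<Union>y\<in>set (leaves (ts ! i)). B y)"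
        using 2(8) n(5) by simp
    qed (use n(1,2) in simp_all)
  qed
qed

text \<open>The product of the values of the vertices on the path from the root to the leaf
  \<open>x\<close>; in a tree with distinct leaves \<open>LEAST\<close> finds the only child
  containing \<open>x\<close>. The recursive call is made under \<open>map\<close>, where its
  argument is visibly an element of \<open>ts\<close>.\<close>

fun tev :: "(nat \<Rightarrow> 'a expr \<Rightarrow> nat \<Rightarrow> 'b addr) \<Rightarrow> 'a expr \<Rightarrow> nat \<Rightarrow> 'b addr" where
  "tev val (Leaf y) x = nil_addr"
| "tev val (Node g ts) x =
     (let i = (LEAST i. i < length ts \<and> x \<in> set (leaves (ts ! i)))
      in cat (val (length ts) g i) (map (\<lambda>t. tev val t x) ts ! i))"
| "tev val _ x = nil_addr"

declare tev.simps(2) [simp del]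

lemma tev_Node:
  assumes "Node g ts \<in> vals (tree_operad U) X" "i < length ts" "x \<in> set (leaves (ts ! i))"
  shows "tev val (Node g ts) x = cat (val (length ts) g i) (tev val (ts ! i) x)"
proof -
  have "(LEAST i. i < length ts \<and> x \<in> set (leaves (ts ! i))) = i"
    by (rule Least_equality)
      (use assms Node_valsD(4)[OF assms(1)] in \<open>auto simp: disjoint_family_on_def intro!: eq_refl\<close>)
  then show ?thesis using assms(2) by (simp add: Let_def tev.simps(2))
qed

text \<open>The path to \<open>x\<close> in the grafted tree runs to the leaf \<open>y\<close> of
  \<open>t\<close> and continues inside \<open>s y\<close>.\<close>

lemma tev_subst:
  assumes "t \<in> vals (tree_operad U) Y" "\<And>y. y \<in> Y \<Longrightarrow> s y \<in> vals (tree_operad U) (B y)"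
    "disjoint_family_on B Y" "y \<in> Y" "x \<in> B y"
  shows "tev val (subst s t) x = cat (tev val t y) (tev val (s y) x)"
proof -
  have "is_tree U t" using assms(1) by (simp add: tree_vals)
  then show ?thesis using assms
  proof (induction arbitrary: Y rule: is_tree.induct)
    case (1 z)
    then show ?case by simp
  next
    case (2 ts g)
    note n = Node_valsD[OF 2(5)]
    obtain i where i: "i < length ts" "y \<in> set (leaves (ts ! i))" using n(5) 2(8) by blast
    let ?L = "set (leaves (ts ! i))"
    have L: "?L \<subseteq> Y" using n(5) i by blast
    have dj: "disjoint_family_on B ?L" using 2(7) L by (auto simp: disjoint_family_on_def)
    have sv: "subst s (ts ! i) \<in> vals (tree_operad U) (\<Union>y\<in>?L. B y)"
      by (rule subst_vals[OF n(3)[OF i(1)] _ dj]) (use L 2(6) in auto)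
    have xs: "x \<in> set (leaves (map (subst s) ts ! i))"
      using sv i 2(9) by (auto simp: tree_vals)
    have v: "Node g (map (subst s) ts) \<in> vals (tree_operad U) (\<Union>y\<in>Y. B y)"
      using subst_vals[OF 2(5) _ 2(7) HOL.refl] 2(6) by simp
    have "tev val (subst s (Node g ts)) x =
        cat (val (length ts) g i) (tev val (subst s (ts ! i)) x)"
      using tev_Node[OF v _ xs] i(1) by simp
    also have "tev val (subst s (ts ! i)) x = cat (tev val (ts ! i) y) (tev val (s y) x)"
      by (rule 2(4)[of "ts ! i" ?L]) (use i n(3) 2(6,9) L dj in auto)
    also have "cat (val (length ts) g i) \<dots> = cat (tev val (Node g ts) y) (tev val (s y) x)"
      by (simp only: tev_Node[OF 2(5) i] cat_assoc)
    finally show ?case .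
  qed
qed

lemma tree_pull: "pull (tree_operad U) X f t = subst (\<lambda>y. Leaf (inv_into X f y)) t"
  and tree_unit: "ounit (tree_operad U) = Leaf"
  and tree_comp: "ocomp (tree_operad U) p Bs qs = subst (\<lambda>i. qs ! i) p"
  by (simp_all add: tree_operad_def)

lemma closed_tree: "closed_operad (tree_operad U)"
  unfolding closed_operad_def
proof (intro conjI allI ballI impI; (elim conjE)?)
  fix X f a assume "fin_ne X" "inj_on f X" "a \<in> vals (tree_operad U) (f ` X)"
  then show "pull (tree_operad U) X f a \<in> vals (tree_operad U) X"
    unfolding tree_pull
    by (intro subst_vals[where B = "\<lambda>y. {inv_into X f y}"])
      (auto simp: disjoint_family_on_def)
next
  fix X Bs p qs
  assume a: "ordered_partition Bs X" "Bs \<noteq> []" "p \<in> vals (tree_operad U) {..<length Bs}"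
    "length qs = length Bs" "\<forall>i<length Bs. qs ! i \<in> vals (tree_operad U) (Bs ! i)"
  show "ocomp (tree_operad U) p Bs qs \<in> vals (tree_operad U) X"
    unfolding tree_comp
    by (rule subst_vals[OF a(3), where B = "\<lambda>i. Bs ! i"])
      (use a ordered_partition_nth[OF a(1)] in auto)
qed (auto simp: tree_fin_ne tree_unit)

lemma tree_addr: "addr_hom (tree_operad U) (tev val)"
  unfolding addr_hom_def
proof (intro conjI allI ballI impI; (elim conjE)?)
  fix X f a x assume a: "fin_ne X" "inj_on f X" "a \<in> vals (tree_operad U) (f ` X)" "x \<in> X"
  have "tev val (subst (\<lambda>y. Leaf (inv_into X f y)) a) x =
      cat (tev val a (f x)) (tev val (Leaf (inv_into X f (f x))) x)"
    by (rule tev_subst[OF a(3), where B = "\<lambda>y. {inv_into X f y}"])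
      (use a in \<open>auto simp: disjoint_family_on_def\<close>)
  then show "tev val (pull (tree_operad U) X f a) x = tev val a (f x)"
    by (simp add: tree_pull)
next
  fix X Bs p qs i x
  assume a: "ordered_partition Bs X" "Bs \<noteq> []" "p \<in> vals (tree_operad U) {..<length Bs}"
    "length qs = length Bs" "\<forall>i<length Bs. qs ! i \<in> vals (tree_operad U) (Bs ! i)"
    "i < length Bs" "x \<in> Bs ! i"
  show "tev val (ocomp (tree_operad U) p Bs qs) x = cat (tev val p i) (tev val (qs ! i) x)"
    unfolding tree_comp
    by (rule tev_subst[OF a(3), where B = "\<lambda>i. Bs ! i"])
      (use a ordered_partition_nth[OF a(1)] in auto)
qed (auto simp: tree_unit)

section \<open>Letters\<close>

type_synonym 'a letter = "(nat \<times> 'a \<times> nat) set"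

text \<open>The letter of the input \<open>c\<close> of \<open>x\<close> is an orbit of pairs of an element and an input. It records the
  arity, since \<open>vals F {..<m}\<close> and \<open>vals F {..<n}\<close> need not be disjoint.\<close>

definition letter :: "('a, 'z) collection_scheme \<Rightarrow> nat set \<Rightarrow> 'a \<Rightarrow> nat \<Rightarrow> 'a letter" where
  "letter F X x c = {(card X, pull F {..<card X} f x, c') | f c'.
     bij_betw f {..<card X} X \<and> c' < card X \<and> f c' = c}"

definition good_coll :: "('a, 'z) collection_scheme \<Rightarrow> bool" where
  "good_coll F \<longleftrightarrow> is_collection F \<and> free_collection F \<and> no_small_arities F"

lemma collectionD:
  assumes "is_collection F"
  shows "fin_ne X \<Longrightarrow> inj_on f X \<Longrightarrow> x \<in> vals F (f ` X) \<Longrightarrow> pull F X f x \<in> vals F X"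
    "fin_ne X \<Longrightarrow> x \<in> vals F X \<Longrightarrow> pull F X (\<lambda>i. i) x = x"
    "fin_ne X \<Longrightarrow> inj_on g X \<Longrightarrow> inj_on f (g ` X) \<Longrightarrow> x \<in> vals F (f ` g ` X) \<Longrightarrow>
        pull F X (\<lambda>i. f (g i)) x = pull F X g (pull F (g ` X) f x)"
    "fin_ne X \<Longrightarrow> inj_on f X \<Longrightarrow> (\<And>i. i \<in> X \<Longrightarrow> f i = g i) \<Longrightarrow> x \<in> vals F (f ` X) \<Longrightarrow>
        pull F X f x = pull F X g x"
proof -
  note a = assms[unfolded is_collection_def]
  show "fin_ne X \<Longrightarrow> inj_on f X \<Longrightarrow> x \<in> vals F (f ` X) \<Longrightarrow> pull F X f x \<in> vals F X"
    using a[THEN conjunct1] by blast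
  show "fin_ne X \<Longrightarrow> x \<in> vals F X \<Longrightarrow> pull F X (\<lambda>i. i) x = x"
    using a[THEN conjunct2, THEN conjunct1] by blast
  show "fin_ne X \<Longrightarrow> inj_on g X \<Longrightarrow> inj_on f (g ` X) \<Longrightarrow> x \<in> vals F (f ` g ` X) \<Longrightarrow>
        pull F X (\<lambda>i. f (g i)) x = pull F X g (pull F (g ` X) f x)"
    using a[THEN conjunct2, THEN conjunct2, THEN conjunct1, rule_format, of X g f x] by simp
  show "fin_ne X \<Longrightarrow> inj_on f X \<Longrightarrow> (\<And>i. i \<in> X \<Longrightarrow> f i = g i) \<Longrightarrow> x \<in> vals F (f ` X) \<Longrightarrow>
        pull F X f x = pull F X g x"
    using a[THEN conjunct2, THEN conjunct2, THEN conjunct2, rule_format, of X f g x] by simp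
qed

lemma pull_bij:
  assumes "is_collection F" "fin_ne X" "bij_betw f X Y" "x \<in> vals F Y"
  shows "pull F X f x \<in> vals F X"
  using collectionD(1)[OF assms(1,2)] assms(3,4) by (simp add: bij_betw_def)

lemma pull_pull:
  assumes "is_collection F" "fin_ne X" "bij_betw g X Y" "bij_betw f Y Z" "x \<in> vals F Z"
    and "\<And>i. i \<in> X \<Longrightarrow> h i = f (g i)"
  shows "pull F X g (pull F Y f x) = pull F X h x"
proof -
  have i: "g ` X = Y" "f ` Y = Z" "inj_on g X" "inj_on f Y"
    using assms by (auto simp: bij_betw_def)
  have "pull F X g (pull F Y f x) = pull F X (\<lambda>i. f (g i)) x"
    using collectionD(3)[OF assms(1,2), of g f x] i assms(5) by simp
  also have "\<dots> = pull F X h x"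
    by (rule collectionD(4)[OF assms(1,2)])
      (use i assms(5,6) in \<open>auto simp: inj_on_def image_image[symmetric]\<close>)
  finally show ?thesis .
qed

lemma pull_id:
  assumes "is_collection F" "fin_ne X" "x \<in> vals F X" "\<And>i. i \<in> X \<Longrightarrow> h i = i"
  shows "pull F X h x = x"
proof -
  have "pull F X (\<lambda>i. i) x = pull F X h x"
    by (rule collectionD(4)[OF assms(1,2)]) (use assms in auto)
  then show ?thesis using collectionD(2)[OF assms(1-3)] by simp
qed

lemma fin_ne_lessThan [simp]: "fin_ne {..<n} \<longleftrightarrow> n > 0"
  by (auto simp: fin_ne_def)

lemma fin_ne_card: "fin_ne X \<Longrightarrow> card X > 0"
  by (simp add: fin_ne_def card_gt_0_iff)

lemma bij_to_set:
  assumes "fin_ne X" obtains f where "bij_betw f {..<card X} X"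
  using assms ex_bij_betw_nat_finite[of X] by (auto simp: fin_ne_def atLeast0LessThan)

lemma letter_ne:
  assumes "fin_ne X" "c \<in> X"
  obtains f c' where "bij_betw f {..<card X} X" "c' < card X" "f c' = c"
    "(card X, pull F {..<card X} f x, c') \<in> letter F X x c"
proof -
  obtain f where f: "bij_betw f {..<card X} X" using bij_to_set[OF assms(1)] .
  then obtain c' where "c' < card X" "f c' = c"
    using assms(2) unfolding bij_betw_def by (metis imageE lessThan_iff)
  with f that show ?thesis by (auto simp: letter_def)
qed

text \<open>The enumerations of \<open>Y\<close> are those of \<open>X\<close> followed by
  \<open>f\<close>, so both sides run over the same orbit.\<close>

lemma letter_pull:
  assumes F: "is_collection F" and X: "fin_ne X" and f: "bij_betw f X Y" and x: "x \<in> vals F Y"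
    and c: "c \<in> X"
  shows "letter F X (pull F X f x) c = letter F Y x (f c)"
proof -
  have card: "card Y = card X" using bij_betw_same_card[OF f] by simp
  have n: "fin_ne {..<card X}" using fin_ne_card[OF X] by simp
  show ?thesis
  proof (intro equalityI subsetI)
    fix z assume "z \<in> letter F X (pull F X f x) c"
    then obtain g c' where z: "z = (card X, pull F {..<card X} g (pull F X f x), c')"
      "bij_betw g {..<card X} X" "c' < card X" "g c' = c" by (auto simp: letter_def)
    have "pull F {..<card X} g (pull F X f x) = pull F {..<card X} (f \<circ> g) x"
      by (rule pull_pull[OF F n z(2) f x]) simp
    moreover have "bij_betw (f \<circ> g) {..<card X} Y" using z(2) f by (rule bij_betw_trans)
    ultimately show "z \<in> letter F Y x (f c)"
      using z unfolding letter_def card by (intro CollectI exI[of _ "f \<circ> g"] exI[of _ c']) auto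
  next
    fix z assume "z \<in> letter F Y x (f c)"
    then obtain h c' where z: "z = (card X, pull F {..<card X} h x, c')"
      "bij_betw h {..<card X} Y" "c' < card X" "h c' = f c" by (auto simp: letter_def card)
    let ?g = "inv_into X f \<circ> h"
    have g: "bij_betw ?g {..<card X} X"
      using z(2) bij_betw_inv_into[OF f] by (rule bij_betw_trans)
    have "pull F {..<card X} ?g (pull F X f x) = pull F {..<card X} h x"
      by (rule pull_pull[OF F n g f x])
        (use z(2) f in \<open>auto simp: bij_betw_def f_inv_into_f\<close>)
    moreover have "?g c' = c" using z(4) f c by (simp add: bij_betw_def)
    ultimately show "z \<in> letter F X (pull F X f x) c"
      using z g unfolding letter_def by (intro CollectI exI[of _ ?g] exI[of _ c']) auto
  qed
qed

text \<open>A common element of the two orbits comes with an enumeration of \<open>X\<close> and one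
  of \<open>Y\<close>; the inverse of the first followed by the second is
  \<open>\<sigma>\<close>.\<close>

lemma letter_eqD:
  assumes F: "is_collection F" and X: "fin_ne X" and Y: "fin_ne Y"
    and x: "x \<in> vals F X" and y: "y \<in> vals F Y" and c: "c \<in> X"
    and eq: "letter F X x c = letter F Y y d"
  obtains \<sigma> where "bij_betw \<sigma> X Y" "x = pull F X \<sigma> y" "\<sigma> c = d"
proof -
  obtain f c' where f: "bij_betw f {..<card X} X" "c' < card X" "f c' = c"
    "(card X, pull F {..<card X} f x, c') \<in> letter F X x c"
    by (rule letter_ne[OF X c])
  from f(4)[unfolded eq] obtain g where g: "card X = card Y" "bij_betw g {..<card X} Y"
    "pull F {..<card X} f x = pull F {..<card X} g y" "g c' = d"
    by (auto simp: letter_def)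
  have n: "fin_ne {..<card X}" using fin_ne_card[OF X] by simp
  let ?f' = "inv_into {..<card X} f"
  have f': "bij_betw ?f' X {..<card X}" using f(1) by (rule bij_betw_inv_into)
  have ff': "f (?f' i) = i" if "i \<in> X" for i
    using f(1) that by (auto simp: bij_betw_def f_inv_into_f)
  have "x = pull F X (\<lambda>i. i) x" using collectionD(2)[OF F X x] by simp
  also have "\<dots> = pull F X ?f' (pull F {..<card X} f x)"
    by (rule pull_pull[OF F X f' f(1) x, symmetric]) (simp add: ff')
  also have "\<dots> = pull F X (g \<circ> ?f') y"
    unfolding g(3) by (rule pull_pull[OF F X f' g(2) y]) simp
  finally have "x = pull F X (g \<circ> ?f') y" .
  moreover have "bij_betw (g \<circ> ?f') X Y" using f' g(2) by (rule bij_betw_trans)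
  moreover have "(g \<circ> ?f') c = d" using f g(4) by (auto simp: bij_betw_def inv_into_f_f)
  ultimately show ?thesis using that by blast
qed

text \<open>\<open>free_collection\<close> speaks of standard sets only, so the bijection is
  conjugated by an enumeration of \<open>X\<close>.\<close>

lemma free_on:
  assumes "good_coll F" and X: "fin_ne X" and x: "x \<in> vals F X"
    and s: "bij_betw \<sigma> X X" and e: "pull F X \<sigma> x = x" and c: "c \<in> X"
  shows "\<sigma> c = c"
proof -
  have F: "is_collection F" and fr: "free_collection F" using assms(1) by (auto simp: good_coll_def)
  obtain f where f: "bij_betw f {..<card X} X" using bij_to_set[OF X] .
  have n: "fin_ne {..<card X}" using fin_ne_card[OF X] by simp
  let ?n = "{..<card X}" and ?f' = "inv_into {..<card X} f"
  \<comment> \<open>The conjugate is extended by the identity because \<open>permutes\<close> fixes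
    everything off the set.\<close>
  define \<tau> where "\<tau> = (\<lambda>i. if i \<in> ?n then ?f' (\<sigma> (f i)) else i)"
  have f': "bij_betw ?f' X ?n" using f by (rule bij_betw_inv_into)
  have ff': "f (?f' i) = i" if "i \<in> X" for i
    using f that by (auto simp: bij_betw_def f_inv_into_f)
  have "bij_betw (?f' \<circ> (\<sigma> \<circ> f)) ?n ?n" using f s f' by (blast intro: bij_betw_trans)
  then have t: "bij_betw \<tau> ?n ?n" by (rule bij_betw_cong[THEN iffD1, rotated]) (simp add: \<tau>_def)
  then have perm: "\<tau> permutes ?n" by (rule bij_imp_permutes) (simp add: \<tau>_def)
  have y: "pull F ?n f x \<in> vals F ?n" by (rule pull_bij[OF F n f x])
  have fX: "f i \<in> X" if "i \<in> ?n" for i using f that by (auto simp: bij_betw_def)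
  have sX: "\<sigma> i \<in> X" if "i \<in> X" for i using s that by (auto simp: bij_betw_def)
  have "pull F ?n \<tau> (pull F ?n f x) = pull F ?n (\<sigma> \<circ> f) x"
    by (rule pull_pull[OF F n t f x]) (simp add: \<tau>_def ff' fX sX)
  also have "\<dots> = pull F ?n f (pull F X \<sigma> x)"
    by (rule pull_pull[OF F n f s x, symmetric]) simp
  finally have "pull F ?n \<tau> (pull F ?n f x) = pull F ?n f x" by (simp add: e)
  with fr perm y have "\<tau> = id" by (auto simp: free_collection_def)
  then have "\<tau> i = i" for i by simp
  then have "?f' (\<sigma> (f i)) = i" if "i \<in> ?n" for i
    using that unfolding \<tau>_def by presburger
  then have *: "\<sigma> (f i) = f i" if "i \<in> ?n" for i
    using that ff'[OF sX[OF fX[OF that]]] by simp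
  have "?f' c \<in> ?n" using bij_betw_apply[OF f' c] .
  then show ?thesis using *[of "?f' c"] ff'[OF c] by simp
qed

text \<open>Equal letters yield a bijection that fixes \<open>x\<close> and takes \<open>c\<close>
  to \<open>d\<close>; freeness makes it the identity.\<close>

lemma letter_inj:
  assumes "good_coll F" "fin_ne X" "x \<in> vals F X" "c \<in> X" "letter F X x c = letter F X x d"
  shows "c = d"
proof -
  have F: "is_collection F" using assms(1) by (simp add: good_coll_def)
  obtain \<sigma> where "bij_betw \<sigma> X X" "x = pull F X \<sigma> x" "\<sigma> c = d"
    by (rule letter_eqD[OF F assms(2,2,3,3,4,5)])
  then show ?thesis using free_on[OF assms(1-3)] assms(4) by metis
qed

text \<open>A single common letter already makes \<open>x\<close> a relabelling of \<open>y\<close>;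
  comparing the other letters with \<open>letter_inj\<close> shows that the relabelling moves no
  input.\<close>

lemma letter_faithful:
  assumes "good_coll F" "fin_ne X" "x \<in> vals F X" "y \<in> vals F X"
    "\<And>c. c \<in> X \<Longrightarrow> letter F X x c = letter F X y c"
  shows "x = y"
proof -
  have F: "is_collection F" using assms(1) by (simp add: good_coll_def)
  obtain c where c: "c \<in> X" using assms(2) by (auto simp: fin_ne_def)
  obtain \<sigma> where s: "bij_betw \<sigma> X X" "x = pull F X \<sigma> y" "\<sigma> c = c"
    by (rule letter_eqD[OF F assms(2,2,3,4) c assms(5)[OF c]])
  have "\<sigma> c' = c'" if "c' \<in> X" for c'
    using letter_pull[OF F assms(2) s(1) assms(4) that] assms(5)[OF that]
      letter_inj[OF assms(1,2,4) that] s(2) by metis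
  then show ?thesis using s(2) pull_id[OF F assms(2,4)] by metis
qed

lemma arity_ge_2:
  assumes "good_coll F" "fin_ne X" "g \<in> vals F X"
  shows "card X \<ge> 2"
proof (rule ccontr)
  assume "\<not> 2 \<le> card X"
  then have 1: "card X = 1" using fin_ne_card[OF assms(2)] by linarith
  obtain f where "bij_betw f {..<card X} X" using bij_to_set[OF assms(2)] .
  then have "pull F {..<1} f g \<in> vals F {..<1}"
    using assms pull_bij[of F "{..<1}" f X g] unfolding good_coll_def 1 by simp
  then show False using assms(1) by (simp add: good_coll_def no_small_arities_def)
qed

lemma letter_eq_permutes:
  assumes "good_coll F" "0 < m" "0 < n" "h \<in> vals F {..<m}" "g \<in> vals F {..<n}" "c < m"
    "letter F {..<m} h c = letter F {..<n} g c'"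
  obtains \<sigma> where "m = n" "\<sigma> permutes {..<n}" "h = pull F {..<n} \<sigma> g"
    "\<And>d. d < n \<Longrightarrow> letter F {..<n} h d = letter F {..<n} g (\<sigma> d)"
proof -
  have F: "is_collection F" using assms(1) by (simp add: good_coll_def)
  obtain \<sigma> where s: "bij_betw \<sigma> {..<m} {..<n}" "h = pull F {..<m} \<sigma> g"
    by (rule letter_eqD[OF F _ _ assms(4,5) _ assms(7)]) (use assms in auto)
  have mn: "m = n" using bij_betw_same_card[OF s(1)] by simp
  define \<tau> where "\<tau> = (\<lambda>i. if i \<in> {..<n} then \<sigma> i else i)"
  have t: "bij_betw \<tau> {..<n} {..<n}"
    by (rule bij_betw_cong[THEN iffD1, OF _ s(1)[unfolded mn]]) (simp add: \<tau>_def)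
  have p: "\<tau> permutes {..<n}" using t by (rule bij_imp_permutes) (simp add: \<tau>_def)
  have fn: "fin_ne {..<n}" using assms by simp
  have h: "h = pull F {..<n} \<tau> g"
    unfolding s(2) mn
    by (rule collectionD(4)[OF F fn]) (use s(1) mn assms(5) in \<open>auto simp: \<tau>_def bij_betw_def\<close>)
  show ?thesis
    by (rule that[OF mn p h]) (simp add: h letter_pull[OF F fn t assms(5)])
qed

section \<open>Splitting a generator off at the root\<close>

definition gen_addr :: "'a collection list \<Rightarrow> nat \<Rightarrow> 'a \<Rightarrow> nat \<Rightarrow> nat \<Rightarrow> 'a letter addr" where
  "gen_addr Fs n g i c = (\<lambda>j. if j = i then [letter (Fs ! i) {..<n} g c] else [])"

text \<open>On the addresses of an element this is the criterion for the generator \<open>g\<close>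
  of direction \<open>i\<close> to be its root; \<open>part\<close> then gives the leaves of the
  factors.\<close>

definition rooted ::
  "'a collection list \<Rightarrow> nat \<Rightarrow> 'a \<Rightarrow> nat \<Rightarrow> nat set \<Rightarrow> (nat \<Rightarrow> 'a letter addr) \<Rightarrow> bool" where
  "rooted Fs n g i X w \<longleftrightarrow> i < length Fs \<and> n > 0 \<and> g \<in> vals (Fs ! i) {..<n} \<and>
     (\<forall>x\<in>X. \<exists>c<n. \<exists>l. w x i = letter (Fs ! i) {..<n} g c # l)"

definition part ::
  "'a collection list \<Rightarrow> nat \<Rightarrow> 'a \<Rightarrow> nat \<Rightarrow> nat set \<Rightarrow> (nat \<Rightarrow> 'a letter addr) \<Rightarrow> nat \<Rightarrow> nat set" where
  "part Fs n g i X w c = {x \<in> X. \<exists>l. w x i = letter (Fs ! i) {..<n} g c # l}"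

lemma part_cover: "rooted Fs n g i X w \<Longrightarrow> (\<Union>c<n. part Fs n g i X w c) = X"
  by (fastforce simp: rooted_def part_def)

lemma part_disjoint:
  assumes "\<forall>F\<in>set Fs. good_coll F" "rooted Fs n g i X w"
  shows "disjoint_family_on (part Fs n g i X w) {..<n}"
proof -
  have "good_coll (Fs ! i)" using assms by (auto simp: rooted_def)
  then have "c = d" if "letter (Fs ! i) {..<n} g c = letter (Fs ! i) {..<n} g d" "c < n" for c d
    using letter_inj[of "Fs ! i" "{..<n}" g c d] assms(2) that by (auto simp: rooted_def)
  then show ?thesis by (fastforce simp: disjoint_family_on_def part_def)
qed

text \<open>An operad described through addresses alone. By \<open>root\<close> every non-unit
  admits a generator at its root, and by \<open>part_ne\<close> and \<open>division\<close> the
  criterion \<open>rooted\<close> really produces a nonempty factor for each input. This is the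
  invariant carried through the iterated tensor product, and all that the resolution knows about the
  operad.\<close>

locale models =
  fixes P :: "('o, 'z) operad_scheme" and Fs :: "'a collection list"
    and e :: "'o \<Rightarrow> nat \<Rightarrow> 'a letter addr" and \<gamma> :: "nat \<Rightarrow> nat \<Rightarrow> 'a \<Rightarrow> 'o"
  assumes closed: "closed_operad P"
    and addr: "addr_hom P e"
    and bounded: "\<lbrakk>a \<in> vals P X; x \<in> X; length Fs \<le> i\<rbrakk> \<Longrightarrow> e a x i = []"
    and faithful: "\<lbrakk>a \<in> vals P X; b \<in> vals P X; \<And>x. x \<in> X \<Longrightarrow> e a x = e b x\<rbrakk> \<Longrightarrow> a = b"
    and gen_vals: "\<lbrakk>i < length Fs; n > 0; g \<in> vals (Fs ! i) {..<n}\<rbrakk> \<Longrightarrow> \<gamma> i n g \<in> vals P {..<n}"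
    and gen_addr: "\<lbrakk>i < length Fs; n > 0; g \<in> vals (Fs ! i) {..<n}; c < n\<rbrakk> \<Longrightarrow>
       e (\<gamma> i n g) c = gen_addr Fs n g i c"
    and root: "a \<in> vals P X \<Longrightarrow>
       (\<exists>x. X = {x} \<and> a = ounit P x) \<or> (\<exists>i n g. rooted Fs n g i X (e a))"
    and part_ne: "\<lbrakk>a \<in> vals P X; rooted Fs n g i X (e a); c < n\<rbrakk> \<Longrightarrow> part Fs n g i X (e a) c \<noteq> {}"
    and division: "\<lbrakk>a \<in> vals P X; rooted Fs n g i X (e a); c < n\<rbrakk> \<Longrightarrow>
       \<exists>q\<in>vals P (part Fs n g i X (e a) c). \<forall>x\<in>part Fs n g i X (e a) c.
              e a x = cat (gen_addr Fs n g i c) (e q x)"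

section \<open>Faithfulness of addresses\<close>

text \<open>Allows an identity between trees with standard leaves to be used at the root of larger
  trees, together with identities inside the subtrees grafted there.\<close>

lemma hom_subst:
  assumes hom: "op_hom (tree_operad U) P \<pi>" and n: "n > 0"
    and ab: "a \<in> vals (tree_operad U) {..<n}" "b \<in> vals (tree_operad U) {..<n}"
      "\<pi> {..<n} a = \<pi> {..<n} b"
    and s: "\<And>i. i < n \<Longrightarrow> s i \<in> vals (tree_operad U) (B i)"
      "\<And>i. i < n \<Longrightarrow> s' i \<in> vals (tree_operad U) (B i)"
      "\<And>i. i < n \<Longrightarrow> \<pi> (B i) (s i) = \<pi> (B i) (s' i)"
    and B: "disjoint_family_on B {..<n}" "X = (\<Union>i<n. B i)"
  shows "\<pi> X (subst s a) = \<pi> X (subst s' b)"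
proof -
  define Bs where "Bs = map B [0..<n]"
  have len: "length Bs = n" by (simp add: Bs_def)
  have nth: "Bs ! i = B i" if "i < n" for i using that by (simp add: Bs_def)
  have B1: "fin_ne (B i)" if "i < n" for i using tree_fin_ne[OF s(1)[OF that]] .
  have op: "ordered_partition Bs X"
  proof (rule ordered_partitionI)
    show "finite X" using B1 B(2) by (auto simp: fin_ne_def)
  qed (use B B1 in \<open>auto simp: len nth fin_ne_def disjoint_family_on_def\<close>)
  have Bs: "Bs \<noteq> []" using n len by auto
  have *: "\<pi> X (subst s a) = ocomp P (\<pi> {..<n} a) Bs (map2 \<pi> Bs (map s [0..<n]))"
    if "a \<in> vals (tree_operad U) {..<n}" "\<And>i. i < n \<Longrightarrow> s i \<in> vals (tree_operad U) (B i)" for s a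
  proof -
    have "\<pi> X (subst s a) = \<pi> X (ocomp (tree_operad U) a Bs (map s [0..<n]))"
      unfolding tree_comp using that(1)
      by (intro arg_cong[of _ _ "\<pi> X"] subst_cong) (auto simp: tree_vals)
    also have "\<dots> = ocomp P (\<pi> {..<n} a) Bs (map2 \<pi> Bs (map s [0..<n]))"
      using op_homD(4)[OF hom op Bs, of a "map s [0..<n]"] that len nth by simp
    finally show ?thesis .
  qed
  have "map2 \<pi> Bs (map s [0..<n]) = map2 \<pi> Bs (map s' [0..<n])"
    by (rule nth_equalityI) (use s(3) len nth in auto)
  then show ?thesis using *[OF ab(1) s(1)] *[OF ab(2) s(2)] ab(3) by simp
qed

lemma map_Leaf_vals:
  assumes "u \<in> vals U {..<n}" "n > 0" "bij_betw f {..<n} X"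
  shows "Node u (map (\<lambda>c. Leaf (f c)) [0..<n]) \<in> vals (tree_operad U) X"
  by (rule Node_valsI[where B = "\<lambda>i. {f i}"])
    (use assms in \<open>auto simp: disjoint_family_on_def bij_betw_def inj_on_def\<close>)

lemma corolla_vals:
  assumes "u \<in> vals U {..<n}" "n > 0"
  shows "Node u (map Leaf [0..<n]) \<in> vals (tree_operad U) {..<n}"
  using map_Leaf_vals[OF assms bij_betw_id] by (simp add: id_def comp_def)

lemma subst_corolla: "length ts = n \<Longrightarrow> subst (\<lambda>i. ts ! i) (Node u (map Leaf [0..<n])) = Node u ts"
  by (auto intro!: nth_equalityI)

lemma hom_Node:
  assumes hom: "op_hom (tree_operad U) P \<pi>"
    and N: "Node u ts \<in> vals (tree_operad U) X"
    and l: "length ts' = length ts"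
    and s: "\<And>i. i < length ts \<Longrightarrow> ts' ! i \<in> vals (tree_operad U) (set (leaves (ts ! i)))"
      "\<And>i. i < length ts \<Longrightarrow>
         \<pi> (set (leaves (ts ! i))) (ts ! i) = \<pi> (set (leaves (ts ! i))) (ts' ! i)"
  shows "Node u ts' \<in> vals (tree_operad U) X" "\<pi> X (Node u ts) = \<pi> X (Node u ts')"
proof -
  note n = Node_valsD[OF N]
  show "Node u ts' \<in> vals (tree_operad U) X"
    by (rule Node_valsI[where B = "\<lambda>i. set (leaves (ts ! i))"]) (use n l s(1) in auto)
  have c: "Node u (map Leaf [0..<length ts]) \<in> vals (tree_operad U) {..<length ts}"
    using corolla_vals n(1,2) by blast
  show "\<pi> X (Node u ts) = \<pi> X (Node u ts')"
    using hom_subst[OF hom _ c c HOL.refl n(3) s n(4,5)] n(1)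
    by (simp add: subst_corolla l del: subst.simps)
qed

text \<open>Every child has a leaf, and a child other than number \<open>c\<close> exists, whose
  leaves are missing from number \<open>c\<close>. This lets inductions over \<open>card X\<close>
  pass to the children.\<close>

lemma Node_card_less:
  assumes "Node u ts \<in> vals (tree_operad U) X" "length ts \<ge> 2" "c < length ts"
  shows "card (set (leaves (ts ! c))) < card X"
proof (rule psubset_card_mono)
  note n = Node_valsD[OF assms(1)]
  show "finite X" using tree_fin_ne[OF assms(1)] by (simp add: fin_ne_def)
  obtain d where d: "d < length ts" "d \<noteq> c" using assms(2)
    by (metis One_nat_def less_2_cases_iff less_le_trans zero_neq_one)
  obtain x where x: "x \<in> set (leaves (ts ! d))"
    using tree_fin_ne[OF n(3)[OF d(1)]] unfolding fin_ne_def by (metis ex_in_conv)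
  then have "x \<in> X" "x \<notin> set (leaves (ts ! c))"
    using n(4,5) d assms(3) by (auto simp: disjoint_family_on_def)
  moreover have "set (leaves (ts ! c)) \<subseteq> X" using n(5) assms(3) by blast
  ultimately show "set (leaves (ts ! c)) \<subset> X" by blast
qed

lemma rooted_cong:
  assumes "\<And>x. x \<in> X \<Longrightarrow> w x = w' x"
  shows "rooted Fs n g i X w = rooted Fs n g i X w'" "part Fs n g i X w c = part Fs n g i X w' c"
  using assms by (auto simp: rooted_def part_def)

section \<open>Numbering the leaves of two-level trees\<close>

lemma disjoint_family_on_times:
  assumes "\<And>p q p' q'. p \<in> A \<Longrightarrow> q \<in> C \<Longrightarrow> p' \<in> A \<Longrightarrow> q' \<in> C \<Longrightarrow> p \<noteq> p' \<or> q \<noteq> q' \<Longrightarrow>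
    B p q \<inter> B p' q' = {}"
  shows "disjoint_family_on (\<lambda>(p, q). B p q) (A \<times> C)"
  unfolding disjoint_family_on_def
proof (intro ballI impI)
  fix a b assume ab: "a \<in> A \<times> C" "b \<in> A \<times> C" "a \<noteq> b"
  obtain p q p' q' where "a = (p, q)" "b = (p', q')" by fastforce
  with ab assms[of p q p' q'] show "(case a of (p, q) \<Rightarrow> B p q) \<inter> (case b of (p, q) \<Rightarrow> B p q) = {}"
    by auto
qed

lemma disjoint_family_on_timesD:
  assumes "disjoint_family_on (\<lambda>(p, q). B p q) (A \<times> C)"
    "p \<in> A" "q \<in> C" "p' \<in> A" "q' \<in> C" "p \<noteq> p' \<or> q \<noteq> q'"
  shows "B p q \<inter> B p' q' = {}"
  using assms unfolding disjoint_family_on_def by fastforce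

lemma grid_less:
  assumes "p < k" "q < (l::nat)"
  shows "p * l + q < k * l"
proof -
  have "p * l + q < Suc p * l" using assms by simp
  also have "\<dots> \<le> k * l" using assms by (intro mult_right_mono) auto
  finally show ?thesis .
qed

lemma grid_inj:
  assumes "p * l + q = p' * l + q'" "q < l" "q' < (l::nat)"
  shows "p = p' \<and> q = q'"
  using arg_cong[OF assms(1), of "\<lambda>m. m div l"] arg_cong[OF assms(1), of "\<lambda>m. m mod l"] assms(2,3)
  by simp

lemma grid_ex:
  assumes "x < k * (l::nat)"
  obtains p q where "p < k" "q < l" "x = p * l + q"
proof -
  have "l > 0" using assms by (cases l) auto
  with assms that[of "x div l" "x mod l"] show ?thesis by (auto simp: less_mult_imp_div_less)
qed

lemma grid_vals:
  assumes "u \<in> vals U {..<k}" "v \<in> vals U {..<l}" "k > 0" "l > 0"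
    "\<And>p q. p < k \<Longrightarrow> q < l \<Longrightarrow> s p q \<in> vals (tree_operad U) (B p q)"
    "disjoint_family_on (\<lambda>(p, q). B p q) ({..<k} \<times> {..<l})" "X = (\<Union>p<k. \<Union>q<l. B p q)"
  shows "Node u (map (\<lambda>p. Node v (map (s p) [0..<l])) [0..<k]) \<in> vals (tree_operad U) X"
proof (rule Node_valsI[where B = "\<lambda>p. \<Union>q<l. B p q"])
  have dj: "B p q \<inter> B p' q' = {}" if "p < k" "q < l" "p' < k" "q' < l" "(p, q) \<noteq> (p', q')" for p q p' q'
    using assms(6) that unfolding disjoint_family_on_def by fastforce
  fix i assume i: "i < length (map (\<lambda>p. Node v (map (s p) [0..<l])) [0..<k])"
  show "map (\<lambda>p. Node v (map (s p) [0..<l])) [0..<k] ! i \<in> vals (tree_operad U) (\<Union>q<l. B i q)"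
    using i by simp (rule Node_valsI[where B = "\<lambda>q. B i q"];
        use assms(2,4,5) dj[of i _ i] in \<open>simp add: disjoint_family_on_def\<close>)
next
  have dj: "B p q \<inter> B p' q' = {}" if "p < k" "q < l" "p' < k" "q' < l" "(p, q) \<noteq> (p', q')" for p q p' q'
    using assms(6) that unfolding disjoint_family_on_def by fastforce
  show "disjoint_family_on (\<lambda>p. \<Union>q<l. B p q) {..<length (map (\<lambda>p. Node v (map (s p) [0..<l])) [0..<k])}"
    unfolding disjoint_family_on_def
  proof (intro ballI impI)
    fix p p' assume "p \<in> {..<length (map (\<lambda>p. Node v (map (s p) [0..<l])) [0..<k])}"
      "p' \<in> {..<length (map (\<lambda>p. Node v (map (s p) [0..<l])) [0..<k])}" "p \<noteq> p'"
    then have "B p q \<inter> B p' q' = {}" if "q < l" "q' < l" for q q' using that dj[of p q p' q'] by simp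
    then show "(\<Union>q<l. B p q) \<inter> (\<Union>q<l. B p' q) = {}" by blast
  qed
qed (use assms in auto)

text \<open>\<open>P\<close> is a quotient of the trees over \<open>U\<close> by
  \<open>\<pi>\<close>. A vertex may carry any label from \<open>U\<close>, generator or composite;
  \<open>lab\<close> names the generators among the labels, and \<open>root\<close> asks that modulo
  \<open>\<pi>\<close> one of them can be brought to the root of any non-unit. Both the absolutely
  free operads and the tensor products are of this form.\<close>

locale presentation =
  fixes U :: "'a expr collection" and Fs :: "'a collection list"
    and val :: "nat \<Rightarrow> 'a expr \<Rightarrow> nat \<Rightarrow> 'a letter addr" and lab :: "nat \<Rightarrow> nat \<Rightarrow> 'a \<Rightarrow> 'a expr"
    and P :: "'a expr operad" and \<pi> :: "nat set \<Rightarrow> 'a expr \<Rightarrow> 'a expr"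
  assumes good: "F \<in> set Fs \<Longrightarrow> good_coll F"
    and P_closed: "closed_operad P"
    and vals_P: "vals P X = {t \<in> vals (tree_operad U) X. \<pi> X t = t}"
    and hom: "op_hom (tree_operad U) P \<pi>"
    and P_addr: "addr_hom P (tev val)"
    and \<pi>_addr: "t \<in> vals (tree_operad U) X \<Longrightarrow> x \<in> X \<Longrightarrow> tev val (\<pi> X t) x = tev val t x"
    and val_bounded: "u \<in> vals U {..<n} \<Longrightarrow> c < n \<Longrightarrow> length Fs \<le> i \<Longrightarrow> val n u c i = []"
    and lab_vals: "i < length Fs \<Longrightarrow> n > 0 \<Longrightarrow> g \<in> vals (Fs ! i) {..<n} \<Longrightarrow> lab i n g \<in> vals U {..<n}"
    and lab_val: "i < length Fs \<Longrightarrow> n > 0 \<Longrightarrow> g \<in> vals (Fs ! i) {..<n} \<Longrightarrow> c < n \<Longrightarrow>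
       val n (lab i n g) c = gen_addr Fs n g i c"
    and root: "t \<in> vals (tree_operad U) X \<Longrightarrow> (\<exists>x. X = {x} \<and> \<pi> X t = \<pi> X (Leaf x)) \<or>
       (\<exists>i n g ts. i < length Fs \<and> n > 0 \<and> length ts = n \<and> g \<in> vals (Fs ! i) {..<n} \<and>
          Node (lab i n g) ts \<in> vals (tree_operad U) X \<and> \<pi> X t = \<pi> X (Node (lab i n g) ts))"
    and equivar: "i < length Fs \<Longrightarrow> n > 0 \<Longrightarrow> g \<in> vals (Fs ! i) {..<n} \<Longrightarrow> \<sigma> permutes {..<n} \<Longrightarrow>
       \<pi> {..<n} (Node (lab i n (pull (Fs ! i) {..<n} \<sigma> g)) (map Leaf [0..<n])) =
       \<pi> {..<n} (Node (lab i n g) (map (\<lambda>c. Leaf (inv \<sigma> c)) [0..<n]))"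
    and interchange: "i < j \<Longrightarrow> j < length Fs \<Longrightarrow> k > 0 \<Longrightarrow> l > 0 \<Longrightarrow>
       g \<in> vals (Fs ! i) {..<k} \<Longrightarrow> h \<in> vals (Fs ! j) {..<l} \<Longrightarrow>
       \<pi> {..<k * l} (Node (lab i k g)
          (map (\<lambda>p. Node (lab j l h) (map (\<lambda>q. Leaf (p * l + q)) [0..<l])) [0..<k])) =
       \<pi> {..<k * l} (Node (lab j l h)
          (map (\<lambda>q. Node (lab i k g) (map (\<lambda>p. Leaf (p * l + q)) [0..<k])) [0..<l]))"
begin

abbreviation "T \<equiv> tree_operad U"

lemma Node_addr:
  assumes "i < length Fs" "n > 0" "g \<in> vals (Fs ! i) {..<n}" "length ts = n"
    "Node (lab i n g) ts \<in> vals T X" "c < n" "x \<in> set (leaves (ts ! c))"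
  shows "tev val (Node (lab i n g) ts) x = cat (gen_addr Fs n g i c) (tev val (ts ! c) x)"
  by (simp add: tev_Node[OF assms(5), of c] lab_val[OF assms(1-3,6)] assms(4,6,7))

lemma Node_rooted:
  assumes i: "i < length Fs" "n > 0" "g \<in> vals (Fs ! i) {..<n}" "length ts = n"
    "Node (lab i n g) ts \<in> vals T X"
  shows "rooted Fs n g i X (tev val (Node (lab i n g) ts))"
    and "c < n \<Longrightarrow> part Fs n g i X (tev val (Node (lab i n g) ts)) c = set (leaves (ts ! c))"
proof -
  note n = Node_valsD[OF i(5)]
  have hd: "\<exists>l. tev val (Node (lab i n g) ts) x i = letter (Fs ! i) {..<n} g c # l"
    if "c < n" "x \<in> set (leaves (ts ! c))" for c x
    using Node_addr[OF i that] by (simp add: cat_def gen_addr_def)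
  show "rooted Fs n g i X (tev val (Node (lab i n g) ts))"
    unfolding rooted_def using i(1-4) hd n(5) by blast
  assume c: "c < n"
  have gc: "good_coll (Fs ! i)" using good i(1) by simp
  show "part Fs n g i X (tev val (Node (lab i n g) ts)) c = set (leaves (ts ! c))"
  proof (intro equalityI subsetI)
    fix x assume "x \<in> set (leaves (ts ! c))"
    then show "x \<in> part Fs n g i X (tev val (Node (lab i n g) ts)) c"
      using hd[OF c] n(5) c i(4) by (auto simp: part_def)
  next
    fix x assume x: "x \<in> part Fs n g i X (tev val (Node (lab i n g) ts)) c"
    then obtain d where d: "d < n" "x \<in> set (leaves (ts ! d))" using n(5) i(4) by (auto simp: part_def)
    then have "letter (Fs ! i) {..<n} g c = letter (Fs ! i) {..<n} g d"
      using hd[OF d] x by (auto simp: part_def)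
    then have "c = d" by (rule letter_inj[OF gc _ i(3), rotated 2]) (use i(2) c in auto)
    then show "x \<in> set (leaves (ts ! c))" using d by simp
  qed
qed

text \<open>The axiom concerns matrices whose entries are numbered leaves; here arbitrary subtrees
  are grafted onto these leaves, and the order of the two directions becomes free.\<close>

lemma interchange_subst:
  assumes ij: "i \<noteq> j" "i < length Fs" "j < length Fs" "k > 0" "l > 0"
    and gh: "g \<in> vals (Fs ! i) {..<k}" "h \<in> vals (Fs ! j) {..<l}"
    and s: "\<And>p q. p < k \<Longrightarrow> q < l \<Longrightarrow> s p q \<in> vals T (B p q)"
    and B: "disjoint_family_on (\<lambda>(p, q). B p q) ({..<k} \<times> {..<l})" "X = (\<Union>p<k. \<Union>q<l. B p q)"
  shows "\<pi> X (Node (lab i k g) (map (\<lambda>p. Node (lab j l h) (map (s p) [0..<l])) [0..<k])) =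
    \<pi> X (Node (lab j l h) (map (\<lambda>q. Node (lab i k g) (map (\<lambda>p. s p q) [0..<k])) [0..<l]))"
proof -
  \<comment> \<open>Quantified over all its data, as the case \<open>j < i\<close> is an instance
    with the two directions exchanged and the matrix transposed.\<close>
  have main: "\<pi> X (Node (lab i k g) (map (\<lambda>p. Node (lab j l h) (map (s p) [0..<l])) [0..<k])) =
    \<pi> X (Node (lab j l h) (map (\<lambda>q. Node (lab i k g) (map (\<lambda>p. s p q) [0..<k])) [0..<l]))"
    if ij: "i < j" "j < length Fs" "k > 0" "l > 0"
      and gh: "g \<in> vals (Fs ! i) {..<k}" "h \<in> vals (Fs ! j) {..<l}"
      and s: "\<And>p q. p < k \<Longrightarrow> q < l \<Longrightarrow> s p q \<in> vals T (B p q)"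
      and B: "disjoint_family_on (\<lambda>(p, q). B p q) ({..<k} \<times> {..<l})" "X = (\<Union>p<k. \<Union>q<l. B p q)"
    for i j k l g h s B
  proof -
    let ?A = "Node (lab i k g)
          (map (\<lambda>p. Node (lab j l h) (map (\<lambda>q. Leaf (p * l + q)) [0..<l])) [0..<k])"
    let ?B = "Node (lab j l h)
          (map (\<lambda>q. Node (lab i k g) (map (\<lambda>p. Leaf (p * l + q)) [0..<k])) [0..<l])"
    have v: "lab i k g \<in> vals U {..<k}" "lab j l h \<in> vals U {..<l}"
      using ij gh by (auto intro: lab_vals)
    have lt: "p * l + q < k * l" if "p < k" "q < l" for p q by (rule grid_less[OF that])
    have dm: "m div l < k" "m mod l < l" "m div l * l + m mod l = m" if "m < k * l" for m
      using that ij(4) by (auto simp: less_mult_imp_div_less)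
    have inj: "p = p' \<and> q = q'" if "p * l + q = p' * l + q'" "q < l" "q' < l" for p q p' q'
      by (rule grid_inj[OF that])
    have cov: "{..<k * l} = (\<Union>p<k. \<Union>q<l. {p * l + q})"
    proof (intro equalityI subsetI)
      fix m assume "m \<in> {..<k * l}"
      then have d: "m div l < k" "m mod l < l" by (simp_all add: dm)
      show "m \<in> (\<Union>p<k. \<Union>q<l. {p * l + q})"
        by (rule UN_I[of "m div l"], simp add: d, rule UN_I[of "m mod l"]) (simp_all add: d)
    next
      fix m assume "m \<in> (\<Union>p<k. \<Union>q<l. {p * l + q})"
      then obtain p q where "p < k" "q < l" "m = p * l + q" by blast
      then show "m \<in> {..<k * l}" using lt by simp
    qed
    have cov': "{..<k * l} = (\<Union>q<l. \<Union>p<k. {p * l + q})"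
      unfolding cov by (rule SUP_commute)
    have dj: "{p * l + q} \<inter> {p' * l + q'} = {}" if "q < l" "q' < l" "p \<noteq> p' \<or> q \<noteq> q'" for p q p' q'
    proof -
      have "p * l + q \<noteq> p' * l + q'" using inj[of p q p' q'] that by blast
      then show ?thesis by simp
    qed
    have dj1: "disjoint_family_on (\<lambda>(p, q). {p * l + q}) ({..<k} \<times> {..<l})"
      by (rule disjoint_family_on_times, rule dj) auto
    have dj2: "disjoint_family_on (\<lambda>(q, p). {p * l + q}) ({..<l} \<times> {..<k})"
      by (rule disjoint_family_on_times, rule dj) auto
    have A: "?A \<in> vals T {..<k * l}"
      by (rule grid_vals[OF v ij(3,4) _ dj1 cov]) simp
    have Bv: "?B \<in> vals T {..<k * l}"
      by (rule grid_vals[OF v(2,1) ij(4,3) _ dj2 cov']) simp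
    \<comment> \<open>Leaf \<open>p * l + q\<close> of the numbered matrix receives the subtree
      \<open>s p q\<close>.\<close>
    let ?s = "\<lambda>m. s (m div l) (m mod l)" and ?B' = "\<lambda>m. B (m div l) (m mod l)"
    have Bdj: "B p q \<inter> B p' q' = {}" if "p < k" "q < l" "p' < k" "q' < l" "(p, q) \<noteq> (p', q')" for p q p' q'
      using B(1) that unfolding disjoint_family_on_def by fastforce
    have dj: "disjoint_family_on ?B' {..<k * l}"
    proof (unfold disjoint_family_on_def, intro ballI impI)
      fix m m' assume m: "m \<in> {..<k * l}" "m' \<in> {..<k * l}" "m \<noteq> m'"
      then have "(m div l, m mod l) \<noteq> (m' div l, m' mod l)" by (metis dm(3) lessThan_iff prod.inject)
      with m show "?B' m \<inter> ?B' m' = {}"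
        by (intro Bdj) (simp_all add: dm)
    qed
    have X: "X = (\<Union>m<k * l. ?B' m)"
    proof (intro equalityI subsetI)
      fix x assume "x \<in> X"
      then obtain p q where "p < k" "q < l" "x \<in> B p q" unfolding B(2) by auto
      then show "x \<in> (\<Union>m<k * l. ?B' m)"
        using lt[of p q] by (intro UN_I[of "p * l + q"]) simp_all
    next
      fix x assume "x \<in> (\<Union>m<k * l. ?B' m)"
      then obtain m where "m < k * l" "x \<in> ?B' m" by blast
      then show "x \<in> X" using dm(1,2)[of m] unfolding B(2) by blast
    qed
    have "\<pi> X (subst ?s ?A) = \<pi> X (subst ?s ?B)"
      by (rule hom_subst[OF hom _ A Bv interchange[OF ij gh] _ _ HOL.refl dj X])
        (use ij dm s in auto)
    also have "subst ?s ?A =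
      Node (lab i k g) (map (\<lambda>p. Node (lab j l h) (map (s p) [0..<l])) [0..<k])" by simp
    also have "subst ?s ?B =
      Node (lab j l h) (map (\<lambda>q. Node (lab i k g) (map (\<lambda>p. s p q) [0..<k])) [0..<l])" by simp
    finally show ?thesis .
  qed
  show ?thesis
  proof (cases "i < j")
    case True
    then show ?thesis using main[OF True ij(3-5) gh s B] by simp
  next
    case False
    then have "j < i" using ij(1) by simp
    have dj': "disjoint_family_on (\<lambda>(q, p). B p q) ({..<l} \<times> {..<k})"
      by (rule disjoint_family_on_times, rule disjoint_family_on_timesD[OF B(1)]) auto
    have X': "X = (\<Union>q<l. \<Union>p<k. B p q)" unfolding B(2) by (rule SUP_commute)
    show ?thesis
      using main[OF \<open>j < i\<close> ij(2,5,4) gh(2,1), of "\<lambda>q p. s p q" "\<lambda>q p. B p q", OF s dj' X'] by simp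
  qed
qed

text \<open>The induction is over the number of leaves because \<open>root\<close> replaces
  \<open>t\<close> by a congruent tree that may have another shape.\<close>

lemma factor_out:
  assumes "t \<in> vals T X" "rooted Fs n g i X (tev val t)"
  shows "\<exists>ts. length ts = n \<and> Node (lab i n g) ts \<in> vals T X \<and> \<pi> X t = \<pi> X (Node (lab i n g) ts)"
  using assms
proof (induction "card X" arbitrary: X t rule: less_induct)
  case less
  have r: "i < length Fs" "n > 0" "g \<in> vals (Fs ! i) {..<n}"
    "\<And>x. x \<in> X \<Longrightarrow> \<exists>c<n. \<exists>l. tev val t x i = letter (Fs ! i) {..<n} g c # l"
    using less.prems(2) by (auto simp: rooted_def)
  have gc: "good_coll (Fs ! i)" using good r(1) by simp
  have lv: "lab i n g \<in> vals U {..<n}" using lab_vals r(1-3) by blast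
  from root[OF less.prems(1)] show ?case
  proof (elim disjE exE conjE)
    fix x assume x: "X = {x}" "\<pi> X t = \<pi> X (Leaf x)"
    \<comment> \<open>A unit has empty words, which contradicts \<open>rooted\<close>.\<close>
    have "tev val t x = tev val (Leaf x) x"
      using \<pi>_addr[OF less.prems(1), of x] \<pi>_addr[of "Leaf x" X x] x by simp
    then show ?thesis using r(4)[of x] x by (simp add: nil_addr_def)
  next
    fix j m h ts
    assume j: "j < length Fs" "0 < m" "length ts = m" "h \<in> vals (Fs ! j) {..<m}"
      "Node (lab j m h) ts \<in> vals T X" "\<pi> X t = \<pi> X (Node (lab j m h) ts)"
    note n = Node_valsD[OF j(5)]
    note Na = Node_addr[OF j(1,2,4,3,5)]
    have eq: "tev val t x = tev val (Node (lab j m h) ts) x" if "x \<in> X" for x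
      using \<pi>_addr[OF less.prems(1) that] \<pi>_addr[OF j(5) that] j(6) by simp
    have sub: "set (leaves (ts ! c)) \<subseteq> X" if "c < m" for c using n(5) j(3) that by blast
    show ?thesis
    proof (cases "i = j")
      case True
      \<comment> \<open>Both \<open>h\<close> and \<open>g\<close> begin words of the same
        direction. One common letter already makes \<open>h\<close> a relabelling of
        \<open>g\<close>, and equivariance turns the root into \<open>g\<close> with its children
        permuted.\<close>
      obtain x where x: "x \<in> X" using tree_fin_ne[OF less.prems(1)] by (auto simp: fin_ne_def)
      then obtain c where c: "c < m" "x \<in> set (leaves (ts ! c))" using n(5) j(3) by blast
      obtain c' where c': "c' < n" "letter (Fs ! i) {..<m} h c = letter (Fs ! i) {..<n} g c'"
        using r(4)[OF x] eq[OF x] Na[OF c] True by (auto simp: cat_def gen_addr_def)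
      obtain \<sigma> where s: "m = n" "\<sigma> permutes {..<n}" "h = pull (Fs ! i) {..<n} \<sigma> g"
        by (rule letter_eq_permutes[OF gc j(2) r(2) _ r(3) c(1) c'(2)]) (use j(4) True in auto)
      let ?C = "Node (lab i n g) (map (\<lambda>c. Leaf (inv \<sigma> c)) [0..<n])"
      have C: "?C \<in> vals T {..<n}"
        by (rule map_Leaf_vals[OF lv r(2)]) (use s(2) in \<open>simp add: permutes_inv permutes_imp_bij\<close>)
      have C0: "Node (lab j m h) (map Leaf [0..<n]) \<in> vals T {..<n}"
        using corolla_vals[OF lab_vals[OF j(1,2,4)] j(2)] s(1) by simp
      have nn: "i < n \<Longrightarrow> ts ! i \<in> vals T (set (leaves (ts ! i)))"
        "disjoint_family_on (\<lambda>i. set (leaves (ts ! i))) {..<n}"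
        "X = (\<Union>i<n. set (leaves (ts ! i)))" for i
        using n(3,4,5) j(3) s(1) by auto
      have "\<pi> X (subst (\<lambda>i. ts ! i) (Node (lab j m h) (map Leaf [0..<n]))) = \<pi> X (subst (\<lambda>i. ts ! i) ?C)"
        by (rule hom_subst[OF hom r(2) C0 C _ nn(1) nn(1) HOL.refl nn(2,3)])
          (use equivar[OF r(1-3) s(2)] s(1,3) True in auto)
      then have "\<pi> X (Node (lab j m h) ts) = \<pi> X (Node (lab i n g) (map (\<lambda>c. ts ! inv \<sigma> c) [0..<n]))"
        using subst_corolla[of ts n] j(3) s(1) by (simp add: comp_def)
      moreover have "subst (\<lambda>i. ts ! i) ?C \<in> vals T X"
        by (rule subst_vals[OF C nn(1) nn(2,3)]) auto
      ultimately show ?thesis using j(6)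
        by (intro exI[of _ "map (\<lambda>c. ts ! inv \<sigma> c) [0..<n]"]) (simp add: comp_def)
    next
      case False
      let ?L = "\<lambda>c. set (leaves (ts ! c))"
      have m2: "m \<ge> 2" using arity_ge_2[OF _ _ j(4)] good j(1,2) by simp
      have "\<exists>us. length us = n \<and> Node (lab i n g) us \<in> vals T (?L c) \<and>
          \<pi> (?L c) (ts ! c) = \<pi> (?L c) (Node (lab i n g) us)" if c: "c < m" for c
      proof (rule less.hyps)
        show "card (?L c) < card X" using Node_card_less[OF j(5)] m2 c j(3) by simp
        show "ts ! c \<in> vals T (?L c)" using n(3) c j(3) by simp
        \<comment> \<open>The root \<open>h\<close> contributes letters to direction
          \<open>j\<close> only, so the words in direction \<open>i\<close> are those of the
          children.\<close>
        have "tev val (ts ! c) x i = tev val t x i" if "x \<in> ?L c" for x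
          using Na[OF c that] eq sub[OF c] that False by (auto simp: cat_def gen_addr_def)
        then show "rooted Fs n g i (?L c) (tev val (ts ! c))"
          using r(1-3) r(4) sub[OF c] by (auto simp: rooted_def)
      qed
      then obtain us where us: "\<And>c. c < m \<Longrightarrow> length (us c) = n"
        "\<And>c. c < m \<Longrightarrow> Node (lab i n g) (us c) \<in> vals T (?L c)"
        "\<And>c. c < m \<Longrightarrow> \<pi> (?L c) (ts ! c) = \<pi> (?L c) (Node (lab i n g) (us c))" by metis
      let ?M = "\<lambda>c p. set (leaves (us c ! p))"
      note un = Node_valsD[OF us(2)]
      have e1: "\<pi> X (Node (lab j m h) ts) =
          \<pi> X (Node (lab j m h) (map (\<lambda>c. Node (lab i n g) (us c)) [0..<m]))"
        by (rule hom_Node(2)[OF hom j(5)]) (use us j(3) in auto)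
      have e2: "map (\<lambda>c. Node (lab i n g) (us c)) [0..<m] =
          map (\<lambda>c. Node (lab i n g) (map (\<lambda>p. us c ! p) [0..<n])) [0..<m]"
        using us(1) by (auto intro!: nth_equalityI)
      have us_vals: "us c ! p \<in> vals T (?M c p)" if "c < m" "p < n" for c p
        using un(3)[OF that(1)] us(1) that by simp
      have Mdj: "?M c p \<inter> ?M c' p' = {}"
        if a: "c < m" "p < n" "c' < m" "p' < n" "(c, p) \<noteq> (c', p')" for c p c' p'
      proof (cases "c = c'")
        case True
        then show ?thesis using un(4)[OF a(1)] us(1) a by (auto simp: disjoint_family_on_def)
      next
        case False
        have "?M c p \<subseteq> ?L c" "?M c' p' \<subseteq> ?L c'"
          using un(5)[OF a(1)] un(5)[OF a(3)] us(1) a by auto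
        moreover have "?L c \<inter> ?L c' = {}"
          using n(4) a j(3) False by (auto simp: disjoint_family_on_def)
        ultimately show ?thesis by blast
      qed
      have dj: "disjoint_family_on (\<lambda>(c, p). ?M c p) ({..<m} \<times> {..<n})"
        by (rule disjoint_family_on_times, rule Mdj) auto
      have X: "X = (\<Union>c<m. \<Union>p<n. ?M c p)"
        using n(5) j(3) un(5) us(1) by auto
      have X': "X = (\<Union>p<n. \<Union>c<m. ?M c p)" unfolding X by (rule SUP_commute)
      have dj': "disjoint_family_on (\<lambda>(p, c). ?M c p) ({..<n} \<times> {..<m})"
        by (rule disjoint_family_on_times, rule Mdj) auto
      let ?W = "map (\<lambda>p. Node (lab j m h) (map (\<lambda>c. us c ! p) [0..<m])) [0..<n]"
      have "\<pi> X (Node (lab j m h) (map (\<lambda>c. Node (lab i n g) (map (\<lambda>p. us c ! p) [0..<n])) [0..<m])) =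
          \<pi> X (Node (lab i n g) ?W)"
        by (rule interchange_subst[OF _ j(1) r(1) j(2) r(2) j(4) r(3) us_vals dj X])
          (use False in auto)
      moreover have "Node (lab i n g) ?W \<in> vals T X"
        by (rule grid_vals[OF lv lab_vals[OF j(1,2,4)] r(2) j(2) us_vals dj' X'])
      ultimately show ?thesis using j(6) e1 e2 by (intro exI[of _ ?W]) simp
    qed
  qed
qed

text \<open>A generator at the root of one tree is visible in its addresses, so
  \<open>factor_out\<close> puts the same generator at the root of the other. The common first
  letters cancel, and the children are compared by induction.\<close>

lemma tree_faithful:
  assumes "t \<in> vals T X" "t' \<in> vals T X" "\<And>x. x \<in> X \<Longrightarrow> tev val t x = tev val t' x"
  shows "\<pi> X t = \<pi> X t'"
  using assms
proof (induction "card X" arbitrary: X t t' rule: less_induct)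
  case less
  \<comment> \<open>Stated for arbitrary \<open>t\<close> and \<open>t'\<close> because it is
    applied with the roles exchanged when the first tree is a unit and the second is not.\<close>
  have node: "\<pi> X t = \<pi> X t'"
    if j: "j < length Fs" "0 < m" "length ts = m" "h \<in> vals (Fs ! j) {..<m}"
      "Node (lab j m h) ts \<in> vals T X" "\<pi> X t = \<pi> X (Node (lab j m h) ts)"
      and t: "t \<in> vals T X" "t' \<in> vals T X" "\<And>x. x \<in> X \<Longrightarrow> tev val t x = tev val t' x"
    for j m h ts t t'
  proof -
    note n = Node_valsD[OF j(5)]
    have eq: "tev val (Node (lab j m h) ts) x = tev val t' x" if "x \<in> X" for x
      using \<pi>_addr[OF t(1) that] \<pi>_addr[OF j(5) that] j(6) t(3)[OF that] by simp
    have "rooted Fs m h j X (tev val t')"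
      using Node_rooted(1)[OF j(1,2,4,3,5)] rooted_cong(1)[of X, OF eq] by simp
    from factor_out[OF t(2) this] obtain ts' where ts': "length ts' = m"
      "Node (lab j m h) ts' \<in> vals T X" "\<pi> X t' = \<pi> X (Node (lab j m h) ts')" by blast
    have eq': "tev val (Node (lab j m h) ts) x = tev val (Node (lab j m h) ts') x" if "x \<in> X" for x
      using \<pi>_addr[OF t(2) that] \<pi>_addr[OF ts'(2) that] ts'(3) eq[OF that] by simp
    let ?L = "\<lambda>c. set (leaves (ts ! c))"
    \<comment> \<open>Both sides consist of the leaves whose word in direction \<open>j\<close>
      starts with input \<open>c\<close> of \<open>h\<close>, a set that the addresses
      determine.\<close>
    have L: "set (leaves (ts' ! c)) = ?L c" if "c < m" for c
      using Node_rooted(2)[OF j(1,2,4,3,5) that] Node_rooted(2)[OF j(1,2,4) ts'(1,2) that]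
        rooted_cong(2)[of X, OF eq'] by simp
    have m2: "m \<ge> 2" using arity_ge_2[OF _ _ j(4)] good j(1,2) by simp
    have "\<pi> (?L c) (ts ! c) = \<pi> (?L c) (ts' ! c)" if c: "c < m" for c
    proof (rule less.hyps)
      show "card (?L c) < card X" using Node_card_less[OF j(5)] m2 c j(3) by simp
      show "ts ! c \<in> vals T (?L c)" using n(3) c j(3) by simp
      show "ts' ! c \<in> vals T (?L c)" using Node_valsD(3)[OF ts'(2), of c] c ts'(1) by (simp add: L)
      fix x assume x: "x \<in> ?L c"
      then have "x \<in> X" using n(5) c j(3) by blast
      then show "tev val (ts ! c) x = tev val (ts' ! c) x"
        using Node_addr[OF j(1,2,4,3,5) c x] Node_addr[OF j(1,2,4) ts'(1,2) c] eq' L[OF c] x by simp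
    qed
    then show ?thesis unfolding j(6) ts'(3)
      by (intro hom_Node(2)[OF hom j(5)])
        (use ts'(1) j(3) L Node_valsD(3)[OF ts'(2)] in auto)
  qed
  from root[OF less.prems(1)] show ?case
  proof (elim disjE exE conjE)
    fix x assume x: "X = {x}" "\<pi> X t = \<pi> X (Leaf x)"
    from root[OF less.prems(2)] show ?thesis
    proof (elim disjE exE conjE)
      fix j m h ts
      assume "j < length Fs" "0 < m" "length ts = m" "h \<in> vals (Fs ! j) {..<m}"
      "Node (lab j m h) ts \<in> vals T X" "\<pi> X t' = \<pi> X (Node (lab j m h) ts)"
      from node[OF this less.prems(2,1)] less.prems(3) show ?thesis by simp
    qed (use x in auto)
  qed (rule node[OF _ _ _ _ _ _ less.prems])
qed

lemma tree_bounded: "t \<in> vals T X \<Longrightarrow> x \<in> X \<Longrightarrow> length Fs \<le> i \<Longrightarrow> tev val t x i = []"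
proof -
  assume t: "t \<in> vals T X" "x \<in> X" "length Fs \<le> i"
  have "is_tree U t" using t(1) by (simp add: tree_vals)
  then show ?thesis using t
  proof (induction arbitrary: X rule: is_tree.induct)
    case (2 ts g)
    note n = Node_valsD[OF 2(5)]
    obtain c where c: "c < length ts" "x \<in> set (leaves (ts ! c))" using n(5) 2(6) by blast
    have "tev val (ts ! c) x i = []" by (rule 2(4)) (use c n(3) 2(7) in auto)
    then show ?case using val_bounded[OF n(2) c(1) 2(7)] by (simp add: tev_Node[OF 2(5) c] cat_def)
  qed (simp add: nil_addr_def)
qed

lemma model:
  "models P Fs (tev val) (\<lambda>i n g. \<pi> {..<n} (Node (lab i n g) (map Leaf [0..<n])))"
proof
  show "closed_operad P" "addr_hom P (tev val)" by (fact P_closed P_addr)+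
next
  fix a X x i assume "a \<in> vals P X" "x \<in> X" "length Fs \<le> i"
  then show "tev val a x i = []" using tree_bounded by (auto simp: vals_P)
next
  fix a b X assume "a \<in> vals P X" "b \<in> vals P X" "\<And>x. x \<in> X \<Longrightarrow> tev val a x = tev val b x"
  then show "a = b" using tree_faithful[of a X b] by (simp add: vals_P)
next
  fix i n g assume i: "i < length Fs" "0 < n" "g \<in> vals (Fs ! i) {..<n}"
  have c: "Node (lab i n g) (map Leaf [0..<n]) \<in> vals T {..<n}"
    using corolla_vals[OF lab_vals[OF i] i(2)] .
  then show "\<pi> {..<n} (Node (lab i n g) (map Leaf [0..<n])) \<in> vals P {..<n}"
    by (rule op_homD(1)[OF hom])
  fix c assume "c < n"
  then show "tev val (\<pi> {..<n} (Node (lab i n g) (map Leaf [0..<n]))) c = gen_addr Fs n g i c"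
    using \<pi>_addr[OF c, of c] Node_addr[OF i _ c, of c c] by simp
next
  fix a X assume a: "a \<in> vals P X"
  then have t: "a \<in> vals T X" "\<pi> X a = a" by (auto simp: vals_P)
  from root[OF t(1)]
  show "(\<exists>x. X = {x} \<and> a = ounit P x) \<or> (\<exists>i n g. rooted Fs n g i X (tev val a))"
  proof (elim disjE exE conjE)
    fix x assume "X = {x}" "\<pi> X a = \<pi> X (Leaf x)"
    then show ?thesis using op_homD(3)[OF hom, of x] t(2) by (simp add: tree_unit)
  next
    fix i n g ts assume j: "i < length Fs" "0 < n" "length ts = n" "g \<in> vals (Fs ! i) {..<n}"
      "Node (lab i n g) ts \<in> vals T X" "\<pi> X a = \<pi> X (Node (lab i n g) ts)"
    have "rooted Fs n g i X (tev val a)"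
      using Node_rooted(1)[OF j(1,2,4,3,5)] \<pi>_addr[OF j(5)] j(6) t(2)
      by (subst rooted_cong(1)[of X _ "tev val (Node (lab i n g) ts)"]) auto
    then show ?thesis by blast
  qed
next
  fix a X n g i c assume a: "a \<in> vals P X" "rooted Fs n g i X (tev val a)" "c < n"
  then have t: "a \<in> vals T X" "\<pi> X a = a" by (auto simp: vals_P)
  have i: "i < length Fs" "n > 0" "g \<in> vals (Fs ! i) {..<n}" using a(2) by (auto simp: rooted_def)
  obtain ts where ts: "length ts = n" "Node (lab i n g) ts \<in> vals T X"
    "\<pi> X a = \<pi> X (Node (lab i n g) ts)" using factor_out[OF t(1) a(2)] by blast
  have eq: "tev val a x = tev val (Node (lab i n g) ts) x" if "x \<in> X" for x
    using \<pi>_addr[OF ts(2) that] ts(3) t(2) by simp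
  have part: "part Fs n g i X (tev val a) c = set (leaves (ts ! c))"
    using rooted_cong(2)[of X, OF eq] Node_rooted(2)[OF i ts(1,2) a(3)] by simp
  have v: "ts ! c \<in> vals T (set (leaves (ts ! c)))" using Node_valsD(3)[OF ts(2)] ts(1) a(3) by simp
  show "part Fs n g i X (tev val a) c \<noteq> {}"
    unfolding part using tree_fin_ne[OF v] by (simp add: fin_ne_def)
  have "set (leaves (ts ! c)) \<subseteq> X" using Node_valsD(5)[OF ts(2)] ts(1) a(3) by blast
  then have "tev val a x = cat (gen_addr Fs n g i c) (tev val (\<pi> (set (leaves (ts ! c))) (ts ! c)) x)"
    if "x \<in> set (leaves (ts ! c))" for x
    using eq[of x] Node_addr[OF i ts(1,2) a(3) that] \<pi>_addr[OF v that] that by auto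
  then show "\<exists>q\<in>vals P (part Fs n g i X (tev val a) c). \<forall>x\<in>part Fs n g i X (tev val a) c.
              tev val a x = cat (gen_addr Fs n g i c) (tev val q x)"
    unfolding part using op_homD(1)[OF hom v] by blast
qed

end

section \<open>The address model of an absolutely free operad\<close>

lemma gen_addr_pull:
  assumes "good_coll (Fs ! i)" "n > 0" "g \<in> vals (Fs ! i) {..<n}" "\<sigma> permutes {..<n}" "c < n"
  shows "gen_addr Fs n (pull (Fs ! i) {..<n} \<sigma> g) i c = gen_addr Fs n g i (\<sigma> c)"
  using letter_pull[of "Fs ! i" "{..<n}" \<sigma> "{..<n}" g c] assms
  by (auto simp: gen_addr_def good_coll_def permutes_imp_bij)

lemma tev_corolla:
  assumes "u \<in> vals U {..<n}" "c < n"
  shows "tev val (Node u (map Leaf [0..<n])) c = val n u c"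
  using tev_Node[OF corolla_vals[OF assms(1)], of c c val] assms(2) by simp

lemma equivariance_addr:
  assumes val: "\<And>n u \<sigma> c. n > 0 \<Longrightarrow> u \<in> vals U {..<n} \<Longrightarrow> \<sigma> permutes {..<n} \<Longrightarrow> c < n \<Longrightarrow>
      pull U {..<n} \<sigma> u \<in> vals U {..<n} \<and> val n (pull U {..<n} \<sigma> u) c = val n u (\<sigma> c)"
    and e: "equivariance U X a b" and x: "x \<in> X"
  shows "tev val a x = tev val b x"
proof -
  obtain n \<sigma> g where n: "n \<ge> 1" "X = {..<n}" "\<sigma> permutes {..<n}" "g \<in> vals U {..<n}"
    "a = Node (pull U {..<n} \<sigma> g) (map Leaf [0..<n])"
    "b = pull (tree_operad U) {..<n} \<sigma> (Node g (map Leaf [0..<n]))"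
    using e unfolding equivariance_def by blast
  have n0: "n > 0" and xn: "x < n" using n x by auto
  have im: "\<sigma> ` {..<n} = {..<n}" "inj_on \<sigma> {..<n}"
    using n(3) by (auto simp: permutes_image intro: permutes_inj_on)
  have \<sigma>x: "\<sigma> x < n" using permutes_in_image[OF n(3), of x] xn by simp
  have "tev val b x = tev val (Node g (map Leaf [0..<n])) (\<sigma> x)"
    unfolding n(6) using addr_homD(1)[OF tree_addr, of "{..<n}" \<sigma>] im n0 xn corolla_vals[OF n(4) n0]
    by (metis fin_ne_lessThan lessThan_iff)
  then show ?thesis
    using val[OF n0 n(4,3) xn] xn \<sigma>x n(4) by (simp add: n(5) tev_corolla[of _ U])
qed

lemma equivariance_rep:
  assumes "n > 0" "u \<in> vals U {..<n}" "pull U {..<n} \<sigma> u \<in> vals U {..<n}" "\<sigma> permutes {..<n}"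
  shows "rep (tree_operad U) (equivariance U) {..<n} (Node (pull U {..<n} \<sigma> u) (map Leaf [0..<n])) =
    rep (tree_operad U) (equivariance U) {..<n} (Node u (map (\<lambda>c. Leaf (inv \<sigma> c)) [0..<n]))"
proof -
  have im: "\<sigma> ` {..<n} = {..<n}" "inj_on \<sigma> {..<n}"
    using assms(4) by (auto simp: permutes_image intro: permutes_inj_on)
  have inv: "inv_into {..<n} \<sigma> c = inv \<sigma> c" if "c < n" for c
  proof (rule inv_into_f_eq[OF im(2)])
    show "inv \<sigma> c \<in> {..<n}" using permutes_in_image[OF permutes_inv[OF assms(4)], of c] that by simp
    show "\<sigma> (inv \<sigma> c) = c" using permutes_inverses(1)[OF assms(4)] by simp
  qed
  have b: "pull (tree_operad U) {..<n} \<sigma> (Node u (map Leaf [0..<n])) =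
      Node u (map (\<lambda>c. Leaf (inv \<sigma> c)) [0..<n])"
    by (simp add: tree_pull inv)
  show ?thesis
  proof (rule rep_eqI, rule ocong.base)
    show "equivariance U {..<n} (Node (pull U {..<n} \<sigma> u) (map Leaf [0..<n]))
        (Node u (map (\<lambda>c. Leaf (inv \<sigma> c)) [0..<n]))"
      unfolding equivariance_def b[symmetric] using assms(1,2,4) by (intro exI conjI) auto
    show "Node (pull U {..<n} \<sigma> u) (map Leaf [0..<n]) \<in> vals (tree_operad U) {..<n}"
      using corolla_vals assms(1,3) by blast
    show "Node u (map (\<lambda>c. Leaf (inv \<sigma> c)) [0..<n]) \<in> vals (tree_operad U) {..<n}"
      by (rule map_Leaf_vals[OF assms(2,1)]) (use assms(4) in \<open>simp add: permutes_inv permutes_imp_bij\<close>)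
  qed
qed

text \<open>There is only one direction, so the interchange axiom is vacuous, and every vertex label
  already is a generator.\<close>

lemma abs_free_model:
  fixes F :: "'a collection"
  assumes F: "good_coll F"
  shows "\<exists>e \<gamma>. models (abs_free_operad F) [F] e \<gamma>"
proof -
  let ?U = "gen_collection F"
  let ?R = "equivariance ?U"
  define val :: "nat \<Rightarrow> 'a expr \<Rightarrow> nat \<Rightarrow> 'a letter addr"
    where "val = (\<lambda>n u c. case u of Gen g \<Rightarrow> gen_addr [F] n g 0 c | _ \<Rightarrow> nil_addr)"
  have Fc: "is_collection F" using F by (simp add: good_coll_def)
  have U: "vals ?U X = Gen ` vals F X" "pull ?U X f (Gen g) = Gen (pull F X f g)" for X f g
    by (simp_all add: gen_collection_def)
  have pull: "pull F {..<n} \<sigma> g \<in> vals F {..<n}"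
    if "n > 0" "g \<in> vals F {..<n}" "\<sigma> permutes {..<n}" for n \<sigma> g
    using pull_bij[OF Fc _ permutes_imp_bij[OF that(3)] that(2)] that(1) by simp
  have R: "tev val a x = tev val b x" if "?R X a b" "x \<in> X" for X a b x
    by (rule equivariance_addr[OF _ that])
      (use pull gen_addr_pull[of "[F]" 0] F in \<open>auto simp: U val_def\<close>)
  note ct = closed_tree[of ?U]
  have qa: "addr_hom (quot_operad (tree_operad ?U) ?R) (tev val)"
    "\<And>a X x. a \<in> vals (tree_operad ?U) X \<Longrightarrow> x \<in> X \<Longrightarrow>
      tev val (rep (tree_operad ?U) ?R X a) x = tev val a x"
    using quot_addr[OF ct tree_addr, of ?R val] rep_addr[OF ct tree_addr, of ?R val] R by blast+
  have P: "abs_free_operad F = quot_operad (tree_operad ?U) ?R"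
    by (simp add: abs_free_operad_def free_operad_def)
  have "presentation ?U [F] val (\<lambda>i n. Gen) (abs_free_operad F) (rep (tree_operad ?U) ?R)"
    unfolding P
  proof
    fix t X assume t: "t \<in> vals (tree_operad ?U) X"
    show "(\<exists>x. X = {x} \<and> rep (tree_operad ?U) ?R X t = rep (tree_operad ?U) ?R X (Leaf x)) \<or>
       (\<exists>i n g ts. i < length [F] \<and> n > 0 \<and> length ts = n \<and> g \<in> vals ([F] ! i) {..<n} \<and>
          Node (Gen g) ts \<in> vals (tree_operad ?U) X \<and>
          rep (tree_operad ?U) ?R X t = rep (tree_operad ?U) ?R X (Node (Gen g) ts))"
    proof (cases t)
      case (Leaf x)
      with t show ?thesis by auto
    next
      case (Node u ts)
      note n = Node_valsD[OF t[unfolded Node]]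
      obtain g where "u = Gen g" "g \<in> vals F {..<length ts}" using n(2) by (auto simp: U)
      with t n(1) Node show ?thesis
        by (intro disjI2 exI[of _ 0] exI[of _ "length ts"] exI[of _ g] exI[of _ ts]) auto
    qed (use t in \<open>auto simp: tree_vals elim: is_tree.cases\<close>)
  next
    fix i n g \<sigma> assume "i < length [F]" "0 < n" "g \<in> vals ([F] ! i) {..<n}" "\<sigma> permutes {..<n}"
    then show "rep (tree_operad ?U) ?R {..<n} (Node (Gen (pull ([F] ! i) {..<n} \<sigma> g)) (map Leaf [0..<n])) =
       rep (tree_operad ?U) ?R {..<n} (Node (Gen g) (map (\<lambda>c. Leaf (inv \<sigma> c)) [0..<n]))"
      using equivariance_rep[of n "Gen g" ?U \<sigma>] pull by (simp add: U)
  qed (use F ct closed_quot[OF ct] vals_quot[OF ct] rep_hom[OF ct] qa in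
      \<open>auto simp: U val_def gen_addr_def\<close>)
  then show ?thesis using presentation.model by blast
qed

section \<open>The address model of a Boardman--Vogt tensor product\<close>

definition corolla :: "'a expr collection \<Rightarrow> nat set \<Rightarrow> 'a expr \<Rightarrow> 'a expr" where
  "corolla U X u = (let xs = sorted_list_of_set X in
     Node (pull U {..<card X} (\<lambda>i. xs ! i) u) (map Leaf xs))"

lemma generator_eq: "generator U X u = rep (tree_operad U) (equivariance U) X (corolla U X u)"
  by (simp add: generator_def corolla_def Let_def)

text \<open>One of the two inclusions \<open>k\<close> of \<open>P\<close> and \<open>Q\<close> into their disjoint union \<open>U\<close>; the map \<open>sh\<close>
  renumbers the directions of the addresses.\<close>

locale side = models P Fs e \<gamma>
  for P :: "'a expr operad" and Fs :: "'a collection list"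
    and e :: "'a expr \<Rightarrow> nat \<Rightarrow> 'a letter addr" and \<gamma> +
  fixes U :: "'a expr collection" and val :: "nat \<Rightarrow> 'a expr \<Rightarrow> nat \<Rightarrow> 'a letter addr"
    and k :: "'a expr \<Rightarrow> 'a expr" and sh :: "'a letter addr \<Rightarrow> 'a letter addr"
  assumes k_vals: "p \<in> vals P X \<Longrightarrow> k p \<in> vals U X"
    and k_pull: "pull U X f (k p) = k (pull P X f p)"
    and k_val: "val n (k p) c = sh (e p c)"
    and sh_cat: "sh (cat u w) = cat (sh u) (sh w)"
    and sh_nil: "sh nil_addr = nil_addr"
    and goodF: "\<And>F. F \<in> set Fs \<Longrightarrow> good_coll F"
begin

lemma sorted_bij:
  assumes "fin_ne X"
  shows "bij_betw (\<lambda>i. sorted_list_of_set X ! i) {..<card X} X"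
  using bij_betw_nth[OF distinct_sorted_list_of_set, of "{..<card X}" X X] assms
  by (simp add: fin_ne_def)

lemma pull_sorted_vals:
  assumes "p \<in> vals P X"
  shows "pull P {..<card X} (\<lambda>i. sorted_list_of_set X ! i) p \<in> vals P {..<card X}"
    "c < card X \<Longrightarrow> e (pull P {..<card X} (\<lambda>i. sorted_list_of_set X ! i) p) c =
       e p (sorted_list_of_set X ! c)"
proof -
  have X: "fin_ne X" using closed_operadD(1)[OF closed assms] .
  note b = sorted_bij[OF X, unfolded bij_betw_def]
  have n: "fin_ne {..<card X}" using fin_ne_card[OF X] by simp
  show "pull P {..<card X} (\<lambda>i. sorted_list_of_set X ! i) p \<in> vals P {..<card X}"
    by (rule closed_operadD(2)[OF closed n]) (use b assms in auto)
  show "c < card X \<Longrightarrow> e (pull P {..<card X} (\<lambda>i. sorted_list_of_set X ! i) p) c =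
       e p (sorted_list_of_set X ! c)"
    by (rule addr_homD(1)[OF addr n]) (use b assms in auto)
qed

lemma corolla_tree:
  assumes "p \<in> vals P X"
  shows "corolla U X (k p) \<in> vals (tree_operad U) X"
    "x \<in> X \<Longrightarrow> tev val (corolla U X (k p)) x = sh (e p x)"
proof -
  have X: "fin_ne X" using closed_operadD(1)[OF closed assms] .
  let ?xs = "sorted_list_of_set X" and ?p = "pull P {..<card X} (\<lambda>i. sorted_list_of_set X ! i) p"
  have b: "inj_on (\<lambda>i. ?xs ! i) {..<card X}" "(\<lambda>i. ?xs ! i) ` {..<card X} = X"
    using sorted_bij[OF X] by (auto simp: bij_betw_def)
  have l: "length ?xs = card X" using X by (simp add: fin_ne_def)
  have c: "corolla U X (k p) = Node (k ?p) (map Leaf ?xs)"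
    by (simp add: corolla_def k_pull Let_def)
  show v: "corolla U X (k p) \<in> vals (tree_operad U) X"
    unfolding c
  proof (rule Node_valsI[where B = "\<lambda>i. {?xs ! i}"])
    show "map Leaf ?xs \<noteq> []"
      using X by (simp add: fin_ne_def)
    show "k ?p \<in> vals U {..<length (map Leaf ?xs)}"
      using k_vals[OF pull_sorted_vals(1)[OF assms]] l by simp
    show "disjoint_family_on (\<lambda>i. {?xs ! i}) {..<length (map Leaf ?xs)}"
      using b(1) l by (auto simp: disjoint_family_on_def inj_on_def)
    show "X = (\<Union>i<length (map Leaf ?xs). {?xs ! i})" using b(2) l by auto
  qed auto
  assume "x \<in> X"
  then obtain i where i: "i < card X" "?xs ! i = x" using b(2) by (metis imageE lessThan_iff)
  show "tev val (corolla U X (k p)) x = sh (e p x)"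
    using tev_Node[OF v[unfolded c], of i x val] i l pull_sorted_vals(2)[OF assms i(1)]
    by (simp add: c k_val)
qed

text \<open>An increasing \<open>f\<close> enumerates its image in sorted order, so the corolla of
  the relabelled \<open>p\<close> carries \<open>p\<close> itself as its label.\<close>

lemma corolla_mono:
  assumes p: "p \<in> vals P {..<n}" and f: "strict_mono_on {..<n} f"
  shows "pull P (f ` {..<n}) (inv_into {..<n} f) p \<in> vals P (f ` {..<n})"
    "c < n \<Longrightarrow> e (pull P (f ` {..<n}) (inv_into {..<n} f) p) (f c) = e p c"
    "corolla U (f ` {..<n}) (k (pull P (f ` {..<n}) (inv_into {..<n} f) p)) =
       Node (k p) (map (\<lambda>c. Leaf (f c)) [0..<n])"
proof -
  let ?X = "f ` {..<n}" and ?f' = "inv_into {..<n} f"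
  have n: "n > 0" using closed_operadD(1)[OF closed p] by simp
  have inj: "inj_on f {..<n}" using f by (rule strict_mono_on_imp_inj_on)
  have X: "fin_ne ?X" using n by (auto simp: fin_ne_def)
  have f': "inj_on ?f' ?X" "?f' ` ?X = {..<n}"
    using inj by (auto simp: inj_on_inv_into)
  show p': "pull P ?X ?f' p \<in> vals P ?X"
    by (rule closed_operadD(2)[OF closed X]) (use f' p in auto)
  show e': "e (pull P ?X ?f' p) (f c) = e p c" if "c < n" for c
    using addr_homD(1)[OF addr X f'(1), of p "f c"] f'(2) p that inj by simp
  have xs: "sorted_list_of_set ?X = map f [0..<n]"
  proof (rule sorted_distinct_set_unique)
    show "sorted (map f [0..<n])"
      using f by (auto simp: sorted_iff_nth_mono strict_mono_on_def le_less)
    show "distinct (map f [0..<n])" using inj by (simp add: distinct_map atLeast0LessThan)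
  qed (simp_all add: atLeast0LessThan)
  have card: "card ?X = n" using inj by (simp add: card_image)
  have "pull P {..<n} (\<lambda>i. sorted_list_of_set ?X ! i) (pull P ?X ?f' p) = p"
  proof (rule faithful)
    show "pull P {..<n} (\<lambda>i. sorted_list_of_set ?X ! i) (pull P ?X ?f' p) \<in> vals P {..<n}"
      using pull_sorted_vals(1)[OF p'] card by simp
    show "e (pull P {..<n} (\<lambda>i. sorted_list_of_set ?X ! i) (pull P ?X ?f' p)) c = e p c"
      if "c \<in> {..<n}" for c
      using pull_sorted_vals(2)[OF p', of c] card that e'[of c] xs by simp
  qed (fact p)
  then show "corolla U ?X (k (pull P ?X ?f' p)) = Node (k p) (map (\<lambda>c. Leaf (f c)) [0..<n])"
    unfolding corolla_def Let_def k_pull card xs by simp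
qed

text \<open>The case of the identity map in \<open>corolla_mono\<close>; that relabelling along it
  fixes \<open>p\<close> is seen on addresses.\<close>

lemma corolla_lessThan:
  assumes "p \<in> vals P {..<n}"
  shows "corolla U {..<n} (k p) = Node (k p) (map Leaf [0..<n])"
proof -
  have n: "n > 0" using closed_operadD(1)[OF closed assms] by simp
  have s: "strict_mono_on {..<n} (\<lambda>c. c)" by (simp add: strict_mono_on_def)
  have "pull P {..<n} (inv_into {..<n} (\<lambda>c. c)) p = p"
    by (rule faithful) (use corolla_mono(1,2)[OF assms s] assms in auto)
  then show ?thesis using corolla_mono(3)[OF assms s] by simp
qed

lemma rels_addr:
  assumes T1: "addr_hom (free_operad U) (tev val)"
    and r: "\<And>t X x. t \<in> vals (tree_operad U) X \<Longrightarrow> x \<in> X \<Longrightarrow>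
      tev val (rep (tree_operad U) (equivariance U) X t) x = tev val t x"
    and R: "operad_map_rels P (free_operad U) (\<lambda>Y p. generator U Y (k p)) X a b" and x: "x \<in> X"
  shows "tev val a x = tev val b x"
proof -
  have gv: "generator U Y (k p) \<in> vals (free_operad U) Y" if "p \<in> vals P Y" for Y p
    unfolding generator_eq free_operad_def
    by (rule op_homD(1)[OF rep_hom[OF closed_tree] corolla_tree(1)[OF that]])
  have ge: "tev val (generator U Y (k p)) y = sh (e p y)" if "p \<in> vals P Y" "y \<in> Y" for Y p y
    unfolding generator_eq using r corolla_tree[OF that(1)] that(2) by simp
  from R show ?thesis
    unfolding operad_map_rels_def
  proof (elim disjE exE conjE)
    fix y assume "X = {y}" "a = generator U {y} (k (ounit P y))" "b = ounit (free_operad U) y"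
    then show ?thesis using ge[OF closed_operadD(3)[OF closed], of y] x addr_homD(2)[OF T1]
        addr_homD(2)[OF addr] sh_nil by simp
  next
    fix p Bs qs
    assume a: "Bs \<noteq> []" "ordered_partition Bs X" "p \<in> vals P {..<length Bs}" "length qs = length Bs"
      "\<forall>i<length Bs. qs ! i \<in> vals P (Bs ! i)"
      "a = generator U X (k (ocomp P p Bs qs))"
      "b = ocomp (free_operad U) (generator U {..<length Bs} (k p)) Bs
        (map2 (\<lambda>Y p. generator U Y (k p)) Bs qs)"
    obtain i where i: "i < length Bs" "x \<in> Bs ! i" using ordered_partition_index[OF a(2) x] .
    have "tev val a x = sh (e (ocomp P p Bs qs) x)"
      unfolding a(6) by (rule ge[OF closed_operadD(4)[OF closed a(2,1,3,4)] x]) (use a(5) in simp)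
    also have "\<dots> = cat (sh (e p i)) (sh (e (qs ! i) x))"
      using addr_homD(3)[OF addr a(2,1,3,4) _ i] a(5) by (simp add: sh_cat)
    also have "\<dots> = tev val b x"
      unfolding a(7) using addr_homD(3)[OF T1 a(2,1) gv[OF a(3)], of _ i x] a(4,5) i
      by (simp add: gv ge a(3))
    finally show ?thesis .
  qed
qed

end

text \<open>\<open>W\<close> stands for the tensor product. What enters is that it lies under the
  free operad on \<open>U\<close> and identifies the relations that make \<open>k\<close> a map of
  operads.\<close>

locale side_proj = side P Fs e \<gamma> U val k sh
  for P :: "'a expr operad" and Fs :: "'a collection list"
    and e :: "'a expr \<Rightarrow> nat \<Rightarrow> 'a letter addr" and \<gamma> U val k sh +
  fixes W :: "'a expr operad" and \<pi>' :: "nat set \<Rightarrow> 'a expr \<Rightarrow> 'a expr"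
  assumes hom': "op_hom (free_operad U) W \<pi>'"
    and rel: "operad_map_rels P (free_operad U) (\<lambda>Y p. generator U Y (k p)) X a b \<Longrightarrow>
      a \<in> vals (free_operad U) X \<Longrightarrow> b \<in> vals (free_operad U) X \<Longrightarrow> \<pi>' X a = \<pi>' X b"
begin

definition "\<pi> X t = \<pi>' X (rep (tree_operad U) (equivariance U) X t)"

lemma rep1: "op_hom (tree_operad U) (free_operad U) (rep (tree_operad U) (equivariance U))"
  unfolding free_operad_def by (rule rep_hom[OF closed_tree])

lemma hom: "op_hom (tree_operad U) W \<pi>"
  using op_hom_compose[OF rep1 hom'] by (simp add: \<pi>_def[abs_def])

lemma corolla_unit: "\<pi> {x} (corolla U {x} (k (ounit P x))) = \<pi> {x} (Leaf x)"
proof -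
  have "\<pi>' {x} (generator U {x} (k (ounit P x))) = \<pi>' {x} (ounit (free_operad U) x)"
  proof (rule rel)
    show "generator U {x} (k (ounit P x)) \<in> vals (free_operad U) {x}"
      unfolding generator_eq
      by (rule op_homD(1)[OF rep1 corolla_tree(1)[OF closed_operadD(3)[OF closed]]])
    show "ounit (free_operad U) x \<in> vals (free_operad U) {x}"
      using op_homD(1)[OF rep1, of "Leaf x" "{x}"] op_homD(3)[OF rep1, of x]
      by (simp add: tree_unit)
  qed (auto simp: operad_map_rels_def)
  then show ?thesis
    using op_homD(3)[OF rep1, of x] by (simp add: \<pi>_def generator_eq tree_unit)
qed

text \<open>The defining relation of the coproduct in terms of trees: from right to left it
  contracts a vertex from \<open>P\<close> together with children from \<open>P\<close> to a single
  vertex.\<close>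

lemma corolla_comp:
  assumes a: "ordered_partition Bs X" "Bs \<noteq> []" "p \<in> vals P {..<length Bs}"
    "length qs = length Bs" "\<And>i. i < length Bs \<Longrightarrow> qs ! i \<in> vals P (Bs ! i)"
  shows "\<pi> X (corolla U X (k (ocomp P p Bs qs))) =
    \<pi> X (Node (k p) (map (\<lambda>i. corolla U (Bs ! i) (k (qs ! i))) [0..<length Bs]))"
proof -
  let ?c = "\<lambda>Y p. corolla U Y (k p)" and ?T1 = "free_operad U"
  have c: "?c {..<length Bs} p \<in> vals (tree_operad U) {..<length Bs}"
    by (rule corolla_tree(1)[OF a(3)])
  have cq: "map2 ?c Bs qs ! i \<in> vals (tree_operad U) (Bs ! i)" if "i < length Bs" for i
    using corolla_tree(1)[OF a(5)[OF that]] a(4) that by simp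
  have lq: "length (map2 ?c Bs qs) = length Bs" using a(4) by simp
  have gv: "generator U Y (k p) \<in> vals ?T1 Y" if "p \<in> vals P Y" for Y p
    unfolding generator_eq by (rule op_homD(1)[OF rep1 corolla_tree(1)[OF that]])
  let ?b = "ocomp ?T1 (generator U {..<length Bs} (k p)) Bs (map2 (\<lambda>Y p. generator U Y (k p)) Bs qs)"
  have b: "?b = rep (tree_operad U) (equivariance U) X
      (ocomp (tree_operad U) (?c {..<length Bs} p) Bs (map2 ?c Bs qs))"
  proof -
    have "map2 (rep (tree_operad U) (equivariance U)) Bs (map2 ?c Bs qs) =
        map2 (\<lambda>Y p. generator U Y (k p)) Bs qs"
      by (rule nth_equalityI) (use a(4) in \<open>auto simp: generator_eq\<close>)
    then show ?thesis using op_homD(4)[OF rep1 a(1,2) c lq cq] by (simp add: generator_eq)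
  qed
  have "\<pi>' X (generator U X (k (ocomp P p Bs qs))) = \<pi>' X ?b"
  proof (rule rel)
    show "generator U X (k (ocomp P p Bs qs)) \<in> vals ?T1 X"
      by (rule gv, rule closed_operadD(4)[OF closed a])
    show "operad_map_rels P ?T1 (\<lambda>Y p. generator U Y (k p)) X (generator U X (k (ocomp P p Bs qs))) ?b"
      unfolding operad_map_rels_def using a by (intro disjI2 exI[of _ p] exI[of _ Bs] exI[of _ qs]) simp
    show "?b \<in> vals ?T1 X"
      unfolding b by (rule op_homD(1)[OF rep1], rule closed_operadD(4)[OF closed_tree a(1,2) c lq cq])
  qed
  then have "\<pi> X (?c X (ocomp P p Bs qs)) =
      \<pi> X (ocomp (tree_operad U) (?c {..<length Bs} p) Bs (map2 ?c Bs qs))"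
    unfolding b by (simp add: \<pi>_def generator_eq)
  also have "ocomp (tree_operad U) (?c {..<length Bs} p) Bs (map2 ?c Bs qs) =
      Node (k p) (map (\<lambda>i. ?c (Bs ! i) (qs ! i)) [0..<length Bs])"
    unfolding tree_comp corolla_lessThan[OF a(3)] using a(4) by simp
  finally show ?thesis .
qed

text \<open>The label \<open>p\<close> is decomposed inside \<open>P\<close>. A unit label lets the
  vertex disappear, and a factorisation of \<open>p\<close> with a generator in front splits the
  vertex into two levels by \<open>corolla_comp\<close>.\<close>

lemma side_root:
  assumes t: "Node (k p) ts \<in> vals (tree_operad U) X" and p: "p \<in> vals P {..<length ts}"
  shows "(length ts = 1 \<and> \<pi> X (Node (k p) ts) = \<pi> X (ts ! 0)) \<or>
    (\<exists>i m g us. i < length Fs \<and> m > 0 \<and> length us = m \<and> g \<in> vals (Fs ! i) {..<m} \<and>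
      Node (k (\<gamma> i m g)) us \<in> vals (tree_operad U) X \<and>
      \<pi> X (Node (k p) ts) = \<pi> X (Node (k (\<gamma> i m g)) us))"
proof -
  let ?n = "length ts"
  note n = Node_valsD[OF t]
  have n0: "?n > 0" using n(1) by simp
  have c: "Node (k p) (map Leaf [0..<?n]) \<in> vals (tree_operad U) {..<?n}"
    by (rule corolla_vals[OF n(2) n0])
  have sub: "\<pi> X (Node (k p) ts) = \<pi> X (subst (\<lambda>i. ts ! i) t')"
    if "t' \<in> vals (tree_operad U) {..<?n}" "\<pi> {..<?n} (Node (k p) (map Leaf [0..<?n])) = \<pi> {..<?n} t'" for t'
    using hom_subst[OF hom n0 c that n(3) n(3) HOL.refl n(4,5)] subst_corolla[of ts ?n "k p"] by simp
  from root[OF p] show ?thesis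
  proof (elim disjE exE)
    fix x assume x: "{..<?n} = {x} \<and> p = ounit P x"
    then have 1: "?n = 1" "x = 0" using n0 card_lessThan[of ?n] by (auto simp del: card_lessThan)
    have "\<pi> {..<?n} (Node (k p) (map Leaf [0..<?n])) = \<pi> {..<?n} (Leaf 0)"
      using corolla_unit[of 0] corolla_lessThan[OF p] x 1 by simp
    from sub[OF _ this] show ?thesis using 1 x by simp
  next
    fix i m g assume r: "rooted Fs m g i {..<?n} (e p)"
    have i: "i < length Fs" "m > 0" "g \<in> vals (Fs ! i) {..<m}" using r by (auto simp: rooted_def)
    let ?B = "part Fs m g i {..<?n} (e p)"
    from division[OF p r] obtain q where q: "\<And>c. c < m \<Longrightarrow> q c \<in> vals P (?B c)"
      "\<And>c x. c < m \<Longrightarrow> x \<in> ?B c \<Longrightarrow> e p x = cat (gen_addr Fs m g i c) (e (q c) x)" by metis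
    define Bs where "Bs = map ?B [0..<m]"
    have Bs: "length Bs = m" "Bs \<noteq> []" "\<And>c. c < m \<Longrightarrow> Bs ! c = ?B c"
      using i(2) by (auto simp: Bs_def)
    have op: "ordered_partition Bs {..<?n}"
    proof (rule ordered_partitionI)
      show "(\<Union>c<length Bs. Bs ! c) = {..<?n}" using part_cover[OF r] Bs by auto
      show "Bs ! c \<noteq> {}" if "c < length Bs" for c using part_ne[OF p r] that Bs by simp
      show "Bs ! c \<inter> Bs ! d = {}" if "c < length Bs" "d < length Bs" "c \<noteq> d" for c d
        using part_disjoint[OF _ r] goodF that Bs by (auto simp: disjoint_family_on_def)
    qed simp
    let ?g = "\<gamma> i m g"
    have gv: "?g \<in> vals P {..<length Bs}" using gen_vals[OF i] Bs(1) by simp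
    have qv: "map q [0..<m] ! c \<in> vals P (Bs ! c)" if "c < length Bs" for c
      using q(1) that Bs by simp
    have lq: "length (map q [0..<m]) = length Bs" using Bs by simp
    \<comment> \<open>\<open>division\<close> provides factors with the right addresses; that they
      compose to \<open>p\<close> is a consequence of faithfulness.\<close>
    have pe: "p = ocomp P ?g Bs (map q [0..<m])"
    proof (rule faithful[OF p])
      show "ocomp P ?g Bs (map q [0..<m]) \<in> vals P {..<?n}"
        by (rule closed_operadD(4)[OF closed op Bs(2) gv lq qv])
      fix x assume "x \<in> {..<?n}"
      then obtain c where c: "c < length Bs" "x \<in> Bs ! c" using ordered_partition_index[OF op] by blast
      show "e p x = e (ocomp P ?g Bs (map q [0..<m])) x"
        using addr_homD(3)[OF addr op Bs(2) gv lq qv c] q(2)[of c x] gen_addr[OF i, of c] c Bs by simp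
    qed
    let ?us = "map (\<lambda>i. corolla U (Bs ! i) (k (map q [0..<m] ! i))) [0..<length Bs]"
    have e1: "\<pi> {..<?n} (Node (k p) (map Leaf [0..<?n])) = \<pi> {..<?n} (Node (k ?g) ?us)"
      using corolla_comp[OF op Bs(2) gv lq qv] pe corolla_lessThan[OF p] by simp
    have tv: "Node (k ?g) ?us \<in> vals (tree_operad U) {..<?n}"
    proof (rule Node_valsI[where B = "\<lambda>c. Bs ! c"])
      show "k ?g \<in> vals U {..<length ?us}" using k_vals[OF gv] by simp
      show "?us ! c \<in> vals (tree_operad U) (Bs ! c)" if "c < length ?us" for c
        using corolla_tree(1)[OF qv, of c] that by simp
    qed (use ordered_partition_nth[OF op] Bs in auto)
    have "subst (\<lambda>i. ts ! i) (Node (k ?g) ?us) \<in> vals (tree_operad U) X"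
      by (rule subst_vals[OF tv n(3) n(4,5)]) simp
    with sub[OF tv e1] i Bs(1) show ?thesis
      by (intro disjI2 exI[of _ i] exI[of _ m] exI[of _ g]
          exI[of _ "map (subst (\<lambda>i. ts ! i)) ?us"]) simp
  qed
qed

text \<open>\<open>corolla_comp\<close> from right to left contracts the two levels to one vertex
  labelled by an element \<open>a\<close> of \<open>P\<close>. The leaf maps are taken increasing so
  that \<open>corolla_mono\<close> keeps the inner labels equal to \<open>q\<close>.\<close>

lemma nested_corolla:
  assumes p: "p \<in> vals P {..<m}" "q \<in> vals P {..<l}"
    and f: "\<And>c. c < m \<Longrightarrow> strict_mono_on {..<l} (f c)"
      "disjoint_family_on (\<lambda>c. f c ` {..<l}) {..<m}" "X = (\<Union>c<m. f c ` {..<l})"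
  shows "\<exists>a\<in>vals P X. (\<forall>c<m. \<forall>d<l. e a (f c d) = cat (e p c) (e q d)) \<and>
    \<pi> X (Node (k p) (map (\<lambda>c. Node (k q) (map (\<lambda>d. Leaf (f c d)) [0..<l])) [0..<m])) =
    \<pi> X (corolla U X (k a))"
proof -
  have n: "m > 0" "l > 0"
    using closed_operadD(1)[OF closed p(1)] closed_operadD(1)[OF closed p(2)] by simp_all
  let ?B = "\<lambda>c. f c ` {..<l}" and ?q = "\<lambda>c. pull P (f c ` {..<l}) (inv_into {..<l} (f c)) q"
  define Bs where "Bs = map ?B [0..<m]"
  define qs where "qs = map ?q [0..<m]"
  have Bs: "length Bs = m" "Bs \<noteq> []" "\<And>c. c < m \<Longrightarrow> Bs ! c = ?B c" "\<And>c. c < m \<Longrightarrow> qs ! c = ?q c"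
    using n by (auto simp: Bs_def qs_def)
  note cm = corolla_mono[OF p(2) f(1)]
  have op: "ordered_partition Bs X"
  proof (rule ordered_partitionI)
    show "finite X" unfolding f(3) by simp
    show "(\<Union>c<length Bs. Bs ! c) = X" using f(3) Bs by auto
    show "Bs ! c \<noteq> {}" if "c < length Bs" for c using that Bs n by (auto simp: lessThan_empty_iff)
    show "Bs ! c \<inter> Bs ! d = {}" if "c < length Bs" "d < length Bs" "c \<noteq> d" for c d
      using f(2) that Bs by (simp add: disjoint_family_on_def)
  qed
  have pv: "p \<in> vals P {..<length Bs}" using p(1) Bs by simp
  have lq: "length qs = length Bs" by (simp add: qs_def Bs_def)
  have qv: "qs ! c \<in> vals P (Bs ! c)" if "c < length Bs" for c
    using cm(1)[of c] that Bs by simp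
  let ?a = "ocomp P p Bs qs"
  have "?a \<in> vals P X" by (rule closed_operadD(4)[OF closed op Bs(2) pv lq qv])
  moreover have "e ?a (f c d) = cat (e p c) (e q d)" if "c < m" "d < l" for c d
    using addr_homD(3)[OF addr op Bs(2) pv lq qv, of c "f c d"] that Bs cm(2)[of c d] by simp
  moreover have "\<pi> X (corolla U X (k ?a)) =
      \<pi> X (Node (k p) (map (\<lambda>c. Node (k q) (map (\<lambda>d. Leaf (f c d)) [0..<l])) [0..<m]))"
  proof -
    have "map (\<lambda>c. corolla U (Bs ! c) (k (qs ! c))) [0..<length Bs] =
        map (\<lambda>c. Node (k q) (map (\<lambda>d. Leaf (f c d)) [0..<l])) [0..<m]"
      by (rule nth_equalityI) (use Bs cm(3) in auto)
    then show ?thesis using corolla_comp[OF op Bs(2) pv lq qv] by simp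
  qed
  ultimately show ?thesis by (intro bexI[of _ ?a]) auto
qed

text \<open>For two directions of the same factor the interchange is inherited from
  \<open>P\<close>: both trees contract to corollas, and letters of different directions commute, so
  the labels of these corollas have equal addresses and coincide.\<close>

lemma side_interchange:
  assumes i: "i < length Fs" "m > 0" "g \<in> vals (Fs ! i) {..<m}"
    and j: "j < length Fs" "l > 0" "h \<in> vals (Fs ! j) {..<l}" and ij: "i \<noteq> j"
  shows "\<pi> {..<m * l} (Node (k (\<gamma> i m g))
          (map (\<lambda>p. Node (k (\<gamma> j l h)) (map (\<lambda>q. Leaf (p * l + q)) [0..<l])) [0..<m])) =
       \<pi> {..<m * l} (Node (k (\<gamma> j l h))
          (map (\<lambda>q. Node (k (\<gamma> i m g)) (map (\<lambda>p. Leaf (p * l + q)) [0..<m])) [0..<l]))"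
proof -
  let ?g = "\<gamma> i m g" and ?h = "\<gamma> j l h"
  note gv = gen_vals[OF i] and hv = gen_vals[OF j]
  have inj: "p = p' \<and> q = q'" if "p * l + q = p' * l + q'" "q < l" "q' < l" for p q p' q'
    by (rule grid_inj[OF that])
  have lt: "p * l + q < m * l" if "p < m" "q < l" for p q by (rule grid_less[OF that])
  have ex: "\<exists>p<m. \<exists>q<l. x = p * l + q" if "x < m * l" for x
    using that j(2) by (intro exI[of _ "x div l"] exI[of _ "x mod l"] conjI)
      (auto simp: less_mult_imp_div_less)
  have c1: "{..<m * l} = (\<Union>p<m. (\<lambda>q. p * l + q) ` {..<l})"
    using lt ex by (force simp: image_iff)
  have c2: "{..<m * l} = (\<Union>q<l. (\<lambda>p. p * l + q) ` {..<m})"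
    using lt ex by (force simp: image_iff)
  have d1: "disjoint_family_on (\<lambda>p. (\<lambda>q. p * l + q) ` {..<l}) {..<m}"
    unfolding disjoint_family_on_def using inj by blast
  have d2: "disjoint_family_on (\<lambda>q. (\<lambda>p. p * l + q) ` {..<m}) {..<l}"
    unfolding disjoint_family_on_def using inj by blast
  obtain a where a: "a \<in> vals P {..<m * l}"
    "\<And>c d. c < m \<Longrightarrow> d < l \<Longrightarrow> e a (c * l + d) = cat (e ?g c) (e ?h d)"
    "\<pi> {..<m * l} (Node (k ?g) (map (\<lambda>c. Node (k ?h) (map (\<lambda>d. Leaf (c * l + d)) [0..<l])) [0..<m])) =
    \<pi> {..<m * l} (corolla U {..<m * l} (k a))"
    using nested_corolla[OF gv hv _ d1 c1] by (auto simp: strict_mono_on_def)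
  obtain b where b: "b \<in> vals P {..<m * l}"
    "\<And>c d. c < l \<Longrightarrow> d < m \<Longrightarrow> e b (d * l + c) = cat (e ?h c) (e ?g d)"
    "\<pi> {..<m * l} (Node (k ?h) (map (\<lambda>c. Node (k ?g) (map (\<lambda>d. Leaf (d * l + c)) [0..<m])) [0..<l])) =
    \<pi> {..<m * l} (corolla U {..<m * l} (k b))"
    using nested_corolla[OF hv gv _ d2 c2] j(2) by (auto simp: strict_mono_on_def)
  have "a = b"
  proof (rule faithful[OF a(1) b(1)])
    fix x assume "x \<in> {..<m * l}"
    then obtain c d where cd: "c < m" "d < l" "x = c * l + d" using ex[of x] by auto
    have "cat (e ?g c) (e ?h d) = cat (e ?h d) (e ?g c)"
      using ij cd gen_addr[OF i, of c] gen_addr[OF j, of d] by (auto simp: cat_def gen_addr_def)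
    then show "e a x = e b x" using a(2) b(2) cd by simp
  qed
  then show ?thesis using a(3) b(3) by simp
qed

end

definition shift :: "nat \<Rightarrow> 'b addr \<Rightarrow> 'b addr" where
  "shift m u = (\<lambda>i. if i < m then [] else u (i - m))"

lemma shift_cat: "shift m (cat u w) = cat (shift m u) (shift m w)"
  and shift_nil: "shift m nil_addr = nil_addr"
  by (auto simp: shift_def cat_def nil_addr_def)

locale bv_step = P: models P Fs eP \<gamma>P + Q: models Q Gs eQ \<gamma>Q
  for P :: "'a expr operad" and Fs :: "'a collection list"
    and eP :: "'a expr \<Rightarrow> nat \<Rightarrow> 'a letter addr" and \<gamma>P
    and Q :: "'a expr operad" and Gs :: "'a collection list"
    and eQ :: "'a expr \<Rightarrow> nat \<Rightarrow> 'a letter addr" and \<gamma>Q +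
  assumes good_all: "\<And>F. F \<in> set Fs \<union> set Gs \<Longrightarrow> good_coll F"
begin

abbreviation "U \<equiv> disj_union P Q"
abbreviation "T \<equiv> tree_operad U"
abbreviation "T1 \<equiv> free_operad U"
abbreviation "C \<equiv> coproduct P Q"
abbreviation "W \<equiv> bv_tensor P Q"
abbreviation "m \<equiv> length Fs"

definition val :: "nat \<Rightarrow> 'a expr \<Rightarrow> nat \<Rightarrow> 'a letter addr" where
  "val n u c = (case u of InL p \<Rightarrow> eP p c | InR q \<Rightarrow> shift m (eQ q c) | _ \<Rightarrow> nil_addr)"

definition lab :: "nat \<Rightarrow> nat \<Rightarrow> 'a \<Rightarrow> 'a expr" where
  "lab i n g = (if i < m then InL (\<gamma>P i n g) else InR (\<gamma>Q (i - m) n g))"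

text \<open>The three successive quotients: by equivariance, by the relations making both inclusions
  maps of operads, and by interchange. \<open>\<pi>2\<close> goes from trees to the coproduct,
  \<open>\<pi>'\<close> from the free operad to the tensor product, and \<open>\<pi>\<close> all the
  way.\<close>

definition "rep1 = rep T (equivariance U)"
definition "rep2 = rep T1 (coproduct_rels P Q)"
definition "rep3 = rep C (interchange P Q)"
definition "\<pi>2 X t = rep2 X (rep1 X t)"
definition "\<pi>' X t = rep3 X (rep2 X t)"
definition "\<pi> X t = rep3 X (\<pi>2 X t)"

lemma vals_U: "vals U X = InL ` vals P X \<union> InR ` vals Q X"
  and pull_U: "pull U X f (InL p) = InL (pull P X f p)" "pull U X f (InR q) = InR (pull Q X f q)"
  by (simp_all add: disj_union_def)

lemma side_L: "side P Fs eP \<gamma>P U val InL (\<lambda>u. u)"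
  by unfold_locales (auto simp: vals_U pull_U val_def good_all)

lemma side_R: "side Q Gs eQ \<gamma>Q U val InR (shift m)"
  by unfold_locales (auto simp: vals_U pull_U val_def good_all shift_cat shift_nil)

lemma closed_T1: "closed_operad T1" and closed_C: "closed_operad C" and closed_W: "closed_operad W"
  by (simp_all add: closed_quot closed_tree free_operad_def coproduct_def bv_tensor_def)

lemma rep1: "op_hom T T1 rep1"
  unfolding rep1_def free_operad_def by (rule rep_hom[OF closed_tree])

lemma rep2: "op_hom T1 C rep2"
  unfolding rep2_def coproduct_def by (rule rep_hom[OF closed_T1])

lemma rep3: "op_hom C W rep3"
  unfolding rep3_def bv_tensor_def by (rule rep_hom[OF closed_C])

lemma \<pi>2: "op_hom T C \<pi>2"
  using op_hom_compose[OF rep1 rep2] by (simp add: \<pi>2_def[abs_def])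

lemma \<pi>': "op_hom T1 W \<pi>'"
  using op_hom_compose[OF rep2 rep3] by (simp add: \<pi>'_def[abs_def])

lemma \<pi>_hom: "op_hom T W \<pi>"
  using op_hom_compose[OF \<pi>2 rep3] by (simp add: \<pi>_def[abs_def])

lemma proj_L: "side_proj P Fs eP \<gamma>P U val InL (\<lambda>u. u) W \<pi>'"
proof (intro side_proj.intro side_proj_axioms.intro side_L \<pi>')
  fix X a b
  assume "operad_map_rels P T1 (\<lambda>Y p. generator U Y (InL p)) X a b" "a \<in> vals T1 X" "b \<in> vals T1 X"
  then have "rep2 X a = rep2 X b"
    unfolding rep2_def by (intro rep_eqI ocong.base) (simp_all add: coproduct_rels_def Let_def)
  then show "\<pi>' X a = \<pi>' X b" by (simp add: \<pi>'_def)
qed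

lemma proj_R: "side_proj Q Gs eQ \<gamma>Q U val InR (shift m) W \<pi>'"
proof (intro side_proj.intro side_proj_axioms.intro side_R \<pi>')
  fix X a b
  assume "operad_map_rels Q T1 (\<lambda>Y p. generator U Y (InR p)) X a b" "a \<in> vals T1 X" "b \<in> vals T1 X"
  then have "rep2 X a = rep2 X b"
    unfolding rep2_def by (intro rep_eqI ocong.base) (simp_all add: coproduct_rels_def Let_def)
  then show "\<pi>' X a = \<pi>' X b" by (simp add: \<pi>'_def)
qed

lemma side_proj_\<pi>: "side_proj.\<pi> U \<pi>' = \<pi>"
  using side_proj.\<pi>_def[OF proj_L] by (auto simp: fun_eq_iff \<pi>'_def \<pi>_def \<pi>2_def rep1_def)

lemma pull_P:
  assumes "n > 0" "p \<in> vals P {..<n}" "\<sigma> permutes {..<n}"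
  shows "pull P {..<n} \<sigma> p \<in> vals P {..<n}" "c < n \<Longrightarrow> eP (pull P {..<n} \<sigma> p) c = eP p (\<sigma> c)"
  using closed_operadD(2)[OF P.closed, of "{..<n}" \<sigma> p] addr_homD(1)[OF P.addr, of "{..<n}" \<sigma> p c] assms
  by (simp_all add: permutes_image permutes_inj_on)

lemma pull_Q:
  assumes "n > 0" "p \<in> vals Q {..<n}" "\<sigma> permutes {..<n}"
  shows "pull Q {..<n} \<sigma> p \<in> vals Q {..<n}" "c < n \<Longrightarrow> eQ (pull Q {..<n} \<sigma> p) c = eQ p (\<sigma> c)"
  using closed_operadD(2)[OF Q.closed, of "{..<n}" \<sigma> p] addr_homD(1)[OF Q.addr, of "{..<n}" \<sigma> p c] assms
  by (simp_all add: permutes_image permutes_inj_on)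

lemma R1_addr:
  assumes "equivariance U X a b" "x \<in> X"
  shows "tev val a x = tev val b x"
  by (rule equivariance_addr[OF _ assms])
    (auto simp: vals_U pull_U val_def pull_P pull_Q)

lemma T1_addr: "addr_hom T1 (tev val)"
  unfolding free_operad_def by (rule quot_addr[OF closed_tree tree_addr R1_addr])

lemma rep1_addr: "t \<in> vals T X \<Longrightarrow> x \<in> X \<Longrightarrow> tev val (rep1 X t) x = tev val t x"
  unfolding rep1_def by (rule rep_addr[OF closed_tree tree_addr R1_addr])

lemma R2_addr:
  assumes "coproduct_rels P Q X a b" "x \<in> X"
  shows "tev val a x = tev val b x"
proof -
  have "operad_map_rels P T1 (\<lambda>Y p. generator U Y (InL p)) X a b \<or>
      operad_map_rels Q T1 (\<lambda>Y p. generator U Y (InR p)) X a b"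
    using assms(1) by (simp add: coproduct_rels_def Let_def)
  then show ?thesis
    using side.rels_addr[OF side_L T1_addr rep1_addr[unfolded rep1_def] _ assms(2)]
      side.rels_addr[OF side_R T1_addr rep1_addr[unfolded rep1_def] _ assms(2)] by blast
qed

lemma C_addr: "addr_hom C (tev val)"
  unfolding coproduct_def by (rule quot_addr[OF closed_T1 T1_addr R2_addr])

lemma \<pi>2_addr: "t \<in> vals T X \<Longrightarrow> x \<in> X \<Longrightarrow> tev val (\<pi>2 X t) x = tev val t x"
  unfolding \<pi>2_def rep2_def
  by (subst rep_addr[OF closed_T1 T1_addr R2_addr op_homD(1)[OF rep1]]) (simp_all add: rep1_addr)

section \<open>The interchange relation on trees\<close>

definition matrix :: "nat \<Rightarrow> nat \<Rightarrow> 'a expr \<Rightarrow> 'a expr \<Rightarrow> (nat \<Rightarrow> nat \<Rightarrow> nat) \<Rightarrow> 'a expr" where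
  "matrix k l u v f = Node u (map (\<lambda>p. Node v (map (\<lambda>q. Leaf (f p q)) [0..<l])) [0..<k])"

lemma matrix_vals:
  assumes "u \<in> vals U {..<k}" "v \<in> vals U {..<l}" "k > 0" "l > 0"
  shows "matrix k l u v (\<lambda>p q. p * l + q) \<in> vals T {..<k * l}"
    "matrix l k v u (\<lambda>q p. p * l + q) \<in> vals T {..<k * l}"
proof -
  have c: "{..<k * l} = (\<Union>p<k. \<Union>q<l. {p * l + q})"
  proof (intro equalityI subsetI)
    fix x assume "x \<in> {..<k * l}"
    then obtain p q where "p < k" "q < l" "x = p * l + q" by (auto elim: grid_ex)
    then show "x \<in> (\<Union>p<k. \<Union>q<l. {p * l + q})" by blast
  qed (auto simp: grid_less)
  then have c': "{..<k * l} = (\<Union>q<l. \<Union>p<k. {p * l + q})" by (subst SUP_commute)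
  have dj: "{p * l + q} \<inter> {p' * l + q'} = {}" if "q < l" "q' < l" "p \<noteq> p' \<or> q \<noteq> q'" for p q p' q'
    using grid_inj[of p l q p' q'] that by (cases "p * l + q = p' * l + q'") auto
  have "disjoint_family_on (\<lambda>(p, q). {p * l + q}) ({..<k} \<times> {..<l})"
    "disjoint_family_on (\<lambda>(q, p). {p * l + q}) ({..<l} \<times> {..<k})"
    by (rule disjoint_family_on_times, rule dj, auto)+
  then show "matrix k l u v (\<lambda>p q. p * l + q) \<in> vals T {..<k * l}"
    "matrix l k v u (\<lambda>q p. p * l + q) \<in> vals T {..<k * l}"
    unfolding matrix_def
    by (auto intro!: grid_vals[OF assms _ _ c] grid_vals[OF assms(2,1,4,3) _ _ c'] simp del: subst.simps)
qed

lemma matrix_addr: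
  assumes "matrix k l u v f \<in> vals T X" "p < k" "q < l"
  shows "tev val (matrix k l u v f) (f p q) = cat (val k u p) (val l v q)"
proof -
  let ?ts = "map (\<lambda>p. Node v (map (\<lambda>q. Leaf (f p q)) [0..<l])) [0..<k]"
  have t: "Node u ?ts \<in> vals T X" using assms(1) by (simp add: matrix_def)
  have "?ts ! p \<in> vals T (set (leaves (?ts ! p)))" using Node_valsD(3)[OF t] assms(2) by simp
  then have v: "Node v (map (\<lambda>q. Leaf (f p q)) [0..<l]) \<in> vals T (set (leaves (?ts ! p)))"
    using assms(2) by simp
  have "tev val (matrix k l u v f) (f p q) = cat (val k u p) (tev val (?ts ! p) (f p q))"
  proof -
    have "f p q \<in> set (leaves (?ts ! p))" using assms(2,3) by auto
    then show ?thesis unfolding matrix_def using tev_Node[OF t, of p "f p q" val] assms(2) by simp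
  qed
  also have "tev val (?ts ! p) (f p q) = cat (val l v q) nil_addr"
    using tev_Node[OF v, of q "f p q" val] assms(2,3) by simp
  finally show ?thesis by simp
qed

text \<open>The blocks of \<open>diag_comp\<close> are intervals of length \<open>l\<close>, so
  input \<open>q\<close> of copy \<open>p\<close> is numbered \<open>p * l + q\<close>. As
  \<open>\<pi>2\<close> is a map of operads, the composite can be formed on trees.\<close>

lemma diag_comp_C:
  assumes uv: "u \<in> vals U {..<k}" "v \<in> vals U {..<l}" and kl: "k > 0" "l > 0"
  shows "diag_comp C k l (\<pi>2 {..<k} (Node u (map Leaf [0..<k]))) (\<pi>2 {..<l} (Node v (map Leaf [0..<l]))) =
    \<pi>2 {..<k * l} (matrix k l u v (\<lambda>p q. p * l + q))"
proof -
  let ?B = "\<lambda>i. {i * l..<(i + 1) * l}" and ?f = "\<lambda>i m. m - i * l"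
  define Bs where "Bs = map ?B [0..<k]"
  let ?v = "Node v (map Leaf [0..<l])" and ?u = "Node u (map Leaf [0..<k])"
  define qs where "qs = map (\<lambda>i. pull T (?B i) (?f i) ?v) [0..<k]"
  have Bs: "length Bs = k" "\<And>i. i < k \<Longrightarrow> Bs ! i = ?B i" "Bs \<noteq> []" "length qs = length Bs"
    using kl by (auto simp: Bs_def qs_def)
  have img: "?f i ` ?B i = {..<l}" for i
  proof (intro equalityI subsetI)
    fix q assume "q \<in> {..<l}" then show "q \<in> ?f i ` ?B i" by (intro image_eqI[of _ _ "i * l + q"]) auto
  qed auto
  have inj: "inj_on (?f i) (?B i)" for i by (auto simp: inj_on_def)
  have B: "fin_ne (?B i)" for i using kl by (simp add: fin_ne_def)
  have iv: "inv_into (?B i) (?f i) q = i * l + q" if "q < l" for i q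
    by (rule inv_into_f_eq[OF inj]) (use that in auto)
  have mem: "x \<in> ?B i \<longleftrightarrow> (\<exists>q<l. x = i * l + q)" for x i
    by (auto intro: exI[of _ "x - i * l"])
  have op: "ordered_partition Bs {..<k * l}"
  proof (rule ordered_partitionI)
    show "(\<Union>i<length Bs. Bs ! i) = {..<k * l}"
    proof (intro equalityI subsetI)
      fix x assume "x \<in> (\<Union>i<length Bs. Bs ! i)"
      then obtain i where "i < k" "x \<in> ?B i" using Bs by auto
      then show "x \<in> {..<k * l}" unfolding mem using grid_less by auto
    next
      fix x assume "x \<in> {..<k * l}"
      then obtain p q where "p < k" "q < l" "x = p * l + q" by (auto elim: grid_ex)
      then show "x \<in> (\<Union>i<length Bs. Bs ! i)" using Bs mem[of x p] by (intro UN_I[of p]) auto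
    qed
    show "Bs ! i \<noteq> {}" if "i < length Bs" for i using that Bs B[of i] by (simp add: fin_ne_def)
    show "Bs ! i \<inter> Bs ! j = {}" if "i < length Bs" "j < length Bs" "i \<noteq> j" for i j
    proof -
      have False if "x \<in> ?B i" "x \<in> ?B j" for x
        using that grid_inj[of i l _ j] \<open>i \<noteq> j\<close> unfolding mem by blast
      then have "?B i \<inter> ?B j = {}" by blast
      then show ?thesis using that Bs(1,2) by simp
    qed
  qed simp
  have cu: "?u \<in> vals T {..<length Bs}" and cv: "?v \<in> vals T {..<l}"
    using corolla_vals uv kl Bs(1) by blast+
  have qv: "qs ! i \<in> vals T (Bs ! i)" if "i < length Bs" for i
  proof -
    have "pull T (?B i) (?f i) ?v \<in> vals T (?B i)"
      by (rule closed_operadD(2)[OF closed_tree B inj]) (use cv img[of i] in simp)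
    then show ?thesis using that Bs by (simp add: qs_def)
  qed
  have q1: "map2 \<pi>2 Bs qs = map (\<lambda>i. pull C (?B i) (?f i) (\<pi>2 {..<l} ?v)) [0..<k]"
  proof (rule nth_equalityI)
    fix i assume "i < length (map2 \<pi>2 Bs qs)"
    then have i: "i < k" using Bs by simp
    have "\<pi>2 (?B i) (pull T (?B i) (?f i) ?v) = pull C (?B i) (?f i) (\<pi>2 (?f i ` ?B i) ?v)"
      by (rule op_homD(2)[OF \<pi>2 B inj]) (use cv img[of i] in simp)
    then show "map2 \<pi>2 Bs qs ! i = map (\<lambda>i. pull C (?B i) (?f i) (\<pi>2 {..<l} ?v)) [0..<k] ! i"
      using i Bs img[of i] by (simp add: qs_def)
  qed (use Bs in simp)
  have "diag_comp C k l (\<pi>2 {..<k} ?u) (\<pi>2 {..<l} ?v) = ocomp C (\<pi>2 {..<k} ?u) Bs (map2 \<pi>2 Bs qs)"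
    by (simp only: q1 diag_comp_def, simp only: Bs_def)
  also have "\<dots> = \<pi>2 {..<k * l} (ocomp T ?u Bs qs)"
    using op_homD(4)[OF \<pi>2 op Bs(3) cu Bs(4) qv] unfolding Bs(1) by (rule HOL.sym)
  also have "ocomp T ?u Bs qs = matrix k l u v (\<lambda>p q. p * l + q)"
    unfolding tree_comp matrix_def by (simp add: qs_def tree_pull iv[simplified])
  finally show ?thesis .
qed

text \<open>The permutation sends \<open>p * l + q\<close> to \<open>q * k + p\<close>, so pulling
  back renames leaf \<open>q * k + p\<close> to \<open>p * l + q\<close>: the transposed matrix
  takes over the numbering of the original one.\<close>

lemma pull_diag:
  assumes uv: "u \<in> vals U {..<k}" "v \<in> vals U {..<l}" and kl: "k > 0" "l > 0"
  shows "pull C {..<k * l} (\<lambda>m. (m mod l) * k + m div l)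
      (\<pi>2 {..<l * k} (matrix l k v u (\<lambda>q p. q * k + p))) =
    \<pi>2 {..<k * l} (matrix l k v u (\<lambda>q p. p * l + q))"
proof -
  let ?s = "\<lambda>m. (m mod l) * k + m div l"
  have s: "?s (p * l + q) = q * k + p" if "q < l" for p q using that by simp
  have img: "?s ` {..<k * l} = {..<l * k}"
  proof (intro equalityI subsetI)
    fix x assume "x \<in> ?s ` {..<k * l}"
    then obtain y where y: "y < k * l" "x = ?s y" by auto
    obtain p q where pq: "p < k" "q < l" "y = p * l + q" using grid_ex[OF y(1)] .
    have "x = q * k + p" unfolding y(2) pq(3) by (rule s[OF pq(2)])
    then show "x \<in> {..<l * k}" using grid_less[OF pq(2,1)] by simp
  next
    fix x assume "x \<in> {..<l * k}"
    then obtain q p where pq: "q < l" "p < k" "x = q * k + p" by (auto elim: grid_ex)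
    show "x \<in> ?s ` {..<k * l}"
      using s[OF pq(1), of p] pq(3) grid_less[OF pq(2,1)]
      by (metis (no_types, lifting) imageI lessThan_iff)
  qed
  have inj: "inj_on ?s {..<k * l}"
  proof (rule inj_onI)
    fix x y assume a: "x \<in> {..<k * l}" "y \<in> {..<k * l}" "?s x = ?s y"
    obtain p q where pq: "p < k" "q < l" "x = p * l + q" using a(1) by (auto elim: grid_ex)
    obtain p' q' where pq': "p' < k" "q' < l" "y = p' * l + q'" using a(2) by (auto elim: grid_ex)
    have "q * k + p = q' * k + p'" using a(3) s[OF pq(2), of p] s[OF pq'(2), of p'] pq(3) pq'(3) by simp
    then show "x = y" using grid_inj[of q k p q' p'] pq pq' by simp
  qed
  have iv: "inv_into {..<k * l} ?s (q * k + p) = p * l + q" if "p < k" "q < l" for p q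
    by (rule inv_into_f_eq[OF inj]) (use that s grid_less in auto)
  have X: "fin_ne {..<k * l}" using kl by simp
  have D: "matrix l k v u (\<lambda>q p. q * k + p) \<in> vals T {..<l * k}"
    by (rule matrix_vals(1)[OF uv(2,1) kl(2,1)])
  have "pull T {..<k * l} ?s (matrix l k v u (\<lambda>q p. q * k + p)) = matrix l k v u (\<lambda>q p. p * l + q)"
    unfolding tree_pull matrix_def by (simp add: iv)
  then show ?thesis using op_homD(2)[OF \<pi>2 X inj, unfolded img, OF D] by simp
qed

text \<open>With the transposition absorbed, both sides number their leaves alike, which is the form
  required by \<open>presentation\<close>.\<close>

lemma interchange_iff:
  "interchange P Q X a b \<longleftrightarrow> (\<exists>k l p q. k \<ge> 1 \<and> l \<ge> 1 \<and> p \<in> vals P {..<k} \<and> q \<in> vals Q {..<l} \<and>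
     X = {..<k * l} \<and> a = \<pi>2 X (matrix k l (InL p) (InR q) (\<lambda>p q. p * l + q)) \<and>
     b = \<pi>2 X (matrix l k (InR q) (InL p) (\<lambda>q p. p * l + q)))"
proof -
  have L: "inl_map P Q {..<k} p = \<pi>2 {..<k} (Node (InL p) (map Leaf [0..<k]))" if "p \<in> vals P {..<k}" for k p
    using side.corolla_lessThan[OF side_L that]
    by (simp add: inl_map_def coproj_def generator_eq \<pi>2_def rep1_def rep2_def)
  have R: "inr_map P Q {..<k} p = \<pi>2 {..<k} (Node (InR p) (map Leaf [0..<k]))" if "p \<in> vals Q {..<k}" for k p
    using side.corolla_lessThan[OF side_R that]
    by (simp add: inr_map_def coproj_def generator_eq \<pi>2_def rep1_def rep2_def)
  have *: "diag_comp C k l (inl_map P Q {..<k} p) (inr_map P Q {..<l} q) =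
      \<pi>2 {..<k * l} (matrix k l (InL p) (InR q) (\<lambda>p q. p * l + q))"
    "pull C {..<k * l} (\<lambda>m. (m mod l) * k + m div l)
      (diag_comp C l k (inr_map P Q {..<l} q) (inl_map P Q {..<k} p)) =
      \<pi>2 {..<k * l} (matrix l k (InR q) (InL p) (\<lambda>q p. p * l + q))"
    if "k \<ge> 1" "l \<ge> 1" "p \<in> vals P {..<k}" "q \<in> vals Q {..<l}" for k l p q
    using diag_comp_C[of "InL p" k "InR q" l] diag_comp_C[of "InR q" l "InL p" k]
      pull_diag[of "InL p" k "InR q" l] that L[OF that(3)] R[OF that(4)] by (simp_all add: vals_U)
  show ?thesis
    unfolding interchange_def Let_def using * by (intro iff_exI) (metis (no_types, lifting))
qed

lemma R3_addr:
  assumes "interchange P Q X a b" "x \<in> X"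
  shows "tev val a x = tev val b x"
proof -
  obtain k l p q where k: "k \<ge> 1" "l \<ge> 1" "p \<in> vals P {..<k}" "q \<in> vals Q {..<l}"
     "X = {..<k * l}" "a = \<pi>2 X (matrix k l (InL p) (InR q) (\<lambda>p q. p * l + q))"
     "b = \<pi>2 X (matrix l k (InR q) (InL p) (\<lambda>q p. p * l + q))"
    using assms(1) unfolding interchange_iff by blast
  have "x < k * l" using assms(2) k(5) by simp
  then obtain c d where cd: "c < k" "d < l" "x = c * l + d" by (rule grid_ex)
  have M: "matrix k l (InL p) (InR q) (\<lambda>p q. p * l + q) \<in> vals T {..<k * l}"
    "matrix l k (InR q) (InL p) (\<lambda>q p. p * l + q) \<in> vals T {..<k * l}"
    using matrix_vals[of "InL p" k "InR q" l] k by (auto simp: vals_U)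
  \<comment> \<open>\<open>P\<close> uses only directions below \<open>m\<close>, and the shifted
    addresses of \<open>Q\<close> only those from \<open>m\<close> on, so the two addresses
    commute.\<close>
  have "cat (eP p c) (shift m (eQ q d)) = cat (shift m (eQ q d)) (eP p c)"
    using P.bounded[OF k(3), of c] cd by (auto simp: cat_def shift_def fun_eq_iff)
  then show ?thesis
    using \<pi>2_addr[OF M(1), of x] \<pi>2_addr[OF M(2), of x] matrix_addr[OF M(1) cd(1,2)]
      matrix_addr[OF M(2) cd(2,1)] assms(2) k(5-7) cd(3)
    by (simp add: val_def)
qed

lemma W_addr: "addr_hom W (tev val)"
  unfolding bv_tensor_def by (rule quot_addr[OF closed_C C_addr R3_addr])

lemma \<pi>_addr: "t \<in> vals T X \<Longrightarrow> x \<in> X \<Longrightarrow> tev val (\<pi> X t) x = tev val t x"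
  unfolding \<pi>_def rep3_def
  by (subst rep_addr[OF closed_C C_addr R3_addr op_homD(1)[OF \<pi>2]]) (simp_all add: \<pi>2_addr)

lemma vals_W: "vals W X = {t \<in> vals T X. \<pi> X t = t}"
proof -
  have 1: "vals T1 X = {t \<in> vals T X. rep1 X t = t}"
    unfolding rep1_def free_operad_def by (rule vals_quot[OF closed_tree])
  have 2: "vals C X = {t \<in> vals T1 X. rep2 X t = t}"
    unfolding rep2_def coproduct_def by (rule vals_quot[OF closed_T1])
  have 3: "vals W X = {t \<in> vals C X. rep3 X t = t}"
    unfolding rep3_def bv_tensor_def by (rule vals_quot[OF closed_C])
  have "\<pi> X t \<in> vals W X" if "t \<in> vals T X" for t
    by (rule op_homD(1)[OF \<pi>_hom that])
  then have "t \<in> vals W X" if "t \<in> vals T X" "\<pi> X t = t" for t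
    using that by metis
  moreover have "t \<in> vals T X \<and> \<pi> X t = t" if "t \<in> vals W X" for t
    using that unfolding 3 2 1 by (simp add: \<pi>_def \<pi>2_def)
  ultimately show ?thesis by blast
qed

text \<open>The induction serves the roots labelled by a unit: such a vertex has a single child and
  disappears, and the question passes to that child.\<close>

lemma tree_root:
  "t \<in> vals T X \<Longrightarrow> (\<exists>x. X = {x} \<and> \<pi> X t = \<pi> X (Leaf x)) \<or>
       (\<exists>i n g ts. i < length (Fs @ Gs) \<and> n > 0 \<and> length ts = n \<and> g \<in> vals ((Fs @ Gs) ! i) {..<n} \<and>
          Node (lab i n g) ts \<in> vals T X \<and> \<pi> X t = \<pi> X (Node (lab i n g) ts))"
proof -
  assume t: "t \<in> vals T X"
  then have "is_tree U t" by (simp add: tree_vals)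
  then show ?thesis using t
  proof (induction arbitrary: X rule: is_tree.induct)
    case (2 ts u)
    note n = Node_valsD[OF 2(5)]
    have unit: ?case if "length ts = 1" "\<pi> X (Node u ts) = \<pi> X (ts ! 0)"
    proof -
      have "ts ! 0 \<in> vals T X" using n(3)[of 0] n(5) that(1) by (simp add: lessThan_Suc)
      then show ?thesis using 2(4)[of "ts ! 0" X] that by simp
    qed
    have "u \<in> InL ` vals P {..<length ts} \<union> InR ` vals Q {..<length ts}" using n(2) by (simp add: vals_U)
    then show ?case
    proof (elim UnE imageE)
      fix p assume p: "u = InL p" "p \<in> vals P {..<length ts}"
      show ?thesis
        using side_proj.side_root[OF proj_L 2(5)[unfolded p(1)] p(2)] unfolding side_proj_\<pi>
      proof (elim disjE exE conjE)
        fix i n g us assume "i < m" "0 < n" "length us = n" "g \<in> vals (Fs ! i) {..<n}"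
          "Node (InL (\<gamma>P i n g)) us \<in> vals T X" "\<pi> X (Node (InL p) ts) = \<pi> X (Node (InL (\<gamma>P i n g)) us)"
        then show ?thesis using p(1)
          by (intro disjI2 exI[of _ i] exI[of _ n] exI[of _ g] exI[of _ us]) (simp add: lab_def nth_append)
      qed (rule unit, simp_all add: p)
    next
      fix p assume p: "u = InR p" "p \<in> vals Q {..<length ts}"
      show ?thesis
        using side_proj.side_root[OF proj_R 2(5)[unfolded p(1)] p(2)] unfolding side_proj_\<pi>
      proof (elim disjE exE conjE)
        fix i n g us assume "i < length Gs" "0 < n" "length us = n" "g \<in> vals (Gs ! i) {..<n}"
          "Node (InR (\<gamma>Q i n g)) us \<in> vals T X" "\<pi> X (Node (InR p) ts) = \<pi> X (Node (InR (\<gamma>Q i n g)) us)"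
        then show ?thesis using p(1)
          by (intro disjI2 exI[of _ "m + i"] exI[of _ n] exI[of _ g] exI[of _ us])
            (simp add: lab_def nth_append)
      qed (rule unit, simp_all add: p)
    qed
  qed auto
qed

lemma shift_gen_addr:
  "m \<le> i \<Longrightarrow> shift m (gen_addr Gs n g (i - m) c) = gen_addr (Fs @ Gs) n g i c"
  by (auto simp: shift_def gen_addr_def nth_append fun_eq_iff)

lemma presentation: "presentation U (Fs @ Gs) val lab W \<pi>"
proof
  show "F \<in> set (Fs @ Gs) \<Longrightarrow> good_coll F" for F using good_all by simp
  show "closed_operad W" "addr_hom W (tev val)" by (rule closed_W W_addr)+
  show "vals W X = {t \<in> vals T X. \<pi> X t = t}" for X by (rule vals_W)
  show "op_hom T W \<pi>" by (rule \<pi>_hom)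
  show "t \<in> vals T X \<Longrightarrow> x \<in> X \<Longrightarrow> tev val (\<pi> X t) x = tev val t x" for t X x by (rule \<pi>_addr)
next
  fix u n c i assume "u \<in> vals U {..<n}" "c < n" "length (Fs @ Gs) \<le> i"
  then show "val n u c i = []"
    using P.bounded[of _ "{..<n}" c i] Q.bounded[of _ "{..<n}" c "i - m"]
    by (auto simp: vals_U val_def shift_def)
next
  fix i n g assume i: "i < length (Fs @ Gs)" "n > 0" "g \<in> vals ((Fs @ Gs) ! i) {..<n}"
  show "lab i n g \<in> vals U {..<n}"
    using i P.gen_vals[of i n g] Q.gen_vals[of "i - m" n g]
    by (auto simp: lab_def vals_U nth_append split: if_splits)
  fix c assume c: "c < n"
  show "val n (lab i n g) c = gen_addr (Fs @ Gs) n g i c"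
  proof (cases "i < m")
    case True
    then show ?thesis using i c P.gen_addr[of i n g c]
      by (auto simp: lab_def val_def nth_append gen_addr_def fun_eq_iff)
  next
    case False
    then show ?thesis using i c Q.gen_addr[of "i - m" n g c] shift_gen_addr[of i n g c]
      by (simp add: lab_def val_def nth_append)
  qed
next
  fix t X assume "t \<in> vals T X"
  then show "(\<exists>x. X = {x} \<and> \<pi> X t = \<pi> X (Leaf x)) \<or>
       (\<exists>i n g ts. i < length (Fs @ Gs) \<and> n > 0 \<and> length ts = n \<and> g \<in> vals ((Fs @ Gs) ! i) {..<n} \<and>
          Node (lab i n g) ts \<in> vals T X \<and> \<pi> X t = \<pi> X (Node (lab i n g) ts))"
    by (rule tree_root)
next
  fix i n g \<sigma>
  assume i: "i < length (Fs @ Gs)" "n > 0" "g \<in> vals ((Fs @ Gs) ! i) {..<n}" and \<sigma>: "\<sigma> permutes {..<n}"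
  let ?F = "(Fs @ Gs) ! i"
  have good: "good_coll ?F" using good_all nth_mem[OF i(1)] by simp
  have g': "pull ?F {..<n} \<sigma> g \<in> vals ?F {..<n}"
    using good pull_bij[OF _ _ permutes_imp_bij[OF \<sigma>] i(3)] i(2) by (simp add: good_coll_def)
  \<comment> \<open>The generators are equivariant as elements of \<open>P\<close> or
    \<open>Q\<close>, which is read off their addresses.\<close>
  have lab: "lab i n (pull ?F {..<n} \<sigma> g) = pull U {..<n} \<sigma> (lab i n g) \<and>
      lab i n g \<in> vals U {..<n} \<and> pull U {..<n} \<sigma> (lab i n g) \<in> vals U {..<n}"
  proof (cases "i < m")
    case True
    then have F: "?F = Fs ! i" by (simp add: nth_append)
    have v: "\<gamma>P i n g \<in> vals P {..<n}" using P.gen_vals[OF True i(2)] i(3) F by simp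
    have "\<gamma>P i n (pull ?F {..<n} \<sigma> g) = pull P {..<n} \<sigma> (\<gamma>P i n g)"
    proof (rule P.faithful)
      show "\<gamma>P i n (pull ?F {..<n} \<sigma> g) \<in> vals P {..<n}" using P.gen_vals[OF True i(2)] g' F by simp
      show "pull P {..<n} \<sigma> (\<gamma>P i n g) \<in> vals P {..<n}" by (rule pull_P(1)[OF i(2) v \<sigma>])
      fix c assume c: "c \<in> {..<n}"
      then have "\<sigma> c < n" using permutes_in_image[OF \<sigma>, of c] by simp
      then show "eP (\<gamma>P i n (pull ?F {..<n} \<sigma> g)) c = eP (pull P {..<n} \<sigma> (\<gamma>P i n g)) c"
        using pull_P(2)[OF i(2) v \<sigma>, of c] c P.gen_addr[OF True i(2)] g' i(3) F
          gen_addr_pull[of Fs i n g \<sigma> c] good i(2) \<sigma> by simp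
    qed
    then show ?thesis using True v pull_P(1)[OF i(2) v \<sigma>] by (simp add: lab_def pull_U vals_U)
  next
    case False
    then have F: "?F = Gs ! (i - m)" and im: "i - m < length Gs" using i(1) by (auto simp: nth_append)
    have v: "\<gamma>Q (i - m) n g \<in> vals Q {..<n}" using Q.gen_vals[OF im i(2)] i(3) F by simp
    have "\<gamma>Q (i - m) n (pull ?F {..<n} \<sigma> g) = pull Q {..<n} \<sigma> (\<gamma>Q (i - m) n g)"
    proof (rule Q.faithful)
      show "\<gamma>Q (i - m) n (pull ?F {..<n} \<sigma> g) \<in> vals Q {..<n}" using Q.gen_vals[OF im i(2)] g' F by simp
      show "pull Q {..<n} \<sigma> (\<gamma>Q (i - m) n g) \<in> vals Q {..<n}" by (rule pull_Q(1)[OF i(2) v \<sigma>])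
      fix c assume c: "c \<in> {..<n}"
      then have "\<sigma> c < n" using permutes_in_image[OF \<sigma>, of c] by simp
      then show "eQ (\<gamma>Q (i - m) n (pull ?F {..<n} \<sigma> g)) c = eQ (pull Q {..<n} \<sigma> (\<gamma>Q (i - m) n g)) c"
        using pull_Q(2)[OF i(2) v \<sigma>, of c] c Q.gen_addr[OF im i(2)] g' i(3) F
          gen_addr_pull[of Gs "i - m" n g \<sigma> c] good i(2) \<sigma> by simp
    qed
    then show ?thesis using False v pull_Q(1)[OF i(2) v \<sigma>] by (simp add: lab_def pull_U vals_U)
  qed
  then show "\<pi> {..<n} (Node (lab i n (pull ?F {..<n} \<sigma> g)) (map Leaf [0..<n])) =
       \<pi> {..<n} (Node (lab i n g) (map (\<lambda>c. Leaf (inv \<sigma> c)) [0..<n]))"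
    using equivariance_rep[OF i(2), of "lab i n g" U \<sigma>] \<sigma> by (simp add: \<pi>_def \<pi>2_def rep1_def)
next
  fix i j k l g h
  assume ij: "i < j" "j < length (Fs @ Gs)" "k > 0" "l > 0"
    "g \<in> vals ((Fs @ Gs) ! i) {..<k}" "h \<in> vals ((Fs @ Gs) ! j) {..<l}"
  let ?goal = "\<pi> {..<k * l} (Node (lab i k g)
          (map (\<lambda>p. Node (lab j l h) (map (\<lambda>q. Leaf (p * l + q)) [0..<l])) [0..<k])) =
       \<pi> {..<k * l} (Node (lab j l h)
          (map (\<lambda>q. Node (lab i k g) (map (\<lambda>p. Leaf (p * l + q)) [0..<k])) [0..<l]))"
  \<comment> \<open>Two directions on one side interchange already in \<open>P\<close> or
    \<open>Q\<close>; the mixed case is the defining relation of the tensor product.\<close>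
  consider "j < m" | "m \<le> i" | "i < m" "m \<le> j" by linarith
  then show ?goal
  proof cases
    case 1
    then show ?thesis
      using side_proj.side_interchange[OF proj_L, of i k g j l h] ij unfolding side_proj_\<pi>
      by (simp add: lab_def nth_append)
  next
    case 2
    then show ?thesis
      using side_proj.side_interchange[OF proj_R, of "i - m" k g "j - m" l h] ij unfolding side_proj_\<pi>
      by (simp add: lab_def nth_append)
  next
    case 3
    have v: "\<gamma>P i k g \<in> vals P {..<k}" "\<gamma>Q (j - m) l h \<in> vals Q {..<l}"
      using P.gen_vals[of i k g] Q.gen_vals[of "j - m" l h] ij 3 by (simp_all add: nth_append)
    have M: "matrix k l (InL (\<gamma>P i k g)) (InR (\<gamma>Q (j - m) l h)) (\<lambda>p q. p * l + q) \<in> vals T {..<k * l}"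
      "matrix l k (InR (\<gamma>Q (j - m) l h)) (InL (\<gamma>P i k g)) (\<lambda>q p. p * l + q) \<in> vals T {..<k * l}"
      using matrix_vals[of "InL (\<gamma>P i k g)" k "InR (\<gamma>Q (j - m) l h)" l] v ij(3,4) by (auto simp: vals_U)
    have "\<pi> {..<k * l} (matrix k l (InL (\<gamma>P i k g)) (InR (\<gamma>Q (j - m) l h)) (\<lambda>p q. p * l + q)) =
      \<pi> {..<k * l} (matrix l k (InR (\<gamma>Q (j - m) l h)) (InL (\<gamma>P i k g)) (\<lambda>q p. p * l + q))"
      unfolding \<pi>_def rep3_def
    proof (rule rep_eqI, rule ocong.base)
      show "interchange P Q {..<k * l}
         (\<pi>2 {..<k * l} (matrix k l (InL (\<gamma>P i k g)) (InR (\<gamma>Q (j - m) l h)) (\<lambda>p q. p * l + q)))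
         (\<pi>2 {..<k * l} (matrix l k (InR (\<gamma>Q (j - m) l h)) (InL (\<gamma>P i k g)) (\<lambda>q p. p * l + q)))"
        unfolding interchange_iff using v ij(3,4)
        by (intro exI[of _ k] exI[of _ l] exI[of _ "\<gamma>P i k g"] exI[of _ "\<gamma>Q (j - m) l h"]) auto
    qed (use M op_homD(1)[OF \<pi>2] in auto)
    then show ?thesis using 3 by (simp add: matrix_def lab_def)
  qed
qed

end

lemma bv_tensor_model:
  fixes P Q :: "'a expr operad" and Fs Gs :: "'a collection list"
  assumes "models P Fs eP \<gamma>P" "models Q Gs eQ \<gamma>Q" "\<And>F. F \<in> set Fs \<union> set Gs \<Longrightarrow> good_coll F"
  shows "\<exists>e \<gamma>. models (bv_tensor P Q) (Fs @ Gs) e \<gamma>"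
proof -
  interpret bv_step P Fs eP \<gamma>P Q Gs eQ \<gamma>Q
    using assms by (simp add: bv_step_def bv_step_axioms_def)
  show ?thesis using presentation.model[OF presentation] by blast
qed

text \<open>\<open>foldl\<close> brackets to the left, so the list is taken apart from its right
  end.\<close>

lemma bv_tensor_list_model:
  fixes Xs :: "'a collection list"
  assumes "Xs \<noteq> []" "\<And>F. F \<in> set Xs \<Longrightarrow> good_coll F"
  shows "\<exists>e \<gamma>. models (bv_tensor_list (map abs_free_operad Xs)) Xs e \<gamma>"
  using assms
proof (induction Xs rule: rev_nonempty_induct)
  case (single F)
  then show ?case using abs_free_model[of F] by (simp add: bv_tensor_list_def)
next
  case (snoc F Xs)
  obtain e \<gamma> where "models (bv_tensor_list (map abs_free_operad Xs)) Xs e \<gamma>" using snoc by auto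
  moreover obtain e' \<gamma>' where "models (abs_free_operad F) [F] e' \<gamma>'"
    using abs_free_model[of F] snoc by auto
  moreover have "bv_tensor_list (map abs_free_operad (Xs @ [F])) =
      bv_tensor (bv_tensor_list (map abs_free_operad Xs)) (abs_free_operad F)"
    using snoc(1) by (simp add: bv_tensor_list_def)
  ultimately show ?case using bv_tensor_model[of _ Xs e \<gamma> _ "[F]" e' \<gamma>'] snoc.prems by auto
qed

section \<open>Matrix products\<close>

text \<open>The addresses of the inputs obtained by nesting one generator \<open>g j\<close> for
  each direction \<open>j\<close> of \<open>J\<close>: such a nesting has one input for each choice
  of an input in every direction.\<close>

definition grid ::
  "'a collection list \<Rightarrow> nat set \<Rightarrow> (nat \<Rightarrow> nat) \<Rightarrow> (nat \<Rightarrow> 'a) \<Rightarrow> 'a letter addr set" where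
  "grid Fs J n g = {u. (\<forall>j\<in>J. \<exists>c<n j. u j = [letter (Fs ! j) {..<n j} (g j) c]) \<and>
     (\<forall>j. j \<notin> J \<longrightarrow> u j = [])}"

definition valid_box ::
  "'a collection list \<Rightarrow> nat set \<Rightarrow> (nat \<Rightarrow> nat) \<Rightarrow> (nat \<Rightarrow> 'a) \<Rightarrow> bool" where
  "valid_box Fs J n g \<longleftrightarrow> J \<subseteq> {..<length Fs} \<and> (\<forall>j\<in>J. n j > 0 \<and> g j \<in> vals (Fs ! j) {..<n j})"

lemma grid_empty: "grid Fs {} n g = {nil_addr}"
  by (auto simp: grid_def nil_addr_def)

lemma grid_nonempty:
  assumes "valid_box Fs J n g"
  shows "grid Fs J n g \<noteq> {}"
proof -
  have "(\<lambda>j. if j \<in> J then [letter (Fs ! j) {..<n j} (g j) 0] else []) \<in> grid Fs J n g"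
    using assms by (auto simp: grid_def valid_box_def)
  then show ?thesis by blast
qed

text \<open>The counterpart of \<open>models\<close> for the generators of the resolution: an
  element over \<open>X\<close> amounts to a bijection of \<open>X\<close> with a grid, and its
  degree is the number of directions of the grid.\<close>

locale cell_model =
  fixes V :: "'a cell graded_collection" and Fs :: "'a collection list"
    and ev :: "nat set \<Rightarrow> 'a cell \<Rightarrow> nat \<Rightarrow> 'a letter addr"
  assumes shape: "\<lbrakk>fin_ne X; v \<in> vals V X\<rbrakk> \<Longrightarrow>
      \<exists>J n g. valid_box Fs J n g \<and> bij_betw (ev X v) X (grid Fs J n g) \<and> hdeg V X v = card J"
    and realize: "\<lbrakk>fin_ne X; valid_box Fs J n g; bij_betw w X (grid Fs J n g)\<rbrakk> \<Longrightarrow>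
      \<exists>v\<in>vals V X. \<forall>x\<in>X. ev X v x = w x"
    and faithful: "\<lbrakk>fin_ne X; v \<in> vals V X; v' \<in> vals V X; \<And>x. x \<in> X \<Longrightarrow> ev X v x = ev X v' x\<rbrakk> \<Longrightarrow>
      v = v'"
    and pull_vals: "\<lbrakk>fin_ne X; inj_on f X; v \<in> vals V (f ` X)\<rbrakk> \<Longrightarrow> pull V X f v \<in> vals V X"
    and pull_ev: "\<lbrakk>fin_ne X; inj_on f X; v \<in> vals V (f ` X); x \<in> X\<rbrakk> \<Longrightarrow>
      ev X (pull V X f v) x = ev (f ` X) v (f x)"

lemma unit_plus_model:
  fixes F :: "'a collection"
  assumes F: "good_coll F"
  shows "\<exists>ev. cell_model (unit_plus F) [F] ev"
proof -
  have Fc: "is_collection F" using F by (simp add: good_coll_def)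
  define ev :: "nat set \<Rightarrow> 'a cell \<Rightarrow> nat \<Rightarrow> 'a letter addr" where
    "ev = (\<lambda>X v c. case v of Cell x \<Rightarrow> (\<lambda>j. if j = 0 then [letter F X x c] else []) | _ \<Rightarrow> nil_addr)"
  have ev: "ev X Unit c = nil_addr" "ev X (Cell x) c = (\<lambda>j. if j = 0 then [letter F X x c] else [])"
    for X c x by (simp_all add: ev_def)
  have V: "vals (unit_plus F) X = (if card X = 1 then {Unit} else {}) \<union> Cell ` vals F X"
    "pull (unit_plus F) X f Unit = Unit" "pull (unit_plus F) X f (Cell x) = Cell (pull F X f x)"
    "hdeg (unit_plus F) X Unit = 0" "hdeg (unit_plus F) X (Cell x) = 1" for X f x
    by (simp_all add: unit_plus_def)
  have grid1: "u \<in> grid [F] {0} n g \<longleftrightarrow> (\<exists>c<n 0. u = (\<lambda>j. if j = 0 then [letter F {..<n 0} (g 0) c] else []))"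
    for u n g
  proof
    assume "u \<in> grid [F] {0} n g"
    then obtain c where "c < n 0" "u 0 = [letter F {..<n 0} (g 0) c]" "\<And>j. j \<noteq> 0 \<Longrightarrow> u j = []"
      by (auto simp: grid_def)
    then show "\<exists>c<n 0. u = (\<lambda>j. if j = 0 then [letter F {..<n 0} (g 0) c] else [])"
      by (intro exI[of _ c] conjI ext) auto
  qed (auto simp: grid_def)
  have "cell_model (unit_plus F) [F] ev"
  proof
    fix X v assume X: "fin_ne X" and v: "v \<in> vals (unit_plus F) X"
    show "\<exists>J n g. valid_box [F] J n g \<and> bij_betw (ev X v) X (grid [F] J n g) \<and>
        hdeg (unit_plus F) X v = card J"
    proof (cases "v = Unit")
      case True
      then have "card X = 1" using v by (auto simp: V split: if_splits)
      then obtain x where "X = {x}" by (auto simp: card_1_singleton_iff)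
      then show ?thesis using True
        by (intro exI[of _ "{}"]) (simp add: valid_box_def V ev grid_empty bij_betw_def)
    next
      case False
      then obtain x where x: "v = Cell x" "x \<in> vals F X" using v by (auto simp: V split: if_splits)
      obtain f where f: "bij_betw f {..<card X} X" using bij_to_set[OF X] .
      have n: "fin_ne {..<card X}" using fin_ne_card[OF X] by simp
      \<comment> \<open>\<open>valid_box\<close> asks for a generator over a standard set, so
        \<open>x\<close> is read through an enumeration of \<open>X\<close>; the letters stay the
        same by \<open>letter_pull\<close>.\<close>
      let ?g = "pull F {..<card X} f x"
      have l: "letter F {..<card X} ?g c = letter F X x (f c)" if "c < card X" for c
        using letter_pull[OF Fc n f x(2)] that by simp
      have "bij_betw (ev X v) X (grid [F] {0} (\<lambda>_. card X) (\<lambda>_. ?g))"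
        unfolding bij_betw_def
      proof
        show "inj_on (ev X v) X"
        proof (rule inj_onI)
          fix c d assume c: "c \<in> X" "d \<in> X" "ev X v c = ev X v d"
          then have "ev X v c 0 = ev X v d 0" by simp
          then have "letter F X x c = letter F X x d" by (simp add: x(1) ev)
          then show "c = d" using letter_inj[OF F X x(2) c(1)] by simp
        qed
        show "ev X v ` X = grid [F] {0} (\<lambda>_. card X) (\<lambda>_. ?g)"
        proof (intro equalityI subsetI)
          fix u assume "u \<in> ev X v ` X"
          then obtain z where "z \<in> X" "u = ev X v z" by blast
          then obtain c where c: "c < card X" "u = ev X v (f c)"
            using f unfolding bij_betw_def by (metis imageE lessThan_iff)
          have "u = (\<lambda>j. if j = 0 then [letter F {..<card X} ?g c] else [])"
            unfolding c(2) x(1) ev l[OF c(1)] ..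
          then show "u \<in> grid [F] {0} (\<lambda>_. card X) (\<lambda>_. ?g)"
            unfolding grid1 using c(1) by blast
        next
          fix u assume "u \<in> grid [F] {0} (\<lambda>_. card X) (\<lambda>_. ?g)"
          then obtain c where c: "c < card X" "u = (\<lambda>j. if j = 0 then [letter F {..<card X} ?g c] else [])"
            unfolding grid1 by blast
          then have c: "c < card X" "u = ev X v (f c)" unfolding x(1) ev l[OF c(1)] by simp_all
          then have "f c \<in> X" using f by (auto simp: bij_betw_def)
          then show "u \<in> ev X v ` X" using c(2) by blast
        qed
      qed
      moreover have "valid_box [F] {0} (\<lambda>_. card X) (\<lambda>_. ?g)"
        using pull_bij[OF Fc n f x(2)] n by (simp add: valid_box_def)
      ultimately show ?thesis by (intro exI conjI) (auto simp: x V)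
    qed
  next
    fix X J n g w assume X: "fin_ne X" and v: "valid_box [F] J n g" and w: "bij_betw w X (grid [F] J n g)"
    have "J \<subseteq> {0}" using v by (auto simp: valid_box_def)
    then consider "J = {}" | "J = {0}" by blast
    then show "\<exists>v\<in>vals (unit_plus F) X. \<forall>x\<in>X. ev X v x = w x"
    proof cases
      case 1
      then have "card X = 1" using bij_betw_same_card[OF w] by (simp add: grid_empty)
      moreover have "w x = nil_addr" if "x \<in> X" for x
        using w that 1 by (auto simp: bij_betw_def grid_empty)
      ultimately show ?thesis by (intro bexI[of _ Unit]) (auto simp: V ev)
    next
      case 2
      let ?A = "\<lambda>c. (\<lambda>j. if j = 0 then [letter F {..<n 0} (g 0) c] else [])"
      have n: "n 0 > 0" and g: "g 0 \<in> vals F {..<n 0}" using v 2 by (auto simp: valid_box_def)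
      have A: "bij_betw ?A {..<n 0} (grid [F] J n g)"
        unfolding bij_betw_def
      proof
        show "inj_on ?A {..<n 0}"
          by (rule inj_onI) (use n letter_inj[OF F _ g] in \<open>auto simp: fun_eq_iff dest!: spec[of _ 0] split: if_splits\<close>)
        show "?A ` {..<n 0} = grid [F] J n g" unfolding 2 by (auto simp: grid1)
      qed
      \<comment> \<open>\<open>\<tau>\<close> numbers each point of \<open>X\<close> by the input
        whose letter \<open>w\<close> assigns to it; the generator pulled back along it then has the
        prescribed letters.\<close>
      define \<tau> where "\<tau> = inv_into {..<n 0} ?A \<circ> w"
      have t: "bij_betw \<tau> X {..<n 0}"
        unfolding \<tau>_def by (rule bij_betw_trans[OF w bij_betw_inv_into[OF A]])
      have At: "?A (\<tau> x) = w x" if "x \<in> X" for x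
      proof -
        have "w x \<in> ?A ` {..<n 0}" using w A that by (auto simp: bij_betw_def)
        then show ?thesis unfolding \<tau>_def comp_def by (rule f_inv_into_f)
      qed
      have "ev X (Cell (pull F X \<tau> (g 0))) x = w x" if "x \<in> X" for x
        unfolding At[OF that, symmetric] ev letter_pull[OF Fc X t g that] ..
      then show ?thesis
        by (intro bexI[of _ "Cell (pull F X \<tau> (g 0))"]) (use pull_bij[OF Fc X t g] in \<open>auto simp: V\<close>)
    qed
  next
    fix X v v' assume X: "fin_ne X" and v: "v \<in> vals (unit_plus F) X" "v' \<in> vals (unit_plus F) X"
      and eq: "\<And>x. x \<in> X \<Longrightarrow> ev X v x = ev X v' x"
    obtain c where c: "c \<in> X" using X unfolding fin_ne_def by blast
    have ne: "ev X (Cell x) c \<noteq> ev X Unit c" for x by (auto simp: ev nil_addr_def fun_eq_iff)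
    show "v = v'"
    proof (cases "v = Unit \<or> v' = Unit")
      case True
      then show ?thesis using eq[OF c] ne v by (auto simp: V split: if_splits) (metis ne)+
    next
      case False
      then obtain x x' where x: "v = Cell x" "v' = Cell x'" "x \<in> vals F X" "x' \<in> vals F X"
        using v by (auto simp: V split: if_splits)
      have "letter F X x c = letter F X x' c" if "c \<in> X" for c
        using fun_cong[OF eq[OF that], of 0] by (simp add: x ev)
      then show ?thesis using letter_faithful[OF F X x(3,4)] x by simp
    qed
  next
    fix X f v x assume X: "fin_ne X" and f: "inj_on f X" and v: "v \<in> vals (unit_plus F) (f ` X)"
    have b: "bij_betw f X (f ` X)" using f by (simp add: bij_betw_def)
    show "pull (unit_plus F) X f v \<in> vals (unit_plus F) X"
      using v pull_bij[OF Fc X b] card_image[OF f] by (auto simp: V split: if_splits)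
    show "x \<in> X \<Longrightarrow> ev X (pull (unit_plus F) X f v) x = ev (f ` X) v (f x)"
      using v letter_pull[OF Fc X b] by (auto simp: V ev split: if_splits)
  qed
  then show ?thesis by blast
qed

section \<open>Pairs of partitions as matrices\<close>

definition blk :: "nat set set \<Rightarrow> nat \<Rightarrow> nat" where
  "blk \<pi> c = set_encode (\<Union>{B \<in> \<pi>. c \<in> B})"

lemma blk:
  assumes p: "partition_on X \<pi>" and X: "finite X" and c: "c \<in> X"
  shows "set_decode (blk \<pi> c) \<in> \<pi>" "c \<in> set_decode (blk \<pi> c)" "blk \<pi> c \<in> code \<pi>"
    "B \<in> \<pi> \<Longrightarrow> c \<in> B \<Longrightarrow> blk \<pi> c = set_encode B"
    "c' \<in> X \<Longrightarrow> blk \<pi> c = blk \<pi> c' \<longleftrightarrow> c' \<in> set_decode (blk \<pi> c)"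
proof -
  have U: "\<Union>{B \<in> \<pi>. c \<in> B} = B" if "B \<in> \<pi>" "c \<in> B" for B c
    using p that by (auto simp: partition_on_def disjoint_def)
  have fin: "finite B" if "B \<in> \<pi>" for B
    using p that X by (metis Union_upper finite_subset partition_on_def)
  have ex: "\<exists>B\<in>\<pi>. c \<in> B" if "c \<in> X" for c using p that by (auto simp: partition_on_def)
  have *: "set_decode (blk \<pi> c) \<in> \<pi> \<and> c \<in> set_decode (blk \<pi> c) \<and> blk \<pi> c = set_encode (set_decode (blk \<pi> c))"
    if "c \<in> X" for c
    using ex[OF that] U fin by (auto simp: blk_def set_encode_inverse)
  show 1: "set_decode (blk \<pi> c) \<in> \<pi>" "c \<in> set_decode (blk \<pi> c)" using *[OF c] by auto
  show "blk \<pi> c \<in> code \<pi>" using *[OF c] unfolding code_def by (metis imageI)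
  show b: "B \<in> \<pi> \<Longrightarrow> c \<in> B \<Longrightarrow> blk \<pi> c = set_encode B" for B c using U by (simp add: blk_def)
  show "c' \<in> X \<Longrightarrow> blk \<pi> c = blk \<pi> c' \<longleftrightarrow> c' \<in> set_decode (blk \<pi> c)"
    using 1 *[OF c] * b by metis
qed

lemma blk_image:
  assumes p: "partition_on X \<pi>" and X: "finite X"
  shows "blk \<pi> ` X = code \<pi>"
proof (intro equalityI subsetI)
  fix b assume "b \<in> code \<pi>"
  then obtain B where B: "B \<in> \<pi>" "b = set_encode B" by (auto simp: code_def)
  then obtain c where c: "c \<in> B" using p unfolding partition_on_def by (metis ex_in_conv)
  then have "c \<in> X" using p B by (auto simp: partition_on_def)
  then show "b \<in> blk \<pi> ` X" using blk(4)[OF p X _ B(1) c] B(2) by (metis image_eqI)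
qed (use blk(3)[OF p X] in auto)

lemma code_fin_ne:
  assumes "partition_on X \<pi>" "fin_ne X"
  shows "fin_ne (code \<pi>)"
  using blk_image[OF assms(1)] assms(2) unfolding fin_ne_def by (metis finite_imageI image_is_empty)

lemma partition_eqI:
  assumes p: "partition_on X \<pi>" "partition_on X \<pi>'" and X: "finite X"
    and eq: "\<And>c c'. c \<in> X \<Longrightarrow> c' \<in> X \<Longrightarrow> blk \<pi> c = blk \<pi> c' \<longleftrightarrow> blk \<pi>' c = blk \<pi>' c'"
  shows "\<pi> = \<pi>'"
proof -
  have sub: "\<pi> \<subseteq> \<pi>'"
    if p: "partition_on X \<pi>" "partition_on X \<pi>'"
      and eq: "\<And>c c'. c \<in> X \<Longrightarrow> c' \<in> X \<Longrightarrow> blk \<pi> c = blk \<pi> c' \<longleftrightarrow> blk \<pi>' c = blk \<pi>' c'" for \<pi> \<pi>'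
  proof
    fix B assume B: "B \<in> \<pi>"
    have BX: "B \<subseteq> X" using p B by (auto simp: partition_on_def)
    obtain c where "c \<in> B" using p B unfolding partition_on_def by (metis ex_in_conv)
    with BX have c: "c \<in> B" "c \<in> X" by auto
    have fin: "finite B" using BX X finite_subset by blast
    have "set_decode (blk \<pi> c) = B" using blk(4)[OF p(1) X c(2) B c(1)] fin by (simp add: set_encode_inverse)
    moreover have "set_decode (blk \<pi>' c) \<subseteq> X" using blk(1)[OF p(2) X c(2)] p(2) by (auto simp: partition_on_def)
    ultimately have "B = set_decode (blk \<pi>' c)"
      using blk(5)[OF p(1) X c(2)] blk(5)[OF p(2) X c(2)] eq[OF c(2)] BX by blast
    then show "B \<in> \<pi>'" using blk(1)[OF p(2) X c(2)] by simp
  qed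
  show ?thesis using sub[OF p eq] sub[OF p(2,1)] eq by blast
qed

definition matrix_pair :: "nat set \<Rightarrow> nat set set \<Rightarrow> nat set set \<Rightarrow> bool" where
  "matrix_pair X \<pi> \<tau> \<longleftrightarrow>
     partition_on X \<pi> \<and> partition_on X \<tau> \<and> (\<forall>B\<in>\<pi>. \<forall>C\<in>\<tau>. card (B \<inter> C) = 1)"

text \<open>The intersection condition makes \<open>X\<close> a matrix whose rows and columns are
  the blocks of the two partitions: a point is a pair of blocks.\<close>

lemma matrix_pair_bij:
  assumes m: "matrix_pair X \<pi> \<tau>" and X: "finite X"
  shows "bij_betw (\<lambda>c. (blk \<pi> c, blk \<tau> c)) X (code \<pi> \<times> code \<tau>)"
proof -
  have p: "partition_on X \<pi>" "partition_on X \<tau>"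
    and one: "\<And>B C. B \<in> \<pi> \<Longrightarrow> C \<in> \<tau> \<Longrightarrow> card (B \<inter> C) = 1"
    using m by (auto simp: matrix_pair_def)
  show ?thesis
    unfolding bij_betw_def
  proof
    show "inj_on (\<lambda>c. (blk \<pi> c, blk \<tau> c)) X"
    proof (rule inj_onI)
      fix c d assume c: "c \<in> X" "d \<in> X" "(blk \<pi> c, blk \<tau> c) = (blk \<pi> d, blk \<tau> d)"
      let ?I = "set_decode (blk \<pi> c) \<inter> set_decode (blk \<tau> c)"
      have "card ?I = 1" using one blk(1)[OF p(1) X c(1)] blk(1)[OF p(2) X c(1)] by blast
      moreover have "c \<in> ?I" using blk(2)[OF p(1) X c(1)] blk(2)[OF p(2) X c(1)] by simp
      moreover have "d \<in> ?I" using blk(2)[OF p(1) X c(2)] blk(2)[OF p(2) X c(2)] c(3) by simp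
      ultimately show "c = d" by (metis card_1_singletonE singletonD)
    qed
    show "(\<lambda>c. (blk \<pi> c, blk \<tau> c)) ` X = code \<pi> \<times> code \<tau>"
    proof (intro equalityI subsetI)
      fix z assume "z \<in> code \<pi> \<times> code \<tau>"
      then obtain B C where BC: "B \<in> \<pi>" "C \<in> \<tau>" "z = (set_encode B, set_encode C)"
        by (auto simp: code_def)
      obtain c where c: "c \<in> B" "c \<in> C" using one[OF BC(1,2)] by (auto simp: card_1_singleton_iff)
      then have cX: "c \<in> X" using p BC by (auto simp: partition_on_def)
      show "z \<in> (\<lambda>c. (blk \<pi> c, blk \<tau> c)) ` X"
        using blk(4)[OF p(1) X cX BC(1) c(1)] blk(4)[OF p(2) X cX BC(2) c(2)] BC(3) cX by force
    qed (use blk(3)[OF p(1) X] blk(3)[OF p(2) X] in auto)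
  qed
qed

definition fibres :: "nat set \<Rightarrow> (nat \<Rightarrow> 'b) \<Rightarrow> nat set set" where
  "fibres X f = (\<lambda>x. {y \<in> X. f y = f x}) ` X"

lemma fibres:
  assumes X: "finite X"
  shows "partition_on X (fibres X f)"
    "c \<in> X \<Longrightarrow> d \<in> X \<Longrightarrow> blk (fibres X f) c = blk (fibres X f) d \<longleftrightarrow> f c = f d"
proof -
  show p: "partition_on X (fibres X f)"
    by (auto simp: partition_on_def disjoint_def fibres_def)
  show "blk (fibres X f) c = blk (fibres X f) d \<longleftrightarrow> f c = f d" if c: "c \<in> X" "d \<in> X"
  proof -
    have "blk (fibres X f) c = set_encode {y \<in> X. f y = f c}"
      by (rule blk(4)[OF p X c(1)]) (use c in \<open>auto simp: fibres_def\<close>)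
    then have "set_decode (blk (fibres X f) c) = {y \<in> X. f y = f c}"
      using X by (simp add: set_encode_inverse)
    then show ?thesis unfolding blk(5)[OF p X c] using c(2) by (simp add: eq_commute)
  qed
qed

text \<open>Converse to \<open>matrix_pair_bij\<close>: two coordinates that identify
  \<open>X\<close> with a product have the rows and the columns as their fibres.\<close>

lemma fibres_matrix:
  assumes X: "finite X" and b: "bij_betw (\<lambda>x. (f x, h x)) X (A \<times> B)"
  shows "matrix_pair X (fibres X f) (fibres X h)"
  unfolding matrix_pair_def
proof (intro conjI ballI fibres[OF X])
  fix P Q assume "P \<in> fibres X f" "Q \<in> fibres X h"
  then obtain c d where c: "c \<in> X" "d \<in> X" "P = {y \<in> X. f y = f c}" "Q = {y \<in> X. h y = h d}"
    by (auto simp: fibres_def)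
  have "(f c, h c) \<in> A \<times> B" "(f d, h d) \<in> A \<times> B" using b c by (auto simp: bij_betw_def)
  then have "(f c, h d) \<in> (\<lambda>x. (f x, h x)) ` X" using b by (auto simp: bij_betw_def)
  then obtain e where e: "e \<in> X" "f e = f c" "h e = h d" by auto
  have "P \<inter> Q = {e}" using e b unfolding c by (auto simp: bij_betw_def inj_on_def)
  then show "card (P \<inter> Q) = 1" by simp
qed

lemma fibres_bij:
  assumes X: "finite X" and A: "f ` X = A"
  shows "\<exists>w. bij_betw w (code (fibres X f)) A \<and> (\<forall>c\<in>X. w (blk (fibres X f) c) = f c)"
proof -
  let ?p = "fibres X f"
  define w where "w b = f (SOME c. c \<in> X \<and> blk ?p c = b)" for b
  have w: "w (blk ?p c) = f c" if "c \<in> X" for c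
  proof -
    let ?d = "SOME d. d \<in> X \<and> blk ?p d = blk ?p c"
    have "?d \<in> X \<and> blk ?p ?d = blk ?p c" by (rule someI[of _ c]) (use that in simp)
    then show ?thesis unfolding w_def using fibres(2)[OF X, of ?d c f] that by simp
  qed
  have "bij_betw w (code ?p) A"
    unfolding bij_betw_def blk_image[OF fibres(1)[OF X] X, symmetric]
  proof
    show "inj_on w (blk ?p ` X)"
    proof (rule inj_onI)
      fix x y assume a: "x \<in> blk ?p ` X" "y \<in> blk ?p ` X" "w x = w y"
      then obtain c d where "c \<in> X" "d \<in> X" "x = blk ?p c" "y = blk ?p d" by auto
      then show "x = y" using a(3) w fibres(2)[OF X, of c d f] by simp
    qed
    show "w ` blk ?p ` X = A" using w A by (simp add: image_image)
  qed
  then show ?thesis using w by blast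
qed

section \<open>Splitting the directions of a grid\<close>

definition join :: "nat \<Rightarrow> 'b addr \<Rightarrow> 'b addr \<Rightarrow> 'b addr" where
  "join m u v = (\<lambda>i. if i < m then u i else v (i - m))"

definition fst_addr :: "nat \<Rightarrow> 'b addr \<Rightarrow> 'b addr" where
  "fst_addr m u = (\<lambda>i. if i < m then u i else [])"

definition snd_addr :: "nat \<Rightarrow> 'b addr \<Rightarrow> 'b addr" where
  "snd_addr m u = (\<lambda>i. u (i + m))"

lemma join_simps: "snd_addr m (join m u v) = v" "join m (fst_addr m w) (snd_addr m w) = w"
  by (auto simp: join_def fst_addr_def snd_addr_def fun_eq_iff)

lemma fst_join: "(\<And>i. m \<le> i \<Longrightarrow> u i = []) \<Longrightarrow> fst_addr m (join m u v) = u"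
  by (auto simp: join_def fst_addr_def fun_eq_iff)

lemma grid_bounded: "valid_box Fs J n g \<Longrightarrow> u \<in> grid Fs J n g \<Longrightarrow> length Fs \<le> i \<Longrightarrow> u i = []"
  by (auto simp: grid_def valid_box_def)

text \<open>A choice of inputs in the directions of \<open>Fs @ Gs\<close> is a choice below
  \<open>m\<close> together with one from \<open>m\<close> on, so the grid becomes a product. This
  matches the product of rows and columns in a matrix pair.\<close>

lemma grid_append:
  assumes "valid_box (Fs @ Gs) J n g"
  defines "m \<equiv> length Fs"
  shows "valid_box Fs (J \<inter> {..<m}) n g"
    "valid_box Gs {j. j + m \<in> J} (\<lambda>j. n (j + m)) (\<lambda>j. g (j + m))"
    "bij_betw (\<lambda>w. (fst_addr m w, snd_addr m w)) (grid (Fs @ Gs) J n g)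
       (grid Fs (J \<inter> {..<m}) n g \<times> grid Gs {j. j + m \<in> J} (\<lambda>j. n (j + m)) (\<lambda>j. g (j + m)))"
    "card J = card (J \<inter> {..<m}) + card {j. j + m \<in> J}"
proof -
  have J: "J \<subseteq> {..<m + length Gs}" using assms(1) by (simp add: valid_box_def m_def)
  show v1: "valid_box Fs (J \<inter> {..<m}) n g"
    using assms(1) by (auto simp: valid_box_def m_def nth_append)
  show "valid_box Gs {j. j + m \<in> J} (\<lambda>j. n (j + m)) (\<lambda>j. g (j + m))"
    unfolding valid_box_def
  proof (intro conjI ballI subsetI)
    fix j assume "j \<in> {j. j + m \<in> J}"
    then have j: "j + m \<in> J" by simp
    then show "j \<in> {..<length Gs}" "n (j + m) > 0" "g (j + m) \<in> vals (Gs ! j) {..<n (j + m)}"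
      using assms(1) J by (auto simp: valid_box_def m_def nth_append dest!: bspec)
  qed
  let ?G1 = "grid Fs (J \<inter> {..<m}) n g" and ?G2 = "grid Gs {j. j + m \<in> J} (\<lambda>j. n (j + m)) (\<lambda>j. g (j + m))"
  let ?G = "grid (Fs @ Gs) J n g"
  show "bij_betw (\<lambda>w. (fst_addr m w, snd_addr m w)) ?G (?G1 \<times> ?G2)"
  proof (rule bij_betwI[where g = "\<lambda>(u, v). join m u v"])
    show "(\<lambda>w. (fst_addr m w, snd_addr m w)) \<in> ?G \<rightarrow> ?G1 \<times> ?G2"
    proof
      fix w assume w: "w \<in> ?G"
      have "fst_addr m w \<in> ?G1"
        unfolding grid_def
      proof (intro CollectI conjI ballI allI impI)
        fix j assume j: "j \<in> J \<inter> {..<m}"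
        then have "\<exists>c<n j. w j = [letter ((Fs @ Gs) ! j) {..<n j} (g j) c]"
          using w by (auto simp: grid_def)
        then show "\<exists>c<n j. fst_addr m w j = [letter (Fs ! j) {..<n j} (g j) c]"
          using j by (simp add: fst_addr_def m_def nth_append)
      qed (use w in \<open>auto simp: grid_def fst_addr_def\<close>)
      moreover have "snd_addr m w \<in> ?G2"
        unfolding grid_def
      proof (intro CollectI conjI ballI allI impI)
        fix j assume "j \<in> {j. j + m \<in> J}"
        then have "\<exists>c<n (j + m). w (j + m) = [letter ((Fs @ Gs) ! (j + m)) {..<n (j + m)} (g (j + m)) c]"
          using w by (auto simp: grid_def)
        then show "\<exists>c<n (j + m). snd_addr m w j = [letter (Gs ! j) {..<n (j + m)} (g (j + m)) c]"
          by (simp add: snd_addr_def m_def nth_append)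
      qed (use w in \<open>auto simp: grid_def snd_addr_def\<close>)
      ultimately show "(fst_addr m w, snd_addr m w) \<in> ?G1 \<times> ?G2" by simp
    qed
    show "(\<lambda>(u, v). join m u v) \<in> ?G1 \<times> ?G2 \<rightarrow> ?G"
    proof
      fix z assume "z \<in> ?G1 \<times> ?G2"
      then obtain u v where z: "z = (u, v)" "u \<in> ?G1" "v \<in> ?G2" by auto
      have "join m u v \<in> ?G"
        unfolding grid_def
      proof (intro CollectI conjI ballI allI impI)
        fix j assume j: "j \<in> J"
        show "\<exists>c<n j. join m u v j = [letter ((Fs @ Gs) ! j) {..<n j} (g j) c]"
        proof (cases "j < m")
          case True
          then show ?thesis using z(2) j by (auto simp: grid_def join_def nth_append m_def)
        next
          case False
          have "j - m \<in> {j. j + m \<in> J}" using False j by simp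
          then have "\<exists>c<n (j - m + m). v (j - m) = [letter (Gs ! (j - m)) {..<n (j - m + m)} (g (j - m + m)) c]"
            using z(3) unfolding grid_def by blast
          then show ?thesis using False by (simp add: join_def nth_append m_def)
        qed
      qed (use z(2,3) in \<open>auto simp: grid_def join_def\<close>)
      then show "(case z of (u, v) \<Rightarrow> join m u v) \<in> ?G" by (simp add: z)
    qed
    show "(case (fst_addr m w, snd_addr m w) of (u, v) \<Rightarrow> join m u v) = w" for w by (simp add: join_simps)
    show "(fst_addr m (case z of (u, v) \<Rightarrow> join m u v), snd_addr m (case z of (u, v) \<Rightarrow> join m u v)) = z"
      if zz: "z \<in> ?G1 \<times> ?G2" for z
    proof -
      obtain u v where z: "z = (u, v)" "u \<in> ?G1" using zz by auto
      then show ?thesis using fst_join[of m u v] grid_bounded[OF v1 z(2)] by (simp add: join_simps m_def)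
    qed
  qed
  have "J = (J \<inter> {..<m}) \<union> (\<lambda>j. j + m) ` {j. j + m \<in> J}"
  proof (intro equalityI subsetI)
    fix j assume "j \<in> J"
    then show "j \<in> (J \<inter> {..<m}) \<union> (\<lambda>j. j + m) ` {j. j + m \<in> J}"
      by (cases "j < m") (auto intro!: image_eqI[of _ _ "j - m"])
  qed auto
  moreover have "finite {j. j + m \<in> J}" by (rule finite_subset[of _ "{..<length Gs}"]) (use J in auto)
  ultimately have "card J = card (J \<inter> {..<m}) + card ((\<lambda>j. j + m) ` {j. j + m \<in> J})"
    by (metis (no_types, lifting) card_Un_disjoint finite_Int finite_imageI finite_lessThan
        disjoint_iff IntD2 imageE lessThan_iff not_add_less2)
  then show "card J = card (J \<inter> {..<m}) + card {j. j + m \<in> J}" by (simp add: card_image)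
qed

text \<open>Inverse to the splitting. Arities and generators are compared through the grids only, as
  their values off \<open>J\<close> are arbitrary.\<close>

lemma valid_box_append:
  assumes "valid_box Fs J1 n1 g1" "valid_box Gs J2 n2 g2"
  defines "m \<equiv> length Fs"
  obtains J n g where "valid_box (Fs @ Gs) J n g" "J \<inter> {..<m} = J1" "{j. j + m \<in> J} = J2"
    "grid Fs (J \<inter> {..<m}) n g = grid Fs J1 n1 g1"
    "grid Gs {j. j + m \<in> J} (\<lambda>j. n (j + m)) (\<lambda>j. g (j + m)) = grid Gs J2 n2 g2"
proof
  let ?J = "J1 \<union> (\<lambda>j. j + m) ` J2" and ?n = "\<lambda>j. if j < m then n1 j else n2 (j - m)"
    and ?g = "\<lambda>j. if j < m then g1 j else g2 (j - m)"
  have J1: "J1 \<subseteq> {..<m}" using assms by (simp add: valid_box_def)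
  show "valid_box (Fs @ Gs) ?J ?n ?g"
    using assms(1,2) by (auto simp: valid_box_def m_def nth_append)
  show 1: "?J \<inter> {..<m} = J1" and 2: "{j. j + m \<in> ?J} = J2" using J1 by auto
  show "grid Fs (?J \<inter> {..<m}) ?n ?g = grid Fs J1 n1 g1"
    unfolding 1 grid_def using J1 by (intro Collect_cong conj_cong ball_cong) auto
  show "grid Gs {j. j + m \<in> ?J} (\<lambda>j. ?n (j + m)) (\<lambda>j. ?g (j + m)) = grid Gs J2 n2 g2"
    unfolding 2 by simp
qed

lemma pull_partition_blk:
  assumes p: "partition_on (f ` X) \<pi>" and X: "finite X"
  shows "partition_on X (pull_partition X f \<pi>)"
    "c \<in> X \<Longrightarrow> on_blocks f (blk (pull_partition X f \<pi>) c) = blk \<pi> (f c)"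
    "c \<in> X \<Longrightarrow> d \<in> X \<Longrightarrow>
      blk (pull_partition X f \<pi>) c = blk (pull_partition X f \<pi>) d \<longleftrightarrow> blk \<pi> (f c) = blk \<pi> (f d)"
    "bij_betw (on_blocks f) (code (pull_partition X f \<pi>)) (code \<pi>)"
proof -
  let ?p = "pull_partition X f \<pi>"
  note fX = finite_imageI[OF X, of f]
  have U: "\<Union>\<pi> = f ` X" and dj: "\<And>B C. B \<in> \<pi> \<Longrightarrow> C \<in> \<pi> \<Longrightarrow> B \<noteq> C \<Longrightarrow> B \<inter> C = {}" and ne: "{} \<notin> \<pi>"
    using p by (auto simp: partition_on_def disjoint_def)
  show part: "partition_on X ?p"
    unfolding partition_on_def disjoint_def
  proof (intro conjI ballI impI)
    show "\<Union> ?p = X" using U by (auto simp: pull_partition_def)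
    show "{} \<notin> ?p"
    proof
      assume "{} \<in> ?p"
      then obtain B where B: "B \<in> \<pi>" "X \<inter> f -` B = {}" by (auto simp: pull_partition_def)
      then obtain y where y: "y \<in> B" using ne by (metis ex_in_conv)
      then have "y \<in> f ` X" using U B(1) by blast
      then show False using B(2) y by auto
    qed
    fix P Q assume "P \<in> ?p" "Q \<in> ?p" "P \<noteq> Q"
    then show "P \<inter> Q = {}" using dj by (auto simp: pull_partition_def)
  qed
  have dec: "set_decode (blk ?p c) = X \<inter> f -` set_decode (blk \<pi> (f c))" if c: "c \<in> X" for c
  proof -
    have "blk ?p c = set_encode (X \<inter> f -` set_decode (blk \<pi> (f c)))"
      by (rule blk(4)[OF part X c])
        (use blk(1,2)[OF p fX, of "f c"] c in \<open>auto simp: pull_partition_def\<close>)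
    then show ?thesis using X by (simp add: set_encode_inverse)
  qed
  show on: "on_blocks f (blk ?p c) = blk \<pi> (f c)" if c: "c \<in> X" for c
  proof -
    have "set_decode (blk \<pi> (f c)) \<subseteq> f ` X" using blk(1)[OF p fX, of "f c"] U c by blast
    then have "f ` (X \<inter> f -` set_decode (blk \<pi> (f c))) = set_decode (blk \<pi> (f c))" by blast
    then show ?thesis by (simp add: on_blocks_def dec[OF c])
  qed
  show eq: "blk ?p c = blk ?p d \<longleftrightarrow> blk \<pi> (f c) = blk \<pi> (f d)" if c: "c \<in> X" "d \<in> X" for c d
    using blk(5)[OF part X c] blk(5)[OF p fX, of "f c" "f d"] dec[OF c(1)] c by auto
  show "bij_betw (on_blocks f) (code ?p) (code \<pi>)"
    unfolding bij_betw_def blk_image[OF part X, symmetric] blk_image[OF p fX, symmetric]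
  proof
    show "inj_on (on_blocks f) (blk ?p ` X)"
    proof (rule inj_onI)
      fix x y assume a: "x \<in> blk ?p ` X" "y \<in> blk ?p ` X" "on_blocks f x = on_blocks f y"
      then obtain c d where "c \<in> X" "d \<in> X" "x = blk ?p c" "y = blk ?p d" by auto
      then show "x = y" using a(3) on eq by simp
    qed
    show "on_blocks f ` blk ?p ` X = blk \<pi> ` f ` X"
      unfolding image_image by (rule image_cong) (simp_all add: on)
  qed
qed

lemma pull_matrix_pair:
  assumes m: "matrix_pair (f ` X) \<pi> \<tau>" and X: "finite X" and f: "inj_on f X"
  shows "matrix_pair X (pull_partition X f \<pi>) (pull_partition X f \<tau>)"
  unfolding matrix_pair_def
proof (intro conjI ballI)
  have p: "partition_on (f ` X) \<pi>" "partition_on (f ` X) \<tau>" using m by (auto simp: matrix_pair_def)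
  show "partition_on X (pull_partition X f \<pi>)" "partition_on X (pull_partition X f \<tau>)"
    using pull_partition_blk(1)[OF p(1) X] pull_partition_blk(1)[OF p(2) X] .
  fix P Q assume "P \<in> pull_partition X f \<pi>" "Q \<in> pull_partition X f \<tau>"
  then obtain B C where BC: "B \<in> \<pi>" "C \<in> \<tau>" "P = X \<inter> f -` B" "Q = X \<inter> f -` C"
    by (auto simp: pull_partition_def)
  have "B \<subseteq> f ` X" using p(1) BC by (auto simp: partition_on_def)
  then have "f ` (P \<inter> Q) = B \<inter> C" using BC by auto
  moreover have "inj_on f (P \<inter> Q)" by (rule inj_on_subset[OF f]) (use BC in auto)
  ultimately have "card (P \<inter> Q) = card (B \<inter> C)" by (metis card_image)
  then show "card (P \<inter> Q) = 1" using m BC by (simp add: matrix_pair_def)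
qed

text \<open>A point lies in one block of \<open>\<pi>\<close> and one of \<open>\<tau>\<close>,
  which are inputs of \<open>x\<close> and of \<open>y\<close>. Its address joins the address of the
  first in the directions of \<open>Fs\<close> with that of the second in the directions of
  \<open>Gs\<close>.\<close>

lemma matrix_prod_model:
  fixes V W :: "'a cell graded_collection" and Fs Gs :: "'a collection list"
  assumes "cell_model V Fs evV" "cell_model W Gs evW"
  shows "\<exists>ev. cell_model (matrix_prod V W) (Fs @ Gs) ev"
proof -
  interpret V: cell_model V Fs evV by fact
  interpret W: cell_model W Gs evW by fact
  let ?M = "matrix_prod V W"
  define m where "m = length Fs"
  define ev :: "nat set \<Rightarrow> 'a cell \<Rightarrow> nat \<Rightarrow> 'a letter addr" where
    "ev = (\<lambda>X z c. case z of Box \<pi> \<tau> x y \<Rightarrow>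
       join m (evV (code \<pi>) x (blk \<pi> c)) (evW (code \<tau>) y (blk \<tau> c)) | _ \<Rightarrow> nil_addr)"
  have ev: "ev X (Box \<pi> \<tau> x y) c = join m (evV (code \<pi>) x (blk \<pi> c)) (evW (code \<tau>) y (blk \<tau> c))"
    for X \<pi> \<tau> x y c by (simp add: ev_def)
  have vals: "z \<in> vals ?M X \<longleftrightarrow> (\<exists>\<pi> \<tau> x y. z = Box \<pi> \<tau> x y \<and> matrix_pair X \<pi> \<tau> \<and>
      x \<in> vals V (code \<pi>) \<and> y \<in> vals W (code \<tau>))" for z X
    by (auto simp: matrix_prod_def matrix_pair_def)
  have pull: "pull ?M X f (Box \<pi> \<tau> x y) = Box (pull_partition X f \<pi>) (pull_partition X f \<tau>)
      (pull V (code (pull_partition X f \<pi>)) (on_blocks f) x)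
      (pull W (code (pull_partition X f \<tau>)) (on_blocks f) y)" for X f \<pi> \<tau> x y
    by (simp add: matrix_prod_def Let_def)
  have hdeg: "hdeg ?M X (Box \<pi> \<tau> x y) = hdeg V (code \<pi>) x + hdeg W (code \<tau>) y" for X \<pi> \<tau> x y
    by (simp add: matrix_prod_def)
  \<comment> \<open>Truncation at \<open>m\<close> loses nothing because values of
    \<open>evV\<close> lie in a grid for \<open>Fs\<close>.\<close>
  have fst_ev: "fst_addr m (join m (evV Y x b) u) = evV Y x b"
    if Y: "fin_ne Y" "x \<in> vals V Y" "b \<in> Y" for Y x b u
  proof -
    obtain J n g where "valid_box Fs J n g" "bij_betw (evV Y x) Y (grid Fs J n g)"
      using V.shape[OF Y(1,2)] by blast
    then show ?thesis using grid_bounded[of Fs J n g "evV Y x b"] Y(3)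
      by (intro fst_join) (auto simp: m_def bij_betw_def)
  qed
  have inj: "inj_on (evV Y x) Y" if "fin_ne Y" "x \<in> vals V Y" for Y x
    using V.shape[OF that] by (auto simp: bij_betw_def)
  have inj': "inj_on (evW Y x) Y" if "fin_ne Y" "x \<in> vals W Y" for Y x
    using W.shape[OF that] by (auto simp: bij_betw_def)
  have "cell_model ?M (Fs @ Gs) ev"
  proof
    fix X z assume X: "fin_ne X" and z: "z \<in> vals ?M X"
    then obtain \<pi> \<tau> x y where zz: "z = Box \<pi> \<tau> x y" "matrix_pair X \<pi> \<tau>"
      "x \<in> vals V (code \<pi>)" "y \<in> vals W (code \<tau>)" by (auto simp: vals)
    have fX: "finite X" using X by (simp add: fin_ne_def)
    have p: "partition_on X \<pi>" "partition_on X \<tau>" using zz(2) by (auto simp: matrix_pair_def)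
    note cn = code_fin_ne[OF p(1) X] code_fin_ne[OF p(2) X]
    obtain J1 n1 g1 where 1: "valid_box Fs J1 n1 g1" "bij_betw (evV (code \<pi>) x) (code \<pi>) (grid Fs J1 n1 g1)"
      "hdeg V (code \<pi>) x = card J1" using V.shape[OF cn(1) zz(3)] by blast
    obtain J2 n2 g2 where 2: "valid_box Gs J2 n2 g2" "bij_betw (evW (code \<tau>) y) (code \<tau>) (grid Gs J2 n2 g2)"
      "hdeg W (code \<tau>) y = card J2" using W.shape[OF cn(2) zz(4)] by blast
    obtain J n g where J: "valid_box (Fs @ Gs) J n g" "J \<inter> {..<m} = J1" "{j. j + m \<in> J} = J2"
      "grid Fs (J \<inter> {..<m}) n g = grid Fs J1 n1 g1"
      "grid Gs {j. j + m \<in> J} (\<lambda>j. n (j + m)) (\<lambda>j. g (j + m)) = grid Gs J2 n2 g2"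
      by (rule valid_box_append[OF 1(1) 2(1), folded m_def])
    note G = grid_append[OF J(1), folded m_def]
    have b12: "bij_betw (\<lambda>c. (evV (code \<pi>) x (blk \<pi> c), evW (code \<tau>) y (blk \<tau> c))) X
        (grid Fs J1 n1 g1 \<times> grid Gs J2 n2 g2)"
      using bij_betw_trans[OF matrix_pair_bij[OF zz(2) fX] bij_betw_map_prod[OF 1(2) 2(2)]]
      by (simp add: comp_def)
    have b3: "bij_betw (\<lambda>w. (fst_addr m w, snd_addr m w)) (grid (Fs @ Gs) J n g)
        (grid Fs J1 n1 g1 \<times> grid Gs J2 n2 g2)" using G(3) J by simp
    have comp: "(fst_addr m (ev X z c), snd_addr m (ev X z c)) =
        (evV (code \<pi>) x (blk \<pi> c), evW (code \<tau>) y (blk \<tau> c))" if "c \<in> X" for c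
      using fst_ev[OF cn(1) zz(3)] blk(3)[OF p(1) fX that] by (simp add: zz(1) ev join_simps)
    have "bij_betw (ev X z) X (grid (Fs @ Gs) J n g)"
      unfolding bij_betw_def
    proof
      show "inj_on (ev X z) X"
        using b12 comp unfolding bij_betw_def inj_on_def by (metis (no_types, lifting))
      show "ev X z ` X = grid (Fs @ Gs) J n g"
      proof (intro equalityI subsetI)
        fix w assume "w \<in> ev X z ` X"
        then obtain c where c: "c \<in> X" "w = ev X z c" by auto
        have "(fst_addr m w, snd_addr m w) \<in> grid Fs J1 n1 g1 \<times> grid Gs J2 n2 g2"
          using b12 c comp by (auto simp: bij_betw_def)
        then obtain w' where "w' \<in> grid (Fs @ Gs) J n g" "(fst_addr m w, snd_addr m w) = (fst_addr m w', snd_addr m w')"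
          using b3 unfolding bij_betw_def by (metis (no_types, lifting) imageE)
        then show "w \<in> grid (Fs @ Gs) J n g" by (metis join_simps(2) prod.inject)
      next
        fix w assume "w \<in> grid (Fs @ Gs) J n g"
        then have "(fst_addr m w, snd_addr m w) \<in> grid Fs J1 n1 g1 \<times> grid Gs J2 n2 g2"
          using b3 by (auto simp: bij_betw_def)
        then obtain c where "c \<in> X" "(fst_addr m w, snd_addr m w) =
            (evV (code \<pi>) x (blk \<pi> c), evW (code \<tau>) y (blk \<tau> c))"
          using b12 unfolding bij_betw_def by (metis (no_types, lifting) imageE)
        then show "w \<in> ev X z ` X" using comp by (metis imageI join_simps(2) prod.inject)
      qed
    qed
    moreover have "hdeg ?M X z = card J" using G(4) J(2,3) 1(3) 2(3) by (simp add: zz(1) hdeg)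
    ultimately show "\<exists>J n g. valid_box (Fs @ Gs) J n g \<and> bij_betw (ev X z) X (grid (Fs @ Gs) J n g) \<and>
        hdeg ?M X z = card J" using J(1) by blast
  next
    fix X J n g w assume X: "fin_ne X" and J: "valid_box (Fs @ Gs) J n g"
      and w: "bij_betw w X (grid (Fs @ Gs) J n g)"
    have fX: "finite X" using X by (simp add: fin_ne_def)
    note G = grid_append[OF J, folded m_def]
    let ?G1 = "grid Fs (J \<inter> {..<m}) n g" and ?G2 = "grid Gs {j. j + m \<in> J} (\<lambda>j. n (j + m)) (\<lambda>j. g (j + m))"
    let ?f = "\<lambda>x. fst_addr m (w x)" and ?h = "\<lambda>x. snd_addr m (w x)"
    have b: "bij_betw (\<lambda>x. (?f x, ?h x)) X (?G1 \<times> ?G2)"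
      using bij_betw_trans[OF w G(3)] by (simp add: comp_def)
    have im: "(\<lambda>x. (?f x, ?h x)) ` X = ?G1 \<times> ?G2" using b by (simp add: bij_betw_def)
    \<comment> \<open>A projection of the product is onto because the other grid is
      nonempty.\<close>
    have "fst ` (\<lambda>x. (?f x, ?h x)) ` X = ?G1" "snd ` (\<lambda>x. (?f x, ?h x)) ` X = ?G2"
      unfolding im using grid_nonempty[OF G(1)] grid_nonempty[OF G(2)] by simp_all
    then have imf: "?f ` X = ?G1" "?h ` X = ?G2" by (simp_all add: image_image)
    obtain w1 where w1: "bij_betw w1 (code (fibres X ?f)) ?G1"
      "\<And>c. c \<in> X \<Longrightarrow> w1 (blk (fibres X ?f) c) = ?f c" using fibres_bij[OF fX imf(1)] by blast
    obtain w2 where w2: "bij_betw w2 (code (fibres X ?h)) ?G2"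
      "\<And>c. c \<in> X \<Longrightarrow> w2 (blk (fibres X ?h) c) = ?h c" using fibres_bij[OF fX imf(2)] by blast
    note p = fibres(1)[OF fX, of ?f] fibres(1)[OF fX, of ?h]
    obtain x where x: "x \<in> vals V (code (fibres X ?f))"
      "\<And>b. b \<in> code (fibres X ?f) \<Longrightarrow> evV (code (fibres X ?f)) x b = w1 b"
      using V.realize[OF code_fin_ne[OF p(1) X] G(1) w1(1)] by blast
    obtain y where y: "y \<in> vals W (code (fibres X ?h))"
      "\<And>b. b \<in> code (fibres X ?h) \<Longrightarrow> evW (code (fibres X ?h)) y b = w2 b"
      using W.realize[OF code_fin_ne[OF p(2) X] G(2) w2(1)] by blast
    let ?z = "Box (fibres X ?f) (fibres X ?h) x y"
    have "?z \<in> vals ?M X" unfolding vals using fibres_matrix[OF fX b] x(1) y(1) by blast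
    moreover have "ev X ?z c = w c" if "c \<in> X" for c
      using x(2) y(2) w1(2) w2(2) blk(3)[OF p(1) fX that] blk(3)[OF p(2) fX that] that
      by (simp add: ev join_simps)
    ultimately show "\<exists>v\<in>vals ?M X. \<forall>x\<in>X. ev X v x = w x" by blast
  next
    fix X z z' assume X: "fin_ne X" and z: "z \<in> vals ?M X" "z' \<in> vals ?M X"
      and eq: "\<And>c. c \<in> X \<Longrightarrow> ev X z c = ev X z' c"
    have fX: "finite X" using X by (simp add: fin_ne_def)
    obtain \<pi> \<tau> x y where zz: "z = Box \<pi> \<tau> x y" "matrix_pair X \<pi> \<tau>"
      "x \<in> vals V (code \<pi>)" "y \<in> vals W (code \<tau>)" using z(1) by (auto simp: vals)
    obtain \<pi>' \<tau>' x' y' where zz': "z' = Box \<pi>' \<tau>' x' y'" "matrix_pair X \<pi>' \<tau>'"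
      "x' \<in> vals V (code \<pi>')" "y' \<in> vals W (code \<tau>')" using z(2) by (auto simp: vals)
    have p: "partition_on X \<pi>" "partition_on X \<tau>" "partition_on X \<pi>'" "partition_on X \<tau>'"
      using zz(2) zz'(2) by (auto simp: matrix_pair_def)
    note cn = p[THEN code_fin_ne, OF X]
    have e1: "evV (code \<pi>) x (blk \<pi> c) = evV (code \<pi>') x' (blk \<pi>' c)" if c: "c \<in> X" for c
      using arg_cong[OF eq[OF c], of "fst_addr m"]
        fst_ev[OF cn(1) zz(3) blk(3)[OF p(1) fX c]] fst_ev[OF cn(3) zz'(3) blk(3)[OF p(3) fX c]]
      by (simp add: zz zz' ev)
    have e2: "evW (code \<tau>) y (blk \<tau> c) = evW (code \<tau>') y' (blk \<tau>' c)" if c: "c \<in> X" for c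
      using arg_cong[OF eq[OF c], of "snd_addr m"] by (simp add: zz zz' ev join_simps)
    \<comment> \<open>\<open>evV\<close> is injective on blocks, so two points share a block of
      \<open>\<pi>\<close> exactly when their addresses agree in the directions of
      \<open>Fs\<close>; the partition is thus determined by the addresses.\<close>
    have pi: "\<pi> = \<pi>'"
    proof (rule partition_eqI[OF p(1,3) fX])
      fix c d assume c: "c \<in> X" "d \<in> X"
      show "blk \<pi> c = blk \<pi> d \<longleftrightarrow> blk \<pi>' c = blk \<pi>' d"
        using inj_on_eq_iff[OF inj[OF cn(1) zz(3)] blk(3)[OF p(1) fX c(1)] blk(3)[OF p(1) fX c(2)]]
          inj_on_eq_iff[OF inj[OF cn(3) zz'(3)] blk(3)[OF p(3) fX c(1)] blk(3)[OF p(3) fX c(2)]]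
          e1[OF c(1)] e1[OF c(2)] by simp
    qed
    have tau: "\<tau> = \<tau>'"
    proof (rule partition_eqI[OF p(2,4) fX])
      fix c d assume c: "c \<in> X" "d \<in> X"
      show "blk \<tau> c = blk \<tau> d \<longleftrightarrow> blk \<tau>' c = blk \<tau>' d"
        using inj_on_eq_iff[OF inj'[OF cn(2) zz(4)] blk(3)[OF p(2) fX c(1)] blk(3)[OF p(2) fX c(2)]]
          inj_on_eq_iff[OF inj'[OF cn(4) zz'(4)] blk(3)[OF p(4) fX c(1)] blk(3)[OF p(4) fX c(2)]]
          e2[OF c(1)] e2[OF c(2)] by simp
    qed
    have "x = x'"
    proof (rule V.faithful[OF cn(1) zz(3)])
      show "x' \<in> vals V (code \<pi>)" using zz'(3) pi by simp
      fix b assume "b \<in> code \<pi>"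
      then obtain c where "c \<in> X" "b = blk \<pi> c" using blk_image[OF p(1) fX] by blast
      then show "evV (code \<pi>) x b = evV (code \<pi>) x' b" using e1 pi by simp
    qed
    moreover have "y = y'"
    proof (rule W.faithful[OF cn(2) zz(4)])
      show "y' \<in> vals W (code \<tau>)" using zz'(4) tau by simp
      fix b assume "b \<in> code \<tau>"
      then obtain c where "c \<in> X" "b = blk \<tau> c" using blk_image[OF p(2) fX] by blast
      then show "evW (code \<tau>) y b = evW (code \<tau>) y' b" using e2 tau by simp
    qed
    ultimately show "z = z'" using pi tau zz(1) zz'(1) by simp
  next
    fix X f z c assume X: "fin_ne X" and f: "inj_on f X" and z: "z \<in> vals ?M (f ` X)"
    have fX: "finite X" using X by (simp add: fin_ne_def)
    obtain \<pi> \<tau> x y where zz: "z = Box \<pi> \<tau> x y" "matrix_pair (f ` X) \<pi> \<tau>"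
      "x \<in> vals V (code \<pi>)" "y \<in> vals W (code \<tau>)" using z by (auto simp: vals)
    have p: "partition_on (f ` X) \<pi>" "partition_on (f ` X) \<tau>" using zz(2) by (auto simp: matrix_pair_def)
    let ?p = "pull_partition X f \<pi>" and ?t = "pull_partition X f \<tau>"
    note P = pull_partition_blk[OF p(1) fX] and Q = pull_partition_blk[OF p(2) fX]
    note cn = code_fin_ne[OF P(1) X] code_fin_ne[OF Q(1) X]
    have on: "inj_on (on_blocks f) (code ?p)" "on_blocks f ` code ?p = code \<pi>"
      "inj_on (on_blocks f) (code ?t)" "on_blocks f ` code ?t = code \<tau>"
      using P(4) Q(4) by (auto simp: bij_betw_def)
    show "pull ?M X f z \<in> vals ?M X"
      unfolding zz(1) pull vals
      using pull_matrix_pair[OF zz(2) fX f] V.pull_vals[OF cn(1) on(1)] W.pull_vals[OF cn(2) on(3)]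
        zz(3,4) on by auto
    assume c: "c \<in> X"
    show "ev X (pull ?M X f z) c = ev (f ` X) z (f c)"
      unfolding zz(1) pull ev
      using V.pull_ev[OF cn(1) on(1), of x "blk ?p c"] W.pull_ev[OF cn(2) on(3), of y "blk ?t c"]
        on zz(3,4) P(2)[OF c] Q(2)[OF c] blk(3)[OF P(1) fX c] blk(3)[OF Q(1) fX c] by simp
  qed
  then show ?thesis by blast
qed

lemma matrix_prod_list_model:
  fixes Xs :: "'a collection list"
  assumes "Xs \<noteq> []" "\<And>F. F \<in> set Xs \<Longrightarrow> good_coll F"
  shows "\<exists>ev. cell_model (matrix_prod_list (map unit_plus Xs)) Xs ev"
  using assms
proof (induction Xs rule: rev_nonempty_induct)
  case (single F)
  then show ?case using unit_plus_model[of F] by (simp add: matrix_prod_list_def)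
next
  case (snoc F Xs)
  obtain ev where "cell_model (matrix_prod_list (map unit_plus Xs)) Xs ev" using snoc by auto
  moreover obtain ev' where "cell_model (unit_plus F) [F] ev'"
    using unit_plus_model[of F] snoc by auto
  moreover have "matrix_prod_list (map unit_plus (Xs @ [F])) =
      matrix_prod (matrix_prod_list (map unit_plus Xs)) (unit_plus F)"
    using snoc(1) by (simp add: matrix_prod_list_def)
  ultimately show ?case using matrix_prod_model[of _ Xs ev _ "[F]" ev'] by simp
qed

section \<open>Linear extension\<close>

lemma lookup_lin_scale [simp]: "Poly_Mapping.lookup (lin_scale c \<phi>) b = c * Poly_Mapping.lookup \<phi> b"
  unfolding lin_scale_def by (simp add: Poly_Mapping.map.rep_eq when_def)

lemma module_lin_scale: "module (lin_scale :: 'k::field \<Rightarrow> ('b \<Rightarrow>\<^sub>0 'k) \<Rightarrow> _)"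
  by unfold_locales (auto intro!: poly_mapping_eqI simp: lookup_add algebra_simps)

lemma lin_scale_simps [simp]:
  "lin_scale c 0 = 0" "lin_scale 0 \<phi> = 0" "lin_scale 1 \<phi> = \<phi>"
  "lin_scale c (lin_scale c' \<phi>) = lin_scale (c * c') \<phi>"
  "lin_scale c (Poly_Mapping.single b a) = Poly_Mapping.single b (c * a)"
  by (auto intro!: poly_mapping_eqI simp: lookup_single when_def)

lemma lin_scale_add: "lin_scale c (\<phi> + \<psi>) = lin_scale c \<phi> + lin_scale c \<psi>"
  and lin_scale_add_left: "lin_scale (c + c') \<phi> = lin_scale c \<phi> + lin_scale c' \<phi>"
  by (auto intro!: poly_mapping_eqI simp: lookup_add algebra_simps)

lemma lin_scale_sum: "lin_scale c (\<Sum>i\<in>I. f i) = (\<Sum>i\<in>I. lin_scale c (f i))"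
  by (induction I rule: infinite_finite_induct) (simp_all add: lin_scale_add)

lemma lin_zero [simp]: "0 \<in> lin B"
  by (simp add: lin_def)

lemma lin_single: "b \<in> B \<Longrightarrow> Poly_Mapping.single b c \<in> lin B"
  by (simp add: lin_def)

lemma lin_add: "\<phi> \<in> lin B \<Longrightarrow> \<psi> \<in> lin B \<Longrightarrow> \<phi> + \<psi> \<in> lin B"
  using Poly_Mapping.keys_add[of \<phi> \<psi>] by (auto simp: lin_def)

lemma keys_lin_scale: "Poly_Mapping.keys (lin_scale c \<phi>) \<subseteq> Poly_Mapping.keys \<phi>"
  by (auto simp: in_keys_iff)

lemma lin_scale_lin: "\<phi> \<in> lin B \<Longrightarrow> lin_scale c \<phi> \<in> lin B"
  using keys_lin_scale[of c \<phi>] by (auto simp: lin_def)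

lemma lin_sum: "(\<And>i. i \<in> I \<Longrightarrow> f i \<in> lin B) \<Longrightarrow> (\<Sum>i\<in>I. f i) \<in> lin B"
  by (induction I rule: infinite_finite_induct) (simp_all add: lin_add)

definition lin_ext :: "('b \<Rightarrow> ('c \<Rightarrow>\<^sub>0 'k)) \<Rightarrow> ('b \<Rightarrow>\<^sub>0 'k::field) \<Rightarrow> ('c \<Rightarrow>\<^sub>0 'k)" where
  "lin_ext f \<phi> = (\<Sum>b\<in>Poly_Mapping.keys \<phi>. lin_scale (Poly_Mapping.lookup \<phi> b) (f b))"

lemma lin_ext_superset:
  assumes "finite A" "Poly_Mapping.keys \<phi> \<subseteq> A"
  shows "lin_ext f \<phi> = (\<Sum>b\<in>A. lin_scale (Poly_Mapping.lookup \<phi> b) (f b))"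
  unfolding lin_ext_def
  by (rule sum.mono_neutral_left) (use assms in \<open>auto simp: in_keys_iff\<close>)

lemma lin_ext_zero [simp]: "lin_ext f 0 = 0"
  by (simp add: lin_ext_def)

lemma lin_ext_single [simp]: "lin_ext f (Poly_Mapping.single b c) = lin_scale c (f b)"
  using lin_ext_superset[of "{b}" "Poly_Mapping.single b c" f] by simp

lemma lin_ext_add: "lin_ext f (\<phi> + \<psi>) = lin_ext f \<phi> + lin_ext f \<psi>"
proof -
  let ?A = "Poly_Mapping.keys \<phi> \<union> Poly_Mapping.keys \<psi>"
  have "lin_ext f (\<phi> + \<psi>) = (\<Sum>b\<in>?A. lin_scale (Poly_Mapping.lookup (\<phi> + \<psi>) b) (f b))"
    by (rule lin_ext_superset) (use Poly_Mapping.keys_add[of \<phi> \<psi>] in auto)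
  also have "\<dots> = lin_ext f \<phi> + lin_ext f \<psi>"
    by (simp add: lookup_add lin_scale_add_left sum.distrib
        lin_ext_superset[of ?A \<phi>] lin_ext_superset[of ?A \<psi>])
  finally show ?thesis .
qed

lemma lin_ext_scale: "lin_ext f (lin_scale c \<phi>) = lin_scale c (lin_ext f \<phi>)"
proof -
  have "lin_ext f (lin_scale c \<phi>) =
      (\<Sum>b\<in>Poly_Mapping.keys \<phi>. lin_scale (Poly_Mapping.lookup (lin_scale c \<phi>) b) (f b))"
    by (rule lin_ext_superset) (simp_all add: keys_lin_scale)
  then show ?thesis by (simp add: lin_ext_def lin_scale_sum)
qed

lemma lin_ext_sum: "lin_ext f (\<Sum>i\<in>I. g i) = (\<Sum>i\<in>I. lin_ext f (g i))"
  by (induction I rule: infinite_finite_induct) (simp_all add: lin_ext_add)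

lemma lin_ext_lin_ext: "lin_ext f (lin_ext g \<phi>) = lin_ext (\<lambda>b. lin_ext f (g b)) \<phi>"
  by (simp add: lin_ext_def[of g] lin_ext_def[of "\<lambda>b. lin_ext f (g b)"] lin_ext_sum lin_ext_scale)

lemma lin_ext_cong: "\<phi> \<in> lin B \<Longrightarrow> (\<And>b. b \<in> B \<Longrightarrow> f b = g b) \<Longrightarrow> lin_ext f \<phi> = lin_ext g \<phi>"
  unfolding lin_ext_def by (rule sum.cong) (auto simp: lin_def)

lemma lin_ext_lin: "\<phi> \<in> lin B \<Longrightarrow> (\<And>b. b \<in> B \<Longrightarrow> f b \<in> lin C) \<Longrightarrow> lin_ext f \<phi> \<in> lin C"
  unfolding lin_ext_def by (intro lin_sum lin_scale_lin) (auto simp: lin_def)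

lemma lin_ext_plus: "lin_ext (\<lambda>b. f b + g b) \<phi> = lin_ext f \<phi> + lin_ext g \<phi>"
  by (simp add: lin_ext_def lin_scale_add sum.distrib)

lemma lin_ext_id: "lin_ext (\<lambda>b. Poly_Mapping.single b 1) \<phi> = \<phi>"
proof (rule poly_mapping_eqI)
  fix k
  have "Poly_Mapping.lookup (lin_ext (\<lambda>b. Poly_Mapping.single b 1) \<phi>) k =
      (\<Sum>b\<in>Poly_Mapping.keys \<phi>. if b = k then Poly_Mapping.lookup \<phi> b else 0)"
    by (simp add: lin_ext_def lookup_sum lookup_single when_def)
  then show "Poly_Mapping.lookup (lin_ext (\<lambda>b. Poly_Mapping.single b 1) \<phi>) k = Poly_Mapping.lookup \<phi> k"
    by (simp add: in_keys_iff)
qed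

lemma lin_map_ext: "lin_map g = lin_ext (\<lambda>b. Poly_Mapping.single (g b) 1)"
  by (simp add: lin_map_def lin_ext_def fun_eq_iff)

text \<open>A functional is treated as a linear extension with values in the free space on one
  point, so that the rules for \<open>lin_ext\<close> carry over.\<close>

definition lin_form :: "('b \<Rightarrow> 'k) \<Rightarrow> ('b \<Rightarrow>\<^sub>0 'k::field) \<Rightarrow> 'k" where
  "lin_form f \<phi> = Poly_Mapping.lookup (lin_ext (\<lambda>b. Poly_Mapping.single () (f b)) \<phi>) ()"

lemma lin_form_simps:
  "lin_form f 0 = 0" "lin_form f (Poly_Mapping.single b c) = c * f b"
  "lin_form f (\<phi> + \<psi>) = lin_form f \<phi> + lin_form f \<psi>"
  "lin_form f (lin_scale c \<phi>) = c * lin_form f \<phi>"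
  "lin_form f (\<Sum>i\<in>I. h i) = (\<Sum>i\<in>I. lin_form f (h i))"
  "lin_form f (lin_ext g \<phi>) = lin_form (\<lambda>b. lin_form f (g b)) \<phi>"
  by (simp_all add: lin_form_def lin_ext_add lin_ext_scale lin_ext_sum lookup_add lookup_sum
      lin_ext_lin_ext) (simp add: lin_ext_def lookup_sum)

lemma lin_form_eq: "lin_form f \<phi> = (\<Sum>b\<in>Poly_Mapping.keys \<phi>. Poly_Mapping.lookup \<phi> b * f b)"
  by (simp add: lin_form_def lin_ext_def lookup_sum)

lemma lin_form_cong: "\<phi> \<in> lin B \<Longrightarrow> (\<And>b. b \<in> B \<Longrightarrow> f b = g b) \<Longrightarrow> lin_form f \<phi> = lin_form g \<phi>"
  unfolding lin_form_eq by (rule sum.cong) (auto simp: lin_def)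

section \<open>Augmented simplicial chain complexes\<close>

text \<open>For each \<open>u\<close> the basis elements \<open>b\<close> with \<open>w b = u\<close> correspond to the faces of the simplex on
  the vertex set \<open>S X u\<close>; the empty face is included, so that only \<open>S X u = {}\<close> contributes
  homology.\<close>

locale simplices =
  fixes B :: "nat \<Rightarrow> nat set \<Rightarrow> 'b set" and J :: "'b \<Rightarrow> nat set" and w :: "'b \<Rightarrow> 'w"
    and A :: "nat set \<Rightarrow> 'w set" and S :: "nat set \<Rightarrow> 'w \<Rightarrow> nat set"
  assumes bij: "fin_ne X \<Longrightarrow>
      bij_betw (\<lambda>b. (J b, w b)) (B n X) {(I, u). u \<in> A X \<and> I \<subseteq> S X u \<and> card I = n}"
    and S_finite: "fin_ne X \<Longrightarrow> u \<in> A X \<Longrightarrow> finite (S X u)"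
    and S_empty_1: "card X = 1 \<Longrightarrow> \<exists>!u. u \<in> A X \<and> S X u = {}"
    and S_nonempty: "fin_ne X \<Longrightarrow> card X \<noteq> 1 \<Longrightarrow> u \<in> A X \<Longrightarrow> S X u \<noteq> {}"
begin

definition mk :: "nat \<Rightarrow> nat set \<Rightarrow> nat set \<Rightarrow> 'w \<Rightarrow> 'b" where
  "mk n X I u = inv_into (B n X) (\<lambda>b. (J b, w b)) (I, u)"

lemma mk:
  assumes "fin_ne X" "u \<in> A X" "I \<subseteq> S X u" "card I = n"
  shows "mk n X I u \<in> B n X" "J (mk n X I u) = I" "w (mk n X I u) = u"
proof -
  have *: "(I, u) \<in> (\<lambda>b. (J b, w b)) ` B n X" using bij[OF assms(1), of n] assms by (auto simp: bij_betw_def)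
  show "mk n X I u \<in> B n X" unfolding mk_def by (rule inv_into_into[OF *])
  have "(J (mk n X I u), w (mk n X I u)) = (I, u)"
    unfolding mk_def using f_inv_into_f[OF *] by simp
  then show "J (mk n X I u) = I" "w (mk n X I u) = u" by simp_all
qed

lemma basis:
  assumes "fin_ne X" "b \<in> B n X"
  shows "w b \<in> A X" "J b \<subseteq> S X (w b)" "card (J b) = n" "finite (J b)" "mk n X (J b) (w b) = b"
proof -
  have "(J b, w b) \<in> {(I, u). u \<in> A X \<and> I \<subseteq> S X u \<and> card I = n}"
    using bij_betw_apply[OF bij[OF assms(1), of n] assms(2)] .
  then show "w b \<in> A X" "J b \<subseteq> S X (w b)" "card (J b) = n" by auto
  then show "finite (J b)" using S_finite[OF assms(1)] finite_subset by blast
  show "mk n X (J b) (w b) = b"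
    unfolding mk_def by (rule inv_into_f_f[OF bij_betw_imp_inj_on[OF bij[OF assms(1)]] assms(2)])
qed

lemma basis_eqI:
  assumes "fin_ne X" "b \<in> B n X" "b' \<in> B n X" "J b = J b'" "w b = w b'"
  shows "b = b'"
proof -
  have "b = mk n X (J b) (w b)" by (rule basis(5)[OF assms(1,2), symmetric])
  also have "\<dots> = mk n X (J b') (w b')" by (simp only: assms(4,5))
  also have "\<dots> = b'" by (rule basis(5)[OF assms(1,3)])
  finally show ?thesis .
qed

lemma face:
  assumes "fin_ne X" "b \<in> B (Suc n) X" "j \<in> J b"
  shows "mk n X (J b - {j}) (w b) \<in> B n X" "J (mk n X (J b - {j}) (w b)) = J b - {j}"
    "w (mk n X (J b - {j}) (w b)) = w b"
proof -
  note bs = basis[OF assms(1,2)]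
  have "J b - {j} \<subseteq> S X (w b)" "card (J b - {j}) = n" using bs(2-4) assms(3) by auto
  then show "mk n X (J b - {j}) (w b) \<in> B n X" "J (mk n X (J b - {j}) (w b)) = J b - {j}"
    "w (mk n X (J b - {j}) (w b)) = w b" using mk[OF assms(1) bs(1)] by blast+
qed

section \<open>Differential and contracting homotopy\<close>

definition sg :: "nat \<Rightarrow> nat set \<Rightarrow> 'k::field" where
  "sg j I = (- 1) ^ card {i \<in> I. i < j}"

definition bd :: "nat \<Rightarrow> nat set \<Rightarrow> 'b \<Rightarrow> ('b \<Rightarrow>\<^sub>0 'k::field)" where
  "bd n X b = (\<Sum>j\<in>J b. Poly_Mapping.single (mk n X (J b - {j}) (w b)) (sg j (J b)))"

text \<open>Contraction of a simplex onto its smallest vertex. The smallest one is chosen so that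
  the face opposite to it has sign 1; over the empty simplex the value 0 leaves room for the
  homology.\<close>

definition cone :: "nat \<Rightarrow> nat set \<Rightarrow> 'b \<Rightarrow> ('b \<Rightarrow>\<^sub>0 'k::field)" where
  "cone n X b = (let s = Min (S X (w b)) in
     if S X (w b) = {} \<or> s \<in> J b then 0
     else Poly_Mapping.single (mk (Suc n) X (insert s (J b)) (w b)) 1)"

definition eps :: "nat set \<Rightarrow> 'b \<Rightarrow> 'k::field" where
  "eps X b = (if S X (w b) = {} then 1 else 0)"

lemma bd_mem:
  assumes "fin_ne X" "b \<in> B (Suc n) X"
  shows "bd n X b \<in> lin (B n X)"
  unfolding bd_def
proof (rule lin_sum, rule lin_single)
  fix j assume "j \<in> J b"
  then show "mk n X (J b - {j}) (w b) \<in> B n X"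
    by (rule face(1)[OF assms])
qed

lemma cone_mem:
  assumes "fin_ne X" "b \<in> B n X"
  shows "cone n X b \<in> lin (B (Suc n) X)"
proof -
  let ?s = "Min (S X (w b))"
  have "mk (Suc n) X (insert ?s (J b)) (w b) \<in> B (Suc n) X" if "S X (w b) \<noteq> {}" "?s \<notin> J b"
    using mk(1)[OF assms(1) basis(1)[OF assms], of "insert ?s (J b)"] basis[OF assms] that
      Min_in[OF S_finite[OF assms(1)], of "w b"] by auto
  then show ?thesis by (auto simp: cone_def Let_def intro: lin_single)
qed

lemma sg_remove_less:
  assumes "finite I" "i \<in> I" "i < j"
  shows "sg j (I - {i}) = (- sg j I :: 'k::field)"
proof -
  have "{k \<in> I. k < j} = insert i {k \<in> I - {i}. k < j}" using assms by auto
  then have "card {k \<in> I. k < j} = Suc (card {k \<in> I - {i}. k < j})" using assms(1) by simp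
  then show ?thesis by (simp add: sg_def)
qed

lemma sg_remove_ge: "j \<le> i \<Longrightarrow> sg j (I - {i}) = sg j I"
  unfolding sg_def by (rule arg_cong[of _ _ "\<lambda>A. (- 1) ^ card A"]) auto

text \<open>Vertices removed in either order leave the same face. Removing the smaller one changes
  the sign of the larger, but not conversely, so the two terms cancel.\<close>

lemma bd_bd:
  assumes X: "fin_ne X" and b: "b \<in> B (Suc (Suc n)) X"
  shows "lin_ext (bd n X) (bd (Suc n) X b) = (0 :: 'b \<Rightarrow>\<^sub>0 'k::field)"
proof -
  note bs = basis[OF X b]
  let ?I = "J b"
  define f :: "nat \<Rightarrow> nat \<Rightarrow> ('b \<Rightarrow>\<^sub>0 'k)" where
    "f j i = Poly_Mapping.single (mk n X (?I - {j} - {i}) (w b)) (sg j ?I * sg i (?I - {j}))" for j i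
  have mk1: "J (mk (Suc n) X (?I - {j}) (w b)) = ?I - {j}" "w (mk (Suc n) X (?I - {j}) (w b)) = w b"
    if "j \<in> ?I" for j
    using face[OF X b that] by simp_all
  have "lin_ext (bd n X) (bd (Suc n) X b) =
      (\<Sum>j\<in>?I. lin_scale (sg j ?I) (bd n X (mk (Suc n) X (?I - {j}) (w b))))"
    unfolding bd_def[of "Suc n"] by (simp add: lin_ext_sum)
  also have "\<dots> = (\<Sum>j\<in>?I. \<Sum>i\<in>?I - {j}. f j i)"
    by (rule sum.cong[OF HOL.refl]) (simp add: bd_def mk1 lin_scale_sum f_def)
  also have "\<dots> = (\<Sum>j\<in>?I. (\<Sum>i\<in>{i\<in>?I. i < j}. f j i) + (\<Sum>i\<in>{i\<in>?I. j < i}. f j i))"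
  proof (rule sum.cong[OF HOL.refl])
    fix j assume "j \<in> ?I"
    have eq: "?I - {j} = {i\<in>?I. i < j} \<union> {i\<in>?I. j < i}" by auto
    show "(\<Sum>i\<in>?I - {j}. f j i) = (\<Sum>i\<in>{i\<in>?I. i < j}. f j i) + (\<Sum>i\<in>{i\<in>?I. j < i}. f j i)"
      unfolding eq by (rule sum.union_disjoint) (use bs(4) in auto)
  qed
  also have "\<dots> = (\<Sum>j\<in>?I. \<Sum>i\<in>{i\<in>?I. i < j}. f j i) + (\<Sum>j\<in>?I. \<Sum>i\<in>{i\<in>?I. j < i}. f j i)"
    by (rule sum.distrib)
  also have "(\<Sum>j\<in>?I. \<Sum>i\<in>{i\<in>?I. j < i}. f j i) = (\<Sum>i\<in>?I. \<Sum>j\<in>{j\<in>?I. j < i}. f j i)"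
    using sum.swap_restrict[OF bs(4) bs(4), of "\<lambda>j i. f j i" "\<lambda>j i. j < i"] .
  also have "\<dots> = (\<Sum>j\<in>?I. \<Sum>i\<in>{i\<in>?I. i < j}. - f j i)"
  proof (intro sum.cong HOL.refl)
    fix i j assume "i \<in> ?I" "j \<in> {j \<in> ?I. j < i}"
    then have ij: "i \<in> ?I" "j \<in> ?I" "j < i" by auto
    have "?I - {j} - {i} = ?I - {i} - {j}" by auto
    moreover have "(sg i (?I - {j}) :: 'k) = - sg i ?I" using sg_remove_less[OF bs(4) ij(2,3)] .
    moreover have "(sg j (?I - {i}) :: 'k) = sg j ?I"
      by (rule sg_remove_ge) (use ij(3) in simp)
    ultimately show "f j i = - f i j" by (simp add: f_def single_uminus mult.commute)
  qed
  finally show ?thesis by (simp add: sum_negf)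
qed

lemma bd_cone:
  assumes X: "fin_ne X" and b: "b \<in> B n X" and S: "S X (w b) \<noteq> {}" "Min (S X (w b)) \<notin> J b"
  shows "lin_ext (bd n X) (cone n X b) + (\<Sum>j\<in>J b. Poly_Mapping.single
      (mk n X (insert (Min (S X (w b))) (J b - {j})) (w b)) (sg j (J b))) =
    (Poly_Mapping.single b 1 :: 'b \<Rightarrow>\<^sub>0 'k::field)"
proof -
  note bs = basis[OF X b]
  let ?I = "J b" and ?s = "Min (S X (w b))"
  have s: "?s \<in> S X (w b)" "\<And>j. j \<in> S X (w b) \<Longrightarrow> ?s \<le> j"
    using S_finite[OF X bs(1)] S(1) by auto
  let ?c = "mk (Suc n) X (insert ?s ?I) (w b)"
  have c: "J ?c = insert ?s ?I" "w ?c = w b"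
    using mk[OF X bs(1), of "insert ?s ?I" "Suc n"] bs s S by auto
  have sgs: "(sg ?s (insert ?s ?I) :: 'k) = 1"
  proof -
    have "{i \<in> insert ?s ?I. i < ?s} = {}" using s(2) bs(2) by (auto simp: not_less)
    then show ?thesis unfolding sg_def by (simp only: card.empty power_0)
  qed
  have sgj: "(sg j (insert ?s ?I) :: 'k) = - sg j ?I" if "j \<in> ?I" for j
  proof -
    have "?s < j" using s(2)[of j] bs(2) that S(2) by (metis le_neq_implies_less subsetD)
    then have "(sg j (insert ?s ?I - {?s}) :: 'k) = - sg j (insert ?s ?I)"
      using sg_remove_less[of "insert ?s ?I" ?s j] bs(4) by simp
    then show ?thesis using S(2) by simp
  qed
  have "lin_ext (bd n X) (cone n X b :: 'b \<Rightarrow>\<^sub>0 'k) = bd n X ?c"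
    using S by (simp add: cone_def)
  also have "\<dots> = Poly_Mapping.single (mk n X ?I (w b)) 1 +
      (\<Sum>j\<in>?I. Poly_Mapping.single (mk n X (insert ?s ?I - {j}) (w b)) (sg j (insert ?s ?I)))"
    unfolding bd_def c using bs(4) S(2) by (simp add: sgs)
  also have "(\<Sum>j\<in>?I. Poly_Mapping.single (mk n X (insert ?s ?I - {j}) (w b)) (sg j (insert ?s ?I))) =
      - (\<Sum>j\<in>?I. Poly_Mapping.single (mk n X (insert ?s (?I - {j})) (w b)) (sg j ?I :: 'k))"
    unfolding sum_negf[symmetric]
  proof (rule sum.cong[OF HOL.refl])
    fix j assume j: "j \<in> ?I"
    then have "insert ?s ?I - {j} = insert ?s (?I - {j})" using S(2) by auto
    then show "Poly_Mapping.single (mk n X (insert ?s ?I - {j}) (w b)) (sg j (insert ?s ?I)) =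
        - Poly_Mapping.single (mk n X (insert ?s (?I - {j})) (w b)) (sg j ?I :: 'k)"
      by (simp add: sgj[OF j] single_uminus)
  qed
  finally show ?thesis using bs(5) by simp
qed

lemma homotopy_0:
  assumes X: "fin_ne X" and b: "b \<in> B 0 X" and S: "S X (w b) \<noteq> {}"
  shows "lin_ext (bd 0 X) (cone 0 X b) = (Poly_Mapping.single b 1 :: 'b \<Rightarrow>\<^sub>0 'k::field)"
proof -
  have "J b = {}" using basis(3,4)[OF X b] by simp
  then show ?thesis using bd_cone[OF X b S] by simp
qed

lemma homotopy_Suc:
  assumes X: "fin_ne X" and b: "b \<in> B (Suc n) X"
  shows "lin_ext (bd (Suc n) X) (cone (Suc n) X b) + lin_ext (cone n X) (bd n X b) =
    (Poly_Mapping.single b 1 :: 'b \<Rightarrow>\<^sub>0 'k::field)"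
proof -
  note bs = basis[OF X b]
  let ?I = "J b" and ?s = "Min (S X (w b))"
  have "?I \<noteq> {}" using bs(3) by auto
  then have S: "S X (w b) \<noteq> {}" using bs(2) by auto
  have s: "?s \<in> S X (w b)" "\<And>j. j \<in> S X (w b) \<Longrightarrow> ?s \<le> j"
    using S_finite[OF X bs(1)] S by auto
  have mk1: "J (mk n X (?I - {j}) (w b)) = ?I - {j}" "w (mk n X (?I - {j}) (w b)) = w b"
    if "j \<in> ?I" for j
    using face[OF X b that] by simp_all
  have h: "lin_ext (cone n X) (bd n X b) =
      (\<Sum>j\<in>?I. lin_scale (sg j ?I) (cone n X (mk n X (?I - {j}) (w b)) :: 'b \<Rightarrow>\<^sub>0 'k))"
    unfolding bd_def by (simp add: lin_ext_sum)
  show ?thesis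
  proof (cases "?s \<in> ?I")
    \<comment> \<open>Here the cone over \<open>b\<close> is 0, and the faces that keep the smallest
      vertex have cone 0 as well; the face opposite to it has cone \<open>b\<close>.\<close>
    case True
    have "{i \<in> ?I. i < ?s} = {}" using s(2) bs(2) by (auto simp: not_less)
    then have sgs: "(sg ?s ?I :: 'k) = 1" unfolding sg_def by (simp only: card.empty power_0)
    have "(\<Sum>j\<in>?I. lin_scale (sg j ?I) (cone n X (mk n X (?I - {j}) (w b)) :: 'b \<Rightarrow>\<^sub>0 'k)) =
        (\<Sum>j\<in>?I. if j = ?s then Poly_Mapping.single b 1 else 0)"
      by (rule sum.cong[OF HOL.refl])
        (use True S bs(5) sgs in \<open>auto simp: cone_def mk1 Let_def insert_absorb\<close>)
    also have "\<dots> = Poly_Mapping.single b 1" using True bs(4) by simp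
    finally show ?thesis using True h by (simp add: cone_def Let_def)
  next
    case False
    have "(\<Sum>j\<in>?I. lin_scale (sg j ?I) (cone n X (mk n X (?I - {j}) (w b)) :: 'b \<Rightarrow>\<^sub>0 'k)) =
        (\<Sum>j\<in>?I. Poly_Mapping.single (mk (Suc n) X (insert ?s (?I - {j})) (w b)) (sg j ?I))"
      by (rule sum.cong[OF HOL.refl]) (use False S in \<open>auto simp: cone_def mk1 Let_def\<close>)
    then show ?thesis using bd_cone[OF X b S False] h by simp
  qed
qed

lemma exact_Suc:
  fixes x :: "'b \<Rightarrow>\<^sub>0 'k::field"
  assumes X: "fin_ne X" and x: "x \<in> lin (B (Suc n) X)" "lin_ext (bd n X) x = 0"
  shows "x \<in> lin_ext (bd (Suc n) X) ` lin (B (Suc (Suc n)) X)"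
proof
  let ?h = "lin_ext (cone (Suc n) X) x"
  show "?h \<in> lin (B (Suc (Suc n)) X)" by (rule lin_ext_lin[OF x(1) cone_mem[OF X]])
  have "x = lin_ext (\<lambda>b. lin_ext (bd (Suc n) X) (cone (Suc n) X b) + lin_ext (cone n X) (bd n X b)) x"
    using lin_ext_cong[OF x(1) homotopy_Suc[OF X]] by (simp add: lin_ext_id)
  also have "\<dots> = lin_ext (bd (Suc n) X) ?h + lin_ext (cone n X) (lin_ext (bd n X) x)"
    by (simp add: lin_ext_plus lin_ext_lin_ext)
  finally show "x = lin_ext (bd (Suc n) X) ?h" by (simp add: x(2))
qed

lemma exact_0:
  fixes x :: "'b \<Rightarrow>\<^sub>0 'k::field"
  assumes X: "fin_ne X" and x: "x \<in> lin (B 0 X)" "lin_form (eps X) x = 0"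
  shows "x \<in> lin_ext (bd 0 X) ` lin (B 1 X)"
proof
  let ?h = "lin_ext (cone 0 X) x" and ?K = "{b \<in> B 0 X. S X (w b) \<noteq> {}}"
  show "?h \<in> lin (B 1 X)" using lin_ext_lin[OF x(1) cone_mem[OF X]] by simp
  \<comment> \<open>A degree 0 basis element with empty simplex occurs only in arity 1 and is unique
    there, so \<open>eps\<close> reads off its coefficient, which is therefore 0. On the remaining
    elements \<open>homotopy_0\<close> applies.\<close>
  have "x \<in> lin ?K"
    unfolding lin_def
  proof (intro CollectI subsetI conjI)
    fix b assume b: "b \<in> Poly_Mapping.keys x"
    then show b0: "b \<in> B 0 X" using x(1) by (auto simp: lin_def)
    show "S X (w b) \<noteq> {}"
    proof
      assume e: "S X (w b) = {}"
      then have 1: "card X = 1" using S_nonempty[OF X _ basis(1)[OF X b0]] by auto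
      have uniq: "b' = b" if "b' \<in> B 0 X" "S X (w b') = {}" for b'
      proof (rule basis_eqI[OF X that(1) b0])
        show "w b' = w b" using S_empty_1[OF 1] basis(1)[OF X that(1)] basis(1)[OF X b0] that(2) e by blast
        show "J b' = J b" using basis(3,4)[OF X that(1)] basis(3,4)[OF X b0] by simp
      qed
      have "lin_form (eps X) x = (\<Sum>b'\<in>Poly_Mapping.keys x. if b' = b then Poly_Mapping.lookup x b else 0)"
        unfolding lin_form_eq
      proof (rule sum.cong[OF HOL.refl])
        fix b' assume "b' \<in> Poly_Mapping.keys x"
        then have "b' \<in> B 0 X" using x(1) by (auto simp: lin_def)
        then show "Poly_Mapping.lookup x b' * eps X b' = (if b' = b then Poly_Mapping.lookup x b else 0)"
          by (cases "b' = b") (use uniq[of b'] e in \<open>auto simp: eps_def\<close>)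
      qed
      also have "\<dots> = Poly_Mapping.lookup x b" using b by simp
      finally show False using x(2) b by (simp add: in_keys_iff)
    qed
  qed
  then have "lin_ext (\<lambda>b. lin_ext (bd 0 X) (cone 0 X b)) x = lin_ext (\<lambda>b. Poly_Mapping.single b 1) x"
    by (rule lin_ext_cong) (use homotopy_0[OF X] in auto)
  then show "x = lin_ext (bd 0 X) ?h" by (simp add: lin_ext_lin_ext lin_ext_id)
qed

lemma eps_bd:
  assumes X: "fin_ne X" and b: "b \<in> B 1 X"
  shows "lin_form (eps X) (bd 0 X b) = (0 :: 'k::field)"
proof -
  note bs = basis[OF X b]
  have "S X (w b) \<noteq> {}" using bs(2,3) by auto
  moreover have "w (mk 0 X (J b - {j}) (w b)) = w b" if "j \<in> J b" for j
    using face(3)[OF X b[unfolded One_nat_def] that] .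
  ultimately show ?thesis by (simp add: bd_def lin_form_simps eps_def)
qed

lemma eps_image:
  assumes X: "fin_ne X"
  shows "lin_form (eps X) ` lin (B 0 X) = (if card X = 1 then UNIV else {0 :: 'k::field})"
proof (cases "card X = 1")
  case True
  then obtain u where u: "u \<in> A X" "S X u = {}" using S_empty_1 by blast
  have m: "mk 0 X {} u \<in> B 0 X" "w (mk 0 X {} u) = u" using mk[OF X u(1), of "{}" 0] by auto
  have "c \<in> lin_form (eps X) ` lin (B 0 X)" for c :: 'k
  proof
    show "c = lin_form (eps X) (Poly_Mapping.single (mk 0 X {} u) c)"
      by (simp add: lin_form_simps eps_def m u)
  qed (rule lin_single[OF m(1)])
  then show ?thesis using True by auto
next
  case False
  have "lin_form (eps X) x = (0 :: 'k)" if "x \<in> lin (B 0 X)" for x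
    using lin_form_cong[OF that, of "eps X" "\<lambda>_. 0"] S_nonempty[OF X False basis(1)[OF X]]
    by (simp add: eps_def lin_form_eq)
  moreover have "lin (B 0 X) \<noteq> ({} :: ('b \<Rightarrow>\<^sub>0 'k) set)" using lin_zero by blast
  ultimately show ?thesis using False by (simp add: image_constant_conv cong: image_cong)
qed

text \<open>Faces and signs depend on \<open>J\<close> only, so a map of bases that keeps
  \<open>J\<close> and transforms \<open>w\<close> uniformly commutes with the differential, even if
  the vertex sets grow. Relabelling and the right action are both of this kind.\<close>

lemma bd_natural:
  fixes \<phi> :: "'b \<Rightarrow>\<^sub>0 'k::field"
  assumes X: "fin_ne X" and Y: "fin_ne Y" and \<phi>: "\<phi> \<in> lin (B (Suc n) Y)"
    and g: "\<And>n b. b \<in> B n Y \<Longrightarrow> g b \<in> B n X \<and> J (g b) = J b \<and> w (g b) = G (w b)"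
  shows "lin_map g (lin_ext (bd n Y) \<phi>) = lin_ext (bd n X) (lin_map g \<phi>)"
  unfolding lin_map_ext lin_ext_lin_ext
proof (rule lin_ext_cong[OF \<phi>])
  fix b assume b: "b \<in> B (Suc n) Y"
  note bs = basis[OF Y b]
  have "g (mk n Y (J b - {j}) (w b)) = mk n X (J b - {j}) (G (w b))" if j: "j \<in> J b" for j
  proof -
    note m' = face[OF Y b j]
    show ?thesis using basis(5)[OF X, of "g (mk n Y (J b - {j}) (w b))" n] g[OF m'(1)] m' by simp
  qed
  then show "lin_ext (\<lambda>b. Poly_Mapping.single (g b) 1) (bd n Y b) =
      lin_ext (bd n X) (Poly_Mapping.single (g b) 1 :: 'b \<Rightarrow>\<^sub>0 'k)"
    using g[OF b] by (simp add: bd_def lin_ext_sum)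
qed

end

section \<open>A basis of the composition product\<close>

definition idx :: "nat set list \<Rightarrow> nat \<Rightarrow> nat" where
  "idx Bs x = (LEAST i. i < length Bs \<and> x \<in> Bs ! i)"

lemma idx_eq:
  assumes "ordered_partition Bs X" "i < length Bs" "x \<in> Bs ! i"
  shows "idx Bs x = i"
  unfolding idx_def
proof (rule Least_equality)
  fix j assume "j < length Bs \<and> x \<in> Bs ! j"
  then show "i \<le> j" using ordered_partition_nth(4)[OF assms(1), of i j] assms(2,3) by (cases "i = j") auto
qed (use assms in simp)

lemma idx_mem:
  assumes "ordered_partition Bs X" "x \<in> X"
  shows "idx Bs x < length Bs" "x \<in> Bs ! idx Bs x"
proof -
  obtain i where "i < length Bs" "x \<in> Bs ! i" using ordered_partition_index[OF assms] .
  then show "idx Bs x < length Bs" "x \<in> Bs ! idx Bs x" using idx_eq[OF assms(1)] by auto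
qed

text \<open>Fixes the value off \<open>X\<close>, so that addresses agreeing on \<open>X\<close>
  become equal as functions.\<close>

definition restr :: "nat set \<Rightarrow> (nat \<Rightarrow> 'b addr) \<Rightarrow> nat \<Rightarrow> 'b addr" where
  "restr X w = (\<lambda>x. if x \<in> X then w x else nil_addr)"

lemma restr_in: "x \<in> X \<Longrightarrow> restr X w x = w x"
  by (simp add: restr_def)

text \<open>Points of a grid have words of length 1 in the directions of \<open>J\<close>; this
  recovers such a point from any address that it begins.\<close>

definition heads :: "nat set \<Rightarrow> 'b addr \<Rightarrow> 'b addr" where
  "heads J u = (\<lambda>j. if j \<in> J then take 1 (u j) else [])"

lemma grid_support: "u \<in> grid Fs J n g \<Longrightarrow> {j. u j \<noteq> []} = J"
  by (auto simp: grid_def)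

lemma heads_grid: "u \<in> grid Fs J n g \<Longrightarrow> heads J (cat u w) = u"
  by (auto simp: grid_def heads_def cat_def fun_eq_iff)

text \<open>\<open>comp_pull\<close> and \<open>comp_act\<close> both have this shape. Permuting
  lists commutes with mapping over them, so an orbit goes to an orbit.\<close>

lemma orbit_transform:
  assumes "length ps = length Bs"
  shows "(\<lambda>(v, Bs, ps). (v, map h Bs, map2 g Bs ps)) ` orbit V (v, Bs, ps) =
    orbit V (v, map h Bs, map2 g Bs ps)"
proof -
  have "permute_list \<sigma> (map h Bs) = map h (permute_list \<sigma> Bs)"
    "permute_list \<sigma> (map2 g Bs ps) = map2 g (permute_list \<sigma> Bs) (permute_list \<sigma> ps)"
    if "\<sigma> permutes {..<length Bs}" for \<sigma>
    using that assms by (simp_all add: permute_list_map permute_list_zip[OF that HOL.refl])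
  then show ?thesis
    unfolding orbit_def using assms by (force simp: image_iff)
qed

locale koszul = P: models P Fs e \<gamma> + V: cell_model V Fs ev
  for P :: "'a expr operad" and Fs :: "'a collection list"
    and e :: "'a expr \<Rightarrow> nat \<Rightarrow> 'a letter addr" and \<gamma>
    and V :: "'a cell graded_collection" and ev +
  assumes good: "F \<in> set Fs \<Longrightarrow> good_coll F"
begin

text \<open>The addresses of the composite of \<open>v\<close> with \<open>ps\<close>, computed
  without forming it: \<open>v\<close> lies in the matrix product and not in
  \<open>P\<close>.\<close>

definition pw :: "('a cell, 'a expr) precomp \<Rightarrow> nat \<Rightarrow> 'a letter addr" where
  "pw = (\<lambda>(v, Bs, ps). restr (\<Union>(set Bs))
     (\<lambda>x. cat (ev {..<length Bs} v (idx Bs x)) (e (ps ! idx Bs x) x)))"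

text \<open>By \<open>shape\<close> all inputs of \<open>v\<close> carry letters in the same
  directions, so input 0 stands for any.\<close>

definition pJ :: "('a cell, 'a expr) precomp \<Rightarrow> nat set" where
  "pJ = (\<lambda>(v, Bs, ps). {j. ev {..<length Bs} v 0 j \<noteq> []})"

lemma precompD:
  assumes "(v, Bs, ps) \<in> precomp V P X" "fin_ne X"
  shows "ordered_partition Bs X" "v \<in> vals V {..<length Bs}" "length ps = length Bs"
    "\<And>i. i < length Bs \<Longrightarrow> ps ! i \<in> vals P (Bs ! i)" "length Bs > 0"
    "x \<in> X \<Longrightarrow> pw (v, Bs, ps) x = cat (ev {..<length Bs} v (idx Bs x)) (e (ps ! idx Bs x) x)"
    "x \<notin> X \<Longrightarrow> pw (v, Bs, ps) x = nil_addr"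
    "\<exists>n g. valid_box Fs (pJ (v, Bs, ps)) n g \<and>
      bij_betw (ev {..<length Bs} v) {..<length Bs} (grid Fs (pJ (v, Bs, ps)) n g) \<and>
      hdeg V {..<length Bs} v = card (pJ (v, Bs, ps))"
proof -
  show op: "ordered_partition Bs X" and v: "v \<in> vals V {..<length Bs}" and "length ps = length Bs"
    and "\<And>i. i < length Bs \<Longrightarrow> ps ! i \<in> vals P (Bs ! i)"
    using assms(1) by (auto simp: precomp_def)
  show n: "length Bs > 0"
    using ordered_partition_nth(3)[OF op] assms(2) by (cases "length Bs = 0") (auto simp: fin_ne_def)
  show "x \<in> X \<Longrightarrow> pw (v, Bs, ps) x = cat (ev {..<length Bs} v (idx Bs x)) (e (ps ! idx Bs x) x)"
    "x \<notin> X \<Longrightarrow> pw (v, Bs, ps) x = nil_addr"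
    by (simp_all add: pw_def restr_def ordered_partition_nth(5)[OF op] del: Union_iff)
  have "fin_ne {..<length Bs}" using n by simp
  from V.shape[OF this v] obtain J n g where J: "valid_box Fs J n g"
    "bij_betw (ev {..<length Bs} v) {..<length Bs} (grid Fs J n g)" "hdeg V {..<length Bs} v = card J"
    by blast
  have "ev {..<length Bs} v 0 \<in> grid Fs J n g" using J(2) \<open>length Bs > 0\<close> by (auto simp: bij_betw_def)
  then have "{j. ev {..<length Bs} v 0 j \<noteq> []} = J" by (rule grid_support)
  then have "pJ (v, Bs, ps) = J" by (simp add: pJ_def)
  with J show "\<exists>n g. valid_box Fs (pJ (v, Bs, ps)) n g \<and>
      bij_betw (ev {..<length Bs} v) {..<length Bs} (grid Fs (pJ (v, Bs, ps)) n g) \<and>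
      hdeg V {..<length Bs} v = card (pJ (v, Bs, ps))" by blast
qed

lemma precompI:
  assumes "ordered_partition Bs X" "v \<in> vals V {..<length Bs}" "length ps = length Bs"
    "\<And>i. i < length Bs \<Longrightarrow> ps ! i \<in> vals P (Bs ! i)"
  shows "(v, Bs, ps) \<in> precomp V P X"
  using assms by (simp add: precomp_def)

lemma heads_pw:
  assumes "(v, Bs, ps) \<in> precomp V P X" "fin_ne X" "x \<in> X"
  shows "heads (pJ (v, Bs, ps)) (pw (v, Bs, ps) x) = ev {..<length Bs} v (idx Bs x)"
proof -
  note p = precompD[OF assms(1,2)]
  obtain n g where "bij_betw (ev {..<length Bs} v) {..<length Bs} (grid Fs (pJ (v, Bs, ps)) n g)"
    using p(8) by blast
  then have "ev {..<length Bs} v (idx Bs x) \<in> grid Fs (pJ (v, Bs, ps)) n g"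
    using idx_mem(1)[OF p(1) assms(3)] by (auto simp: bij_betw_def)
  then show ?thesis using heads_grid p(6)[OF assms(3)] by metis
qed

section \<open>Orbits are determined by directions and addresses\<close>

lemma orbit_subset:
  assumes X: "fin_ne X" and p: "(v, Bs, ps) \<in> precomp V P X" and s: "\<sigma> permutes {..<length Bs}"
  defines "p' \<equiv> (pull V {..<length Bs} \<sigma> v, permute_list \<sigma> Bs, permute_list \<sigma> ps)"
  shows "p' \<in> precomp V P X" "pJ p' = pJ (v, Bs, ps)" "pw p' = pw (v, Bs, ps)"
proof -
  note d = precompD[OF p X]
  let ?k = "length Bs"
  let ?v = "pull V {..<?k} \<sigma> v" and ?Bs = "permute_list \<sigma> Bs" and ?ps = "permute_list \<sigma> ps"
  have k: "fin_ne {..<?k}" using d(5) by simp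
  have im: "\<sigma> ` {..<?k} = {..<?k}" "inj_on \<sigma> {..<?k}"
    using s by (auto simp: permutes_image intro: permutes_inj_on)
  have lt: "\<sigma> i < ?k" if "i < ?k" for i using permutes_in_image[OF s, of i] that by simp
  have v: "?v \<in> vals V {..<?k}" using V.pull_vals[OF k im(2)] im(1) d(2) by simp
  have evv: "ev {..<?k} ?v i = ev {..<?k} v (\<sigma> i)" if "i < ?k" for i
    using V.pull_ev[OF k im(2), of v i] im(1) d(2) that by simp
  have nth: "?Bs ! i = Bs ! \<sigma> i" "?ps ! i = ps ! \<sigma> i" if "i < ?k" for i
    using permute_list_nth[of \<sigma> Bs i] permute_list_nth[of \<sigma> ps i] s that d(3) by simp_all
  have op: "ordered_partition ?Bs X"
    using d(1) s by (simp add: ordered_partition_def)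
  show p': "p' \<in> precomp V P X"
    unfolding p'_def by (rule precompI[OF op]) (use v d(3,4) nth lt in auto)
  note d' = precompD[OF p'[unfolded p'_def] X]
  obtain n g where "bij_betw (ev {..<?k} v) {..<?k} (grid Fs (pJ (v, Bs, ps)) n g)"
    using d(8) by blast
  then have "ev {..<?k} v (\<sigma> 0) \<in> grid Fs (pJ (v, Bs, ps)) n g"
    using lt[OF d(5)] by (auto simp: bij_betw_def)
  then have "{j. ev {..<?k} v (\<sigma> 0) j \<noteq> []} = pJ (v, Bs, ps)" by (rule grid_support)
  then show "pJ p' = pJ (v, Bs, ps)" using evv[OF d(5)] by (simp add: p'_def pJ_def)
  show "pw p' = pw (v, Bs, ps)"
  proof
    fix x show "pw p' x = pw (v, Bs, ps) x"
    proof (cases "x \<in> X")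
      case True
      let ?i = "idx ?Bs x"
      have i: "?i < ?k" "x \<in> Bs ! \<sigma> ?i" using idx_mem[OF op True] nth by auto
      have "idx Bs x = \<sigma> ?i" by (rule idx_eq[OF d(1) lt[OF i(1)] i(2)])
      then show ?thesis
        unfolding p'_def d(6)[OF True] d'(6)[OF True] using evv[OF i(1)] nth[OF i(1)] by simp
    next
      case False
      then show ?thesis unfolding p'_def using d(7) d'(7) by simp
    qed
  qed
qed

text \<open>By \<open>heads_pw\<close> the first letters of an address in the directions
  \<open>pJ\<close> tell which input of the cell the leaf lies below. Matching inputs with equal
  letters gives \<open>\<sigma>\<close>, and the remaining letters determine the factors by
  faithfulness.\<close>

lemma same_orbit:
  assumes X: "fin_ne X" and p: "(v, Bs, ps) \<in> precomp V P X" and p': "(v', Bs', ps') \<in> precomp V P X"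
    and J: "pJ (v', Bs', ps') = pJ (v, Bs, ps)" and w: "pw (v', Bs', ps') = pw (v, Bs, ps)"
  obtains \<sigma> where "\<sigma> permutes {..<length Bs}" "v' = pull V {..<length Bs} \<sigma> v"
    "Bs' = permute_list \<sigma> Bs" "ps' = permute_list \<sigma> ps"
proof -
  note d = precompD[OF p X] and d' = precompD[OF p' X]
  let ?k = "length Bs" and ?k' = "length Bs'"
  let ?E = "ev {..<?k} v" and ?E' = "ev {..<?k'} v'"
  have eq: "?E (idx Bs x) = ?E' (idx Bs' x)" if "x \<in> X" for x
    using heads_pw[OF p X that] heads_pw[OF p' X that] J w by simp
  have onto: "idx Bs ` X = {..<length Bs}" if "ordered_partition Bs X" for Bs
  proof (intro equalityI subsetI)
    fix i assume i: "i \<in> {..<length Bs}"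
    then have "Bs ! i \<noteq> {}" using ordered_partition_nth(2)[OF \<open>ordered_partition Bs X\<close>, of i] by simp
    then obtain x where "x \<in> Bs ! i" by blast
    then show "i \<in> idx Bs ` X"
      using idx_eq[OF \<open>ordered_partition Bs X\<close>, of i x] ordered_partition_nth(3)[OF \<open>ordered_partition Bs X\<close>] i
      by (metis UN_I image_eqI lessThan_iff)
  qed (use idx_mem(1)[OF \<open>ordered_partition Bs X\<close>] in auto)
  have inj: "inj_on ?E {..<?k}" "inj_on ?E' {..<?k'}"
    using d(8) d'(8) by (auto simp: bij_betw_def)
  have im: "?E ` {..<?k} = ?E' ` {..<?k'}"
  proof -
    have "?E ` {..<?k} = (\<lambda>x. ?E (idx Bs x)) ` X"
      using arg_cong[OF onto[OF d(1)], of "image ?E"] by (simp add: image_image)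
    also have "\<dots> = (\<lambda>x. ?E' (idx Bs' x)) ` X" by (rule image_cong[OF HOL.refl eq])
    also have "\<dots> = ?E' ` {..<?k'}"
      using arg_cong[OF onto[OF d'(1)], of "image ?E'"] by (simp add: image_image)
    finally show ?thesis .
  qed
  have kk: "?k' = ?k" using card_image[OF inj(1)] card_image[OF inj(2)] im by simp
  \<comment> \<open>Input \<open>i\<close> of \<open>v'\<close> is sent to the input of
    \<open>v\<close> with the same address; off the range the identity is needed for
    \<open>permutes\<close>.\<close>
  define \<sigma> where "\<sigma> = (\<lambda>i. if i \<in> {..<?k} then inv_into {..<?k} ?E (?E' i) else i)"
  have s1: "\<sigma> i < ?k" "?E (\<sigma> i) = ?E' i" if "i < ?k" for i
  proof -
    have "?E' i \<in> ?E ` {..<?k}" using im kk that by auto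
    then have "inv_into {..<?k} ?E (?E' i) \<in> {..<?k}" "?E (inv_into {..<?k} ?E (?E' i)) = ?E' i"
      by (rule inv_into_into, rule f_inv_into_f)
    then show "\<sigma> i < ?k" "?E (\<sigma> i) = ?E' i" using that by (simp_all add: \<sigma>_def)
  qed
  have injs: "inj_on \<sigma> {..<?k}"
  proof (rule inj_onI)
    fix i j assume ij: "i \<in> {..<?k}" "j \<in> {..<?k}" "\<sigma> i = \<sigma> j"
    then have "?E' i = ?E' j" using s1(2)[of i] s1(2)[of j] by simp
    then show "i = j" using inj(2) ij kk by (simp add: inj_on_def)
  qed
  have ims: "\<sigma> ` {..<?k} = {..<?k}"
    by (rule endo_inj_surj[OF _ _ injs]) (use s1 in auto)
  have perm: "\<sigma> permutes {..<?k}"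
    by (rule bij_imp_permutes) (use injs ims in \<open>auto simp: bij_betw_def \<sigma>_def\<close>)
  have k: "fin_ne {..<?k}" using d(5) by simp
  have v: "v' = pull V {..<?k} \<sigma> v"
  proof (rule V.faithful[OF k])
    show "v' \<in> vals V {..<?k}" using d'(2) kk by simp
    show "pull V {..<?k} \<sigma> v \<in> vals V {..<?k}" using V.pull_vals[OF k injs] ims d(2) by simp
    fix i assume "i \<in> {..<?k}"
    then show "ev {..<?k} v' i = ev {..<?k} (pull V {..<?k} \<sigma> v) i"
      using V.pull_ev[OF k injs, of v i] ims d(2) s1(2)[of i] kk by simp
  qed
  have idx: "idx Bs x = \<sigma> (idx Bs' x)" if "x \<in> X" for x
  proof -
    have i: "idx Bs x < ?k" "idx Bs' x < ?k"
      using idx_mem(1)[OF d(1) that] idx_mem(1)[OF d'(1) that] kk by simp_all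
    have "?E (idx Bs x) = ?E (\<sigma> (idx Bs' x))" using eq[OF that] s1(2)[OF i(2)] by simp
    then show ?thesis using inj(1) i(1) s1(1)[OF i(2)] by (simp add: inj_on_def)
  qed
  have B: "Bs' ! i = Bs ! \<sigma> i" if i: "i < ?k" for i
  proof -
    have 1: "x \<in> Bs ! i \<longleftrightarrow> idx Bs x = i" if "ordered_partition Bs X" "i < length Bs" "x \<in> X" for Bs i x
      using idx_eq[OF that(1,2)] idx_mem[OF that(1,3)] by auto
    have "x \<in> Bs' ! i \<longleftrightarrow> x \<in> Bs ! \<sigma> i" if x: "x \<in> X" for x
    proof -
      have "idx Bs' x = i \<longleftrightarrow> \<sigma> (idx Bs' x) = \<sigma> i"
        using injs idx_mem(1)[OF d'(1) x] kk i by (auto simp: inj_on_def)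
      then show ?thesis
        using 1[OF d'(1) _ x, of i] 1[OF d(1) s1(1)[OF i] x] idx[OF x] i kk by simp
    qed
    moreover have "Bs' ! i \<subseteq> X" "Bs ! \<sigma> i \<subseteq> X"
      using ordered_partition_subset[OF d'(1), of i] ordered_partition_subset[OF d(1) s1(1)[OF i]] i kk
      by simp_all
    ultimately show ?thesis by blast
  qed
  have ps: "ps' ! i = ps ! \<sigma> i" if i: "i < ?k" for i
  proof (rule P.faithful)
    show v1: "ps' ! i \<in> vals P (Bs' ! i)" using d'(4) i kk by simp
    show v2: "ps ! \<sigma> i \<in> vals P (Bs' ! i)" using d(4)[OF s1(1)[OF i]] B[OF i] by simp
    fix x assume x: "x \<in> Bs' ! i"
    then have xX: "x \<in> X" using ordered_partition_subset[OF d'(1), of i] i kk by auto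
    have "idx Bs' x = i" using idx_eq[OF d'(1) _ x] i kk by simp
    then show "e (ps' ! i) x = e (ps ! \<sigma> i) x"
      using fun_cong[OF w, of x] unfolding d(6)[OF xX] d'(6)[OF xX] idx[OF xX] using s1(2)[OF i] by simp
  qed
  have "Bs' = permute_list \<sigma> Bs"
    by (rule nth_equalityI) (simp_all add: kk B permute_list_nth[OF perm])
  moreover have "ps' = permute_list \<sigma> ps"
    by (rule nth_equalityI) (simp_all add: kk ps d(3) d'(3) permute_list_nth[of \<sigma> ps] perm)
  ultimately show ?thesis using that perm v by blast
qed

lemma orbit_eq:
  assumes X: "fin_ne X" and p: "p \<in> precomp V P X"
  shows "orbit V p = {p' \<in> precomp V P X. pJ p' = pJ p \<and> pw p' = pw p}"
proof -
  obtain v Bs ps where pp: "p = (v, Bs, ps)" by (cases p)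
  show ?thesis
  proof (intro equalityI subsetI)
    fix p' assume "p' \<in> orbit V p"
    then show "p' \<in> {p' \<in> precomp V P X. pJ p' = pJ p \<and> pw p' = pw p}"
      using orbit_subset[OF X p[unfolded pp]] by (auto simp: orbit_def pp)
  next
    fix p' assume p': "p' \<in> {p' \<in> precomp V P X. pJ p' = pJ p \<and> pw p' = pw p}"
    obtain v' Bs' ps' where pp': "p' = (v', Bs', ps')" by (cases p')
    obtain \<sigma> where "\<sigma> permutes {..<length Bs}" "v' = pull V {..<length Bs} \<sigma> v"
      "Bs' = permute_list \<sigma> Bs" "ps' = permute_list \<sigma> ps"
      using same_orbit[OF X p[unfolded pp], of v' Bs' ps'] p' by (auto simp: pp pp')
    then show "p' \<in> orbit V p" by (auto simp: orbit_def pp pp')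
  qed
qed

definition "B n X = comp_vals (homogeneous V n) P X"
text \<open>\<open>pJ\<close> and \<open>pw\<close> are constant on orbits by
  \<open>orbit_eq\<close>, so these images are singletons.\<close>

definition "bJ b = the_elem (pJ ` b)"
definition "bw b = the_elem (pw ` b)"

lemma orbit_keys:
  assumes "fin_ne X" "p \<in> precomp V P X"
  shows "bJ (orbit V p) = pJ p" "bw (orbit V p) = pw p"
proof -
  have "pJ ` orbit V p = {pJ p}" "pw ` orbit V p = {pw p}"
    unfolding orbit_eq[OF assms] using assms(2) by auto
  then show "bJ (orbit V p) = pJ p" "bw (orbit V p) = pw p" by (simp_all add: bJ_def bw_def)
qed

lemma precomp_homogeneous:
  assumes "fin_ne X"
  shows "p \<in> precomp (homogeneous V n) P X \<longleftrightarrow> p \<in> precomp V P X \<and> card (pJ p) = n"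
proof -
  obtain v Bs ps where p: "p = (v, Bs, ps)" by (cases p)
  have "p \<in> precomp (homogeneous V n) P X \<longleftrightarrow> p \<in> precomp V P X \<and> hdeg V {..<length Bs} v = n"
    by (auto simp: p precomp_def homogeneous_def)
  then show ?thesis using precompD(8)[of v Bs ps, OF _ assms] by (auto simp: p)
qed

lemma B_iff:
  assumes "fin_ne X"
  shows "b \<in> B n X \<longleftrightarrow> (\<exists>p\<in>precomp V P X. b = orbit V p \<and> card (pJ p) = n)"
proof -
  have o: "orbit (homogeneous V n) = orbit V" by (simp add: orbit_def homogeneous_def)
  show ?thesis unfolding B_def comp_vals_def o image_iff using precomp_homogeneous[OF assms] by blast
qed

lemma B_E:
  assumes "fin_ne X" "b \<in> B n X"
  obtains v Bs ps where "(v, Bs, ps) \<in> precomp V P X" "b = orbit V (v, Bs, ps)"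
    "bJ b = pJ (v, Bs, ps)" "bw b = pw (v, Bs, ps)" "card (pJ (v, Bs, ps)) = n"
proof -
  obtain p where "p \<in> precomp V P X" "b = orbit V p" "card (pJ p) = n"
    using B_iff[OF assms(1)] assms(2) by blast
  then show ?thesis using that orbit_keys[OF assms(1), of p] by (cases p) auto
qed

text \<open>Nests the generators of the box: one direction goes to the root, and each of its inputs
  receives the nesting for the remaining directions. In this way cells of the matrix product get
  counterparts in \<open>P\<close>.\<close>

lemma realize_P:
  assumes "finite J" "valid_box Fs J n g" "fin_ne X" "bij_betw u X (grid Fs J n g)"
  shows "\<exists>a\<in>vals P X. \<forall>x\<in>X. e a x = u x"
  using assms
proof (induction J arbitrary: X u rule: finite_induct)
  case empty
  then have "card X = 1" using bij_betw_same_card[OF empty.prems(3)] by (simp add: grid_empty)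
  then obtain x where x: "X = {x}" by (auto simp: card_1_singleton_iff)
  have "u x = nil_addr" using empty.prems(3) x by (simp add: grid_empty bij_betw_def)
  then show ?case
    using closed_operadD(3)[OF P.closed, of x] addr_homD(2)[OF P.addr] x by (intro bexI[of _ "ounit P x"]) auto
next
  case (insert j J)
  have j: "j < length Fs" "n j > 0" "g j \<in> vals (Fs ! j) {..<n j}"
    and vb: "valid_box Fs J n g" using insert.prems(1) by (auto simp: valid_box_def)
  have gc: "good_coll (Fs ! j)" using good j(1) by simp
  let ?l = "letter (Fs ! j) {..<n j} (g j)" and ?G = "grid Fs (insert j J) n g"
  let ?X = "\<lambda>c. {x \<in> X. u x j = [?l c]}"
  \<comment> \<open>With the letter of direction \<open>j\<close> dropped, \<open>u\<close> maps
    each \<open>?X c\<close> bijectively onto the grid for \<open>J\<close>.\<close>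
  let ?u = "\<lambda>x. (u x)(j := [])"
  have inj: "inj_on u X" and im: "u ` X = ?G" using insert.prems(3) by (auto simp: bij_betw_def)
  have li: "c = d" if "?l c = ?l d" "c < n j" for c d
    using letter_inj[OF gc _ j(3), of c d] that j(2) by simp
  have uG: "u x \<in> ?G" if "x \<in> X" for x using im that by blast
  have bij: "bij_betw ?u (?X c) (grid Fs J n g)" if c: "c < n j" for c
    unfolding bij_betw_def
  proof
    show "inj_on ?u (?X c)"
    proof (rule inj_onI)
      fix x y assume a: "x \<in> ?X c" "y \<in> ?X c" "?u x = ?u y"
      have "u x i = u y i" for i
        using a(1,2) fun_cong[OF a(3), of i] by (cases "i = j") simp_all
      then have "u x = u y" by blast
      then show "x = y" using inj a by (auto simp: inj_on_def)
    qed
    show "?u ` ?X c = grid Fs J n g"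
    proof (intro equalityI subsetI)
      fix y assume "y \<in> ?u ` ?X c"
      then obtain x where x: "x \<in> X" "y = ?u x" by auto
      show "y \<in> grid Fs J n g" using uG[OF x(1)] insert.hyps(2) unfolding x(2) by (auto simp: grid_def)
    next
      fix y assume y: "y \<in> grid Fs J n g"
      have "y(j := [?l c]) \<in> ?G" using y c by (auto simp: grid_def)
      then obtain x where x: "x \<in> X" "u x = y(j := [?l c])" using im by (metis imageE)
      have "y j = []" using y insert.hyps(2) by (auto simp: grid_def)
      then have "?u x = y" by (auto simp: x(2) fun_eq_iff)
      then show "y \<in> ?u ` ?X c" using x by (intro image_eqI[of _ _ x]) auto
    qed
  qed
  have fX: "finite X" using insert.prems(2) by (simp add: fin_ne_def)
  have ne: "?X c \<noteq> {}" if "c < n j" for c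
    using bij_betw_imp_surj_on[OF bij[OF that]] grid_nonempty[OF vb] by (metis image_empty)
  have "\<exists>a\<in>vals P (?X c). \<forall>x\<in>?X c. e a x = ?u x" if c: "c < n j" for c
    by (rule insert.IH[OF vb _ bij[OF c]]) (use fX ne[OF c] in \<open>simp add: fin_ne_def\<close>)
  then have "\<forall>c\<in>{..<n j}. \<exists>a. a \<in> vals P (?X c) \<and> (\<forall>x\<in>?X c. e a x = ?u x)" by blast
  from bchoice[OF this] obtain a where
    "\<forall>c\<in>{..<n j}. a c \<in> vals P (?X c) \<and> (\<forall>x\<in>?X c. e (a c) x = ?u x)" ..
  then have a: "\<And>c. c < n j \<Longrightarrow> a c \<in> vals P (?X c)"
    "\<And>c x. c < n j \<Longrightarrow> x \<in> ?X c \<Longrightarrow> e (a c) x = ?u x" by simp_all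
  define Bs where "Bs = map ?X [0..<n j]"
  have Bs: "length Bs = n j" "Bs \<noteq> []" "\<And>c. c < n j \<Longrightarrow> Bs ! c = ?X c"
    using j(2) by (auto simp: Bs_def)
  have op: "ordered_partition Bs X"
  proof (rule ordered_partitionI[OF fX])
    show "(\<Union>i<length Bs. Bs ! i) = X"
    proof (intro equalityI subsetI)
      fix x assume "x \<in> X"
      then obtain c where "c < n j" "u x j = [?l c]" using uG[of x] by (auto simp: grid_def)
      then show "x \<in> (\<Union>i<length Bs. Bs ! i)" using Bs \<open>x \<in> X\<close> by (intro UN_I[of c]) auto
    qed (use Bs in auto)
    show "Bs ! i \<inter> Bs ! k = {}" if "i < length Bs" "k < length Bs" "i \<noteq> k" for i k
      using li[of i k] that Bs by auto
  qed (use ne Bs in auto)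
  have gv: "\<gamma> j (n j) (g j) \<in> vals P {..<length Bs}" using P.gen_vals[OF j] Bs by simp
  have lq: "length (map a [0..<n j]) = length Bs" using Bs by simp
  have qv: "map a [0..<n j] ! c \<in> vals P (Bs ! c)" if "c < length Bs" for c using a(1) Bs that by simp
  let ?a = "ocomp P (\<gamma> j (n j) (g j)) Bs (map a [0..<n j])"
  have "e ?a x = u x" if x: "x \<in> X" for x
  proof -
    obtain c where c: "c < length Bs" "x \<in> Bs ! c" using ordered_partition_index[OF op x] .
    have "e ?a x = cat (gen_addr Fs (n j) (g j) j c) (?u x)"
      using addr_homD(3)[OF P.addr op Bs(2) gv lq qv c] P.gen_addr[OF j, of c] a(2)[of c x] c Bs by simp
    also have "\<dots> = u x"
      using c Bs by (auto simp: cat_def gen_addr_def fun_eq_iff)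
    finally show ?thesis .
  qed
  then show ?case using closed_operadD(4)[OF P.closed op Bs(2) gv lq qv] by blast
qed

text \<open>\<open>a\<close> is divided by the generators of \<open>J\<close>, one direction at a
  time; the factor at \<open>u\<close> collects the leaves below the input \<open>u\<close> of the
  nested generators.\<close>

lemma decompose:
  assumes "finite J" "a \<in> vals P X" "\<And>j. j \<in> J \<Longrightarrow> rooted Fs (n j) (g j) j X (e a)" "u \<in> grid Fs J n g"
  shows "{x \<in> X. heads J (e a x) = u} \<noteq> {} \<and>
    (\<exists>p\<in>vals P {x \<in> X. heads J (e a x) = u}. \<forall>x\<in>X. heads J (e a x) = u \<longrightarrow> e a x = cat u (e p x))"
  using assms
proof (induction J arbitrary: u rule: finite_induct)
  case empty
  have "{x \<in> X. heads {} (e a x) = u} = X" using empty.prems(3) by (simp add: grid_empty heads_def nil_addr_def)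
  moreover have "X \<noteq> {}" using closed_operadD(1)[OF P.closed empty.prems(1)] by (simp add: fin_ne_def)
  ultimately show ?case using empty.prems(1,3) by (auto simp: grid_empty)
next
  case (insert j J)
  have r: "rooted Fs (n j) (g j) j X (e a)" using insert.prems(2) by simp
  let ?l = "letter (Fs ! j) {..<n j} (g j)"
  define u' where "u' = u(j := [])"
  have u': "u' \<in> grid Fs J n g" using insert.prems(3) insert.hyps(2) by (auto simp: grid_def u'_def)
  obtain c where c: "c < n j" "u j = [?l c]" using insert.prems(3) by (auto simp: grid_def)
  have uu: "u = cat u' (gen_addr Fs (n j) (g j) j c)"
    using c by (auto simp: cat_def gen_addr_def u'_def fun_eq_iff)
  let ?X = "{x \<in> X. heads J (e a x) = u'}"
  from insert.IH[OF insert.prems(1) _ u'] insert.prems(2)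
  obtain p where p: "p \<in> vals P ?X" "\<And>x. x \<in> ?X \<Longrightarrow> e a x = cat u' (e p x)" by blast
  \<comment> \<open>The point \<open>u'\<close> has no letter in direction \<open>j\<close>, so the
    division so far leaves these words untouched and \<open>p\<close> is still rooted at
    \<open>g j\<close>.\<close>
  have pj: "e p x j = e a x j" if "x \<in> ?X" for x using p(2)[OF that] by (simp add: cat_def u'_def)
  have rp: "rooted Fs (n j) (g j) j ?X (e p)" using r pj by (auto simp: rooted_def)
  have part: "part Fs (n j) (g j) j ?X (e p) c = {x \<in> X. heads (insert j J) (e a x) = u}"
  proof (intro equalityI subsetI)
    fix x assume x: "x \<in> part Fs (n j) (g j) j ?X (e p) c"
    then have xX: "x \<in> ?X" by (auto simp: part_def)
    obtain l where "e a x j = ?l c # l" using x pj[OF xX] by (auto simp: part_def)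
    then have "heads (insert j J) (e a x) = u"
      using xX c insert.hyps(2) by (auto simp: heads_def u'_def fun_eq_iff split: if_splits)
    then show "x \<in> {x \<in> X. heads (insert j J) (e a x) = u}" using xX by simp
  next
    fix x assume "x \<in> {x \<in> X. heads (insert j J) (e a x) = u}"
    then have x: "x \<in> X" and h: "\<And>i. heads (insert j J) (e a x) i = u i" by auto
    have "heads J (e a x) i = u' i" for i
      using h[of i] insert.hyps(2) by (auto simp: heads_def u'_def)
    then have xX: "x \<in> ?X" using x by blast
    have "take 1 (e a x j) = [?l c]" using h[of j] c by (simp add: heads_def)
    then have "\<exists>l. e p x j = ?l c # l" using pj[OF xX] by (cases "e a x j") auto
    then show "x \<in> part Fs (n j) (g j) j ?X (e p) c" using xX by (auto simp: part_def)
  qed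
  obtain q where q: "q \<in> vals P (part Fs (n j) (g j) j ?X (e p) c)"
    "\<And>x. x \<in> part Fs (n j) (g j) j ?X (e p) c \<Longrightarrow> e p x = cat (gen_addr Fs (n j) (g j) j c) (e q x)"
    using P.division[OF p(1) rp c(1)] by blast
  have "e a x = cat u (e q x)" if "x \<in> X" "heads (insert j J) (e a x) = u" for x
  proof -
    have x: "x \<in> part Fs (n j) (g j) j ?X (e p) c" unfolding part using that by simp
    then have "x \<in> ?X" by (auto simp: part_def)
    then have "e a x = cat u' (cat (gen_addr Fs (n j) (g j) j c) (e q x))"
      using p(2) by (simp only: q(2)[OF x])
    then show ?thesis by (simp only: uu cat_assoc)
  qed
  then show ?case
    using P.part_ne[OF p(1) rp c(1)] q(1) unfolding part by blast
qed

text \<open>The elements of \<open>P\<close> over \<open>X\<close> in the form of their addresses,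
  which determine them.\<close>

definition "A X = (\<lambda>a. restr X (e a)) ` vals P X"
definition "S X u = {i. \<exists>n g. rooted Fs n g i X u}"

lemma S_cong: "(\<And>x. x \<in> X \<Longrightarrow> u x = u' x) \<Longrightarrow> S X u = S X u'"
  unfolding S_def using rooted_cong(1)[of X u u'] by simp

lemma S_restr [simp]: "S X (restr X u) = S X u"
  by (rule S_cong) (simp add: restr_def)

lemma S_empty_iff:
  assumes "a \<in> vals P X"
  shows "S X (e a) = {} \<longleftrightarrow> (\<exists>x. X = {x} \<and> a = ounit P x)"
proof
  show "S X (e a) = {} \<Longrightarrow> \<exists>x. X = {x} \<and> a = ounit P x"
    using P.root[OF assms] by (auto simp: S_def)
  assume "\<exists>x. X = {x} \<and> a = ounit P x"
  then show "S X (e a) = {}"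
    using addr_homD(2)[OF P.addr] by (auto simp: S_def rooted_def nil_addr_def)
qed

lemma unit_iff:
  assumes "a \<in> vals P {x}"
  shows "a = ounit P x \<longleftrightarrow> e a x = nil_addr"
  using P.faithful[OF assms closed_operadD(3)[OF P.closed]] addr_homD(2)[OF P.addr, of x] by auto

text \<open>\<open>realize_P\<close> replaces the cell \<open>v\<close> by an element
  \<open>a0\<close> of \<open>P\<close> with the same addresses, so the addresses of
  \<open>b\<close> are those of the composite of \<open>a0\<close> with \<open>ps\<close>.\<close>

lemma B_sound:
  assumes X: "fin_ne X" and b: "b \<in> B n X"
  shows "bw b \<in> A X" "bJ b \<subseteq> S X (bw b)" "card (bJ b) = n"
proof -
  obtain v Bs ps where p: "(v, Bs, ps) \<in> precomp V P X" "bJ b = pJ (v, Bs, ps)"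
    "bw b = pw (v, Bs, ps)" "card (pJ (v, Bs, ps)) = n"
    using B_E[OF X b] by metis
  note d = precompD[OF p(1) X]
  let ?k = "length Bs" and ?J = "pJ (v, Bs, ps)"
  obtain nn g where g: "valid_box Fs ?J nn g" "bij_betw (ev {..<?k} v) {..<?k} (grid Fs ?J nn g)"
    using d(8) by blast
  have "finite ?J" using g(1) by (auto simp: valid_box_def intro: finite_subset)
  then obtain a0 where a0: "a0 \<in> vals P {..<?k}" "\<And>i. i < ?k \<Longrightarrow> e a0 i = ev {..<?k} v i"
    using realize_P[OF _ g(1) _ g(2)] d(5) by auto
  have ne: "Bs \<noteq> []" using d(5) by auto
  let ?a = "ocomp P a0 Bs ps"
  have a: "?a \<in> vals P X" by (rule closed_operadD(4)[OF P.closed d(1) ne a0(1) d(3,4)])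
  have "bw b = restr X (e ?a)"
  proof
    fix x show "bw b x = restr X (e ?a) x"
    proof (cases "x \<in> X")
      case True
      note i = idx_mem[OF d(1) True]
      show ?thesis
        using addr_homD(3)[OF P.addr d(1) ne a0(1) d(3,4) i] a0(2)[OF i(1)] d(6)[OF True] True
        by (simp add: p(3) restr_def)
    qed (use d(7) p(3) in \<open>simp add: restr_def\<close>)
  qed
  then show "bw b \<in> A X" using a by (simp add: A_def)
  show "bJ b \<subseteq> S X (bw b)"
  proof
    fix j assume j: "j \<in> bJ b"
    have "rooted Fs (nn j) (g j) j X (bw b)"
      unfolding rooted_def
    proof (intro conjI ballI)
      show "j < length Fs" "nn j > 0" "g j \<in> vals (Fs ! j) {..<nn j}"
        using g(1) j p(2) by (auto simp: valid_box_def)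
      fix x assume x: "x \<in> X"
      have "ev {..<?k} v (idx Bs x) \<in> grid Fs ?J nn g"
        using g(2) idx_mem(1)[OF d(1) x] by (auto simp: bij_betw_def)
      then obtain c where "c < nn j" "ev {..<?k} v (idx Bs x) j = [letter (Fs ! j) {..<nn j} (g j) c]"
        using j p(2) by (auto simp: grid_def)
      then show "\<exists>c<nn j. \<exists>l. bw b x j = letter (Fs ! j) {..<nn j} (g j) c # l"
        using d(6)[OF x] p(3) by (auto simp: cat_def)
    qed
    then show "j \<in> S X (bw b)" by (auto simp: S_def)
  qed
  show "card (bJ b) = n" using p by simp
qed

text \<open>The blocks are the sets of leaves with common first letters in the directions
  \<open>I\<close>; the factors come from \<open>decompose\<close> and the cell from
  \<open>realize\<close>.\<close>

lemma B_complete: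
  assumes X: "fin_ne X" and u: "u \<in> A X" and I: "I \<subseteq> S X u"
  shows "\<exists>b\<in>B (card I) X. bJ b = I \<and> bw b = u"
proof -
  obtain a where a: "a \<in> vals P X" "u = restr X (e a)" using u by (auto simp: A_def)
  have "I \<subseteq> S X (e a)" using I by (simp add: a(2))
  then have "\<forall>j\<in>I. \<exists>n g. rooted Fs n g j X (e a)" by (auto simp: S_def)
  then obtain n g where r: "\<And>j. j \<in> I \<Longrightarrow> rooted Fs (n j) (g j) j X (e a)" by metis
  have vb: "valid_box Fs I n g" using r by (auto simp: valid_box_def rooted_def)
  have fI: "finite I" using vb by (auto simp: valid_box_def intro: finite_subset)
  let ?K = "grid Fs I n g" and ?h = "\<lambda>x. heads I (e a x)"
  note D = decompose[OF fI a(1) r]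
  have hK: "?h x \<in> ?K" if x: "x \<in> X" for x
    unfolding grid_def
  proof (intro CollectI conjI ballI allI impI)
    fix j assume j: "j \<in> I"
    then obtain c l where "c < n j" "e a x j = letter (Fs ! j) {..<n j} (g j) c # l"
      using r[OF j] x by (auto simp: rooted_def)
    then show "\<exists>c<n j. ?h x j = [letter (Fs ! j) {..<n j} (g j) c]" using j by (auto simp: heads_def)
  qed (simp add: heads_def)
  have im: "?h ` X = ?K"
  proof (intro equalityI subsetI)
    fix y assume "y \<in> ?K"
    then show "y \<in> ?h ` X" using D[of y] by auto
  qed (use hK in auto)
  have fX: "finite X" "X \<noteq> {}" using X by (auto simp: fin_ne_def)
  have fK: "finite ?K" "?K \<noteq> {}" unfolding im[symmetric] using fX by simp_all
  define k where "k = card ?K"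
  have k: "k > 0" using fK by (simp add: k_def card_gt_0_iff)
  \<comment> \<open>The cell needs a standard carrier, so the points of the grid are numbered
    arbitrarily; another numbering changes the triple only within its orbit.\<close>
  obtain \<beta> where \<beta>: "bij_betw \<beta> {..<k} ?K"
    using ex_bij_betw_nat_finite[OF fK(1)] by (auto simp: k_def atLeast0LessThan)
  obtain v where v: "v \<in> vals V {..<k}" "\<And>i. i < k \<Longrightarrow> ev {..<k} v i = \<beta> i"
    using V.realize[OF _ vb \<beta>] k by auto
  let ?X = "\<lambda>i. {x \<in> X. ?h x = \<beta> i}"
  have \<beta>K: "\<beta> i \<in> ?K" if "i < k" for i using \<beta> that by (auto simp: bij_betw_def)
  have "\<exists>p\<in>vals P (?X i). \<forall>x\<in>X. ?h x = \<beta> i \<longrightarrow> e a x = cat (\<beta> i) (e p x)" if "i < k" for i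
    using D[OF _ \<beta>K[OF that]] by blast
  then have "\<forall>i\<in>{..<k}. \<exists>p. p \<in> vals P (?X i) \<and> (\<forall>x\<in>X. ?h x = \<beta> i \<longrightarrow> e a x = cat (\<beta> i) (e p x))"
    by blast
  from bchoice[OF this] obtain p where
    "\<forall>i\<in>{..<k}. p i \<in> vals P (?X i) \<and> (\<forall>x\<in>X. ?h x = \<beta> i \<longrightarrow> e a x = cat (\<beta> i) (e (p i) x))" ..
  then have p: "\<And>i. i < k \<Longrightarrow> p i \<in> vals P (?X i)"
    "\<And>i x. i < k \<Longrightarrow> x \<in> X \<Longrightarrow> ?h x = \<beta> i \<Longrightarrow> e a x = cat (\<beta> i) (e (p i) x)" by simp_all
  define Bs where "Bs = map ?X [0..<k]"
  define ps where "ps = map p [0..<k]"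
  have Bs: "length Bs = k" "length ps = k" "\<And>i. i < k \<Longrightarrow> Bs ! i = ?X i" "\<And>i. i < k \<Longrightarrow> ps ! i = p i"
    by (simp_all add: Bs_def ps_def)
  have op: "ordered_partition Bs X"
  proof (rule ordered_partitionI[OF fX(1)])
    show "Bs ! i \<noteq> {}" if "i < length Bs" for i using D[OF _ \<beta>K[of i]] that Bs by simp
    show "(\<Union>i<length Bs. Bs ! i) = X"
    proof (intro equalityI subsetI)
      fix x assume x: "x \<in> X"
      then have "?h x \<in> \<beta> ` {..<k}" using hK \<beta> by (auto simp: bij_betw_def)
      then obtain i where "i < k" "?h x = \<beta> i" by blast
      then show "x \<in> (\<Union>i<length Bs. Bs ! i)" using x Bs by (intro UN_I[of i]) auto
    qed (use Bs in auto)
    show "Bs ! i \<inter> Bs ! j = {}" if "i < length Bs" "j < length Bs" "i \<noteq> j" for i j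
    proof -
      have "\<beta> i \<noteq> \<beta> j" using \<beta> that Bs(1) by (auto simp: bij_betw_def inj_on_def)
      then show ?thesis using that Bs by auto
    qed
  qed
  let ?p = "(v, Bs, ps)"
  have pc: "?p \<in> precomp V P X"
    by (rule precompI[OF op]) (use v p Bs in auto)
  note d = precompD[OF pc X]
  have "pJ ?p = I"
    using grid_support[OF \<beta>K[OF k]] v(2)[OF k] Bs(1) by (simp add: pJ_def)
  moreover have "pw ?p = u"
  proof
    fix x show "pw ?p x = u x"
    proof (cases "x \<in> X")
      case True
      note i = idx_mem[OF op True]
      then have "?h x = \<beta> (idx Bs x)" using Bs by auto
      then show ?thesis using p(2)[of "idx Bs x" x] v(2)[of "idx Bs x"] d(6)[OF True] i Bs True
        by (simp add: a(2) restr_def)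
    qed (use d(7) in \<open>simp add: a(2) restr_def\<close>)
  qed
  ultimately show ?thesis
    using orbit_keys[OF X pc] B_iff[OF X, of "orbit V ?p"] pc by (intro bexI[of _ "orbit V ?p"]) auto
qed

lemma A_S: "u \<in> A X \<Longrightarrow> S X u = {} \<longleftrightarrow> (\<exists>x. X = {x} \<and> u = restr X (e (ounit P x)))"
proof
  assume u: "u \<in> A X"
  then obtain a where a: "a \<in> vals P X" "u = restr X (e a)" by (auto simp: A_def)
  show "S X u = {} \<Longrightarrow> \<exists>x. X = {x} \<and> u = restr X (e (ounit P x))"
    using S_empty_iff[OF a(1)] a(2) by auto
  show "\<exists>x. X = {x} \<and> u = restr X (e (ounit P x)) \<Longrightarrow> S X u = {}"
    using S_empty_iff[OF closed_operadD(3)[OF P.closed]] by auto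
qed

lemma simplices: "simplices B bJ bw A S"
proof
  fix X :: "nat set" and n
  assume X: "fin_ne X"
  show "bij_betw (\<lambda>b. (bJ b, bw b)) (B n X) {(I, u). u \<in> A X \<and> I \<subseteq> S X u \<and> card I = n}"
    unfolding bij_betw_def
  proof
    show "inj_on (\<lambda>b. (bJ b, bw b)) (B n X)"
    proof (rule inj_onI)
      fix b b' assume b: "b \<in> B n X" "b' \<in> B n X" "(bJ b, bw b) = (bJ b', bw b')"
      obtain p where p: "p \<in> precomp V P X" "b = orbit V p" using b(1) B_iff[OF X] by blast
      obtain p' where p': "p' \<in> precomp V P X" "b' = orbit V p'" using b(2) B_iff[OF X] by blast
      have "pJ p = pJ p'" "pw p = pw p'"
        using b(3) unfolding p(2) p'(2) by (simp_all add: orbit_keys[OF X p(1)] orbit_keys[OF X p'(1)])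
      then show "b = b'" unfolding p(2) p'(2) by (simp add: orbit_eq[OF X p(1)] orbit_eq[OF X p'(1)])
    qed
    show "(\<lambda>b. (bJ b, bw b)) ` B n X = {(I, u). u \<in> A X \<and> I \<subseteq> S X u \<and> card I = n}"
    proof (intro equalityI subsetI)
      fix z assume "z \<in> {(I, u). u \<in> A X \<and> I \<subseteq> S X u \<and> card I = n}"
      then obtain I u where z: "z = (I, u)" "u \<in> A X" "I \<subseteq> S X u" "card I = n" by auto
      show "z \<in> (\<lambda>b. (bJ b, bw b)) ` B n X" using B_complete[OF X z(2,3)] z(1,4) by force
    next
      fix z assume "z \<in> (\<lambda>b. (bJ b, bw b)) ` B n X"
      then obtain b where b: "b \<in> B n X" "z = (bJ b, bw b)" by blast
      then show "z \<in> {(I, u). u \<in> A X \<and> I \<subseteq> S X u \<and> card I = n}"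
        using B_sound[OF X b(1)] by simp
    qed
  qed
next
  fix X u
  have "S X u \<subseteq> {..<length Fs}" by (auto simp: S_def rooted_def)
  then show "finite (S X u)" using finite_subset by blast
next
  fix X :: "nat set" assume "card X = 1"
  then obtain x where x: "X = {x}" by (auto simp: card_1_singleton_iff)
  have m: "restr X (e (ounit P x)) \<in> A X" using closed_operadD(3)[OF P.closed, of x] x by (auto simp: A_def)
  show "\<exists>!u. u \<in> A X \<and> S X u = {}"
  proof (rule ex1I[of _ "restr X (e (ounit P x))"])
    show "restr X (e (ounit P x)) \<in> A X \<and> S X (restr X (e (ounit P x))) = {}"
      using m A_S[OF m] x by blast
    show "u = restr X (e (ounit P x))" if "u \<in> A X \<and> S X u = {}" for u
      using A_S[of u X] that x by auto
  qed
next
  fix X u assume "card X \<noteq> 1" "u \<in> A X"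
  then show "S X u \<noteq> {}" using A_S by auto
qed

section \<open>Relabelling and the right action on the basis\<close>

lemma comp_pull_key:
  assumes X: "fin_ne X" and f: "inj_on f X" and b: "b \<in> B n (f ` X)"
  shows "comp_pull P X f b \<in> B n X" "bJ (comp_pull P X f b) = bJ b"
    "bw (comp_pull P X f b) = restr X (\<lambda>x. bw b (f x))"
proof -
  have Y: "fin_ne (f ` X)" using X by (simp add: fin_ne_def)
  obtain v Bs ps where p: "(v, Bs, ps) \<in> precomp V P (f ` X)" "b = orbit V (v, Bs, ps)"
    "bJ b = pJ (v, Bs, ps)" "bw b = pw (v, Bs, ps)" "card (pJ (v, Bs, ps)) = n"
    using B_E[OF Y b] by metis
  note d = precompD[OF p(1) Y]
  let ?h = "\<lambda>B. X \<inter> f -` B" and ?g = "\<lambda>B p. pull P (X \<inter> f -` B) f p"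
  let ?Bs = "map ?h Bs" and ?ps = "map2 ?g Bs ps"
  let ?p = "(v, ?Bs, ?ps)"
  have img: "f ` ?h (Bs ! i) = Bs ! i" if "i < length Bs" for i
    using ordered_partition_subset[OF d(1) that] by auto
  have fne: "fin_ne (?h (Bs ! i))" if "i < length Bs" for i
    using img[OF that] ordered_partition_nth(2)[OF d(1) that] X by (auto simp: fin_ne_def)
  have inj: "inj_on f (?h B)" for B by (rule inj_on_subset[OF f]) auto
  have op: "ordered_partition ?Bs X"
  proof (rule ordered_partitionI)
    show "finite X" using X by (simp add: fin_ne_def)
    show "(\<Union>i<length ?Bs. ?Bs ! i) = X"
    proof (intro equalityI subsetI)
      fix x assume x: "x \<in> X"
      then obtain i where "i < length Bs" "f x \<in> Bs ! i"
        using ordered_partition_index[OF d(1), of "f x"] by blast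
      then show "x \<in> (\<Union>i<length ?Bs. ?Bs ! i)" using x by (intro UN_I[of i]) auto
    qed auto
    show "?Bs ! i \<inter> ?Bs ! j = {}" if "i < length ?Bs" "j < length ?Bs" "i \<noteq> j" for i j
      using ordered_partition_nth(4)[OF d(1), of i j] that by auto
  qed (use fne in \<open>auto simp: fin_ne_def\<close>)
  have pc: "?p \<in> precomp V P X"
  proof (rule precompI[OF op])
    fix i assume i: "i < length ?Bs"
    show "?ps ! i \<in> vals P (?Bs ! i)"
      using closed_operadD(2)[OF P.closed fne inj, of i] i d(3,4) img by simp
  qed (use d(2,3) in simp_all)
  note d' = precompD[OF pc X]
  have J: "pJ ?p = pJ (v, Bs, ps)" by (simp add: pJ_def)
  have w: "pw ?p = restr X (\<lambda>x. pw (v, Bs, ps) (f x))"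
  proof
    fix x show "pw ?p x = restr X (\<lambda>x. pw (v, Bs, ps) (f x)) x"
    proof (cases "x \<in> X")
      case True
      then have fx: "f x \<in> f ` X" by simp
      note i = idx_mem[OF d(1) fx]
      have ix: "idx ?Bs x = idx Bs (f x)" by (rule idx_eq[OF op]) (use i True in auto)
      have "e (?ps ! idx Bs (f x)) x = e (ps ! idx Bs (f x)) (f x)"
        using addr_homD(1)[OF P.addr fne[OF i(1)] inj, of "ps ! idx Bs (f x)" x] i d(3,4) img True by simp
      then show ?thesis unfolding d'(6)[OF True] restr_in[OF True] d(6)[OF fx] ix by simp
    qed (use d'(7) in \<open>simp add: restr_def\<close>)
  qed
  have "comp_pull P X f b = orbit V ?p"
    unfolding comp_pull_def p(2) by (rule orbit_transform[OF d(3)])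
  then show "comp_pull P X f b \<in> B n X" "bJ (comp_pull P X f b) = bJ b"
    "bw (comp_pull P X f b) = restr X (\<lambda>x. bw b (f x))"
    using orbit_keys[OF X pc] B_iff[OF X] pc J w p by auto
qed

lemma ocomp_on:
  assumes op: "ordered_partition Bs X" and C: "C \<subseteq> {..<length Bs}" "p \<in> vals P C"
    and qs: "length qs = length Bs" "\<And>i. i < length Bs \<Longrightarrow> qs ! i \<in> vals P (Bs ! i)"
  shows "ocomp_on P C p Bs qs \<in> vals P (\<Union>i\<in>C. Bs ! i)"
    "c \<in> C \<Longrightarrow> x \<in> Bs ! c \<Longrightarrow> e (ocomp_on P C p Bs qs) x = cat (e p c) (e (qs ! c) x)"
proof -
  have fC: "fin_ne C" using closed_operadD(1)[OF P.closed C(2)] .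
  define cs where "cs = sorted_list_of_set C"
  have cs: "length cs = card C" "set cs = C" "distinct cs" using fC by (simp_all add: cs_def fin_ne_def)
  have n: "card C > 0" using fin_ne_card[OF fC] .
  have fn: "fin_ne {..<card C}" using n by simp
  have "bij_betw (\<lambda>i. cs ! i) {..<card C} C" by (rule bij_betw_nth[OF cs(3)]) (simp_all add: cs)
  then have im: "(\<lambda>i. cs ! i) ` {..<card C} = C" "inj_on (\<lambda>i. cs ! i) {..<card C}"
    unfolding bij_betw_def by blast+
  let ?p = "pull P {..<card C} (\<lambda>i. cs ! i) p" and ?Bs = "map (\<lambda>c. Bs ! c) cs" and ?qs = "map (\<lambda>c. qs ! c) cs"
  have nC: "cs ! i \<in> C" "cs ! i < length Bs" if "i < card C" for i
    using im(1) that C(1) by auto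
  have pv: "?p \<in> vals P {..<length ?Bs}"
    using closed_operadD(2)[OF P.closed fn im(2), of p] im(1) C(2) cs(1) by simp
  have op': "ordered_partition ?Bs (\<Union>i\<in>C. Bs ! i)"
  proof (rule ordered_partitionI)
    have "(\<Union>i\<in>C. Bs ! i) \<subseteq> (\<Union>i<length Bs. Bs ! i)" by (rule UN_mono[OF C(1)]) simp
    then have "(\<Union>i\<in>C. Bs ! i) \<subseteq> X" using ordered_partition_nth(3)[OF op] by simp
    then show "finite (\<Union>i\<in>C. Bs ! i)" using ordered_partition_nth(1)[OF op] finite_subset by blast
    show "?Bs ! i \<noteq> {}" if "i < length ?Bs" for i
      using ordered_partition_nth(2)[OF op nC(2)[of i]] that cs(1) by simp
    have "(\<Union>i<length ?Bs. ?Bs ! i) = (\<Union>i<card C. Bs ! (cs ! i))" using cs(1) by simp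
    also have "\<dots> = (\<Union>i\<in>(\<lambda>i. cs ! i) ` {..<card C}. Bs ! i)" by simp
    finally show "(\<Union>i<length ?Bs. ?Bs ! i) = (\<Union>i\<in>C. Bs ! i)" unfolding im(1) .
    show "?Bs ! i \<inter> ?Bs ! j = {}" if "i < length ?Bs" "j < length ?Bs" "i \<noteq> j" for i j
    proof -
      have "cs ! i \<noteq> cs ! j" using cs(1,3) that by (simp add: nth_eq_iff_index_eq)
      then show ?thesis using ordered_partition_nth(4)[OF op nC(2)[of i] nC(2)[of j]] that cs(1) by simp
    qed
  qed
  have ne: "?Bs \<noteq> []" using n cs(1) by auto
  have lq: "length ?qs = length ?Bs" by simp
  have qv: "?qs ! i \<in> vals P (?Bs ! i)" if "i < length ?Bs" for i
    using qs(2)[OF nC(2)[of i]] that cs(1) by simp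
  have eq: "ocomp_on P C p Bs qs = ocomp P ?p ?Bs ?qs" by (simp add: ocomp_on_def cs_def Let_def)
  show "ocomp_on P C p Bs qs \<in> vals P (\<Union>i\<in>C. Bs ! i)"
    unfolding eq by (rule closed_operadD(4)[OF P.closed op' ne pv lq qv])
  assume c: "c \<in> C" "x \<in> Bs ! c"
  obtain i where i: "i < card C" "cs ! i = c" using im(1) c(1) by (metis imageE lessThan_iff)
  have "e ?p i = e p c" using addr_homD(1)[OF P.addr fn im(2), of p i] im(1) C(2) i by simp
  then show "e (ocomp_on P C p Bs qs) x = cat (e p c) (e (qs ! c) x)"
    unfolding eq using addr_homD(3)[OF P.addr op' ne pv lq qv, of i x] i c(2) cs(1) by simp
qed

text \<open>The action grafts onto the factors \<open>ps\<close> and leaves the cell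
  \<open>v\<close> alone, so the directions stay and only the addresses grow.\<close>

lemma comp_act_key:
  assumes op: "ordered_partition Bs X" and Bs: "Bs \<noteq> []" and b: "b \<in> B n {..<length Bs}"
    and qs: "length qs = length Bs" "\<And>i. i < length Bs \<Longrightarrow> qs ! i \<in> vals P (Bs ! i)"
  shows "comp_act P b Bs qs \<in> B n X" "bJ (comp_act P b Bs qs) = bJ b"
    "bw (comp_act P b Bs qs) = restr X (\<lambda>x. cat (bw b (idx Bs x)) (e (qs ! idx Bs x) x))"
proof -
  have X: "fin_ne X" using ordered_partition_ne(1)[OF op Bs] .
  have Y: "fin_ne {..<length Bs}" using Bs by simp
  obtain v Cs ps where p: "(v, Cs, ps) \<in> precomp V P {..<length Bs}" "b = orbit V (v, Cs, ps)"
    "bJ b = pJ (v, Cs, ps)" "bw b = pw (v, Cs, ps)" "card (pJ (v, Cs, ps)) = n"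
    using B_E[OF Y b] by metis
  note d = precompD[OF p(1) Y]
  let ?h = "\<lambda>C. \<Union>i\<in>C. Bs ! i" and ?g = "\<lambda>C p. ocomp_on P C p Bs qs"
  let ?Cs = "map ?h Cs" and ?ps = "map2 ?g Cs ps"
  let ?p = "(v, ?Cs, ?ps)"
  have sub: "Cs ! i \<subseteq> {..<length Bs}" if "i < length Cs" for i
    using ordered_partition_subset[OF d(1) that] .
  have on: "ocomp_on P (Cs ! i) (ps ! i) Bs qs \<in> vals P (\<Union>c\<in>Cs ! i. Bs ! c)"
    "c \<in> Cs ! i \<Longrightarrow> x \<in> Bs ! c \<Longrightarrow>
      e (ocomp_on P (Cs ! i) (ps ! i) Bs qs) x = cat (e (ps ! i) c) (e (qs ! c) x)"
    if "i < length Cs" for i c x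
    using ocomp_on[OF op sub[OF that] d(4)[OF that] qs] by blast+
  have op': "ordered_partition ?Cs X"
  proof (rule ordered_partitionI)
    show "finite X" using X by (simp add: fin_ne_def)
    show "?Cs ! i \<noteq> {}" if "i < length ?Cs" for i
    proof -
      have "Cs ! i \<noteq> {}" using ordered_partition_nth(2)[OF d(1), of i] that by simp
      then obtain c where c: "c \<in> Cs ! i" by blast
      then have "c < length Bs" using sub[of i] that by auto
      then show ?thesis using ordered_partition_nth(2)[OF op, of c] c that by auto
    qed
    show "(\<Union>i<length ?Cs. ?Cs ! i) = X"
    proof -
      have "(\<Union>i<length ?Cs. ?Cs ! i) = (\<Union>c\<in>(\<Union>i<length Cs. Cs ! i). Bs ! c)" by simp
      also have "\<dots> = X" using ordered_partition_nth(3)[OF d(1)] ordered_partition_nth(3)[OF op] by simp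
      finally show ?thesis .
    qed
    show "?Cs ! i \<inter> ?Cs ! j = {}" if "i < length ?Cs" "j < length ?Cs" "i \<noteq> j" for i j
    proof -
      have "Bs ! c \<inter> Bs ! c' = {}" if c: "c \<in> Cs ! i" "c' \<in> Cs ! j" for c c'
      proof (rule ordered_partition_nth(4)[OF op])
        show "c < length Bs" "c' < length Bs"
          using sub[of i] sub[of j] c \<open>i < length ?Cs\<close> \<open>j < length ?Cs\<close> by auto
        show "c \<noteq> c'" using ordered_partition_nth(4)[OF d(1), of i j] c
            \<open>i < length ?Cs\<close> \<open>j < length ?Cs\<close> \<open>i \<noteq> j\<close> by auto
      qed
      then show ?thesis using that by (simp add: Int_UN_distrib2)
    qed
  qed
  have pc: "?p \<in> precomp V P X"
  proof (rule precompI[OF op'])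
    fix i assume "i < length ?Cs"
    then show "?ps ! i \<in> vals P (?Cs ! i)" using on(1)[of i] d(3) by simp
  qed (use d(2,3) in simp_all)
  note d' = precompD[OF pc X]
  have J: "pJ ?p = pJ (v, Cs, ps)" by (simp add: pJ_def)
  have w: "pw ?p = restr X (\<lambda>x. cat (pw (v, Cs, ps) (idx Bs x)) (e (qs ! idx Bs x) x))"
  proof
    fix x show "pw ?p x = restr X (\<lambda>x. cat (pw (v, Cs, ps) (idx Bs x)) (e (qs ! idx Bs x) x)) x"
    proof (cases "x \<in> X")
      case True
      let ?c = "idx Bs x"
      note c = idx_mem[OF op True]
      have cY: "?c \<in> {..<length Bs}" using c by simp
      note i = idx_mem[OF d(1) cY]
      have ix: "idx ?Cs x = idx Cs ?c" by (rule idx_eq[OF op']) (use i c in auto)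
      have "e (?ps ! idx Cs ?c) x = cat (e (ps ! idx Cs ?c) ?c) (e (qs ! ?c) x)"
        using on(2)[OF i c(2)] i(1) d(3) by simp
      then show ?thesis unfolding d'(6)[OF True] restr_in[OF True] d(6)[OF cY] ix by (simp add: cat_assoc)
    qed (use d'(7) in \<open>simp add: restr_def\<close>)
  qed
  have "comp_act P b Bs qs = orbit V ?p"
    unfolding comp_act_def p(2) by (rule orbit_transform[OF d(3)])
  then show "comp_act P b Bs qs \<in> B n X" "bJ (comp_act P b Bs qs) = bJ b"
    "bw (comp_act P b Bs qs) = restr X (\<lambda>x. cat (bw b (idx Bs x)) (e (qs ! idx Bs x) x))"
    using orbit_keys[OF X pc] B_iff[OF X] pc J w p by auto
qed

end

section \<open>The minimal resolution\<close>

lemma listsetD: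
  "qs \<in> listset As \<Longrightarrow> length qs = length As \<and> (\<forall>i<length As. qs ! i \<in> As ! i)"
proof (induction As arbitrary: qs)
  case (Cons A As)
  then obtain q qs' where "qs = q # qs'" "q \<in> A" "qs' \<in> listset As" by (auto simp: set_Cons_def)
  then show ?case using Cons.IH[of qs'] by (auto simp: nth_Cons split: nat.splits)
qed simp

lemma cat_eq_nil: "cat u w = nil_addr \<longleftrightarrow> u = nil_addr \<and> w = nil_addr"
  by (auto simp: cat_def nil_addr_def fun_eq_iff)

lemma free_rmodule_act:
  "mact (free_rmodule V P) m Bs as = (\<Sum>qs\<in>listset (map Poly_Mapping.keys as).
     lin_scale (\<Prod>i<length as. Poly_Mapping.lookup (as ! i) (qs ! i))
       (lin_map (\<lambda>b. comp_act P b Bs qs) m))"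
proof -
  have "mact (free_rmodule V P) m Bs as = (\<Sum>qs\<in>listset (map Poly_Mapping.keys as).
      \<Sum>b\<in>Poly_Mapping.keys m. Poly_Mapping.single (comp_act P b Bs qs)
        (Poly_Mapping.lookup m b * (\<Prod>i<length as. Poly_Mapping.lookup (as ! i) (qs ! i))))"
    by (simp add: free_rmodule_def) (rule sum.swap)
  also have "\<dots> = (\<Sum>qs\<in>listset (map Poly_Mapping.keys as).
     lin_scale (\<Prod>i<length as. Poly_Mapping.lookup (as ! i) (qs ! i))
       (lin_map (\<lambda>b. comp_act P b Bs qs) m))"
    by (rule sum.cong[OF HOL.refl]) (simp add: lin_map_def lin_scale_sum mult.commute)
  finally show ?thesis .
qed

lemma free_rmodule_simps:
  "mvals (free_rmodule V P) X = lin (comp_vals V P X)"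
  "mscale (free_rmodule V P) = lin_scale"
  "mpull (free_rmodule V P) X f = lin_map (comp_pull P X f)"
  by (simp_all add: free_rmodule_def)

context koszul
begin

interpretation K: simplices B bJ bw A S
  by (rule simplices)

abbreviation M :: "nat \<Rightarrow> ('k::field, 'a expr, ('a cell, 'a expr) precomp set \<Rightarrow>\<^sub>0 'k) rmodule" where
  "M \<equiv> graded_free_rmodule V P"

definition diff ::
  "nat \<Rightarrow> nat set \<Rightarrow> (('a cell, 'a expr) precomp set \<Rightarrow>\<^sub>0 'k::field) \<Rightarrow> (('a cell, 'a expr) precomp set \<Rightarrow>\<^sub>0 'k)"
  where "diff n X = lin_ext (K.bd n X)"

definition augm :: "nat set \<Rightarrow> (('a cell, 'a expr) precomp set \<Rightarrow>\<^sub>0 'k::field) \<Rightarrow> 'k" where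
  "augm X = lin_form (K.eps X)"

lemma M_simps:
  "mvals (M n) X = lin (B n X)" "mscale (M n) = lin_scale" "mpull (M n) X f = lin_map (comp_pull P X f)"
  "mact (M n) m Bs as = (\<Sum>qs\<in>listset (map Poly_Mapping.keys as).
     lin_scale (\<Prod>i<length as. Poly_Mapping.lookup (as ! i) (qs ! i))
       (lin_map (\<lambda>b. comp_act P b Bs qs) m))"
  by (simp_all add: graded_free_rmodule_def free_rmodule_simps free_rmodule_act B_def)

lemma lin_argsD:
  assumes "lin_args P X Bs as" "qs \<in> listset (map Poly_Mapping.keys as)"
  shows "length qs = length Bs" "\<And>i. i < length Bs \<Longrightarrow> qs ! i \<in> vals P (Bs ! i)"
  using assms listsetD[OF assms(2)] by (auto simp: lin_args_def lin_def)

lemma diff_mem: "fin_ne X \<Longrightarrow> \<phi> \<in> lin (B (Suc n) X) \<Longrightarrow> diff n X \<phi> \<in> lin (B n X)"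
  unfolding diff_def by (rule lin_ext_lin) (auto intro: K.bd_mem)

lemma diff_hom: "rmodule_hom P (M (Suc n)) (M n) (diff n :: _ \<Rightarrow> _ \<Rightarrow> _ \<Rightarrow>\<^sub>0 'k::field)"
  unfolding rmodule_hom_def M_simps(1-3)
proof (intro conjI allI impI ballI)
  fix X :: "nat set" and \<phi> :: "('a cell, 'a expr) precomp set \<Rightarrow>\<^sub>0 'k"
  assume "fin_ne X" "\<phi> \<in> lin (B (Suc n) X)"
  then show "diff n X \<phi> \<in> lin (B n X)" by (rule diff_mem)
next
  fix X f and \<phi> :: "('a cell, 'a expr) precomp set \<Rightarrow>\<^sub>0 'k"
  assume X: "fin_ne X \<and> inj_on f X" and \<phi>: "\<phi> \<in> lin (B (Suc n) (f ` X))"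
  have Y: "fin_ne (f ` X)" using X by (simp add: fin_ne_def)
  have "lin_map (comp_pull P X f) (lin_ext (K.bd n (f ` X)) \<phi>) =
      lin_ext (K.bd n X) (lin_map (comp_pull P X f) \<phi>)"
    by (rule K.bd_natural[OF _ Y \<phi>, where G = "\<lambda>u. restr X (\<lambda>x. u (f x))"])
      (use X comp_pull_key[of X f] in auto)
  then show "diff n X (lin_map (comp_pull P X f) \<phi>) = lin_map (comp_pull P X f) (diff n (f ` X) \<phi>)"
    by (simp add: diff_def)
next
  fix X Bs and as :: "('a expr \<Rightarrow>\<^sub>0 'k) list" and m :: "('a cell, 'a expr) precomp set \<Rightarrow>\<^sub>0 'k"
  assume la: "lin_args P X Bs as" and m: "m \<in> lin (B (Suc n) {..<length Bs})"
  have op: "ordered_partition Bs X" "Bs \<noteq> []" using la by (auto simp: lin_args_def)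
  have X: "fin_ne X" using ordered_partition_ne(1)[OF op] .
  have "lin_ext (K.bd n X) (lin_map (\<lambda>b. comp_act P b Bs qs) m) =
      lin_map (\<lambda>b. comp_act P b Bs qs) (lin_ext (K.bd n {..<length Bs}) m)"
    if qs: "qs \<in> listset (map Poly_Mapping.keys as)" for qs
    by (rule K.bd_natural[OF X _ m, symmetric,
          where G = "\<lambda>u. restr X (\<lambda>x. cat (u (idx Bs x)) (e (qs ! idx Bs x) x))"])
      (use op(2) comp_act_key[OF op _ lin_argsD[OF la qs]] in auto)
  then show "diff n X (mact (M (Suc n)) m Bs as) = mact (M n) (diff n {..<length Bs} m) Bs as"
    by (simp add: diff_def M_simps(4) lin_ext_sum lin_ext_scale)
qed (simp_all add: diff_def lin_ext_add lin_ext_scale)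

section \<open>The augmentation\<close>

lemma S_image: "S X (\<lambda>x. u (f x)) = S (f ` X) u"
  by (simp add: S_def rooted_def)

text \<open>A concatenation of words is empty only if both parts are, so a composite is a unit
  exactly when all its factors are. This is what makes the augmentation compatible with the
  action.\<close>

lemma S_comp:
  assumes op: "ordered_partition Bs X" and Bs: "Bs \<noteq> []" and a: "a \<in> vals P {..<length Bs}"
    and qs: "length qs = length Bs" "\<And>i. i < length Bs \<Longrightarrow> qs ! i \<in> vals P (Bs ! i)"
  shows "S X (\<lambda>x. cat (e a (idx Bs x)) (e (qs ! idx Bs x) x)) = {} \<longleftrightarrow>
    S {..<length Bs} (e a) = {} \<and> length Bs = 1 \<and> card (Bs ! 0) = 1 \<and> qs ! 0 = ounit P (the_elem (Bs ! 0))"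
proof -
  let ?a = "ocomp P a Bs qs"
  have av: "?a \<in> vals P X" by (rule closed_operadD(4)[OF P.closed op Bs a qs])
  have ea: "e ?a x = cat (e a (idx Bs x)) (e (qs ! idx Bs x) x)" if "x \<in> X" for x
    by (rule addr_homD(3)[OF P.addr op Bs a qs idx_mem[OF op that]])
  have *: "S X (\<lambda>x. cat (e a (idx Bs x)) (e (qs ! idx Bs x) x)) = S X (e ?a)"
    by (rule S_cong) (simp add: ea)
  have sub: "Bs ! i \<subseteq> X" "Bs ! i \<noteq> {}" if "i < length Bs" for i
    using ordered_partition_subset[OF op that] ordered_partition_nth(2)[OF op that] .
  show ?thesis
    unfolding * S_empty_iff[OF av] S_empty_iff[OF a]
  proof (intro iffI; (elim exE conjE)?)
    fix x assume x: "X = {x}" "?a = ounit P x"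
    have Bx: "Bs ! i = {x}" if "i < length Bs" for i using sub[OF that] x(1) by auto
    have len: "length Bs = 1"
    proof (rule ccontr)
      assume "length Bs \<noteq> 1"
      with Bs have "1 < length Bs" by (cases Bs) auto
      then show False using Bx[of 0] Bx[of 1] ordered_partition_nth(4)[OF op, of 0 1] Bs by auto
    qed
    have i: "idx Bs x = 0" using idx_mem(1)[OF op, of x] x(1) len by simp
    have "cat (e a 0) (e (qs ! 0) x) = nil_addr"
      using ea[of x] x i addr_homD(2)[OF P.addr, of x] by simp
    then have n: "e a 0 = nil_addr" "e (qs ! 0) x = nil_addr" by (simp_all add: cat_eq_nil)
    have l0: "{..<length Bs} = {0}" using len by auto
    have "a = ounit P 0" using unit_iff[of a 0] a l0 n(1) by simp
    moreover have "qs ! 0 = ounit P x" using unit_iff[of "qs ! 0" x] qs(2)[of 0] Bx[of 0] len n(2) by simp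
    ultimately show "(\<exists>x. {..<length Bs} = {x} \<and> a = ounit P x) \<and> length Bs = 1 \<and> card (Bs ! 0) = 1 \<and>
        qs ! 0 = ounit P (the_elem (Bs ! 0))"
      using len Bx[of 0] l0 by simp
  next
    fix y assume y: "{..<length Bs} = {y}" "a = ounit P y" "length Bs = 1" "card (Bs ! 0) = 1"
      "qs ! 0 = ounit P (the_elem (Bs ! 0))"
    then obtain x where x: "Bs ! 0 = {x}" by (auto simp: card_1_singleton_iff)
    have X: "X = {x}" using ordered_partition_nth(3)[OF op] y(3) x by (simp add: lessThan_Suc)
    have y0: "y = 0" using y(1,3) by (auto simp: lessThan_Suc)
    have i: "idx Bs x = 0" using idx_mem(1)[OF op, of x] X y(3) by simp
    have "e ?a x = nil_addr"
      using ea[of x] X i y(2,5) x y0 addr_homD(2)[OF P.addr] by (simp add: cat_eq_nil)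
    then have "?a = ounit P x" using unit_iff[of ?a x] av X by simp
    then show "\<exists>x. X = {x} \<and> ?a = ounit P x" using X by blast
  qed
qed

text \<open>\<open>eps\<close> is 1 on the basis elements with the addresses of a unit and 0 on the
  others, so \<open>S_comp\<close> computes it after an action by basis elements; the rest is
  multilinearity.\<close>

lemma augm_act:
  fixes m :: "('a cell, 'a expr) precomp set \<Rightarrow>\<^sub>0 'k::field"
  assumes la: "lin_args P X Bs as" and m: "m \<in> lin (B 0 {..<length Bs})"
  shows "augm X (mact (M 0) m Bs as) = mact (aug_module P) (augm {..<length Bs} m) Bs as"
proof -
  have op: "ordered_partition Bs X" "Bs \<noteq> []" using la by (auto simp: lin_args_def)
  have las: "length as = length Bs" using la by (simp add: lin_args_def)
  have Y: "fin_ne {..<length Bs}" using op(2) by simp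
  let ?u = "\<lambda>qs. length Bs = 1 \<and> card (Bs ! 0) = 1 \<and> qs ! 0 = ounit P (the_elem (Bs ! 0))"
  have key: "augm X (lin_map (\<lambda>b. comp_act P b Bs qs) m) = (if ?u qs then augm {..<length Bs} m else 0)"
    if qs: "qs \<in> listset (map Poly_Mapping.keys as)" for qs
  proof -
    note q = lin_argsD[OF la qs]
    have "K.eps X (comp_act P b Bs qs) = (if ?u qs then 1 else 0) * (K.eps {..<length Bs} b :: 'k)"
      if b: "b \<in> B 0 {..<length Bs}" for b
    proof -
      obtain a where a: "a \<in> vals P {..<length Bs}" "bw b = restr {..<length Bs} (e a)"
        using K.basis(1)[OF Y b] by (auto simp: A_def)
      have "bw (comp_act P b Bs qs) = restr X (\<lambda>x. cat (bw b (idx Bs x)) (e (qs ! idx Bs x) x))"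
        by (rule comp_act_key(3)[OF op b q])
      then have "S X (bw (comp_act P b Bs qs)) = S X (\<lambda>x. cat (bw b (idx Bs x)) (e (qs ! idx Bs x) x))"
        by simp
      also have "\<dots> = S X (\<lambda>x. cat (e a (idx Bs x)) (e (qs ! idx Bs x) x))"
        by (rule S_cong) (simp add: a(2) restr_def idx_mem(1)[OF op(1)])
      finally show ?thesis
        using S_comp[OF op a(1) q] by (auto simp: K.eps_def a(2))
    qed
    then have "augm X (lin_map (\<lambda>b. comp_act P b Bs qs) m) =
        lin_form (\<lambda>b. (if ?u qs then 1 else 0) * K.eps {..<length Bs} b) m"
      unfolding augm_def lin_map_ext lin_form_simps by (intro lin_form_cong[OF m]) simp
    then show ?thesis by (simp add: augm_def lin_form_eq)
  qed
  have "augm X (mact (M 0) m Bs as) = (\<Sum>qs\<in>listset (map Poly_Mapping.keys as).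
      (\<Prod>i<length as. Poly_Mapping.lookup (as ! i) (qs ! i)) * (if ?u qs then augm {..<length Bs} m else 0))"
    unfolding M_simps(4) using key by (simp add: augm_def lin_form_simps)
  \<comment> \<open>With a single block \<open>listset\<close> runs over the keys of the only
    argument, and the condition picks out the coefficient of the unit, which is
    \<open>aug\<close>.\<close>
  also have "\<dots> = (if length Bs = 1 then augm {..<length Bs} m * aug P (hd Bs) (hd as) else 0)"
  proof (cases "length Bs = 1")
    case True
    then obtain B0 a0 where Ba: "Bs = [B0]" "as = [a0]"
      using las by (metis One_nat_def length_0_conv length_Suc_conv)
    let ?q = "ounit P (the_elem B0)"
    have ls: "listset (map Poly_Mapping.keys as) = (\<lambda>q. [q]) ` Poly_Mapping.keys a0"
      by (auto simp: Ba set_Cons_def)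
    have "(\<Sum>qs\<in>listset (map Poly_Mapping.keys as).
      (\<Prod>i<length as. Poly_Mapping.lookup (as ! i) (qs ! i)) * (if ?u qs then augm {..<length Bs} m else 0)) =
      (\<Sum>q\<in>Poly_Mapping.keys a0. if q = ?q then
         (if card B0 = 1 then Poly_Mapping.lookup a0 q * augm {..<length Bs} m else 0) else 0)"
    proof -
      have inj: "inj_on (\<lambda>q. [q]) (Poly_Mapping.keys a0)" by (simp add: inj_on_def)
      show ?thesis unfolding ls sum.reindex[OF inj] by (rule sum.cong) (auto simp: Ba)
    qed
    also have "\<dots> = augm {..<length Bs} m * aug P B0 a0"
      by (simp add: aug_def in_keys_iff mult.commute)
    finally show ?thesis using True Ba by simp
  qed simp
  finally show ?thesis by (simp add: aug_module_def)
qed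

lemma augm_hom: "rmodule_hom P (M 0) (aug_module P) (augm :: _ \<Rightarrow> _ \<Rightarrow> 'k::field)"
  unfolding rmodule_hom_def
proof (intro conjI allI impI ballI)
  fix X and x :: "('a cell, 'a expr) precomp set \<Rightarrow>\<^sub>0 'k"
  assume "fin_ne X" "x \<in> mvals (M 0) X"
  then have "augm X x \<in> lin_form (K.eps X) ` lin (B 0 X)" by (simp add: augm_def M_simps)
  then show "augm X x \<in> mvals (aug_module P) X"
    unfolding K.eps_image[OF \<open>fin_ne X\<close>] by (simp add: aug_module_def)
next
  fix X f and \<phi> :: "('a cell, 'a expr) precomp set \<Rightarrow>\<^sub>0 'k"
  assume X: "fin_ne X \<and> inj_on f X" and \<phi>: "\<phi> \<in> mvals (M 0) (f ` X)"
  have \<phi>': "\<phi> \<in> lin (B 0 (f ` X))" using \<phi> by (simp add: M_simps)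
  have "K.eps X (comp_pull P X f b) = (K.eps (f ` X) b :: 'k)" if "b \<in> B 0 (f ` X)" for b
    unfolding K.eps_def comp_pull_key(3)[OF conjunct1[OF X] conjunct2[OF X] that] by (simp add: S_image)
  then have "augm X (lin_map (comp_pull P X f) \<phi>) = augm (f ` X) \<phi>"
    unfolding augm_def lin_map_ext lin_form_simps by (intro lin_form_cong[OF \<phi>']) simp
  then show "augm X (mpull (M 0) X f \<phi>) = mpull (aug_module P) X f (augm (f ` X) \<phi>)"
    by (simp add: M_simps aug_module_def)
next
  fix X Bs and as :: "('a expr \<Rightarrow>\<^sub>0 'k) list" and m :: "('a cell, 'a expr) precomp set \<Rightarrow>\<^sub>0 'k"
  assume "lin_args P X Bs as" "m \<in> mvals (M 0) {..<length Bs}"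
  then show "augm X (mact (M 0) m Bs as) = mact (aug_module P) (augm {..<length Bs} m) Bs as"
    by (intro augm_act) (simp_all add: M_simps)
qed (simp_all add: augm_def lin_form_simps M_simps aug_module_def)

lemma resolution: "resolution_of_unit P (M :: nat \<Rightarrow> ('k::field, _, _) rmodule) diff augm"
  unfolding resolution_of_unit_def
proof (intro conjI allI impI ballI diff_hom augm_hom)
  fix X n and x :: "('a cell, 'a expr) precomp set \<Rightarrow>\<^sub>0 'k"
  assume X: "fin_ne X"
  show "diff n X (diff (Suc n) X x) = 0" if "x \<in> mvals (M (Suc (Suc n))) X"
  proof -
    have x: "x \<in> lin (B (Suc (Suc n)) X)" using that by (simp add: M_simps)
    have "lin_ext (\<lambda>b. lin_ext (K.bd n X) (K.bd (Suc n) X b)) x = lin_ext (\<lambda>b. 0) x"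
      by (rule lin_ext_cong[OF x K.bd_bd[OF X]])
    also have "\<dots> = 0" by (simp add: lin_ext_def)
    finally show ?thesis by (simp add: diff_def lin_ext_lin_ext)
  qed
  show "augm X (diff 0 X x) = 0" if "x \<in> mvals (M (Suc 0)) X"
  proof -
    have x: "x \<in> lin (B 1 X)" using that by (simp add: M_simps)
    have "lin_form (\<lambda>b. lin_form (K.eps X) (K.bd 0 X b)) x = lin_form (\<lambda>b. 0) x"
      by (rule lin_form_cong[OF x K.eps_bd[OF X]])
    then show ?thesis by (simp add: diff_def augm_def lin_form_simps) (simp add: lin_form_eq)
  qed
  show "x \<in> diff (Suc n) X ` mvals (M (Suc (Suc n))) X" if "x \<in> mvals (M (Suc n)) X" "diff n X x = 0"
    using K.exact_Suc[OF X, of x n] that by (simp add: diff_def M_simps)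
  show "x \<in> diff 0 X ` mvals (M (Suc 0)) X" if "x \<in> mvals (M 0) X" "augm X x = 0"
    using K.exact_0[OF X, of x] that by (simp add: diff_def augm_def M_simps)
next
  fix X :: "nat set" assume X: "fin_ne X"
  show "augm X ` mvals (M 0) X = (mvals (aug_module P) X :: 'k set)"
    using K.eps_image[OF X] by (simp add: augm_def M_simps aug_module_def)
qed

text \<open>A basis element \<open>v \<circ> (p\<^sub>0, \<dots>)\<close> with a non-unit \<open>p\<^sub>i\<close> is \<open>v\<close> acted upon by \<open>p\<close>, and the augmentation
  kills \<open>p\<^sub>i\<close>. A proper face always is of this kind, as otherwise its address would only use the
  directions of \<open>v\<close>.\<close>

lemma face_in_kernel:
  assumes X: "fin_ne X" and b: "b \<in> B n X" and ne: "S X (bw b) \<noteq> bJ b"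
  shows "Poly_Mapping.single b c \<in>
    rel_composite_kernel P (M n :: ('k::field, 'a expr, ('a cell, 'a expr) precomp set \<Rightarrow>\<^sub>0 'k) rmodule) X"
proof -
  obtain v Bs ps where p: "(v, Bs, ps) \<in> precomp V P X" "b = orbit V (v, Bs, ps)"
    "bJ b = pJ (v, Bs, ps)" "bw b = pw (v, Bs, ps)" "card (pJ (v, Bs, ps)) = n"
    using B_E[OF X b] by metis
  note d = precompD[OF p(1) X]
  let ?k = "length Bs"
  have Bs: "Bs \<noteq> []" using d(5) by auto
  have Y: "fin_ne {..<?k}" using d(5) by simp
  obtain nn g where g: "bij_betw (ev {..<?k} v) {..<?k} (grid Fs (pJ (v, Bs, ps)) nn g)"
    using d(8) by blast
  have "\<exists>i<?k. \<not> (\<exists>x. Bs ! i = {x} \<and> ps ! i = ounit P x)"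
  proof (rule ccontr)
    assume "\<not> ?thesis"
    then have u: "\<And>i. i < ?k \<Longrightarrow> \<exists>x. Bs ! i = {x} \<and> ps ! i = ounit P x" by blast
    obtain j where j: "j \<in> S X (bw b)" "j \<notin> bJ b" using ne K.basis(2)[OF X b] by blast
    obtain x where x: "x \<in> X" using X unfolding fin_ne_def by (metis ex_in_conv)
    note i = idx_mem[OF d(1) x]
    obtain y where "Bs ! idx Bs x = {y}" "ps ! idx Bs x = ounit P y" using u[OF i(1)] by blast
    then have "e (ps ! idx Bs x) x = nil_addr" using i(2) addr_homD(2)[OF P.addr, of x] by simp
    then have w: "bw b x = ev {..<?k} v (idx Bs x)" using d(6)[OF x] p(4) by simp
    have "ev {..<?k} v (idx Bs x) \<in> grid Fs (pJ (v, Bs, ps)) nn g"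
      using g i(1) by (auto simp: bij_betw_def)
    then have "bw b x j = []" using j(2) p(3) w by (auto simp: grid_def)
    then show False using j(1) x by (auto simp: S_def rooted_def)
  qed
  then obtain i where i: "i < ?k" "\<not> (\<exists>x. Bs ! i = {x} \<and> ps ! i = ounit P x)" by blast
  \<comment> \<open>The cell \<open>v\<close> composed with units only is a basis element over
    \<open>{..<?k}\<close>; acting on it by \<open>ps\<close> along \<open>Bs\<close> gives back
    \<open>b\<close>.\<close>
  define Cs where "Cs = map (\<lambda>i. {i}) [0..<?k]"
  define us where "us = map (ounit P) [0..<?k]"
  have Cs: "length Cs = ?k" "length us = ?k" "\<And>i. i < ?k \<Longrightarrow> Cs ! i = {i}" "\<And>i. i < ?k \<Longrightarrow> us ! i = ounit P i"
    by (simp_all add: Cs_def us_def)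
  have opC: "ordered_partition Cs {..<?k}"
    by (rule ordered_partitionI) (use Cs in auto)
  let ?q = "(v, Cs, us)"
  have q: "?q \<in> precomp V P {..<?k}"
    by (rule precompI[OF opC]) (use d(2) Cs closed_operadD(3)[OF P.closed] in auto)
  note dq = precompD[OF q Y]
  have Jq: "pJ ?q = pJ (v, Bs, ps)" using Cs(1) by (simp add: pJ_def)
  let ?b = "orbit V ?q"
  have bB: "?b \<in> B n {..<?k}" unfolding B_iff[OF Y] by (rule bexI[OF _ q]) (simp add: Jq p(5))
  have wq: "pw ?q i = ev {..<?k} v i" if "i < ?k" for i
  proof -
    have "idx Cs i = i" by (rule idx_eq[OF opC]) (use that Cs in auto)
    then show ?thesis using dq(6)[of i] that Cs addr_homD(2)[OF P.addr, of i] by simp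
  qed
  have act: "comp_act P ?b Bs ps = b"
  proof (rule K.basis_eqI[OF X _ b])
    note ck = comp_act_key[OF d(1) Bs bB d(3,4)]
    show "comp_act P ?b Bs ps \<in> B n X" by (rule ck(1))
    show "bJ (comp_act P ?b Bs ps) = bJ b" using ck(2) orbit_keys(1)[OF Y q] Jq p(3) by simp
    have "bw (comp_act P ?b Bs ps) = restr X (\<lambda>x. cat (bw ?b (idx Bs x)) (e (ps ! idx Bs x) x))"
      by (rule ck(3))
    also have "\<dots> = bw b"
    proof
      fix x show "restr X (\<lambda>x. cat (bw ?b (idx Bs x)) (e (ps ! idx Bs x) x)) x = bw b x"
        unfolding p(4) orbit_keys(2)[OF Y q]
        by (cases "x \<in> X") (simp_all add: restr_def d(6,7) wq idx_mem(1)[OF d(1)])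
    qed
    finally show "bw (comp_act P ?b Bs ps) = bw b" .
  qed
  define as :: "('a expr \<Rightarrow>\<^sub>0 'k) list" where "as = map (\<lambda>p. Poly_Mapping.single p 1) ps"
  let ?m = "Poly_Mapping.single ?b c :: _ \<Rightarrow>\<^sub>0 'k"
  have la: "lin_args P X Bs as"
    using d(1,3,4) Bs by (auto simp: lin_args_def as_def intro: lin_single)
  have m: "?m \<in> mvals (M n) {..<?k}" unfolding M_simps by (rule lin_single[OF bB])
  have keys: "map Poly_Mapping.keys as = map (\<lambda>p. {p}) ps" by (simp add: as_def)
  have ls: "listset (map (\<lambda>p. {p}) ps) = {ps}" for ps :: "'a expr list"
    by (induction ps) (auto simp: set_Cons_def)
  have "(\<Prod>i<length as. Poly_Mapping.lookup (as ! i) (ps ! i)) = 1"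
    by (rule prod.neutral) (simp add: as_def)
  then have m1: "mact (M n) ?m Bs as = Poly_Mapping.single b c"
    unfolding M_simps keys ls by (simp add: lin_map_ext act)
  have "map2 (unit_aug P) Bs as ! i = 0"
  proof -
    have "unit_aug P (Bs ! i) (Poly_Mapping.single (ps ! i) 1) = (0 :: 'a expr \<Rightarrow>\<^sub>0 'k)"
    proof (cases "card (Bs ! i) = 1")
      case True
      then obtain x where x: "Bs ! i = {x}" by (auto simp: card_1_singleton_iff)
      then have "ps ! i \<noteq> ounit P x" using i by blast
      then show ?thesis using x by (simp add: unit_aug_def aug_def lookup_single when_def)
    qed (simp add: unit_aug_def)
    then show ?thesis using i(1) d(3) by (simp add: as_def)
  qed
  moreover have "qs ! i \<in> Poly_Mapping.keys (map2 (unit_aug P) Bs as ! i)"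
    if "qs \<in> listset (map Poly_Mapping.keys (map2 (unit_aug P) Bs as))" for qs
    using listsetD[OF that] i(1) d(3) by (simp add: as_def)
  \<comment> \<open>One argument has become 0 and has no keys, so there is no monomial to sum over
    and the action vanishes.\<close>
  ultimately have "listset (map Poly_Mapping.keys (map2 (unit_aug P) Bs as)) = {}" by fastforce
  then have m2: "mact (M n) ?m Bs (map2 (unit_aug P) Bs as) = 0" by (simp add: M_simps)
  have gen: "mact (M n) ?m Bs as - mact (M n) ?m Bs (map2 (unit_aug P) Bs as) = Poly_Mapping.single b c"
    using m1 m2 by simp
  have base: "Poly_Mapping.single b c \<in> {mact (M n) m Bs as - mact (M n) m Bs (map2 (unit_aug P) Bs as) | m Bs as.
          lin_args P X Bs as \<and> m \<in> mvals (M n) {..<length Bs}}"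
    using gen[symmetric] la m by blast
  interpret L: module "lin_scale :: 'k \<Rightarrow> (('a cell, 'a expr) precomp set \<Rightarrow>\<^sub>0 'k) \<Rightarrow> _"
    by (rule module_lin_scale)
  show ?thesis
    unfolding rel_composite_kernel_def M_simps(2) by (rule L.span_base[OF base])
qed

lemma minimal: "minimal_complex P (M :: nat \<Rightarrow> ('k::field, _, _) rmodule) diff"
  unfolding minimal_complex_def
proof (intro allI impI ballI)
  fix n X and x :: "('a cell, 'a expr) precomp set \<Rightarrow>\<^sub>0 'k"
  assume X: "fin_ne X" and x: "x \<in> mvals (M (Suc n)) X"
  interpret L: module "lin_scale :: 'k \<Rightarrow> (('a cell, 'a expr) precomp set \<Rightarrow>\<^sub>0 'k) \<Rightarrow> _"
    by (rule module_lin_scale)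
  have "lin_scale (Poly_Mapping.lookup x b) (K.bd n X b) \<in> rel_composite_kernel P (M n) X"
    if "b \<in> Poly_Mapping.keys x" for b
  proof -
    have b: "b \<in> B (Suc n) X" using x that by (auto simp: M_simps lin_def)
    \<comment> \<open>The face keeps the addresses of \<open>b\<close>, so \<open>j\<close> still is
      a vertex of its simplex while its own directions no longer contain \<open>j\<close>.\<close>
    have "Poly_Mapping.single (K.mk n X (bJ b - {j}) (bw b)) c \<in> rel_composite_kernel P (M n) X"
      if j: "j \<in> bJ b" for j and c :: 'k
      using face_in_kernel[OF X K.face(1)[OF X b j], of c] K.face(2,3)[OF X b j] K.basis(2)[OF X b] j
      by auto
    then show ?thesis
      unfolding K.bd_def rel_composite_kernel_def M_simps(2)
      by (intro L.span_scale L.span_sum)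
  qed
  then show "diff n X x \<in> rel_composite_kernel P (M n) X"
    unfolding diff_def lin_ext_def rel_composite_kernel_def M_simps(2) by (intro L.span_sum)
qed

end

theorem theorem3p5:
  fixes Xs :: "'a collection list"
  assumes "length Xs \<ge> 1"
    and "\<forall>X\<in>set Xs. is_collection X \<and> finite_valued X \<and> free_collection X \<and> no_small_arities X"
  shows "let V = matrix_prod_list (map unit_plus Xs);
             P = bv_tensor_list (map abs_free_operad Xs)
         in \<exists>(d :: nat \<Rightarrow> nat set \<Rightarrow> (('a cell, 'a expr) precomp set \<Rightarrow>\<^sub>0 'k::field) \<Rightarrow>
                                     (('a cell, 'a expr) precomp set \<Rightarrow>\<^sub>0 'k)) \<epsilon>.
              resolution_of_unit P (graded_free_rmodule V P) d \<epsilon> \<and>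
              minimal_complex P (graded_free_rmodule V P) d"
proof -
  have Xs: "Xs \<noteq> []" using assms(1) by auto
  have good: "good_coll F" if "F \<in> set Xs" for F using assms(2) that by (simp add: good_coll_def)
  obtain e \<gamma> where m: "models (bv_tensor_list (map abs_free_operad Xs)) Xs e \<gamma>"
    using bv_tensor_list_model[OF Xs good] by blast
  obtain ev where c: "cell_model (matrix_prod_list (map unit_plus Xs)) Xs ev"
    using matrix_prod_list_model[OF Xs good] by blast
  have "koszul (bv_tensor_list (map abs_free_operad Xs)) Xs e \<gamma> (matrix_prod_list (map unit_plus Xs)) ev"
    by (intro koszul.intro koszul_axioms.intro m c good)
  then show ?thesis
    unfolding Let_def using koszul.resolution koszul.minimal by blast
qed

end
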